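(* Let $X$ be a compact connected Riemann surface, $G$ a connected complex reductive linear algebraic group, $K\subset G$ a maximal compact subgroup, $E^0_K\to X$ a $C^\infty$ principal $K$-bundle, and $E^0_G=E^0_K\times_K G$. Let $\mathcal B_0=\mathcal A_0\times A^{1,0}(\mathrm{ad}(E^0_G))$, let $\mathcal S(E^0_G)\subset\mathcal B_0$ be the subset of pairs that are Higgs $G$-bundles, and let $\mathrm{YMH}_G:\mathcal B_0\to\mathbb R$ be the Yang--Mills--Higgs functional. Take any $z=(\overline\partial_{E^0_G},\theta)\in\mathcal S(E^0_G)$. Let $\gamma_z:\mathbb R\to\mathcal B_0$ be the integral curve for the gradient flow on $\mathcal B_0$ for the function $\mathrm{YMH}_G$ such that $\gamma_z(0)=z$. Then $\gamma_z(t)\in\mathcal S(E^0_G)$ for all $t\in\mathbb R$.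
   Context: $A^{p,q}(F)$ is the space of $C^\infty$ $(p,q)$-forms with values in a $C^\infty$ vector bundle $F$. $\mathfrak g=\mathrm{Lie}(G)$, $\mathfrak k=\mathrm{Lie}(K)$, $\mathrm{ad}(E^0_G)=E^0_G\times_G\mathfrak g$. $\mathcal A_0$ is the space of holomorphic structures on $E^0_G$, an affine space for $A^{0,1}(\mathrm{ad}(E^0_G))$. $\mathcal S(E^0_G)$ consists of the pairs $(\overline\partial_{E^0_G},\theta)\in\mathcal B_0$ with $\overline\partial_{E^0_G}(\theta)=0$, i.e. $\theta$ is a holomorphic section of $\mathrm{ad}(E^0_G)\otimes K_X$ ($K_X$ the canonical bundle). Fix a faithful representation $\rho:G\to \mathrm{GL}(V)$ and a maximal compact subgroup $\widetilde K$ of $\mathrm{GL}(V)$ with $\rho(K)\subset\widetilde K$. The inner product $\langle A,B\rangle=-\mathrm{trace}(AB)$ on $\mathrm{Lie}(\widetilde K)$, restricted to $\mathfrak k$ through $d\rho$ and extended to a Hermitian inner product on $\mathfrak g=\mathfrak k\oplus\sqrt{-1}\mathfrak k$, is $K$-invariant and gives a Hermitian metric on the fibers of $\mathrm{ad}(E^0_G)$. On $A^{0,1}(\mathrm{ad}(E^0_G))\oplus A^{1,0}(\mathrm{ad}(E^0_G))$ use the $L^2$ inner product whose norm squared is the integral over $X$ of the form given locally by $(|A|^2+|B|^2)\sqrt{-1}\,dz\wedge d\overline z$ for $\omega_{1,0}=A\,dz$, $\omega_{0,1}=B\,d\overline z$. This gives a constant (K\"ahler, hence Riemannian) metric on $\mathcal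 B_0$, with respect to which the gradient is taken. Fix a Hermitian metric $h_0$ on $T^{1,0}X$. For a holomorphic structure $\overline\partial_{E^0_G}$, $K(\overline\partial_{E^0_G})$ denotes the curvature of its Chern connection (the unique connection on $E^0_K$ whose induced connection on $E^0_G$ is compatible with $\overline\partial_{E^0_G}$). Let $*:\mathrm{ad}(E^0_G)\to\mathrm{ad}(E^0_G)$ be the conjugate linear automorphism equal to $-1$ on $\mathrm{ad}(E^0_K)$; if locally $\theta=A\,dz$, then $[\theta,\theta^*]=[A,A^*]\,dz\wedge d\overline z$. Then $\mathrm{YMH}_G(\overline\partial_{E^0_G},\theta)=\|K(\overline\partial_{E^0_G})+[\theta,\theta^*]\|^2$, the $L^2$ norm on $\mathrm{ad}(E^0_G)$-valued $2$-forms being defined by $h_0$ and the metric on $\mathrm{ad}(E^0_G)$. The gradient flow is the flow $\dot\gamma=-\mathrm{grad}\,\mathrm{YMH}_G(\gamma)$; existence of the integral curve $\gamma_z$ is part of the hypothesis. *)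

theory Defs
  imports "HOL-Analysis.Analysis" "HOL-Algebra.Coset"
begin

section \<open>Smooth maps between open subsets of normed spaces\<close>

primrec iter_deriv ::
  "'a list \<Rightarrow> ('a::real_normed_vector \<Rightarrow> 'b::real_normed_vector) \<Rightarrow> 'a \<Rightarrow> 'b" where
  "iter_deriv [] f = f"
| "iter_deriv (v # vs) f = iter_deriv vs (\<lambda>z. frechet_derivative f (at z) v)"

text \<open>Only meant for open \<open>S\<close>.\<close>

definition smooth_on :: "'a set \<Rightarrow> ('a::real_normed_vector \<Rightarrow> 'b::real_normed_vector) \<Rightarrow> bool" where
  "smooth_on S f \<longleftrightarrow> (\<forall>vs. \<forall>z\<in>S. iter_deriv vs f differentiable (at z))"


section \<open>Riemann surfaces\<close>

text \<open>A chart is a pair of an open set and a complex coordinate on it; the surface is the whole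
  type \<open>'x\<close>, and \<open>X\<close> is a holomorphic atlas.\<close>

type_synonym 'x chart = "'x set \<times> ('x \<Rightarrow> complex)"

definition param :: "'x chart \<Rightarrow> complex \<Rightarrow> 'x" where
  "param c = inv_into (fst c) (snd c)"

definition riemann_surface :: "('x::t2_space) chart set \<Rightarrow> bool" where
  "riemann_surface X \<longleftrightarrow>
     (\<Union>c\<in>X. fst c) = UNIV \<and>
     (\<forall>c\<in>X. open (fst c) \<and> open (snd c ` fst c) \<and>
        homeomorphism (fst c) (snd c ` fst c) (snd c) (param c)) \<and>
     (\<forall>c\<in>X. \<forall>d\<in>X. (snd d \<circ> param c) holomorphic_on (snd c ` (fst c \<inter> fst d)))"

text \<open>\<open>dw/dz\<close> at \<open>x\<close>, where \<open>z\<close> and \<open>w\<close> are the coordinates of \<open>c\<close> and \<open>d\<close>.\<close>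

definition coord_deriv :: "'x chart \<Rightarrow> 'x chart \<Rightarrow> 'x \<Rightarrow> complex" where
  "coord_deriv c d x = deriv (snd d \<circ> param c) (snd c x)"

definition smooth_map ::
  "('x::t2_space) chart set \<Rightarrow> 'x set \<Rightarrow> ('x \<Rightarrow> 'b::real_normed_vector) \<Rightarrow> bool" where
  "smooth_map X W f \<longleftrightarrow> (\<forall>c\<in>X. smooth_on (snd c ` (fst c \<inter> W)) (f \<circ> param c))"

definition partition_of_unity ::
  "('x::t2_space) chart set \<Rightarrow> nat \<Rightarrow> (nat \<Rightarrow> 'x chart) \<Rightarrow> (nat \<Rightarrow> 'x \<Rightarrow> real) \<Rightarrow> bool" where
  "partition_of_unity X N c u \<longleftrightarrow>
     (\<forall>i<N. c i \<in> X \<and> smooth_map X UNIV (u i) \<and> (\<forall>x. 0 \<le> u i x) \<and>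
        closure {x. u i x \<noteq> 0} \<subseteq> fst (c i)) \<and>
     (\<forall>x. (\<Sum>i<N. u i x) = 1)"

text \<open>The integral over a compact surface of the 2-form given by \<open>\<eta> c \<cdot> \<surd>-1 dz \<and> d(cnj z)\<close> in
  the chart \<open>c\<close>. The factor 2 comes from \<open>\<surd>-1 dz \<and> d(cnj z) = 2 dx \<and> dy\<close>; the value does not depend on
  the chosen partition of unity.\<close>

definition surface_integral :: "('x::t2_space) chart set \<Rightarrow> ('x chart \<Rightarrow> 'x \<Rightarrow> real) \<Rightarrow> real" where
  "surface_integral X \<eta> =
     (case (SOME (N, c, u). partition_of_unity X N c u) of
        (N, c, u) \<Rightarrow>
          \<Sum>i<N. LINT z : snd (c i) ` fst (c i) | lborel.
            2 * (u i (param (c i) z) * \<eta> (c i) (param (c i) z)))"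

text \<open>A smooth Hermitian metric on \<open>T\<^sup>1\<^sup>,\<^sup>0X\<close>, given in the chart \<open>c\<close> by \<open>h c = |\<partial>/\<partial>z|\<^sup>2\<close>.\<close>

definition hermitian_metric :: "('x::t2_space) chart set \<Rightarrow> ('x chart \<Rightarrow> 'x \<Rightarrow> real) \<Rightarrow> bool" where
  "hermitian_metric X h \<longleftrightarrow>
     (\<forall>c\<in>X. (\<forall>x\<in>fst c. h c x > 0) \<and> smooth_on (snd c ` fst c) (h c \<circ> param c)) \<and>
     (\<forall>c\<in>X. \<forall>d\<in>X. \<forall>x\<in>fst c \<inter> fst d. h c x = (cmod (coord_deriv c d x))\<^sup>2 * h d x)"


section \<open>Linear algebraic groups\<close>

text \<open>The componentwise product that the library puts on \<open>complex ^ 'n ^ 'n\<close> is never used; matrix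
  multiplication is \<open>**\<close>.\<close>

type_synonym 'n cmat = "complex ^ 'n ^ 'n"

definition cscale :: "complex \<Rightarrow> 'n::finite cmat \<Rightarrow> 'n cmat" where
  "cscale a A = (\<chi> i j. a * A $ i $ j)"

definition bracket :: "'n::finite cmat \<Rightarrow> 'n cmat \<Rightarrow> 'n cmat" where
  "bracket A B = A ** B - B ** A"

definition GL :: "('n::finite cmat) monoid" where
  "GL = \<lparr>carrier = {A. invertible A}, mult = (**), one = mat 1\<rparr>"

inductive_set polynomial_funs :: "('n::finite cmat \<Rightarrow> complex) set" where
  const: "(\<lambda>_. a) \<in> polynomial_funs"
| entry: "(\<lambda>A. A $ i $ j) \<in> polynomial_funs"
| add: "p \<in> polynomial_funs \<Longrightarrow> q \<in> polynomial_funs \<Longrightarrow> (\<lambda>A. p A + q A) \<in> polynomial_funs"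
| mult: "p \<in> polynomial_funs \<Longrightarrow> q \<in> polynomial_funs \<Longrightarrow> (\<lambda>A. p A * q A) \<in> polynomial_funs"

definition linear_algebraic_group :: "'n::finite cmat set \<Rightarrow> bool" where
  "linear_algebraic_group G \<longleftrightarrow>
     subgroup G GL \<and>
     (\<exists>S\<subseteq>polynomial_funs. G = {g \<in> carrier GL. \<forall>p\<in>S. p g = 0})"

definition regular_function :: "'n::finite cmat set \<Rightarrow> ('n cmat \<Rightarrow> complex) \<Rightarrow> bool" where
  "regular_function G f \<longleftrightarrow>
     (\<exists>p\<in>polynomial_funs. \<exists>k::nat. \<forall>g\<in>G. f g = p g / det g ^ k)"

definition unipotent :: "'n::finite cmat \<Rightarrow> bool" where
  "unipotent g \<longleftrightarrow> (\<exists>k. (((**) (g - mat 1)) ^^ k) (mat 1) = 0)"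

text \<open>Reductive: the unipotent radical is trivial.\<close>

definition reductive :: "'n::finite cmat set \<Rightarrow> bool" where
  "reductive G \<longleftrightarrow>
     linear_algebraic_group G \<and>
     (\<forall>N. linear_algebraic_group N \<and> connected N \<and> N \<lhd> (GL\<lparr>carrier := G\<rparr>) \<and>
        (\<forall>g\<in>N. unipotent g) \<longrightarrow> N = {mat 1})"

definition faithful_representation ::
  "'n::finite cmat set \<Rightarrow> ('n cmat \<Rightarrow> 'm::finite cmat) \<Rightarrow> bool" where
  "faithful_representation G \<rho> \<longleftrightarrow>
     \<rho> \<in> hom (GL\<lparr>carrier := G\<rparr>) GL \<and> inj_on \<rho> G \<and>
     (\<forall>i j. regular_function G (\<lambda>g. \<rho> g $ i $ j))"

definition maximal_compact_subgroup :: "'n::finite cmat set \<Rightarrow> 'n cmat set \<Rightarrow> bool" where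
  "maximal_compact_subgroup K G \<longleftrightarrow>
     subgroup K GL \<and> compact K \<and> K \<subseteq> G \<and>
     (\<forall>L. subgroup L GL \<and> compact L \<and> K \<subseteq> L \<and> L \<subseteq> G \<longrightarrow> L = K)"

text \<open>The Lie algebra of a closed subgroup, as its tangent space at the identity.\<close>

definition curve_through_one :: "'n::finite cmat set \<Rightarrow> 'n cmat \<Rightarrow> (real \<Rightarrow> 'n cmat) \<Rightarrow> bool" where
  "curve_through_one H A c \<longleftrightarrow>
     range c \<subseteq> H \<and> smooth_on UNIV c \<and> c 0 = mat 1 \<and> (c has_vector_derivative A) (at 0)"

definition lie_algebra :: "'n::finite cmat set \<Rightarrow> 'n cmat set" where
  "lie_algebra H = {A. \<exists>c. curve_through_one H A c}"

definition lie_map ::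
  "'n::finite cmat set \<Rightarrow> ('n cmat \<Rightarrow> 'm::finite cmat) \<Rightarrow> 'n cmat \<Rightarrow> 'm cmat" where
  "lie_map G \<rho> A =
     (THE B. \<forall>c. curve_through_one G A c \<longrightarrow> (\<rho> \<circ> c has_vector_derivative B) (at 0))"

text \<open>\<open>\<gg> = \<kk> \<oplus> \<surd>-1 \<kk>\<close>, for \<open>\<gg>\<close>, \<open>\<kk>\<close> the Lie algebras of \<open>G\<close>, \<open>K\<close>; this
  holds for every connected reductive \<open>G\<close> with maximal compact subgroup \<open>K\<close>.\<close>

definition lie_complexification :: "'n::finite cmat set \<Rightarrow> 'n cmat set \<Rightarrow> bool" where
  "lie_complexification G K \<longleftrightarrow>
     lie_algebra G = {A + cscale \<i> B | A B. A \<in> lie_algebra K \<and> B \<in> lie_algebra K} \<and>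
     lie_algebra K \<inter> cscale \<i> ` lie_algebra K = {0}"

definition lie_re :: "'n::finite cmat set \<Rightarrow> 'n cmat \<Rightarrow> 'n cmat" where
  "lie_re K Z = (THE A. A \<in> lie_algebra K \<and> (\<exists>B\<in>lie_algebra K. Z = A + cscale \<i> B))"

definition lie_im :: "'n::finite cmat set \<Rightarrow> 'n cmat \<Rightarrow> 'n cmat" where
  "lie_im K Z = (THE B. B \<in> lie_algebra K \<and> (\<exists>A\<in>lie_algebra K. Z = A + cscale \<i> B))"

text \<open>The conjugate linear involution that is \<open>-1\<close> on \<open>\<kk>\<close>.\<close>

definition star :: "'n::finite cmat set \<Rightarrow> 'n cmat \<Rightarrow> 'n cmat" where
  "star K Z = - lie_re K Z + cscale \<i> (lie_im K Z)"

text \<open>The real inner product \<open>-trace(AB)\<close>, pulled back by \<open>d\<rho>\<close> to \<open>\<kk>\<close>, where the trace is real,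
  and its extension to \<open>\<gg>\<close> as a Hermitian form, linear in the first argument.\<close>

definition inner_k ::
  "'n::finite cmat set \<Rightarrow> ('n cmat \<Rightarrow> 'm::finite cmat) \<Rightarrow> 'n cmat \<Rightarrow> 'n cmat \<Rightarrow> real" where
  "inner_k G \<rho> A B = Re (- trace (lie_map G \<rho> A ** lie_map G \<rho> B))"

definition herm ::
  "'n::finite cmat set \<Rightarrow> 'n cmat set \<Rightarrow> ('n cmat \<Rightarrow> 'm::finite cmat) \<Rightarrow> 'n cmat \<Rightarrow> 'n cmat \<Rightarrow> complex"
where
  "herm G K \<rho> Y Z =
     Complex (inner_k G \<rho> (lie_re K Y) (lie_re K Z) + inner_k G \<rho> (lie_im K Y) (lie_im K Z))
             (inner_k G \<rho> (lie_im K Y) (lie_re K Z) - inner_k G \<rho> (lie_re K Y) (lie_im K Z))"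


section \<open>Principal bundles\<close>

text \<open>A frame is a local section. The smooth structure of the total space is the one for which the
  local trivialisations \<open>(x, h) \<mapsto> s x \<cdot> h\<close> given by the frames of the atlas \<open>frames E\<close> are
  diffeomorphisms.\<close>

type_synonym ('x, 'p) frame = "'x set \<times> ('x \<Rightarrow> 'p)"

record ('p, 'x, 'n) pbundle =
  total :: "'p set"
  proj :: "'p \<Rightarrow> 'x"
  ract :: "'p \<Rightarrow> complex ^ 'n ^ 'n \<Rightarrow> 'p"
  frames :: "('x, 'p) frame set"

definition transition ::
  "'n::finite cmat set \<Rightarrow> ('p, 'x, 'n) pbundle \<Rightarrow> ('x, 'p) frame \<Rightarrow> ('x, 'p) frame \<Rightarrow> 'x \<Rightarrow> 'n cmat"
where
  "transition H E s t x = (THE h. h \<in> H \<and> snd t x = ract E (snd s x) h)"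

definition principal_bundle ::
  "('x::t2_space) chart set \<Rightarrow> 'n::finite cmat set \<Rightarrow> ('p, 'x, 'n) pbundle \<Rightarrow> bool" where
  "principal_bundle X H E \<longleftrightarrow>
     (\<forall>p\<in>total E. ract E p (mat 1) = p \<and>
        (\<forall>g\<in>H. ract E p g \<in> total E \<and> proj E (ract E p g) = proj E p \<and>
           (\<forall>h\<in>H. ract E (ract E p g) h = ract E p (g ** h)))) \<and>
     (\<forall>p\<in>total E. \<forall>q\<in>total E. proj E p = proj E q \<longrightarrow> (\<exists>!h. h \<in> H \<and> q = ract E p h)) \<and>
     (\<Union>s\<in>frames E. fst s) = UNIV \<and>
     (\<forall>s\<in>frames E. open (fst s) \<and> (\<forall>x\<in>fst s. snd s x \<in> total E \<and> proj E (snd s x) = x)) \<and>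
     (\<forall>s\<in>frames E. \<forall>t\<in>frames E. smooth_map X (fst s \<inter> fst t) (transition H E s t))"

text \<open>The extension of structure group \<open>E \<times>\<^sub>K G\<close>: the quotient of \<open>E \<times> G\<close> by
  \<open>(p k, h) \<sim> (p, k h)\<close>. A frame \<open>s\<close> of \<open>E\<close> induces the frame \<open>x \<mapsto> [s x, 1]\<close>.\<close>

definition ext_rel ::
  "'n::finite cmat set \<Rightarrow> 'n cmat set \<Rightarrow> ('p, 'x, 'n) pbundle \<Rightarrow> (('p \<times> 'n cmat) \<times> ('p \<times> 'n cmat)) set"
where
  "ext_rel G K E =
     {((p, g), (q, h)) | p g q h. p \<in> total E \<and> q \<in> total E \<and> g \<in> G \<and> h \<in> G \<and>
        (\<exists>k\<in>K. q = ract E p k \<and> g = k ** h)}"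

definition ext_frame ::
  "'n::finite cmat set \<Rightarrow> 'n cmat set \<Rightarrow> ('p, 'x, 'n) pbundle \<Rightarrow>
   ('x, 'p) frame \<Rightarrow> ('x, ('p \<times> 'n cmat) set) frame" where
  "ext_frame G K E s = (fst s, \<lambda>x. ext_rel G K E `` {(snd s x, mat 1)})"

definition extension ::
  "'n::finite cmat set \<Rightarrow> 'n cmat set \<Rightarrow> ('p, 'x, 'n) pbundle \<Rightarrow> (('p \<times> 'n cmat) set, 'x, 'n) pbundle"
where
  "extension G K E =
     \<lparr>total = (total E \<times> G) // ext_rel G K E,
      proj = (\<lambda>e. proj E (fst (SOME y. y \<in> e))),
      ract = (\<lambda>e g. (\<lambda>(p, h). (p, h ** g)) ` e),
      frames = ext_frame G K E ` frames E\<rparr>"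


section \<open>Forms, holomorphic structures and connections\<close>

text \<open>Sections and forms are families of local expressions, indexed by a chart \<open>c\<close> and a frame
  \<open>s\<close>. They are taken to be 0 off \<open>fst c \<inter> fst s\<close>, so that equal forms are equal families.\<close>

type_synonym ('x, 'p, 'n) family = "'x chart \<Rightarrow> ('x, 'p) frame \<Rightarrow> 'x \<Rightarrow> complex ^ 'n ^ 'n"

definition d_zbar :: "(complex \<Rightarrow> 'n::finite cmat) \<Rightarrow> complex \<Rightarrow> 'n cmat" where
  "d_zbar f z =
     cscale (1 / 2) (frechet_derivative f (at z) 1 + cscale \<i> (frechet_derivative f (at z) \<i>))"

definition local_family ::
  "('x::t2_space) chart set \<Rightarrow> 'n::finite cmat set \<Rightarrow> ('p, 'x, 'n) pbundle \<Rightarrow> ('x, 'p, 'n) family \<Rightarrow> bool"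
where
  "local_family X H E \<omega> \<longleftrightarrow>
     (\<forall>c s x. \<not> (c \<in> X \<and> s \<in> frames E \<and> x \<in> fst c \<inter> fst s) \<longrightarrow> \<omega> c s x = 0) \<and>
     (\<forall>c\<in>X. \<forall>s\<in>frames E. \<forall>x\<in>fst c \<inter> fst s. \<omega> c s x \<in> lie_algebra H) \<and>
     (\<forall>c\<in>X. \<forall>s\<in>frames E. smooth_on (snd c ` (fst c \<inter> fst s)) (\<omega> c s \<circ> param c))"

text \<open>\<open>A\<^sup>m\<^sup>,\<^sup>n(ad E)\<close> for an \<open>H\<close>-bundle \<open>E\<close>, where \<open>\<omega> c s\<close> is the coefficient of
  \<open>(dz)\<^sup>m (d(cnj z))\<^sup>n\<close>.\<close>

definition ad_forms ::
  "('x::t2_space) chart set \<Rightarrow> 'n::finite cmat set \<Rightarrow> ('p, 'x, 'n) pbundle \<Rightarrow> nat \<Rightarrow> nat \<Rightarrow>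
   ('x, 'p, 'n) family set" where
  "ad_forms X H E m n = {\<omega>. local_family X H E \<omega> \<and>
     (\<forall>c\<in>X. \<forall>d\<in>X. \<forall>s\<in>frames E. \<forall>x\<in>fst c \<inter> fst d \<inter> fst s.
        \<omega> c s x = cscale (coord_deriv c d x ^ m * cnj (coord_deriv c d x) ^ n) (\<omega> d s x)) \<and>
     (\<forall>c\<in>X. \<forall>s\<in>frames E. \<forall>t\<in>frames E. \<forall>x\<in>fst c \<inter> fst s \<inter> fst t.
        let g = transition H E s t x in \<omega> c t x = matrix_inv g ** \<omega> c s x ** g)}"

text \<open>Holomorphic structures on the \<open>H\<close>-bundle \<open>E\<close>, given by their Dolbeault operators
  \<open>\<partial>\<^sub>z\<^sub>b\<^sub>a\<^sub>r + \<alpha>\<close> with respect to the frames, \<open>\<alpha> c s\<close> being the coefficient of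
  \<open>d(cnj z)\<close>; on a Riemann surface there is no integrability condition.\<close>

definition holomorphic_structures ::
  "('x::t2_space) chart set \<Rightarrow> 'n::finite cmat set \<Rightarrow> ('p, 'x, 'n) pbundle \<Rightarrow> ('x, 'p, 'n) family set"
where
  "holomorphic_structures X H E = {\<alpha>. local_family X H E \<alpha> \<and>
     (\<forall>c\<in>X. \<forall>d\<in>X. \<forall>s\<in>frames E. \<forall>x\<in>fst c \<inter> fst d \<inter> fst s.
        \<alpha> c s x = cscale (cnj (coord_deriv c d x)) (\<alpha> d s x)) \<and>
     (\<forall>c\<in>X. \<forall>s\<in>frames E. \<forall>t\<in>frames E. \<forall>x\<in>fst c \<inter> fst s \<inter> fst t.
        let g = transition H E s t in
        \<alpha> c t x = matrix_inv (g x) ** \<alpha> c s x ** g x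
                  + matrix_inv (g x) ** d_zbar (g \<circ> param c) (snd c x))}"

text \<open>Connections on the \<open>H\<close>-bundle \<open>E\<close>: \<open>A c s x v\<close> is the value of the local connection form on
  the real tangent vector at \<open>x\<close> with coordinate expression \<open>v\<close>.\<close>

definition connections ::
  "('x::t2_space) chart set \<Rightarrow> 'n::finite cmat set \<Rightarrow> ('p, 'x, 'n) pbundle \<Rightarrow>
   ('x chart \<Rightarrow> ('x, 'p) frame \<Rightarrow> 'x \<Rightarrow> complex \<Rightarrow> 'n cmat) set" where
  "connections X H E = {A.
     (\<forall>c s x. linear (A c s x)) \<and>
     (\<forall>v. local_family X H E (\<lambda>c s x. A c s x v)) \<and>
     (\<forall>c\<in>X. \<forall>d\<in>X. \<forall>s\<in>frames E. \<forall>x\<in>fst c \<inter> fst d \<inter> fst s. \<forall>v.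
        A c s x v = A d s x (coord_deriv c d x * v)) \<and>
     (\<forall>c\<in>X. \<forall>s\<in>frames E. \<forall>t\<in>frames E. \<forall>x\<in>fst c \<inter> fst s \<inter> fst t. \<forall>v.
        let g = transition H E s t in
        A c t x v = matrix_inv (g x) ** A c s x v ** g x
                    + matrix_inv (g x) ** frechet_derivative (g \<circ> param c) (at (snd c x)) v)}"

text \<open>The Chern connection of a holomorphic structure on \<open>E \<times>\<^sub>K G\<close>. In induced frames the induced
  connection on \<open>E \<times>\<^sub>K G\<close> has the same local forms; compatibility means that its \<open>(0,1)\<close>-part
  \<open>(A(\<partial>\<^sub>x) + \<surd>-1 A(\<partial>\<^sub>y))/2\<close> is the given structure.\<close>

definition chern_connection ::
  "('x::t2_space) chart set \<Rightarrow> 'n::finite cmat set \<Rightarrow> 'n cmat set \<Rightarrow> ('p, 'x, 'n) pbundle \<Rightarrow>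
   ('x, ('p \<times> 'n cmat) set, 'n) family \<Rightarrow>
   ('x chart \<Rightarrow> ('x, 'p) frame \<Rightarrow> 'x \<Rightarrow> complex \<Rightarrow> 'n cmat)" where
  "chern_connection X G K E \<alpha> = (THE A. A \<in> connections X K E \<and>
     (\<forall>c\<in>X. \<forall>s\<in>frames E. \<forall>x\<in>fst c \<inter> fst s.
        cscale (1 / 2) (A c s x 1 + cscale \<i> (A c s x \<i>)) = \<alpha> c (ext_frame G K E s) x))"

text \<open>The coefficient of \<open>dz \<and> d(cnj z)\<close> in the curvature \<open>dA + A \<and> A\<close>; note
  \<open>dx \<and> dy = (\<surd>-1/2) dz \<and> d(cnj z)\<close>.\<close>

definition curvature ::
  "('x chart \<Rightarrow> ('x, 'p) frame \<Rightarrow> 'x \<Rightarrow> complex \<Rightarrow> 'n::finite cmat) \<Rightarrow> ('x, 'p, 'n) family" where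
  "curvature A c s x = cscale (\<i> / 2)
     (frechet_derivative (\<lambda>z. A c s (param c z) \<i>) (at (snd c x)) 1
      - frechet_derivative (\<lambda>z. A c s (param c z) 1) (at (snd c x)) \<i>
      + bracket (A c s x 1) (A c s x \<i>))"


section \<open>The Yang--Mills--Higgs functional\<close>

type_synonym ('x, 'p, 'n) pair =
  "('x, ('p \<times> 'n cmat) set, 'n) family \<times> ('x, ('p \<times> 'n cmat) set, 'n) family"

definition B0 ::
  "('x::t2_space) chart set \<Rightarrow> 'n::finite cmat set \<Rightarrow> 'n cmat set \<Rightarrow> ('p, 'x, 'n) pbundle \<Rightarrow>
   ('x, 'p, 'n) pair set" where
  "B0 X G K E =
     holomorphic_structures X G (extension G K E) \<times> ad_forms X G (extension G K E) 1 0"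

definition tangent_B0 ::
  "('x::t2_space) chart set \<Rightarrow> 'n::finite cmat set \<Rightarrow> 'n cmat set \<Rightarrow> ('p, 'x, 'n) pbundle \<Rightarrow>
   ('x, 'p, 'n) pair set" where
  "tangent_B0 X G K E =
     ad_forms X G (extension G K E) 0 1 \<times> ad_forms X G (extension G K E) 1 0"

definition translate :: "('x, 'p, 'n::finite) pair \<Rightarrow> real \<Rightarrow> ('x, 'p, 'n) pair \<Rightarrow> ('x, 'p, 'n) pair"
where
  "translate b r w =
     (\<lambda>c s x. fst b c s x + r *\<^sub>R fst w c s x, \<lambda>c s x. snd b c s x + r *\<^sub>R snd w c s x)"

definition dbar_ad ::
  "('x, 'p, 'n::finite) family \<Rightarrow> ('x, 'p, 'n) family \<Rightarrow> ('x, 'p, 'n) family" where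
  "dbar_ad \<alpha> \<theta> c s x = d_zbar (\<theta> c s \<circ> param c) (snd c x) + bracket (\<alpha> c s x) (\<theta> c s x)"

definition higgs_pairs ::
  "('x::t2_space) chart set \<Rightarrow> 'n::finite cmat set \<Rightarrow> 'n cmat set \<Rightarrow> ('p, 'x, 'n) pbundle \<Rightarrow>
   ('x, 'p, 'n) pair set" where
  "higgs_pairs X G K E = {(\<alpha>, \<theta>) \<in> B0 X G K E.
     \<forall>c\<in>X. \<forall>s\<in>frames (extension G K E). \<forall>x\<in>fst c \<inter> fst s. dbar_ad \<alpha> \<theta> c s x = 0}"

text \<open>Fibre norms are computed in a frame induced from \<open>E\<close>; by the \<open>K\<close>-invariance of
  the Hermitian form the choice of the frame is irrelevant.\<close>

definition frame_at :: "('p, 'x, 'n::finite) pbundle \<Rightarrow> 'x \<Rightarrow> ('x, 'p) frame" where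
  "frame_at E x = (SOME s. s \<in> frames E \<and> x \<in> fst s)"

definition riemannian ::
  "('x::t2_space) chart set \<Rightarrow> 'n::finite cmat set \<Rightarrow> 'n cmat set \<Rightarrow> ('n cmat \<Rightarrow> 'm::finite cmat) \<Rightarrow>
   ('p, 'x, 'n) pbundle \<Rightarrow> ('x, 'p, 'n) pair \<Rightarrow> ('x, 'p, 'n) pair \<Rightarrow> real" where
  "riemannian X G K \<rho> E v w = surface_integral X (\<lambda>c x.
     let s = ext_frame G K E (frame_at E x) in
     Re (herm G K \<rho> (fst v c s x) (fst w c s x) + herm G K \<rho> (snd v c s x) (snd w c s x)))"

text \<open>The coefficient of \<open>dz \<and> d(cnj z)\<close> in \<open>K(\<alpha>) + [\<theta>, \<theta>\<^sup>*]\<close>, in the frames of \<open>E\<close>.\<close>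

definition hitchin_form ::
  "('x::t2_space) chart set \<Rightarrow> 'n::finite cmat set \<Rightarrow> 'n cmat set \<Rightarrow> ('p, 'x, 'n) pbundle \<Rightarrow>
   ('x, 'p, 'n) pair \<Rightarrow> ('x, 'p, 'n) family" where
  "hitchin_form X G K E b c s x =
     curvature (chern_connection X G K E (fst b)) c s x
     + (let T = snd b c (ext_frame G K E s) x in bracket T (star K T))"

text \<open>Since \<open>|dz \<and> d(cnj z)|\<^sup>2 = 1/h\<^sup>2\<close> and the volume form of the metric is
  \<open>h \<surd>-1 dz \<and> d(cnj z)\<close>, the squared \<open>L\<^sup>2\<close> norm of \<open>M dz \<and> d(cnj z)\<close> is the integral of
  \<open>(|M|\<^sup>2 / h) \<surd>-1 dz \<and> d(cnj z)\<close>.\<close>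

definition YMH ::
  "('x::t2_space) chart set \<Rightarrow> ('x chart \<Rightarrow> 'x \<Rightarrow> real) \<Rightarrow> 'n::finite cmat set \<Rightarrow> 'n cmat set \<Rightarrow>
   ('n cmat \<Rightarrow> 'm::finite cmat) \<Rightarrow> ('p, 'x, 'n) pbundle \<Rightarrow> ('x, 'p, 'n) pair \<Rightarrow> real" where
  "YMH X h G K \<rho> E b = surface_integral X (\<lambda>c x.
     let M = hitchin_form X G K E b c (frame_at E x) x in Re (herm G K \<rho> M M) / h c x)"

definition is_gradient_YMH ::
  "('x::t2_space) chart set \<Rightarrow> ('x chart \<Rightarrow> 'x \<Rightarrow> real) \<Rightarrow> 'n::finite cmat set \<Rightarrow> 'n cmat set \<Rightarrow>
   ('n cmat \<Rightarrow> 'm::finite cmat) \<Rightarrow> ('p, 'x, 'n) pbundle \<Rightarrow> ('x, 'p, 'n) pair \<Rightarrow> ('x, 'p, 'n) pair \<Rightarrow>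
   bool" where
  "is_gradient_YMH X h G K \<rho> E b v \<longleftrightarrow>
     v \<in> tangent_B0 X G K E \<and>
     (\<forall>w\<in>tangent_B0 X G K E.
        ((\<lambda>r. YMH X h G K \<rho> E (translate b r w)) has_real_derivative riemannian X G K \<rho> E v w) (at 0))"

text \<open>Differentiability of curves of smooth families in the \<open>C\<^sup>\<infinity>\<close> topology: locally uniform
  convergence of the difference quotients together with all their partial derivatives.\<close>

definition family_has_derivative ::
  "('x::t2_space) chart set \<Rightarrow> ('p, 'x, 'n::finite) pbundle \<Rightarrow> (real \<Rightarrow> ('x, 'p, 'n) family) \<Rightarrow>
   ('x, 'p, 'n) family \<Rightarrow> real \<Rightarrow> bool" where
  "family_has_derivative X E \<omega> \<omega>' t \<longleftrightarrow>
     (\<forall>c\<in>X. \<forall>s\<in>frames E. \<forall>L vs. compact L \<and> L \<subseteq> snd c ` (fst c \<inter> fst s) \<longrightarrow>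
        uniform_limit L
          (\<lambda>r. iter_deriv vs (\<lambda>z. (\<omega> (t + r) c s (param c z) - \<omega> t c s (param c z)) /\<^sub>R r))
          (iter_deriv vs (\<lambda>z. \<omega>' c s (param c z))) (at 0))"

definition gradient_flow_line ::
  "('x::t2_space) chart set \<Rightarrow> ('x chart \<Rightarrow> 'x \<Rightarrow> real) \<Rightarrow> 'n::finite cmat set \<Rightarrow> 'n cmat set \<Rightarrow>
   ('n cmat \<Rightarrow> 'm::finite cmat) \<Rightarrow> ('p, 'x, 'n) pbundle \<Rightarrow> (real \<Rightarrow> ('x, 'p, 'n) pair) \<Rightarrow> bool" where
  "gradient_flow_line X h G K \<rho> E \<gamma> \<longleftrightarrow>
     (\<forall>t. \<gamma> t \<in> B0 X G K E \<and>
        (\<exists>v. is_gradient_YMH X h G K \<rho> E (\<gamma> t) v \<and>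
           family_has_derivative X (extension G K E) (\<lambda>r. fst (\<gamma> r)) (\<lambda>c s x. - fst v c s x) t \<and>
           family_has_derivative X (extension G K E) (\<lambda>r. snd (\<gamma> r)) (\<lambda>c s x. - snd v c s x) t))"

end

theory Submission imports Defs "HOL-Complex_Analysis.Complex_Analysis"
begin

text \<open>Write \<open>\<mu>\<close> for the curvature \<open>K(\<alpha>) + [\<theta>, \<theta>\<^sup>*]\<close> divided by the area form. At every point
  \<open>(\<alpha>, \<theta>)\<close> of \<open>\<B>\<^sub>0\<close>, Higgs or not, integration by parts identifies the gradient with the
  infinitesimal action \<open>(- \<partial>\<^sub>\<alpha> \<Psi>, [\<Psi>, \<theta>])\<close> of the complex gauge transformation \<open>\<Psi> = 2 \<i> \<mu>\<close>, where
  \<open>\<partial>\<^sub>\<alpha>\<close> is the (0,1)-operator of \<open>\<alpha>\<close>. Since \<open>F = \<partial>\<^sub>\<alpha> \<theta>\<close> is equivariant under gauge transformations,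
  along the flow it satisfies, at each point of the surface separately, the linear ordinary
  differential equation \<open>F' = [F, \<Psi>]\<close> in \<open>t\<close>. Hence \<open>F\<close> vanishes for all times if it vanishes at
  time 0.\<close>

section \<open>Calculus of smooth maps\<close>

text \<open>The gradient is given only through its pairings with tangent vectors, so identifying it
  requires a positive definite pairing on \<open>lie_algebra K\<close>. This is where \<rho> and
  \<open>Kt\<close> enter, through two arguments about compact groups: the trace form is negative on
  directions tangent to a compact matrix group, by averaging \<open>adj h ** h\<close> over powers
  of group elements, and the differential of \<rho> is injective on \<open>lie_algebra K\<close>
  because \<rho> is injective on \<open>K\<close>.

  Fibre norms make sense only in frames that differ by elements of \<open>K\<close>. Hence all
  computations use the frames induced from the K-bundle, and the connection is handled through its
  real and imaginary parts in \<open>lie_algebra K\<close>.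

  Along an affine line of pairs the functional is a polynomial of degree at most four, so
  differentiating it is algebra; the analytic input is Stokes' theorem on the surface.

  \<Psi> contains first derivatives of the holomorphic structure, but for a given flow line it is
  just a continuous coefficient in \<open>t\<close> at each point. Negative times are therefore as
  accessible as positive ones.\<close>

lemma frechet_derivative_cong_open:
  assumes "open S" "z \<in> S" "\<And>y. y \<in> S \<Longrightarrow> f y = g y"
  shows "frechet_derivative f (at z) = frechet_derivative g (at z)"
proof -
  have "(f has_derivative D) (at z) \<longleftrightarrow> (g has_derivative D) (at z)" for D
    using assms by (metis has_derivative_transform_within_open)
  then show ?thesis by (simp add: frechet_derivative_def)
qed

lemma differentiable_cong_open:
  assumes "open S" "z \<in> S" "\<And>y. y \<in> S \<Longrightarrow> f y = g y"
  shows "f differentiable (at z) \<longleftrightarrow> g differentiable (at z)"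
  unfolding differentiable_def using assms by (metis has_derivative_transform_within_open)

lemma iter_deriv_cong_open:
  assumes "open S" "\<And>y. y \<in> S \<Longrightarrow> f y = g y" "z \<in> S"
  shows "iter_deriv vs f z = iter_deriv vs g z"
  using assms(2,3)
proof (induction vs arbitrary: f g z)
  case (Cons v vs)
  have "frechet_derivative f (at y) v = frechet_derivative g (at y) v" if "y \<in> S" for y
    by (rule arg_cong[where f="\<lambda>D. D v"], rule frechet_derivative_cong_open[OF assms(1) that]) (rule Cons.prems)
  then show ?case unfolding iter_deriv.simps by (rule Cons.IH) (simp_all add: Cons.prems(2))
qed auto

text \<open>\<open>smooth_on\<close> quantifies over all iterated directional derivatives, so it is
  a greatest fixed point: a class of functions that are differentiable on \<open>S\<close> and
  closed under directional derivatives, up to equality on \<open>S\<close>, contains only smooth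
  functions. The closure proofs below only have to exhibit a suitable class.\<close>

lemma smooth_on_coinduct:
  assumes "open S" "P f"
    and diff: "\<And>f z. P f \<Longrightarrow> z \<in> S \<Longrightarrow> f differentiable (at z)"
    and deriv: "\<And>f v. P f \<Longrightarrow> \<exists>g. P g \<and> (\<forall>z\<in>S. frechet_derivative f (at z) v = g z)"
  shows "smooth_on S f"
proof -
  have "iter_deriv vs f differentiable (at z)" if "P f" "z \<in> S" for vs f z
    using that
  proof (induction vs arbitrary: f z)
    case Nil then show ?case using diff by simp
  next
    case (Cons v vs)
    obtain g where g: "P g" "\<forall>z\<in>S. frechet_derivative f (at z) v = g z"
      using deriv[OF Cons.prems(1)] by blast
    have "iter_deriv vs (\<lambda>z. frechet_derivative f (at z) v) y = iter_deriv vs g y" if "y \<in> S" for y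
      by (rule iter_deriv_cong_open[OF assms(1) _ that]) (use g in auto)
    then have "iter_deriv (v # vs) f differentiable at z \<longleftrightarrow> iter_deriv vs g differentiable at z"
      unfolding iter_deriv.simps by (rule differentiable_cong_open[OF assms(1) Cons.prems(2)])
    then show ?case using Cons.IH[OF g(1) Cons.prems(2)] by simp
  qed
  then show ?thesis using assms(2) by (auto simp: smooth_on_def)
qed

lemma smooth_on_differentiable: "smooth_on S f \<Longrightarrow> z \<in> S \<Longrightarrow> f differentiable (at z)"
  unfolding smooth_on_def by (metis iter_deriv.simps(1))

lemma smooth_on_has_derivative:
  "smooth_on S f \<Longrightarrow> z \<in> S \<Longrightarrow> (f has_derivative frechet_derivative f (at z)) (at z)"
  using smooth_on_differentiable frechet_derivative_works by blast

lemma smooth_on_frechet_derivative: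
  "smooth_on S f \<Longrightarrow> smooth_on S (\<lambda>z. frechet_derivative f (at z) v)"
  unfolding smooth_on_def by (metis iter_deriv.simps(2))

lemma smooth_on_continuous_on: "smooth_on S f \<Longrightarrow> continuous_on S f"
  by (meson continuous_at_imp_continuous_on differentiable_imp_continuous_within smooth_on_differentiable)

lemma smooth_on_subset: "smooth_on T f \<Longrightarrow> S \<subseteq> T \<Longrightarrow> smooth_on S f"
  unfolding smooth_on_def by blast

lemma smooth_on_cong:
  assumes "open S" "\<And>y. y \<in> S \<Longrightarrow> f y = g y"
  shows "smooth_on S f \<longleftrightarrow> smooth_on S g"
proof -
  have "iter_deriv vs f differentiable at z \<longleftrightarrow> iter_deriv vs g differentiable at z" if "z \<in> S" for vs z
    by (rule differentiable_cong_open[OF assms(1) that]) (use iter_deriv_cong_open[OF assms(1)] assms(2) in blast)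
  then show ?thesis by (simp add: smooth_on_def)
qed

lemma smooth_on_Union:
  assumes "\<And>x. x \<in> S \<Longrightarrow> \<exists>T. x \<in> T \<and> smooth_on T f"
  shows "smooth_on S f"
  using assms unfolding smooth_on_def by blast

lemma smooth_on_const: "open S \<Longrightarrow> smooth_on S (\<lambda>_. c)"
  by (rule smooth_on_coinduct[where P="\<lambda>f. \<exists>c. f = (\<lambda>_. c)"]) auto

lemma smooth_on_bounded_linear:
  assumes "bounded_linear L" "smooth_on S f" "open S"
  shows "smooth_on S (\<lambda>z. L (f z))"
proof (rule smooth_on_coinduct[where P="\<lambda>g. \<exists>f. smooth_on S f \<and> g = (\<lambda>z. L (f z))", OF assms(3)])
  have *: "((\<lambda>z. L (f z)) has_derivative (\<lambda>v. L (frechet_derivative f (at z) v))) (at z)"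
    if "smooth_on S f" "z \<in> S" for f z
    by (rule bounded_linear.has_derivative[OF assms(1)]) (rule smooth_on_has_derivative[OF that])
  show "g differentiable at z" if "\<exists>f. smooth_on S f \<and> g = (\<lambda>z. L (f z))" "z \<in> S" for g z
    using that * differentiable_def by blast
  show "\<exists>g'. (\<exists>f. smooth_on S f \<and> g' = (\<lambda>z. L (f z))) \<and> (\<forall>z\<in>S. frechet_derivative g (at z) v = g' z)"
    if g: "\<exists>f. smooth_on S f \<and> g = (\<lambda>z. L (f z))" for g v
  proof -
    obtain f where f: "smooth_on S f" "g = (\<lambda>z. L (f z))" using g by blast
    have "\<forall>z\<in>S. frechet_derivative g (at z) v = L (frechet_derivative f (at z) v)"
      using *[OF f(1)] f(2) frechet_derivative_at by metis
    then show ?thesis using smooth_on_frechet_derivative[OF f(1), of v] by blast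
  qed
qed (use assms in blast)

lemma smooth_on_bounded_linear_id: "bounded_linear L \<Longrightarrow> open S \<Longrightarrow> smooth_on S L"
proof (rule smooth_on_coinduct[where P="\<lambda>g. g = L \<or> (\<exists>c. g = (\<lambda>_. c))"])
  assume L: "bounded_linear L"
  have fd: "frechet_derivative L (at z) = L" for z
    using frechet_derivative_at[OF bounded_linear_imp_has_derivative[OF L]] by metis
  show "f differentiable at z" if "f = L \<or> (\<exists>c. f = (\<lambda>_. c))" for f z
    using that bounded_linear_imp_differentiable[OF L] by auto
  show "\<exists>g. (g = L \<or> (\<exists>c. g = (\<lambda>_. c))) \<and> (\<forall>z\<in>S. frechet_derivative f (at z) v = g z)"
    if "f = L \<or> (\<exists>c. f = (\<lambda>_. c))" for f v
    using that fd by (intro exI[of _ "\<lambda>_. frechet_derivative f (at 0) v"]) auto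
qed auto

lemma smooth_on_add:
  assumes "smooth_on S f" "smooth_on S g" "open S"
  shows "smooth_on S (\<lambda>z. f z + g z)"
proof (rule smooth_on_coinduct[where P="\<lambda>h. \<exists>f g. smooth_on S f \<and> smooth_on S g \<and> h = (\<lambda>z. f z + g z)", OF assms(3)])
  have *: "((\<lambda>z. f z + g z) has_derivative (\<lambda>v. frechet_derivative f (at z) v + frechet_derivative g (at z) v)) (at z)"
    if "smooth_on S f" "smooth_on S g" "z \<in> S" for f g z
    using that by (intro has_derivative_add smooth_on_has_derivative[where S=S])
  show "h differentiable at z" if "\<exists>f g. smooth_on S f \<and> smooth_on S g \<and> h = (\<lambda>z. f z + g z)" "z \<in> S" for h z
    using that * differentiable_def by blast
  show "\<exists>h'. (\<exists>f g. smooth_on S f \<and> smooth_on S g \<and> h' = (\<lambda>z. f z + g z)) \<and> (\<forall>z\<in>S. frechet_derivative h (at z) v = h' z)"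
    if h: "\<exists>f g. smooth_on S f \<and> smooth_on S g \<and> h = (\<lambda>z. f z + g z)" for h v
  proof -
    obtain f g where f: "smooth_on S f" "smooth_on S g" "h = (\<lambda>z. f z + g z)" using h by blast
    have "\<forall>z\<in>S. frechet_derivative h (at z) v = frechet_derivative f (at z) v + frechet_derivative g (at z) v"
      using *[OF f(1,2)] f(3) frechet_derivative_at by metis
    then show ?thesis
      using smooth_on_frechet_derivative[OF f(1), of v] smooth_on_frechet_derivative[OF f(2), of v] by blast
  qed
qed (use assms in blast)

lemma smooth_on_sum:
  assumes "\<And>i. i \<in> I \<Longrightarrow> smooth_on S (f i)" "open S"
  shows "smooth_on S (\<lambda>z. \<Sum>i\<in>I. f i z)"
  using assms by (induction I rule: infinite_finite_induct) (auto simp: smooth_on_const smooth_on_add)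

text \<open>A single product is not stable under differentiation, but sums of products are, by the
  Leibniz rule.\<close>

inductive bilinear_span ::
  "'a::real_normed_vector set \<Rightarrow> ('b::real_normed_vector \<Rightarrow> 'c::real_normed_vector \<Rightarrow> 'd::real_normed_vector) \<Rightarrow> ('a \<Rightarrow> 'd) \<Rightarrow> bool"
  for S bl where
  prod: "smooth_on S f \<Longrightarrow> smooth_on S g \<Longrightarrow> bilinear_span S bl (\<lambda>z. bl (f z) (g z))"
| add: "bilinear_span S bl f \<Longrightarrow> bilinear_span S bl g \<Longrightarrow> bilinear_span S bl (\<lambda>z. f z + g z)"

lemma smooth_on_bounded_bilinear:
  assumes bl: "bounded_bilinear bl" and "smooth_on S f" "smooth_on S g" "open S"
  shows "smooth_on S (\<lambda>z. bl (f z) (g z))"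
proof (rule smooth_on_coinduct[where P="bilinear_span S bl", OF \<open>open S\<close>])
  have *: "\<exists>D. (\<forall>z\<in>S. (f has_derivative (\<lambda>v. D v z)) (at z)) \<and> (\<forall>v. bilinear_span S bl (D v))"
    if "bilinear_span S bl f" for f
    using that
  proof (induction rule: bilinear_span.induct)
    case (prod f g)
    have "((\<lambda>z. bl (f z) (g z)) has_derivative
        (\<lambda>v. bl (f z) (frechet_derivative g (at z) v) + bl (frechet_derivative f (at z) v) (g z))) (at z)"
      if "z \<in> S" for z
      using bounded_bilinear.FDERIV[OF bl smooth_on_has_derivative[OF prod(1) that] smooth_on_has_derivative[OF prod(2) that]] .
    then show ?case
      by (intro exI[of _ "\<lambda>v z. bl (f z) (frechet_derivative g (at z) v) + bl (frechet_derivative f (at z) v) (g z)"])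
         (auto intro!: bilinear_span.intros prod smooth_on_frechet_derivative)
  next
    case (add f g)
    then obtain D E where "\<forall>z\<in>S. (f has_derivative (\<lambda>v. D v z)) (at z)" "\<forall>v. bilinear_span S bl (D v)"
      "\<forall>z\<in>S. (g has_derivative (\<lambda>v. E v z)) (at z)" "\<forall>v. bilinear_span S bl (E v)" by blast
    then show ?case
      by (intro exI[of _ "\<lambda>v z. D v z + E v z"]) (auto intro!: has_derivative_add bilinear_span.add)
  qed
  show "f differentiable at z" if "bilinear_span S bl f" "z \<in> S" for f z
    using *[OF that(1)] that(2) differentiable_def by blast
  show "\<exists>g. bilinear_span S bl g \<and> (\<forall>z\<in>S. frechet_derivative f (at z) v = g z)" if "bilinear_span S bl f" for f v
  proof -
    obtain D where D: "\<forall>z\<in>S. (f has_derivative (\<lambda>v. D v z)) (at z)" "\<forall>v. bilinear_span S bl (D v)"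
      using *[OF \<open>bilinear_span S bl f\<close>] by blast
    have "\<forall>z\<in>S. frechet_derivative f (at z) v = D v z"
      using D(1) frechet_derivative_at by metis
    then show ?thesis using D(2) by blast
  qed
qed (use assms in \<open>auto intro: bilinear_span.intros\<close>)

lemmas smooth_on_mult = smooth_on_bounded_bilinear[OF bounded_bilinear_mult]

text \<open>The chain rule produces compositions with smooth scalar factors in front, and sums of
  these; their span is stable under differentiation.\<close>

inductive comp_span ::
  "'a::real_normed_vector set \<Rightarrow> 'b::euclidean_space set \<Rightarrow> ('a \<Rightarrow> 'b) \<Rightarrow> ('a \<Rightarrow> 'c::real_normed_vector) \<Rightarrow> bool"
  for S T g where
  comp: "smooth_on S a \<Longrightarrow> smooth_on T f \<Longrightarrow> comp_span S T g (\<lambda>z. a z *\<^sub>R f (g z))"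
| add: "comp_span S T g f \<Longrightarrow> comp_span S T g f' \<Longrightarrow> comp_span S T g (\<lambda>z. f z + f' z)"

lemma smooth_on_compose:
  fixes g :: "'a::real_normed_vector \<Rightarrow> 'b::euclidean_space" and f :: "'b \<Rightarrow> 'c::real_normed_vector"
  assumes f: "smooth_on T f" and g: "smooth_on S g" and S: "open S" and T: "open T" and sub: "g ` S \<subseteq> T"
  shows "smooth_on S (\<lambda>z. f (g z))"
proof (rule smooth_on_coinduct[where P="comp_span S T g", OF \<open>open S\<close>])
  have zero: "comp_span S T g (\<lambda>z. 0)"
    using comp_span.comp[OF smooth_on_const[OF S, of 0] smooth_on_const[OF T, of 0], of g] by simp
  have sum: "comp_span S T g (\<lambda>z. \<Sum>i\<in>I. F i z)" if "\<And>i. i \<in> I \<Longrightarrow> comp_span S T g (F i)" "finite I"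
    for F :: "'b \<Rightarrow> 'a \<Rightarrow> 'c" and I
    using that(2,1)
    proof (induction I rule: finite_induct)
      case (insert i I)
      then have "comp_span S T g (\<lambda>z. F i z + (\<Sum>i\<in>I. F i z))" by (intro comp_span.add) auto
      then show ?case using insert by simp
    qed (simp add: zero)
  have *: "\<exists>D. (\<forall>z\<in>S. (f has_derivative (\<lambda>v. D v z)) (at z)) \<and> (\<forall>v. comp_span S T g (D v))"
    if "comp_span S T g f" for f :: "'a \<Rightarrow> 'c"
    using that
  proof (induction rule: comp_span.induct)
    case (comp a f)
    \<comment> \<open>Product rule, with the increment of \<open>g\<close> expanded in
      \<open>Basis\<close>: its coordinates become smooth scalar factors, and \<open>f\<close> is
      only differentiated along fixed basis vectors.\<close>
    define D where "D v z = (\<Sum>e\<in>Basis. (a z * (frechet_derivative g (at z) v \<bullet> e)) *\<^sub>R frechet_derivative f (at (g z)) e)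
        + frechet_derivative a (at z) v *\<^sub>R f (g z)" for v z
    have "((\<lambda>z. a z *\<^sub>R f (g z)) has_derivative (\<lambda>v. D v z)) (at z)" if "z \<in> S" for z
    proof -
      have gz: "g z \<in> T" using that sub by blast
      have df: "(f has_derivative frechet_derivative f (at (g z))) (at (g z))"
        by (rule smooth_on_has_derivative[OF comp(2) gz])
      have lin: "linear (frechet_derivative f (at (g z)))"
        using df has_derivative_linear by blast
      have "((\<lambda>z. f (g z)) has_derivative (\<lambda>v. frechet_derivative f (at (g z)) (frechet_derivative g (at z) v))) (at z)"
        by (rule has_derivative_compose[OF smooth_on_has_derivative[OF g that] df])
      from has_derivative_scaleR[OF smooth_on_has_derivative[OF comp(1) that] this]
      have "((\<lambda>z. a z *\<^sub>R f (g z)) has_derivative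
        (\<lambda>v. a z *\<^sub>R frechet_derivative f (at (g z)) (frechet_derivative g (at z) v) + frechet_derivative a (at z) v *\<^sub>R f (g z))) (at z)" .
      moreover have "a z *\<^sub>R frechet_derivative f (at (g z)) w = (\<Sum>e\<in>Basis. (a z * (w \<bullet> e)) *\<^sub>R frechet_derivative f (at (g z)) e)" for w
      proof -
        have "frechet_derivative f (at (g z)) w = (\<Sum>e\<in>Basis. (w \<bullet> e) *\<^sub>R frechet_derivative f (at (g z)) e)"
        proof -
          have "frechet_derivative f (at (g z)) w = frechet_derivative f (at (g z)) (\<Sum>e\<in>Basis. (w \<bullet> e) *\<^sub>R e)"
            by (simp only: euclidean_representation)
          also have "\<dots> = (\<Sum>e\<in>Basis. (w \<bullet> e) *\<^sub>R frechet_derivative f (at (g z)) e)"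
            by (simp only: linear_sum[OF lin] linear_scale[OF lin])
          finally show ?thesis .
        qed
        then show ?thesis by (simp only: scaleR_sum_right scaleR_scaleR)
      qed
      ultimately show ?thesis unfolding D_def by (simp only:)
    qed
    moreover have "comp_span S T g (D v)" for v
      unfolding D_def
    proof (rule comp_span.add, rule sum)
      show "comp_span S T g (\<lambda>z. (a z * (frechet_derivative g (at z) v \<bullet> e)) *\<^sub>R frechet_derivative f (at (g z)) e)" for e
        by (rule comp_span.comp[OF smooth_on_mult[OF comp(1) smooth_on_bounded_linear[OF bounded_linear_inner_left
              smooth_on_frechet_derivative[OF g] S] S] smooth_on_frechet_derivative[OF comp(2)]])
      show "comp_span S T g (\<lambda>z. frechet_derivative a (at z) v *\<^sub>R f (g z))"
        by (rule comp_span.comp[OF smooth_on_frechet_derivative[OF comp(1)] comp(2)])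
    qed auto
    ultimately show ?case by blast
  next
    case (add h h')
    then obtain D E where "\<forall>z\<in>S. (h has_derivative (\<lambda>v. D v z)) (at z)" "\<forall>v. comp_span S T g (D v)"
      "\<forall>z\<in>S. (h' has_derivative (\<lambda>v. E v z)) (at z)" "\<forall>v. comp_span S T g (E v)" by blast
    then show ?case
      by (intro exI[of _ "\<lambda>v z. D v z + E v z"] conjI ballI allI has_derivative_add comp_span.add) blast+
  qed
  show "f differentiable at z" if "comp_span S T g f" "z \<in> S" for f :: "'a \<Rightarrow> 'c" and z
    using *[OF that(1)] that(2) differentiable_def by blast
  show "\<exists>h. comp_span S T g h \<and> (\<forall>z\<in>S. frechet_derivative f (at z) v = h z)" if "comp_span S T g f" for f :: "'a \<Rightarrow> 'c" and v
  proof -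
    obtain D where D: "\<forall>z\<in>S. (f has_derivative (\<lambda>v. D v z)) (at z)" "\<forall>v. comp_span S T g (D v)"
      using *[OF \<open>comp_span S T g f\<close>] by blast
    have "\<forall>z\<in>S. frechet_derivative f (at z) v = D v z"
      using D(1) frechet_derivative_at by metis
    then show ?thesis using D(2) by blast
  qed
  show "comp_span S T g (\<lambda>z. f (g z))"
    using comp_span.comp[OF smooth_on_const[OF S, of 1] f, of g] by simp
qed

text \<open>In one real variable the directional derivative along \<open>v\<close> is the ordinary
  derivative times \<open>v\<close>; closure under constant factors absorbs this
  \<open>v\<close>.\<close>

lemma smooth_onI_real_deriv:
  fixes P :: "(real \<Rightarrow> real) \<Rightarrow> bool"
  assumes "open S" "P f" "\<And>f. P f \<Longrightarrow> \<exists>g. P g \<and> (\<forall>x\<in>S. (f has_real_derivative g x) (at x))"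
    and scale: "\<And>f v. P f \<Longrightarrow> P (\<lambda>x. f x * v)"
  shows "smooth_on S f"
proof (rule smooth_on_coinduct[where P=P, OF assms(1,2)])
  show "f differentiable at z" if "P f" "z \<in> S" for f z
    using assms(3)[OF that(1)] that(2) field_differentiable_imp_differentiable field_differentiable_def by blast
  show "\<exists>g. P g \<and> (\<forall>z\<in>S. frechet_derivative f (at z) v = g z)" if f: "P f" for f v
  proof -
    obtain g where g: "P g" "\<forall>x\<in>S. (f has_real_derivative g x) (at x)" using assms(3)[OF f] by blast
    have "frechet_derivative f (at z) = (*) (g z)" if "z \<in> S" for z
      using g(2) that frechet_derivative_at[of f "(*) (g z)" z] by (simp add: has_field_derivative_def)
    then show ?thesis using scale[OF g(1), of v] by (intro exI[of _ "\<lambda>x. g x * v"]) auto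
  qed
qed

lemma smooth_on_inverse_real: "smooth_on (- {0}) (inverse :: real \<Rightarrow> real)"
proof (rule smooth_onI_real_deriv[where P="\<lambda>f. \<exists>c n. f = (\<lambda>x. c * inverse x ^ n)"])
  show "\<exists>c n. inverse = (\<lambda>x::real. c * inverse x ^ n)" by (intro exI[of _ 1]) auto
  show "\<exists>g. (\<exists>c n. g = (\<lambda>x. c * inverse x ^ n)) \<and> (\<forall>x\<in>- {0}. (f has_real_derivative g x) (at x))"
    if f: "\<exists>c n. f = (\<lambda>x. c * inverse x ^ n)" for f :: "real \<Rightarrow> real"
  proof -
    obtain c n where f: "f = (\<lambda>x. c * inverse x ^ n)" using f by blast
    have "(f has_real_derivative - (c * n) * inverse x ^ (n + 1)) (at x)" if "x \<in> - {0}" for x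
    proof (cases n)
      case (Suc m)
      have "x \<noteq> 0" using that by simp
      have "((\<lambda>x. c * inverse x ^ n) has_real_derivative
          c * (real n * (- (inverse x ^ Suc (Suc 0)) * inverse x ^ (n - Suc 0)))) (at x)"
        by (intro DERIV_cmult DERIV_power DERIV_inverse \<open>x \<noteq> 0\<close>)
      moreover have "c * (real n * (- (inverse x ^ Suc (Suc 0)) * inverse x ^ (n - Suc 0))) = - (c * n) * inverse x ^ (n + 1)"
        by (simp add: Suc)
      ultimately show ?thesis unfolding f by metis
    qed (simp add: f)
    then show ?thesis by blast
  qed
  show "\<exists>c n. (\<lambda>x. f x * v) = (\<lambda>x. c * inverse x ^ n)" if f: "\<exists>c n. f = (\<lambda>x. c * inverse x ^ n)" for f :: "real \<Rightarrow> real" and v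
    using f by (metis mult.commute mult.assoc)
qed auto

lemma smooth_on_inverse:
  fixes f :: "'a::real_normed_vector \<Rightarrow> real"
  assumes "smooth_on S f" "open S" "\<And>z. z \<in> S \<Longrightarrow> f z \<noteq> 0"
  shows "smooth_on S (\<lambda>z. inverse (f z))"
  by (rule smooth_on_compose[OF smooth_on_inverse_real assms(1,2)]) (use assms(3) in auto)

section \<open>Smooth cutoff functions\<close>

definition flat_exp :: "real poly \<Rightarrow> real \<Rightarrow> real" where
  "flat_exp p t = (if t > 0 then poly p (inverse t) * exp (- inverse t) else 0)"

lemma poly_times_exp_minus_tendsto_0: "((\<lambda>s::real. poly p s * exp (- s)) \<longlongrightarrow> 0) at_top"
proof -
  have "((\<lambda>s::real. \<Sum>i\<le>degree p. coeff p i * (s ^ i / exp s)) \<longlongrightarrow> (\<Sum>i\<le>degree p. coeff p i * 0)) at_top"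
    by (intro tendsto_intros tendsto_power_div_exp_0)
  then show ?thesis by (simp add: poly_altdef sum_distrib_right exp_minus divide_inverse mult.assoc)
qed

text \<open>With u = 1/t one has d/dt = - u^2 d/du, and p(u) exp(-u) has the u-derivative (p'(u) -
  p(u)) exp(-u); this gives the polynomial u^2 (p - p'). Allowing any polynomial in
  \<open>flat_exp\<close> makes the family closed under differentiation; the case
  \<open>p = 1\<close> is the usual exp(-1/t).\<close>

lemma flat_exp_has_derivative:
  "(flat_exp p has_real_derivative flat_exp ([:0,0,1:] * (p - pderiv p)) t) (at t)"
proof -
  consider "t > 0" | "t < 0" | "t = 0" by linarith
  then show ?thesis
  proof cases
    case 1
    have "((\<lambda>t. poly p (inverse t) * exp (- inverse t)) has_real_derivative
        flat_exp ([:0,0,1:] * (p - pderiv p)) t) (at t)"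
      using 1 by (auto intro!: derivative_eq_intros poly_DERIV simp: flat_exp_def power2_eq_square field_simps)
    then show ?thesis
      by (rule has_field_derivative_transform_within_open[where S="{0<..}"]) (use 1 in \<open>auto simp: flat_exp_def\<close>)
  next
    case 2
    have "((\<lambda>t. 0) has_real_derivative flat_exp ([:0,0,1:] * (p - pderiv p)) t) (at t)"
      using 2 by (auto simp: flat_exp_def)
    then show ?thesis
      by (rule has_field_derivative_transform_within_open[where S="{..<0}"]) (use 2 in \<open>auto simp: flat_exp_def\<close>)
  next
    case 3
    \<comment> \<open>Dividing by \<open>h\<close> multiplies the polynomial by u = 1/h once more,
      and the exponential still wins.\<close>
    have "((\<lambda>h. flat_exp p h / h) \<longlongrightarrow> 0) (at_right 0)"
    proof -
      have "((\<lambda>h::real. poly (p * [:0,1:]) (inverse h) * exp (- inverse h)) \<longlongrightarrow> 0) (at_right 0)"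
        using filterlim_compose[OF poly_times_exp_minus_tendsto_0 filterlim_inverse_at_top_right] .
      moreover have "\<forall>\<^sub>F h in at_right 0. poly (p * [:0,1:]) (inverse h) * exp (- inverse h) = flat_exp p h / h"
        unfolding eventually_at_filter by (auto simp: flat_exp_def field_simps)
      ultimately show ?thesis using tendsto_cong by fast
    qed
    moreover have "((\<lambda>h. flat_exp p h / h) \<longlongrightarrow> 0) (at_left 0)"
      by (rule tendsto_eventually) (auto simp: eventually_at_filter flat_exp_def)
    ultimately have "((\<lambda>h. flat_exp p h / h) \<longlongrightarrow> 0) (at 0)" by (simp add: filterlim_split_at)
    then show ?thesis using 3 by (simp add: DERIV_def flat_exp_def)
  qed
qed

lemma smooth_on_flat_exp: "open S \<Longrightarrow> smooth_on S (flat_exp p)"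
proof (rule smooth_onI_real_deriv[where P="\<lambda>f. \<exists>p. f = flat_exp p"])
  show "\<exists>p. (\<lambda>x. f x * v) = flat_exp p" if f: "\<exists>p. f = flat_exp p" for f v
  proof -
    obtain p where "f = flat_exp p" using f by blast
    then have "(\<lambda>x. f x * v) = flat_exp (smult v p)" by (auto simp: flat_exp_def)
    then show ?thesis by blast
  qed
qed (use flat_exp_has_derivative in blast)+

text \<open>Holomorphic functions on an open set are closed under complex differentiation, and their
  real directional derivatives are \<open>deriv f z * v\<close>.\<close>

lemma smooth_on_holomorphic:
  assumes "f holomorphic_on S" "open S"
  shows "smooth_on S f"
proof (rule smooth_on_coinduct[where P="\<lambda>f. f holomorphic_on S", OF assms(2,1)])
  have D: "(f has_field_derivative deriv f z) (at z)" if "f holomorphic_on S" "z \<in> S" for f z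
    using holomorphic_derivI[OF that(1) assms(2) that(2)] .
  show "f differentiable at z" if "f holomorphic_on S" "z \<in> S" for f z
    using D[OF that] field_differentiable_def field_differentiable_imp_differentiable by blast
  show "\<exists>g. g holomorphic_on S \<and> (\<forall>z\<in>S. frechet_derivative f (at z) v = g z)" if f: "f holomorphic_on S" for f v
  proof (intro exI[of _ "\<lambda>z. deriv f z * v"] conjI ballI)
    show "(\<lambda>z. deriv f z * v) holomorphic_on S"
      using f assms(2) by (intro holomorphic_intros)
    show "frechet_derivative f (at z) v = deriv f z * v" if "z \<in> S" for z
      using frechet_derivative_at[of f "(*) (deriv f z)" z] D[OF f that] by (simp add: has_field_derivative_def)
  qed
qed

text \<open>The second difference \<open>f (x + h u + h v) - f (x + h u) - f (x + h v) + f x\<close> is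
  symmetric in \<open>u\<close> and \<open>v\<close>, and by the mean value theorem it is \<open>h\<^sup>2 \<partial>\<^sub>v \<partial>\<^sub>u f + o(h\<^sup>2)\<close>.\<close>

lemma second_difference_bound:
  fixes f :: "'a::real_normed_vector \<Rightarrow> 'b::real_normed_vector"
  assumes S: "open S" "x \<in> S" and f: "smooth_on S f" and e: "e > 0"
  shows "\<exists>d>0. \<forall>h. 0 < h \<and> h < d \<longrightarrow>
    norm (f (x + h *\<^sub>R u + h *\<^sub>R v) - f (x + h *\<^sub>R u) - f (x + h *\<^sub>R v) + f x
      - h\<^sup>2 *\<^sub>R frechet_derivative (\<lambda>z. frechet_derivative f (at z) u) (at x) v) \<le> e * h\<^sup>2"
proof -
  define D where "D = frechet_derivative (\<lambda>z. frechet_derivative f (at z) u) (at x)"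
  define c where "c = norm u + norm v + 1"
  have c: "c > 0" by (simp add: c_def add_nonneg_pos)
  have dD: "((\<lambda>z. frechet_derivative f (at z) u) has_derivative D) (at x)"
    unfolding D_def by (rule smooth_on_has_derivative[OF smooth_on_frechet_derivative[OF f] S(2)])
  interpret D: bounded_linear D using dD by (rule has_derivative_bounded_linear)
  \<comment> \<open>The linearisation error of the derivative is at most \<open>e' * norm w\<close>,
    and \<open>norm w\<close> is at most \<open>h * c\<close> on the parallelogram. Two such errors
    enter each estimate of \<psi>, giving \<open>e * h / 3\<close>; three of these thirds add up in
    the end.\<close>
  define e' where "e' = e / (6 * c)"
  have e': "e' > 0" using e c by (simp add: e'_def)
  obtain r where r: "r > 0" "\<And>w. norm w < r \<Longrightarrow>
      norm (frechet_derivative f (at (x + w)) u - frechet_derivative f (at x) u - D w) \<le> e' * norm w"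
    using dD e' unfolding has_derivative_at_alt by (metis add_diff_cancel_left')
  obtain r' where r': "r' > 0" "ball x r' \<subseteq> S" using S openE by blast
  define d where "d = min r r' / c"
  have "d > 0" using r r' c by (simp add: d_def)
  moreover have "norm (f (x + h *\<^sub>R u + h *\<^sub>R v) - f (x + h *\<^sub>R u) - f (x + h *\<^sub>R v) + f x - h\<^sup>2 *\<^sub>R D v) \<le> e * h\<^sup>2"
    if h: "0 < h" "h < d" for h
  proof -
    have hc: "h * c < min r r'" using h c by (simp add: d_def pos_less_divide_eq)
    have small: "norm (s *\<^sub>R u + t *\<^sub>R v) \<le> h * c" if "0 \<le> s" "s \<le> h" "0 \<le> t" "t \<le> h" for s t
    proof -
      have "norm (s *\<^sub>R u + t *\<^sub>R v) \<le> s * norm u + t * norm v"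
        using norm_triangle_ineq[of "s *\<^sub>R u" "t *\<^sub>R v"] that by simp
      also have "\<dots> \<le> h * norm u + h * norm v" using that by (intro add_mono mult_right_mono) auto
      also have "\<dots> \<le> h * c" using h by (simp add: c_def algebra_simps)
      finally show ?thesis .
    qed
    have inS: "x + w \<in> S" if "norm w \<le> h * c" for w
      using r'(2) hc that by (auto simp: subset_iff dist_norm)
    \<comment> \<open>The second difference is the increment of \<phi> over \<open>{0..h}\<close>,
      so that one mean value estimate in \<open>s\<close> is enough.\<close>
    define \<phi> where "\<phi> s = f (x + s *\<^sub>R u + h *\<^sub>R v) - f (x + s *\<^sub>R u)" for s
    have d\<phi>: "(\<phi> has_vector_derivative
        (frechet_derivative f (at (x + s *\<^sub>R u + h *\<^sub>R v)) u - frechet_derivative f (at (x + s *\<^sub>R u)) u)) (at s)"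
      if "0 \<le> s" "s \<le> h" for s
    proof -
      have 1: "x + s *\<^sub>R u + h *\<^sub>R v \<in> S" "x + s *\<^sub>R u \<in> S"
        using inS[OF small[of s h]] inS[OF small[of s 0]] that h by (auto simp: add.assoc)
      have "((\<lambda>s. f (x + s *\<^sub>R u + w)) has_vector_derivative frechet_derivative f (at (x + s *\<^sub>R u + w)) u) (at s)"
        if "x + s *\<^sub>R u + w \<in> S" for w
      proof -
        have "((\<lambda>s. x + s *\<^sub>R u + w) has_vector_derivative u) (at s)"
          by (auto intro!: derivative_eq_intros)
        from vector_derivative_diff_chain_within[OF this, of f "frechet_derivative f (at (x + s *\<^sub>R u + w))"]
        show ?thesis using smooth_on_has_derivative[OF f that] has_derivative_at_withinI
          by (auto simp: o_def)
      qed
      from has_vector_derivative_diff[OF this[of "h *\<^sub>R v"] this[of 0]] 1 show ?thesis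
        by (simp add: \<phi>_def[abs_def])
    qed
    define \<psi> where "\<psi> s = frechet_derivative f (at (x + s *\<^sub>R u + h *\<^sub>R v)) u - frechet_derivative f (at (x + s *\<^sub>R u)) u" for s
    have \<psi>: "norm (\<psi> s - h *\<^sub>R D v) \<le> e * h / 3" if "0 \<le> s" "s \<le> h" for s
    proof -
      let ?R = "\<lambda>w. frechet_derivative f (at (x + w)) u - frechet_derivative f (at x) u - D w"
      have b: "norm (?R w) \<le> e' * (h * c)" if "norm w \<le> h * c" for w
        using r(2)[of w] that hc e' by (smt (verit) mult_left_mono)
      have "\<psi> s - h *\<^sub>R D v = ?R (s *\<^sub>R u + h *\<^sub>R v) - ?R (s *\<^sub>R u)"
        by (simp add: \<psi>_def D.add D.scaleR add.assoc)
      also have "norm \<dots> \<le> e' * (h * c) + e' * (h * c)"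
      proof (rule order_trans[OF norm_triangle_ineq4 add_mono])
        show "norm (?R (s *\<^sub>R u + h *\<^sub>R v)) \<le> e' * (h * c)" by (rule b[OF small]) (use that h in auto)
        show "norm (?R (s *\<^sub>R u)) \<le> e' * (h * c)" by (rule b) (use small[of s 0] that h in auto)
      qed
      also have "\<dots> = e * h / 3" using c by (simp add: e'_def field_simps)
      finally show ?thesis .
    qed
    have "norm (\<phi> h - \<phi> 0 - (h - 0) *\<^sub>R \<psi> 0) \<le> norm (h - 0) * (2 * (e * h / 3))"
    proof (rule vector_differentiable_bound_linearization[where S="{0..h}"])
      show "(\<phi> has_vector_derivative \<psi> s) (at s within {0..h})" if "s \<in> {0..h}" for s
        unfolding \<psi>_def using d\<phi>[of s] that has_vector_derivative_at_within by auto
      show "closed_segment 0 h \<subseteq> {0..h}" using h by (simp add: closed_segment_eq_real_ivl)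
      show "(0::real) \<in> {0..h}" using h by simp
      show "norm (\<psi> s - \<psi> 0) \<le> 2 * (e * h / 3)" if "s \<in> {0..h}" for s
        using norm_triangle_ineq4[of "\<psi> s - h *\<^sub>R D v" "\<psi> 0 - h *\<^sub>R D v"] \<psi>[of s] \<psi>[of 0] that h by simp
    qed
    moreover have "norm (h *\<^sub>R (\<psi> 0 - h *\<^sub>R D v)) \<le> h * (e * h / 3)"
      using \<psi>[of 0] h by simp
    ultimately have "norm ((\<phi> h - \<phi> 0 - (h - 0) *\<^sub>R \<psi> 0) + h *\<^sub>R (\<psi> 0 - h *\<^sub>R D v)) \<le> h * (2 * (e * h / 3)) + h * (e * h / 3)"
      using h by (intro order_trans[OF norm_triangle_ineq] add_mono) auto
    then show ?thesis using h by (simp add: \<phi>_def power2_eq_square algebra_simps)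
  qed
  ultimately show ?thesis unfolding D_def by blast
qed

lemma frechet_derivative_commute:
  fixes f :: "'a::real_normed_vector \<Rightarrow> 'b::real_normed_vector"
  assumes S: "open S" "x \<in> S" and f: "smooth_on S f"
  shows "frechet_derivative (\<lambda>z. frechet_derivative f (at z) u) (at x) v =
         frechet_derivative (\<lambda>z. frechet_derivative f (at z) v) (at x) u" (is "?a = ?b")
proof -
  have "norm (?a - ?b) \<le> e" if e: "e > 0" for e
  proof -
    obtain d where d: "d > 0" "\<And>h. 0 < h \<Longrightarrow> h < d \<Longrightarrow> norm (f (x + h *\<^sub>R u + h *\<^sub>R v) - f (x + h *\<^sub>R u) - f (x + h *\<^sub>R v) + f x
      - h\<^sup>2 *\<^sub>R ?a) \<le> e/2 * h\<^sup>2" using second_difference_bound[OF assms half_gt_zero[OF e], of u v] by blast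
    obtain d' where d': "d' > 0" "\<And>h. 0 < h \<Longrightarrow> h < d' \<Longrightarrow> norm (f (x + h *\<^sub>R v + h *\<^sub>R u) - f (x + h *\<^sub>R v) - f (x + h *\<^sub>R u) + f x
      - h\<^sup>2 *\<^sub>R ?b) \<le> e/2 * h\<^sup>2" using second_difference_bound[OF assms half_gt_zero[OF e], of v u] by blast
    define h where "h = min d d' / 2"
    have h: "0 < h" "h < d" "h < d'" using d(1) d'(1) by (auto simp: h_def)
    let ?w = "f (x + h *\<^sub>R u + h *\<^sub>R v) - f (x + h *\<^sub>R u) - f (x + h *\<^sub>R v) + f x"
    have "norm (?w - h\<^sup>2 *\<^sub>R ?b) \<le> e/2 * h\<^sup>2"
      using d'(2)[OF h(1,3)] by (simp add: algebra_simps)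
    then have "norm ((?w - h\<^sup>2 *\<^sub>R ?b) - (?w - h\<^sup>2 *\<^sub>R ?a)) \<le> e/2 * h\<^sup>2 + e/2 * h\<^sup>2"
      using d(2)[OF h(1,2)] by (rule order_trans[OF norm_triangle_ineq4 add_mono])
    moreover have "norm ((?w - h\<^sup>2 *\<^sub>R ?b) - (?w - h\<^sup>2 *\<^sub>R ?a)) = h\<^sup>2 * norm (?a - ?b)"
    proof -
      have "(?w - h\<^sup>2 *\<^sub>R ?b) - (?w - h\<^sup>2 *\<^sub>R ?a) = h\<^sup>2 *\<^sub>R (?a - ?b)" by (simp add: scaleR_diff_right)
      then show ?thesis by (simp only: norm_scaleR) simp
    qed
    ultimately have "h\<^sup>2 * norm (?a - ?b) \<le> h\<^sup>2 * e" by (simp add: algebra_simps)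
    then show ?thesis using h(1) by simp
  qed
  then have "norm (?a - ?b) \<le> 0" by (rule field_le_epsilon[of _ 0, simplified]) 
  then show ?thesis by simp
qed

section \<open>Riemann surfaces\<close>

text \<open>Directional derivative in the coordinate of \<open>c\<close>, kept as a function on the
  surface so that it can be iterated, restricted to domains of frames and compared between
  charts.\<close>

definition pd :: "'x chart \<Rightarrow> complex \<Rightarrow> ('x \<Rightarrow> 'b::real_normed_vector) \<Rightarrow> 'x \<Rightarrow> 'b" where
  "pd c v f x = frechet_derivative (f \<circ> param c) (at (snd c x)) v"

definition diff_at :: "'x chart \<Rightarrow> ('x \<Rightarrow> 'b::real_normed_vector) \<Rightarrow> 'x \<Rightarrow> bool" where
  "diff_at c f x \<longleftrightarrow> (f \<circ> param c) differentiable (at (snd c x))"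

lemma pd_has_derivative:
  "diff_at c f x \<Longrightarrow> ((\<lambda>z. f (param c z)) has_derivative (\<lambda>v. pd c v f x)) (at (snd c x))"
  unfolding diff_at_def pd_def by (simp add: frechet_derivative_works comp_def)

lemma pd_eqI:
  assumes "((\<lambda>z. f (param c z)) has_derivative D) (at (snd c x))"
  shows "diff_at c f x" "pd c v f x = D v"
proof -
  have *: "(f \<circ> param c has_derivative D) (at (snd c x))" using assms by (simp add: comp_def)
  show "diff_at c f x" unfolding diff_at_def using * differentiable_def by blast
  show "pd c v f x = D v" unfolding pd_def using frechet_derivative_at[OF *] by simp
qed

lemma linear_pd: "diff_at c f x \<Longrightarrow> linear (\<lambda>v. pd c v f x)"
  by (rule has_derivative_linear[OF pd_has_derivative])

lemma pd_complex: "diff_at c f x \<Longrightarrow> pd c v f x = Re v *\<^sub>R pd c 1 f x + Im v *\<^sub>R pd c \<i> f x"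
proof -
  assume "diff_at c f x"
  from linear_pd[OF this] have lin: "linear (\<lambda>v. pd c v f x)" .
  have "v = Re v *\<^sub>R 1 + Im v *\<^sub>R \<i>" by (simp add: complex_eq_iff)
  then have "pd c v f x = pd c (Re v *\<^sub>R 1 + Im v *\<^sub>R \<i>) f x" by (rule arg_cong)
  also have "\<dots> = Re v *\<^sub>R pd c 1 f x + Im v *\<^sub>R pd c \<i> f x"
    by (simp only: linear_add[OF lin] linear_scale[OF lin])
  finally show ?thesis .
qed

lemma pd_const: "pd c v (\<lambda>_. k) x = 0"
  by (rule pd_eqI(2)[where D="\<lambda>_. 0" and f="\<lambda>_. k"]) simp

lemma
  assumes "diff_at c f x" "diff_at c g x"
  shows diff_at_add: "diff_at c (\<lambda>x. f x + g x) x"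
    and pd_add: "pd c v (\<lambda>x. f x + g x) x = pd c v f x + pd c v g x"
    and diff_at_diff: "diff_at c (\<lambda>x. f x - g x) x"
    and pd_diff: "pd c v (\<lambda>x. f x - g x) x = pd c v f x - pd c v g x"
  using pd_eqI[where f="\<lambda>x. f x + g x", OF has_derivative_add[OF assms[THEN pd_has_derivative]]]
    pd_eqI[where f="\<lambda>x. f x - g x", OF has_derivative_diff[OF assms[THEN pd_has_derivative]]] by auto

lemma
  assumes "bounded_linear L" "diff_at c f x"
  shows diff_at_bounded_linear: "diff_at c (\<lambda>x. L (f x)) x"
    and pd_bounded_linear: "pd c v (\<lambda>x. L (f x)) x = L (pd c v f x)"
  using pd_eqI[where f="\<lambda>x. L (f x)", OF bounded_linear.has_derivative[OF assms(1) pd_has_derivative[OF assms(2)]]] by auto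

lemma
  assumes "bounded_bilinear bl" "diff_at c f x" "diff_at c g x"
  shows diff_at_bounded_bilinear: "param c (snd c x) = x \<Longrightarrow> diff_at c (\<lambda>x. bl (f x) (g x)) x"
    and pd_bounded_bilinear: "param c (snd c x) = x \<Longrightarrow>
      pd c v (\<lambda>x. bl (f x) (g x)) x = bl (f x) (pd c v g x) + bl (pd c v f x) (g x)"
  using pd_eqI[where f="\<lambda>x. bl (f x) (g x)", OF bounded_bilinear.FDERIV[OF assms(1) assms(2,3)[THEN pd_has_derivative]]] by auto

lemma
  assumes "\<And>i. i \<in> I \<Longrightarrow> diff_at c (f i) x"
  shows diff_at_sum: "diff_at c (\<lambda>x. \<Sum>i\<in>I. f i x) x"
    and pd_sum: "pd c v (\<lambda>x. \<Sum>i\<in>I. f i x) x = (\<Sum>i\<in>I. pd c v (f i) x)"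
proof -
  have "((\<lambda>z. \<Sum>i\<in>I. f i (param c z)) has_derivative (\<lambda>v. \<Sum>i\<in>I. pd c v (f i) x)) (at (snd c x))"
    by (intro has_derivative_sum pd_has_derivative assms)
  from pd_eqI[where f="\<lambda>x. \<Sum>i\<in>I. f i x", OF this] show "diff_at c (\<lambda>x. \<Sum>i\<in>I. f i x) x"
    "pd c v (\<lambda>x. \<Sum>i\<in>I. f i x) x = (\<Sum>i\<in>I. pd c v (f i) x)" by auto
qed

locale riemann =
  fixes X :: "('x::t2_space) chart set"
  assumes riemann: "riemann_surface X"
begin

lemma chart_exists: "\<exists>c\<in>X. x \<in> fst c"
  using riemann by (auto simp: riemann_surface_def)

lemma open_chart: "c \<in> X \<Longrightarrow> open (fst c)"
  using riemann by (auto simp: riemann_surface_def)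

lemma homeo: "c \<in> X \<Longrightarrow> homeomorphism (fst c) (snd c ` fst c) (snd c) (param c)"
  using riemann by (auto simp: riemann_surface_def)

lemma param_coord [simp]: "c \<in> X \<Longrightarrow> x \<in> fst c \<Longrightarrow> param c (snd c x) = x"
  using homeo by (auto simp: homeomorphism_def)

lemma coord_param: "c \<in> X \<Longrightarrow> z \<in> snd c ` fst c \<Longrightarrow> snd c (param c z) = z"
  using homeo by (auto simp: homeomorphism_def)

lemma param_in: "c \<in> X \<Longrightarrow> z \<in> snd c ` fst c \<Longrightarrow> param c z \<in> fst c"
  using homeo by (auto simp: homeomorphism_def)

lemma image_eq: "c \<in> X \<Longrightarrow> snd c ` (fst c \<inter> W) = snd c ` fst c \<inter> param c -` W"
  using homeo[of c] unfolding homeomorphism_def by force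

lemma open_image:
  assumes "c \<in> X" "open W"
  shows "open (snd c ` (fst c \<inter> W))"
proof -
  have "open (snd c ` fst c)" using riemann assms(1) by (auto simp: riemann_surface_def)
  moreover have "continuous_on (snd c ` fst c) (param c)"
    using homeo[OF assms(1)] by (auto simp: homeomorphism_def)
  ultimately show ?thesis
    unfolding image_eq[OF assms(1)] using assms(2) by (blast intro: continuous_open_preimage)
qed

lemma open_image_chart: "c \<in> X \<Longrightarrow> open (snd c ` fst c)"
  using open_image[of c UNIV] by simp

lemma open_image_inter: "c \<in> X \<Longrightarrow> d \<in> X \<Longrightarrow> open (snd c ` (fst c \<inter> fst d))"
  using open_image open_chart by blast

lemma transition_holomorphic:
  "c \<in> X \<Longrightarrow> d \<in> X \<Longrightarrow> (\<lambda>z. snd d (param c z)) holomorphic_on (snd c ` (fst c \<inter> fst d))"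
  using riemann by (auto simp: riemann_surface_def comp_def)

lemma coord_has_field_derivative:
  assumes "c \<in> X" "d \<in> X" "x \<in> fst c" "x \<in> fst d"
  shows "((\<lambda>z. snd d (param c z)) has_field_derivative coord_deriv c d x) (at (snd c x))"
  using holomorphic_derivI[OF transition_holomorphic[OF assms(1,2)] open_image_inter[OF assms(1,2)], of "snd c x"]
    assms by (auto simp: coord_deriv_def comp_def)

lemma coord_deriv_chain:
  assumes "c \<in> X" "d \<in> X" "e \<in> X" "x \<in> fst c" "x \<in> fst d" "x \<in> fst e"
  shows "coord_deriv c e x = coord_deriv d e x * coord_deriv c d x"
proof -
  let ?S = "snd c ` (fst c \<inter> (fst d \<inter> fst e))"
  have "((\<lambda>z. snd e (param d (snd d (param c z)))) has_field_derivative coord_deriv d e x * coord_deriv c d x) (at (snd c x))"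
    by (rule DERIV_chain2[where f="\<lambda>z. snd e (param d z)"])
       (use assms coord_has_field_derivative[of d e x] coord_has_field_derivative[of c d x] in auto)
  then have "((\<lambda>z. snd e (param c z)) has_field_derivative coord_deriv d e x * coord_deriv c d x) (at (snd c x))"
  proof (rule has_field_derivative_transform_within_open[where S="?S"])
    show "open ?S" using open_image[OF assms(1)] open_chart assms by blast
  qed (use assms in auto)
  then show ?thesis
    using coord_has_field_derivative[of c e x] assms DERIV_unique by blast
qed

lemma coord_deriv_self [simp]: "c \<in> X \<Longrightarrow> x \<in> fst c \<Longrightarrow> coord_deriv c c x = 1"
proof -
  assume c: "c \<in> X" "x \<in> fst c"
  have "((\<lambda>z. z) has_field_derivative 1) (at (snd c x))" by (rule DERIV_ident)
  then have "((\<lambda>z. snd c (param c z)) has_field_derivative 1) (at (snd c x))"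
    by (rule has_field_derivative_transform_within_open[OF _ open_image_chart[OF c(1)]])
       (use c coord_param in auto)
  then show ?thesis using coord_has_field_derivative[of c c x] c DERIV_unique by blast
qed

lemma coord_deriv_nonzero:
  assumes "c \<in> X" "d \<in> X" "x \<in> fst c" "x \<in> fst d"
  shows "coord_deriv c d x \<noteq> 0"
  using coord_deriv_chain[of c d c x] assms by auto

lemma smooth_map_onD: "smooth_map X W f \<Longrightarrow> c \<in> X \<Longrightarrow> smooth_on (snd c ` (fst c \<inter> W)) (\<lambda>z. f (param c z))"
  by (auto simp: smooth_map_def comp_def)

lemma smooth_mapI: "(\<And>c. c \<in> X \<Longrightarrow> smooth_on (snd c ` (fst c \<inter> W)) (\<lambda>z. f (param c z))) \<Longrightarrow> smooth_map X W f"
  by (auto simp: smooth_map_def comp_def)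

lemma smooth_map_cong:
  assumes "open W" "\<And>x. x \<in> W \<Longrightarrow> f x = g x"
  shows "smooth_map X W f \<longleftrightarrow> smooth_map X W g"
proof -
  have "smooth_on (snd c ` (fst c \<inter> W)) (f \<circ> param c) \<longleftrightarrow> smooth_on (snd c ` (fst c \<inter> W)) (g \<circ> param c)" if "c \<in> X" for c
    by (rule smooth_on_cong[OF open_image[OF that assms(1)]]) (use assms(2) image_eq[OF that] in auto)
  then show ?thesis by (simp add: smooth_map_def)
qed

lemma smooth_map_subset: "smooth_map X W f \<Longrightarrow> V \<subseteq> W \<Longrightarrow> smooth_map X V f"
  unfolding smooth_map_def by (meson Int_mono image_mono order_refl smooth_on_subset)

lemma smooth_map_local:
  assumes "\<And>x. x \<in> W \<Longrightarrow> \<exists>V. x \<in> V \<and> smooth_map X V f"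
  shows "smooth_map X W f"
proof (rule smooth_mapI, rule smooth_on_Union)
  fix c z assume c: "c \<in> X" "z \<in> snd c ` (fst c \<inter> W)"
  then obtain x where x: "x \<in> fst c" "x \<in> W" "z = snd c x" by auto
  obtain V where "x \<in> V" "smooth_map X V f" using assms[OF x(2)] by blast
  then show "\<exists>T. z \<in> T \<and> smooth_on T (\<lambda>z. f (param c z))"
    using smooth_map_onD[OF _ c(1)] x by (intro exI[of _ "snd c ` (fst c \<inter> V)"]) auto
qed

lemma smooth_map_const: "open W \<Longrightarrow> smooth_map X W (\<lambda>_. k)"
  by (rule smooth_mapI, rule smooth_on_const, rule open_image)

lemma smooth_map_add: "smooth_map X W f \<Longrightarrow> smooth_map X W g \<Longrightarrow> open W \<Longrightarrow> smooth_map X W (\<lambda>x. f x + g x)"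
  by (rule smooth_mapI, rule smooth_on_add; (rule smooth_map_onD open_image; assumption)?)

lemma smooth_map_sum: "(\<And>i. i \<in> I \<Longrightarrow> smooth_map X W (f i)) \<Longrightarrow> open W \<Longrightarrow> smooth_map X W (\<lambda>x. \<Sum>i\<in>I. f i x)"
  by (rule smooth_mapI, rule smooth_on_sum; (rule smooth_map_onD open_image; blast)?)

lemma smooth_map_bounded_linear:
  "bounded_linear L \<Longrightarrow> smooth_map X W f \<Longrightarrow> open W \<Longrightarrow> smooth_map X W (\<lambda>x. L (f x))"
  by (rule smooth_mapI, rule smooth_on_bounded_linear[where L=L]; (rule smooth_map_onD open_image; assumption)?)

lemma smooth_map_bounded_bilinear:
  "bounded_bilinear bl \<Longrightarrow> smooth_map X W f \<Longrightarrow> smooth_map X W g \<Longrightarrow> open W \<Longrightarrow> smooth_map X W (\<lambda>x. bl (f x) (g x))"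
  by (rule smooth_mapI, rule smooth_on_bounded_bilinear[where bl=bl]; (rule smooth_map_onD open_image; assumption)?)

lemmas smooth_map_minus = smooth_map_bounded_linear[OF bounded_linear_minus[OF bounded_linear_ident]]

lemma smooth_map_diff: "smooth_map X W f \<Longrightarrow> smooth_map X W g \<Longrightarrow> open W \<Longrightarrow> smooth_map X W (\<lambda>x. f x - g x)"
  using smooth_map_add[of W f "\<lambda>x. - g x"] smooth_map_minus[of W g] by simp

lemmas smooth_map_scaleR = smooth_map_bounded_bilinear[OF bounded_bilinear_scaleR]
lemmas smooth_map_mult = smooth_map_bounded_bilinear[OF bounded_bilinear_mult]

lemma smooth_map_inverse:
  fixes f :: "'x \<Rightarrow> real"
  assumes "smooth_map X W f" "open W" "\<And>x. x \<in> W \<Longrightarrow> f x \<noteq> 0"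
  shows "smooth_map X W (\<lambda>x. inverse (f x))"
proof (rule smooth_mapI, rule smooth_on_inverse)
  show "c \<in> X \<Longrightarrow> smooth_on (snd c ` (fst c \<inter> W)) (\<lambda>z. f (param c z))" for c using smooth_map_onD[OF assms(1)] .
  show "c \<in> X \<Longrightarrow> open (snd c ` (fst c \<inter> W))" for c using open_image[OF _ assms(2)] .
  show "c \<in> X \<Longrightarrow> z \<in> snd c ` (fst c \<inter> W) \<Longrightarrow> f (param c z) \<noteq> 0" for c z using image_eq assms(3) by auto
qed

text \<open>Passing to any other chart composes with a holomorphic, hence smooth, transition
  map.\<close>

lemma smooth_map_chart:
  assumes "d \<in> X" "W \<subseteq> fst d" "open W" "smooth_on (snd d ` W) (\<lambda>z. f (param d z))"
  shows "smooth_map X W f"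
proof (rule smooth_mapI)
  fix c assume c: "c \<in> X"
  have W: "fst d \<inter> W = W" using assms by auto
  have o: "open (snd c ` (fst c \<inter> W))" using open_image c assms by blast
  have "smooth_on (snd c ` (fst c \<inter> W)) (\<lambda>z. f (param d (snd d (param c z))))"
  proof (rule smooth_on_compose[OF assms(4)])
    show "smooth_on (snd c ` (fst c \<inter> W)) (\<lambda>z. snd d (param c z))"
      by (rule smooth_on_holomorphic[OF holomorphic_on_subset[OF transition_holomorphic[OF c assms(1)]] o])
         (use assms(2) in auto)
    show "open (snd d ` W)" using open_image[OF assms(1,3)] W by simp
    show "(\<lambda>z. snd d (param c z)) ` snd c ` (fst c \<inter> W) \<subseteq> snd d ` W"
      using image_eq[OF c, of W] by auto
  qed (rule o)
  then show "smooth_on (snd c ` (fst c \<inter> W)) (\<lambda>z. f (param c z))"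
    by (subst smooth_on_cong[OF o, where g="\<lambda>z. f (param d (snd d (param c z)))"])
       (use image_eq[OF c, of W] assms(1,2) in auto)
qed

lemma smooth_map_diff_at: "smooth_map X W f \<Longrightarrow> c \<in> X \<Longrightarrow> x \<in> W \<Longrightarrow> x \<in> fst c \<Longrightarrow> diff_at c f x"
  unfolding diff_at_def smooth_map_def using smooth_on_differentiable by blast

lemma pd_cong:
  assumes "open W" "c \<in> X" "x \<in> W" "x \<in> fst c" "\<And>y. y \<in> W \<Longrightarrow> f y = g y"
  shows "pd c v f x = pd c v g x"
  unfolding pd_def
  by (rule fun_cong, rule frechet_derivative_cong_open[OF open_image[OF assms(2,1)]])
     (use assms image_eq in auto)

lemma diff_at_chart_change:
  assumes "c \<in> X" "d \<in> X" "x \<in> fst c" "x \<in> fst d" "diff_at d f x"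
  shows "((\<lambda>z. f (param c z)) has_derivative (\<lambda>v. pd d (coord_deriv c d x * v) f x)) (at (snd c x))"
proof -
  have 1: "((\<lambda>z. snd d (param c z)) has_derivative (\<lambda>v. coord_deriv c d x * v)) (at (snd c x))"
    using coord_has_field_derivative[OF assms(1-4)] by (simp add: has_field_derivative_def)
  have 2: "((\<lambda>z. f (param d z)) has_derivative (\<lambda>v. pd d v f x)) (at (snd d (param c (snd c x))))"
    using pd_has_derivative[OF assms(5)] assms by simp
  from has_derivative_compose[OF 1 2]
  show ?thesis
    by (rule has_derivative_transform_within_open[OF _ open_image_inter[OF assms(1,2)]])
       (use assms in auto)
qed

lemma pd_chart_change:
  assumes "c \<in> X" "d \<in> X" "x \<in> fst c" "x \<in> fst d" "diff_at d f x"
  shows "pd c v f x = pd d (coord_deriv c d x * v) f x"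
  by (rule pd_eqI(2)[OF diff_at_chart_change[OF assms]])

lemma smooth_map_pd:
  assumes "smooth_map X W f" "c \<in> X" "open W"
  shows "smooth_map X (fst c \<inter> W) (pd c v f)"
proof (rule smooth_map_chart[OF assms(2)])
  show o: "open (fst c \<inter> W)" using assms open_chart by blast
  have o': "open (snd c ` (fst c \<inter> W))" using open_image assms by blast
  have "smooth_on (snd c ` (fst c \<inter> W)) (\<lambda>z. frechet_derivative (f \<circ> param c) (at z) v)"
    using smooth_on_frechet_derivative assms(1,2) by (auto simp: smooth_map_def)
  then show "smooth_on (snd c ` (fst c \<inter> W)) (\<lambda>z. pd c v f (param c z))"
    by (subst smooth_on_cong[OF o']) (use coord_param[OF assms(2)] in \<open>auto simp: pd_def\<close>)
qed auto

lemma pd_commute: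
  assumes "smooth_map X W f" "c \<in> X" "open W" "x \<in> W" "x \<in> fst c"
  shows "pd c v (pd c w f) x = pd c w (pd c v f) x"
proof -
  have o': "open (snd c ` (fst c \<inter> W))" using open_image assms by blast
  have "pd c v (pd c w f) x = frechet_derivative (\<lambda>z. frechet_derivative (f \<circ> param c) (at z) w) (at (snd c x)) v" for v w
    unfolding pd_def[of c v]
    by (rule fun_cong, rule frechet_derivative_cong_open[OF o']) (use assms in \<open>auto simp: pd_def comp_def\<close>)
  then show ?thesis
    using frechet_derivative_commute[OF o', of "snd c x" "f \<circ> param c" w v] assms unfolding smooth_map_def by auto
qed

lemma smooth_map_coord_deriv:
  assumes "c \<in> X" "d \<in> X"
  shows "smooth_map X (fst c \<inter> fst d) (coord_deriv c d)"
proof (rule smooth_map_chart[OF assms(1)])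
  have o: "open (snd c ` (fst c \<inter> fst d))" using open_image_inter assms by blast
  have "deriv (snd d \<circ> param c) holomorphic_on (snd c ` (fst c \<inter> fst d))"
    using transition_holomorphic[OF assms] o by (intro holomorphic_deriv) (auto simp: comp_def)
  from smooth_on_holomorphic[OF this o]
  show "smooth_on (snd c ` (fst c \<inter> fst d)) (\<lambda>z. coord_deriv c d (param c z))"
    by (subst smooth_on_cong[OF o]) (use assms in \<open>auto simp: coord_deriv_def\<close>)
  show "open (fst c \<inter> fst d)" using assms open_chart by blast
qed auto

text \<open>The coordinate derivative is itself holomorphic, so its differential is complex linear
  in \<open>v\<close>. This makes the second derivatives of coordinate changes drop out of exterior
  derivatives.\<close>

lemma pd_coord_deriv:
  assumes "c \<in> X" "d \<in> X" "x \<in> fst c" "x \<in> fst d"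
  obtains q where "\<And>v. pd c v (coord_deriv c d) x = q * v"
proof -
  have o: "open (snd c ` (fst c \<inter> fst d))" using open_image_inter assms by blast
  have "deriv (snd d \<circ> param c) holomorphic_on (snd c ` (fst c \<inter> fst d))"
    using transition_holomorphic[OF assms(1,2)] o by (intro holomorphic_deriv) (auto simp: comp_def)
  from holomorphic_derivI[OF this o, of "snd c x"] obtain q where
    "(deriv (snd d \<circ> param c) has_field_derivative q) (at (snd c x))" using assms by auto
  then have "((\<lambda>z. coord_deriv c d (param c z)) has_field_derivative q) (at (snd c x))"
    by (rule has_field_derivative_transform_within_open[OF _ o]) (use assms in \<open>auto simp: coord_deriv_def\<close>)
  then have "((\<lambda>z. coord_deriv c d (param c z)) has_derivative (*) q) (at (snd c x))"
    by (simp add: has_field_derivative_def)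
  from pd_eqI(2)[OF this] show ?thesis by (rule that)
qed

section \<open>Bump functions and partitions of unity\<close>

lemma bump_function:
  obtains c B V where "c \<in> X" "open V" "x \<in> V" "\<And>y. y \<in> V \<Longrightarrow> B y > (0::real)" "\<And>y. B y \<ge> 0"
    "smooth_map X UNIV B" "closure {y. B y \<noteq> 0} \<subseteq> fst c"
proof -
  obtain c where c: "c \<in> X" "x \<in> fst c" using chart_exists by blast
  obtain r where r: "r > 0" "cball (snd c x) r \<subseteq> snd c ` fst c"
    using open_image_chart[OF c(1)] c(2) by (meson imageI open_contains_cball)
  \<comment> \<open>Inside the chart this is positive exactly where the coordinate distance to
    \<open>x\<close> is below \<open>r\<close>. Smoothness of the extension by 0 rests on
    \<open>C\<close>, which contains the support and is compact, hence closed in the Hausdorff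
    surface.\<close>
  define B where "B y = (if y \<in> fst c then flat_exp 1 (r\<^sup>2 - (snd c y - snd c x) \<bullet> (snd c y - snd c x)) else 0)" for y
  define C where "C = param c ` cball (snd c x) r"
  have inner: "(snd c y - snd c x) \<bullet> (snd c y - snd c x) = (dist (snd c x) (snd c y))\<^sup>2" for y
    by (simp add: dist_norm dot_square_norm norm_minus_commute)
  have contp: "continuous_on (snd c ` fst c) (param c)" and conts: "continuous_on (fst c) (snd c)"
    using homeo[OF c(1)] by (auto simp: homeomorphism_def)
  have "compact C" unfolding C_def
    by (rule compact_continuous_image[OF continuous_on_subset[OF contp r(2)]]) simp
  then have clC: "closed C" by (rule compact_imp_closed)
  have Csub: "C \<subseteq> fst c" using r(2) param_in[OF c(1)] by (auto simp: C_def)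
  have supp: "{y. B y \<noteq> 0} \<subseteq> C"
  proof
    fix y assume "y \<in> {y. B y \<noteq> 0}"
    then have y: "y \<in> fst c" "(dist (snd c x) (snd c y))\<^sup>2 < r\<^sup>2"
      unfolding B_def inner flat_exp_def by (auto split: if_splits)
    then have "snd c y \<in> cball (snd c x) r" using power2_less_imp_less[OF y(2)] r(1) by simp
    then show "y \<in> C" unfolding C_def using param_coord[OF c(1) y(1)] by (metis image_eqI)
  qed
  let ?V = "fst c \<inter> snd c -` ball (snd c x) r"
  have "open ?V" using continuous_open_preimage[OF conts open_chart[OF c(1)] open_ball] .
  moreover have "x \<in> ?V" using c r by simp
  moreover have "B y > 0" if "y \<in> ?V" for y
  proof -
    have "(dist (snd c x) (snd c y))\<^sup>2 < r\<^sup>2" using that r(1) by (auto intro!: power_strict_mono)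
    then show ?thesis unfolding B_def inner using that by (simp add: flat_exp_def)
  qed
  moreover have "B y \<ge> 0" for y by (simp add: B_def flat_exp_def)
  moreover have "smooth_map X UNIV B"
  proof (rule smooth_map_local)
    fix y
    show "\<exists>V. y \<in> V \<and> smooth_map X V B"
    proof (cases "y \<in> C")
      case True
      have o: "open (snd c ` fst c)" by (rule open_image_chart[OF c(1)])
      have "smooth_on (snd c ` fst c) (\<lambda>z. z - snd c x)"
        using smooth_on_add[OF smooth_on_bounded_linear_id[OF bounded_linear_ident o] smooth_on_const[OF o, of "- snd c x"] o]
        by simp
      note s1 = smooth_on_bounded_bilinear[OF bounded_bilinear_inner this this o]
      have "smooth_on (snd c ` fst c) (\<lambda>z. r\<^sup>2 - (z - snd c x) \<bullet> (z - snd c x))"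
        using smooth_on_add[OF smooth_on_const[OF o, of "r\<^sup>2"] smooth_on_bounded_linear[OF bounded_linear_minus[OF bounded_linear_ident] s1 o] o]
        by simp
      from smooth_on_compose[OF smooth_on_flat_exp[OF open_UNIV] this o open_UNIV]
      have "smooth_on (snd c ` fst c) (\<lambda>z. flat_exp 1 (r\<^sup>2 - (z - snd c x) \<bullet> (z - snd c x)))" by simp
      then have "smooth_on (snd c ` fst c) (\<lambda>z. B (param c z))"
        by (subst smooth_on_cong[OF o]) (use c(1) in \<open>auto simp: B_def\<close>)
      from smooth_map_chart[OF c(1) order_refl open_chart[OF c(1)] this]
      show ?thesis using True Csub by blast
    next
      case False
      have "smooth_map X (- C) B"
        by (subst smooth_map_cong[where g="\<lambda>_. 0"]) (use clC supp in \<open>auto intro!: smooth_map_const\<close>)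
      then show ?thesis using False by blast
    qed
  qed
  moreover have "closure {y. B y \<noteq> 0} \<subseteq> fst c"
    using closure_minimal[OF supp clC] Csub by blast
  ultimately show ?thesis using that c(1) by blast
qed

text \<open>Finitely many of the open sets on which bump functions are positive cover the compact
  surface, so the sum of these bump functions is positive everywhere and one may divide by
  it.\<close>

lemma partition_of_unity_exists:
  assumes "compact (UNIV :: 'x set)"
  shows "\<exists>N c u. partition_of_unity X N c u"
proof -
  have "\<forall>x. \<exists>c B V. c \<in> X \<and> open V \<and> x \<in> V \<and> (\<forall>y\<in>V. B y > (0::real)) \<and> (\<forall>y. B y \<ge> 0) \<and>
    smooth_map X UNIV B \<and> closure {y. B y \<noteq> 0} \<subseteq> fst c"
  proof
    fix x
    show "\<exists>c B V. c \<in> X \<and> open V \<and> x \<in> V \<and> (\<forall>y\<in>V. B y > (0::real)) \<and> (\<forall>y. B y \<ge> 0) \<and>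
      smooth_map X UNIV B \<and> closure {y. B y \<noteq> 0} \<subseteq> fst c"
    proof (rule bump_function[of x])
      fix c B V
      assume "c \<in> X" "open V" "x \<in> V" "\<And>y. y \<in> V \<Longrightarrow> B y > (0::real)" "\<And>y. B y \<ge> 0"
        "smooth_map X UNIV B" "closure {y. B y \<noteq> 0} \<subseteq> fst c"
      then show ?thesis by (intro exI[of _ c] exI[of _ B] exI[of _ V]) simp
    qed
  qed
  then obtain c B V where cBV: "\<And>x. c x \<in> X \<and> open (V x) \<and> x \<in> V x \<and> (\<forall>y\<in>V x. B x y > (0::real)) \<and> (\<forall>y. B x y \<ge> 0) \<and>
    smooth_map X UNIV (B x) \<and> closure {y. B x y \<noteq> 0} \<subseteq> fst (c x)" by metis
  then have cX: "c x \<in> X" and V: "open (V x)" "x \<in> V x" and Bpos: "y \<in> V x \<Longrightarrow> B x y > 0"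
    and Bnonneg: "B x y \<ge> 0" and Bsmooth: "smooth_map X UNIV (B x)" and Bsupp: "closure {y. B x y \<noteq> 0} \<subseteq> fst (c x)" for x y
    by blast+
  obtain F where F: "finite F" "(\<Union>x\<in>F. V x) = UNIV"
  proof (rule compactE_image[OF assms, of UNIV V])
    show "open (V x)" for x by (rule V)
    show "UNIV \<subseteq> \<Union> (range V)" using V(2) by blast
  qed auto
  \<comment> \<open>\<open>partition_of_unity\<close> is indexed by an initial segment of the
    naturals, so the finite subcover is enumerated.\<close>
  obtain p where p: "bij_betw p {..<card F} F"
    using ex_bij_betw_nat_finite[OF F(1)] by (auto simp: lessThan_atLeast0)
  define s where "s y = (\<Sum>i<card F. B (p i) y)" for y
  have spos: "s y > 0" for y
  proof -
    obtain x where "x \<in> F" "y \<in> V x" using F(2) by blast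
    then obtain i where i: "i < card F" "p i = x" using bij_betw_imp_surj_on[OF p] by (metis imageE lessThan_iff)
    have "s y = B (p i) y + (\<Sum>j\<in>{..<card F} - {i}. B (p j) y)"
      unfolding s_def using i by (intro sum.remove) auto
    moreover have "(\<Sum>j\<in>{..<card F} - {i}. B (p j) y) \<ge> 0" by (rule sum_nonneg) (rule Bnonneg)
    moreover have "B (p i) y > 0" using Bpos i \<open>y \<in> V x\<close> by blast
    ultimately show ?thesis by linarith
  qed
  have s: "smooth_map X UNIV s" unfolding s_def by (rule smooth_map_sum) (auto intro: Bsmooth)
  have "partition_of_unity X (card F) (c \<circ> p) (\<lambda>i y. B (p i) y * inverse (s y))"
    unfolding partition_of_unity_def
  proof (intro conjI allI impI)
    fix i assume "i < card F"
    show "(c \<circ> p) i \<in> X" using cX by simp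
    show "smooth_map X UNIV (\<lambda>y. B (p i) y * inverse (s y))"
      by (rule smooth_map_mult[OF Bsmooth smooth_map_inverse[OF s]]) (use spos less_imp_neq in \<open>force+\<close>)
    show "0 \<le> B (p i) x * inverse (s x)" for x using Bnonneg spos[of x] by simp
    show "closure {y. B (p i) y * inverse (s y) \<noteq> 0} \<subseteq> fst ((c \<circ> p) i)"
      using Bsupp[of "p i"] closure_mono[of "{y. B (p i) y * inverse (s y) \<noteq> 0}" "{y. B (p i) y \<noteq> 0}"] by auto
  next
    fix x
    show "(\<Sum>i<card F. B (p i) x * inverse (s x)) = 1"
      unfolding sum_distrib_right[symmetric] s_def[symmetric] using spos[of x] by simp
  qed
  then show ?thesis by blast
qed

end

section \<open>Integration on compact Riemann surfaces\<close>

lemma set_integrable_compact_support: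
  fixes f :: "'a::euclidean_space \<Rightarrow> real"
  assumes "compact K" "continuous_on K f" "K \<subseteq> S" "\<And>z. z \<in> S \<Longrightarrow> z \<notin> K \<Longrightarrow> f z = 0"
  shows "set_integrable lborel S f"
proof -
  have "(\<lambda>z. indicator S z *\<^sub>R f z) = (\<lambda>z. indicator K z *\<^sub>R f z)"
    using assms(3,4) by (force simp: indicator_def)
  then show ?thesis using borel_integrable_compact[OF assms(1,2)] by (simp add: set_integrable_def)
qed

lemma set_integral_cong_support:
  fixes f :: "'a::euclidean_space \<Rightarrow> real"
  assumes "S \<subseteq> T" "\<And>z. z \<in> T \<Longrightarrow> z \<notin> S \<Longrightarrow> f z = 0"
  shows "(LINT z:T|lborel. f z) = (LINT z:S|lborel. f z)"
proof -
  have "(\<lambda>z. indicator T z *\<^sub>R f z) = (\<lambda>z. indicator S z *\<^sub>R f z)"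
    using assms by (force simp: indicator_def)
  then show ?thesis by (simp add: set_lebesgue_integral_def)
qed

section \<open>Change of variables under holomorphic maps\<close>

definition c_of :: "real^2 \<Rightarrow> complex" where "c_of v = Complex (v $ 1) (v $ 2)"
definition r_of :: "complex \<Rightarrow> real^2" where "r_of z = vector [Re z, Im z]"

lemma c_of_r_of [simp]: "c_of (r_of z) = z" "r_of (c_of v) = v"
  by (simp_all add: c_of_def r_of_def vec_eq_iff forall_2)

lemma bounded_linear_c_of: "bounded_linear c_of"
  by (intro linear_conv_bounded_linear[THEN iffD1] linearI) (auto simp: c_of_def complex_eq_iff)

lemma bounded_linear_r_of: "bounded_linear r_of"
  by (intro linear_conv_bounded_linear[THEN iffD1] linearI) (auto simp: r_of_def vec_eq_iff forall_2)

lemma continuous_c_of: "continuous_on A c_of"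
  by (rule linear_continuous_on[OF bounded_linear_c_of])

lemma measurable_c_of [measurable]: "c_of \<in> borel_measurable borel"
  by (rule borel_measurable_continuous_onI[OF continuous_c_of])

text \<open>Jacobian determinants are taken on \<open>real^2\<close>, while charts take values in
  \<open>complex\<close>. The two Lebesgue measures correspond under \<open>c_of\<close> because
  they give the same area to boxes.\<close>

lemma lborel_c_of: "lborel = distr lborel borel c_of"
proof (rule lborel_eqI)
  fix l u :: complex
  assume le: "\<And>b. b \<in> Basis \<Longrightarrow> l \<bullet> b \<le> u \<bullet> b"
  then have lu: "Re l \<le> Re u" "Im l \<le> Im u" using le[of 1] le[of \<i>] by (auto simp: Basis_complex_def)
  have "c_of -` box l u = box (r_of l) (r_of u)"
    by (auto simp: in_box_complex_iff c_of_def r_of_def mem_box_cart forall_2)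
  then have "emeasure (distr lborel borel c_of) (box l u) = emeasure lborel (box (r_of l) (r_of u))"
    by (subst emeasure_distr) auto
  also have "\<dots> = ennreal (\<Prod>b\<in>Basis. (r_of u - r_of l) \<bullet> b)"
  proof (rule emeasure_lborel_box)
    show "r_of l \<bullet> b \<le> r_of u \<bullet> b" if "b \<in> Basis" for b
    proof -
      obtain i where "b = axis i 1" using \<open>b \<in> Basis\<close> by (auto simp: Basis_vec_def)
      then show ?thesis using lu exhaust_2[of i] by (auto simp: inner_axis r_of_def)
    qed
  qed
  also have "(\<Prod>b\<in>Basis. (r_of u - r_of l) \<bullet> b) = (\<Prod>b\<in>Basis. (u - l) \<bullet> b)"
  proof -
    have "(\<Prod>b\<in>Basis. (r_of u - r_of l) \<bullet> b) = (\<Prod>i\<in>UNIV. (r_of u - r_of l) \<bullet> axis i 1)"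
      by (rule prod.reindex_bij_betw[symmetric])
        (auto simp: bij_betw_def inj_on_def Basis_vec_def axis_eq_axis)
    then show ?thesis by (simp add: UNIV_2 inner_axis r_of_def Basis_complex_def)
  qed
  finally show "emeasure (distr lborel borel c_of) (box l u) = (\<Prod>b\<in>Basis. (u - l) \<bullet> b)" .
qed simp

lemma
  fixes F :: "complex \<Rightarrow> real"
  assumes "open S" "set_integrable lborel S F"
  shows set_integrable_c_of: "set_integrable lborel (c_of -` S) (\<lambda>v. F (c_of v))"
    and set_integral_c_of: "(LINT v:c_of -` S|lborel. F (c_of v)) = (LINT z:S|lborel. F z)"
proof -
  let ?f = "\<lambda>z. indicator S z *\<^sub>R F z"
  have int: "integrable lborel ?f" using assms(2) by (simp add: set_integrable_def)
  then have m: "?f \<in> borel_measurable borel" using borel_measurable_integrable by force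
  have eq: "(\<lambda>v. indicator (c_of -` S) v *\<^sub>R F (c_of v)) = (\<lambda>v. ?f (c_of v))"
    by (auto simp: indicator_def)
  have "integrable (distr lborel borel c_of) ?f" using int lborel_c_of by simp
  then have "integrable lborel (\<lambda>v. ?f (c_of v))"
    by (rule integrable_distr[rotated]) simp
  then show "set_integrable lborel (c_of -` S) (\<lambda>v. F (c_of v))"
    by (simp only: set_integrable_def eq)
  have "integral\<^sup>L (distr lborel borel c_of) ?f = (\<integral>v. ?f (c_of v) \<partial>lborel)"
    by (rule integral_distr) (use m in auto)
  then show "(LINT v:c_of -` S|lborel. F (c_of v)) = (LINT z:S|lborel. F z)"
    using lborel_c_of by (simp only: set_lebesgue_integral_def eq)
qed

text \<open>Multiplication by a complex number w acts on the real plane with determinant |w|^2, so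
  the squared modulus of the derivative is the real Jacobian.\<close>

lemma integral_holomorphic_substitution:
  fixes F :: "complex \<Rightarrow> real"
  assumes S: "open S" and \<phi>: "\<phi> holomorphic_on S" and inj: "inj_on \<phi> S"
    and int: "set_integrable lborel (\<phi> ` S) F" "set_integrable lborel S (\<lambda>z. (cmod (deriv \<phi> z))\<^sup>2 * F (\<phi> z))"
  shows "(LINT z:S|lborel. (cmod (deriv \<phi> z))\<^sup>2 * F (\<phi> z)) = (LINT w:\<phi> ` S|lborel. F w)"
proof -
  have oS: "open (\<phi> ` S)"
    using open_mapping_thm3[OF \<phi> S inj] .
  define g where "g v = r_of (\<phi> (c_of v))" for v
  define g' where "g' v w = r_of (deriv \<phi> (c_of v) * c_of w)" for v w
  let ?S = "c_of -` S"
  have img: "g ` ?S = c_of -` (\<phi> ` S)"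
  proof
    show "c_of -` (\<phi> ` S) \<subseteq> g ` ?S"
    proof
      fix v assume "v \<in> c_of -` (\<phi> ` S)"
      then obtain z where "z \<in> S" "c_of v = \<phi> z" by auto
      then have "v = g (r_of z)" "r_of z \<in> ?S" by (metis g_def c_of_r_of, simp)
      then show "v \<in> g ` ?S" by blast
    qed
  qed (auto simp: g_def)
  have oS2: "open ?S" using open_vimage[OF S continuous_c_of] .
  have det: "\<bar>det (matrix (g' v))\<bar> = (cmod (deriv \<phi> (c_of v)))\<^sup>2" for v
  proof -
    have "det (matrix (g' v)) = (Re (deriv \<phi> (c_of v)))\<^sup>2 + (Im (deriv \<phi> (c_of v)))\<^sup>2"
      by (simp add: det_2 matrix_def g'_def r_of_def c_of_def axis_def power2_eq_square)
    then show ?thesis by (simp add: cmod_power2)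
  qed
  \<comment> \<open>The change of variables theorem concerns vector valued integrands;
    \<open>vec\<close> embeds the real integrand into \<open>real^1\<close>, and \<open>key\<close>
    strips it off again.\<close>
  have cv: "((\<lambda>v. \<bar>det (matrix (g' v))\<bar> *\<^sub>R (vec (F (c_of (g v))) :: real^1)) absolutely_integrable_on ?S \<and>
           integral ?S (\<lambda>v. \<bar>det (matrix (g' v))\<bar> *\<^sub>R (vec (F (c_of (g v))) :: real^1)) = b)
     \<longleftrightarrow> (\<lambda>v. vec (F (c_of v)) :: real^1) absolutely_integrable_on (g ` ?S) \<and> integral (g ` ?S) (\<lambda>v. vec (F (c_of v))) = b" for b
  proof (rule has_absolute_integral_change_of_variables)
    show "?S \<in> sets lebesgue" using oS2 by (intro sets_completionI_sets) simp
    show "inj_on g ?S"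
    proof (rule inj_onI)
      fix v w assume vw: "v \<in> ?S" "w \<in> ?S" "g v = g w"
      then have "\<phi> (c_of v) = \<phi> (c_of w)" by (metis g_def c_of_r_of(1))
      then have "c_of v = c_of w" using inj vw(1,2) by (auto dest: inj_onD)
      then show "v = w" by (metis c_of_r_of(2))
    qed
    fix v assume v: "v \<in> ?S"
    have "(\<phi> has_derivative (*) (deriv \<phi> (c_of v))) (at (c_of v))"
      using holomorphic_derivI[OF \<phi> S, of "c_of v"] v by (simp add: has_field_derivative_def)
    then have "((\<lambda>v. \<phi> (c_of v)) has_derivative (\<lambda>w. deriv \<phi> (c_of v) * c_of w)) (at v)"
      by (rule has_derivative_compose[OF bounded_linear_imp_has_derivative[OF bounded_linear_c_of]])
    then show "(g has_derivative g' v) (at v within ?S)"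
      unfolding g_def[abs_def] g'_def[abs_def]
      by (rule has_derivative_at_withinI[OF bounded_linear.has_derivative[OF bounded_linear_r_of]])
  qed
  have key: "((\<lambda>v. (cmod (deriv \<phi> (c_of v)))\<^sup>2 * F (\<phi> (c_of v))) absolutely_integrable_on ?S \<and>
           integral ?S (\<lambda>v. (cmod (deriv \<phi> (c_of v)))\<^sup>2 * F (\<phi> (c_of v))) = b)
     \<longleftrightarrow> (\<lambda>v. F (c_of v)) absolutely_integrable_on (c_of -` (\<phi> ` S)) \<and> integral (c_of -` (\<phi> ` S)) (\<lambda>v. F (c_of v)) = b" for b
    using cv[of "vec b"] unfolding img det absolutely_integrable_on_1_iff integral_on_1_eq
    by (simp add: g_def)
  \<comment> \<open>Absolute integrability refers to the completed measure; for Borel functions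
    completion changes nothing.\<close>
  have leb: "f absolutely_integrable_on A" if "set_integrable lborel A f" for f :: "real^2 \<Rightarrow> real" and A
    using that unfolding set_integrable_def
    by (subst integrable_completion) (auto dest: borel_measurable_integrable)
  have 1: "set_integrable lborel (c_of -` (\<phi> ` S)) (\<lambda>v. F (c_of v))"
    by (rule set_integrable_c_of[OF oS int(1)])
  have 2: "set_integrable lborel ?S (\<lambda>v. (cmod (deriv \<phi> (c_of v)))\<^sup>2 * F (\<phi> (c_of v)))"
    by (rule set_integrable_c_of[OF S int(2)])
  have "(LINT v:c_of -` (\<phi> ` S)|lborel. F (c_of v)) = (LINT v:?S|lborel. (cmod (deriv \<phi> (c_of v)))\<^sup>2 * F (\<phi> (c_of v)))"
    using key leb[OF 1] set_borel_integral_eq_integral(2)[OF 1] set_borel_integral_eq_integral(2)[OF 2] by metis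
  then show ?thesis
    by (simp only: set_integral_c_of[OF oS int(1)] set_integral_c_of[OF S int(2)])
qed

text \<open>By translation invariance the integrals of the difference quotients vanish.\<close>

lemma integral_directional_derivative_eq_0:
  fixes f :: "complex \<Rightarrow> real"
  assumes f: "smooth_on UNIV f" and K: "compact K" "\<And>z. z \<notin> K \<Longrightarrow> f z = 0"
  shows "integrable lborel (\<lambda>z. frechet_derivative f (at z) v)"
    and "(\<integral>z. frechet_derivative f (at z) v \<partial>lborel) = 0"
proof -
  define D where "D z = frechet_derivative f (at z) v" for z
  have contf: "continuous_on A f" for A using smooth_on_continuous_on[OF f] continuous_on_subset by blast
  have contD: "continuous_on A D" for A
    unfolding D_def using smooth_on_continuous_on[OF smooth_on_frechet_derivative[OF f]] continuous_on_subset by blast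
  have D0: "D z = 0" if "z \<notin> K" for z
  proof -
    have "frechet_derivative f (at z) = frechet_derivative (\<lambda>_. 0) (at z)"
      by (rule frechet_derivative_cong_open[where S="- K"]) (use K that compact_imp_closed in auto)
    then show ?thesis by (simp add: D_def)
  qed
  obtain B where B: "\<And>z. \<bar>D z\<bar> \<le> B"
  proof -
    have "bounded (D ` K)" using compact_continuous_image[OF contD K(1)] compact_imp_bounded by blast
    then obtain B where "\<And>z. z \<in> K \<Longrightarrow> \<bar>D z\<bar> \<le> B" "B > 0" by (auto simp: bounded_pos)
    then have "\<bar>D z\<bar> \<le> B" for z using D0[of z] by (cases "z \<in> K") auto
    then show ?thesis by (rule that)
  qed
  have intf: "integrable lborel f"
    using set_integrable_compact_support[OF K(1) contf, of UNIV] K(2) by (auto simp: set_integrable_def)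
  show intD: "integrable lborel (\<lambda>z. frechet_derivative f (at z) v)"
    using set_integrable_compact_support[OF K(1) contD, of UNIV] D0 by (auto simp: set_integrable_def D_def)
  define s where "s n z = (f (z + (1 / real (Suc n)) *\<^sub>R v) - f z) * real (Suc n)" for n z
  have line: "((\<lambda>t. f (z + t *\<^sub>R v)) has_real_derivative D (z + t *\<^sub>R v)) (at t)" for z t
  proof -
    have "((\<lambda>t. z + t *\<^sub>R v) has_vector_derivative v) (at t)"
      by (auto intro!: derivative_eq_intros)
    from vector_derivative_diff_chain_within[OF this, of f "frechet_derivative f (at (z + t *\<^sub>R v))"]
    show ?thesis using has_derivative_at_withinI[OF smooth_on_has_derivative[OF f UNIV_I]]
      by (simp add: o_def has_real_derivative_iff_has_vector_derivative D_def)
  qed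
  have s0: "(\<integral>z. s n z \<partial>lborel) = 0" and ints: "s n \<in> borel_measurable lborel" for n
  proof -
    have m: "f \<in> borel_measurable borel" using intf borel_measurable_integrable by force
    have i: "integrable (distr lborel borel ((+) a)) f" for a :: complex using intf by (simp add: lborel_distr_plus)
    have 1: "integrable lborel (\<lambda>z. f (a + z))" for a using integrable_distr[OF _ i[of a]] by simp
    have 2: "(\<integral>z. f (a + z) \<partial>lborel) = (\<integral>z. f z \<partial>lborel)" for a
      using integral_distr[of "(+) a" lborel borel f] m by (simp add: lborel_distr_plus)
    show "(\<integral>z. s n z \<partial>lborel) = 0"
    proof -
      define a where "a = (1 / real (Suc n)) *\<^sub>R v"
      have "(\<integral>z. s n z \<partial>lborel) = (\<integral>z. f (a + z) - f z \<partial>lborel) * real (Suc n)"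
        unfolding s_def a_def[symmetric] by (simp only: integral_mult_left_zero add.commute[of _ a])
      also have "(\<integral>z. f (a + z) - f z \<partial>lborel) = 0"
        by (simp only: Bochner_Integration.integral_diff[OF 1 intf] 2 diff_self)
      finally show ?thesis by simp
    qed
    show "s n \<in> borel_measurable lborel" unfolding s_def[abs_def] using m by measurable
  qed
  have lim: "(\<lambda>n. s n z) \<longlonglongrightarrow> D z" for z
  proof -
    have "((\<lambda>h. (f (z + h *\<^sub>R v) - f z) / h) \<longlongrightarrow> D z) (at 0)"
      using line[of z 0] by (simp add: DERIV_def)
    moreover have "filterlim (\<lambda>n. 1 / real (Suc n)) (at 0) sequentially"
      by (rule filterlim_atI) (use LIMSEQ_inverse_real_of_nat in \<open>auto simp: inverse_eq_divide\<close>)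
    ultimately have "(\<lambda>n. (f (z + (1 / real (Suc n)) *\<^sub>R v) - f z) / (1 / real (Suc n))) \<longlonglongrightarrow> D z"
      by (rule filterlim_compose)
    then show ?thesis by (simp add: s_def)
  qed
  obtain r where "\<forall>z\<in>K. norm z \<le> r" using compact_imp_bounded[OF K(1)] bounded_iff[of K] by auto
  then have r: "K \<subseteq> cball 0 r" by auto
  \<comment> \<open>All increments \<open>1 / real (Suc n)\<close> are at most 1. By the mean value
    theorem every quotient \<open>s n\<close> is then bounded by \<open>B\<close> and vanishes
    outside this ball, which yields the dominating function.\<close>
  let ?C = "cball (0::complex) (r + norm v)"
  have bd: "\<bar>s n z\<bar> \<le> indicator ?C z *\<^sub>R B" for n z
  proof -
    let ?h = "1 / real (Suc n)"
    have h: "0 < ?h" "?h \<le> 1" by auto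
    obtain t where t: "0 < t" "t < ?h" "f (z + ?h *\<^sub>R v) - f (z + 0 *\<^sub>R v) = (?h - 0) * D (z + t *\<^sub>R v)"
      using MVT2[OF h(1), of "\<lambda>t. f (z + t *\<^sub>R v)" "\<lambda>t. D (z + t *\<^sub>R v)"] line by auto
    have eq: "s n z = D (z + t *\<^sub>R v)" using t(3) by (simp add: s_def)
    show ?thesis
    proof (cases "z \<in> ?C")
      case True then show ?thesis using B eq by simp
    next
      case False
      have "norm z \<le> norm (z + t *\<^sub>R v) + norm (t *\<^sub>R v)" using norm_triangle_ineq4[of "z + t *\<^sub>R v" "t *\<^sub>R v"] by simp
      moreover have "t \<le> 1" using t(2) h(2) by linarith
      then have "norm (t *\<^sub>R v) \<le> norm v" using t(1) by (simp add: mult_left_le_one_le)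
      ultimately have "z + t *\<^sub>R v \<notin> cball 0 r" using False by auto
      then have "D (z + t *\<^sub>R v) = 0" using r D0 by blast
      then show ?thesis using eq False by simp
    qed
  qed
  have "(\<lambda>n. \<integral>z. s n z \<partial>lborel) \<longlonglongrightarrow> (\<integral>z. D z \<partial>lborel)"
  proof (rule integral_dominated_convergence[where w="\<lambda>z. indicator ?C z *\<^sub>R B"])
    show "integrable lborel (\<lambda>z. indicator ?C z *\<^sub>R B)"
      by (rule borel_integrable_compact) auto
    show "D \<in> borel_measurable lborel" using intD borel_measurable_integrable by (force simp: D_def[abs_def])
    show "AE z in lborel. norm (s n z) \<le> indicator ?C z *\<^sub>R B" for n using bd by simp
  qed (use lim ints in auto)
  then have "(\<integral>z. D z \<partial>lborel) = 0" by (simp add: s0 LIMSEQ_const_iff)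
  then show "(\<integral>z. frechet_derivative f (at z) v \<partial>lborel) = 0" by (simp add: D_def)
qed

text \<open>The set where \<open>F\<close> is nonzero is both open and null, and a nonempty open set
  is not negligible.\<close>

lemma continuous_nonneg_integral_0:
  fixes F :: "'a::euclidean_space \<Rightarrow> real"
  assumes "open S" "continuous_on S F" "\<And>z. z \<in> S \<Longrightarrow> 0 \<le> F z" "set_integrable lborel S F"
    "(LINT z:S|lborel. F z) = 0" "z \<in> S"
  shows "F z = 0"
proof -
  let ?f = "\<lambda>z. indicator S z *\<^sub>R F z"
  have "AE z in lborel. ?f z = 0"
    using integral_nonneg_eq_0_iff_AE[of lborel ?f] assms(3-5)
    by (auto simp: set_integrable_def set_lebesgue_integral_def indicator_def)
  then obtain N where N: "N \<in> null_sets lborel" "{z \<in> space lborel. \<not> ?f z = 0} \<subseteq> N"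
    unfolding eventually_ae_filter by blast
  have "open {z \<in> S. F z \<noteq> 0}"
  proof -
    have "{z \<in> S. F z \<noteq> 0} = S \<inter> F -` (- {0})" by auto
    then show ?thesis using continuous_open_preimage[OF assms(2,1), OF open_Compl[OF closed_singleton]] by simp
  qed
  moreover have "{z \<in> S. F z \<noteq> 0} \<subseteq> N" using N(2) by auto
  moreover have "negligible N" using N(1) null_sets_completionI by (auto simp: negligible_iff_null_sets)
  ultimately have "{z \<in> S. F z \<noteq> 0} = {}"
    using open_not_negligible[of "{z \<in> S. F z \<noteq> 0}"] negligible_subset[of N] by blast
  then show ?thesis using assms(6) by auto
qed

section \<open>Forms in local coordinates and Stokes' theorem\<close>

definition density :: "('x::t2_space) chart set \<Rightarrow> ('x chart \<Rightarrow> 'x \<Rightarrow> real) \<Rightarrow> bool" where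
  "density X \<eta> \<longleftrightarrow> (\<forall>c\<in>X. continuous_on (fst c) (\<eta> c)) \<and>
     (\<forall>c\<in>X. \<forall>d\<in>X. \<forall>x\<in>fst c \<inter> fst d. \<eta> c x = (cmod (coord_deriv c d x))\<^sup>2 * \<eta> d x)"

text \<open>For a 1-form given by its values \<open>A c v x\<close> on coordinate vectors
  \<open>v\<close>, this is the coefficient of dx \<and> dy in the exterior derivative.\<close>

definition curl :: "('x chart \<Rightarrow> complex \<Rightarrow> 'x \<Rightarrow> 'b::real_normed_vector) \<Rightarrow> 'x chart \<Rightarrow> 'x \<Rightarrow> 'b" where
  "curl A c x = pd c 1 (A c \<i>) x - pd c \<i> (A c 1) x"

text \<open>The set \<open>W\<close> and the general target accommodate local connection forms,
  which exist only on the domain of a frame.\<close>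

definition one_form :: "('x::t2_space) chart set \<Rightarrow> 'x set \<Rightarrow> ('x chart \<Rightarrow> complex \<Rightarrow> 'x \<Rightarrow> 'b::real_normed_vector) \<Rightarrow> bool" where
  "one_form X W A \<longleftrightarrow>
     (\<forall>c\<in>X. \<forall>v. smooth_map X (fst c \<inter> W) (A c v)) \<and>
     (\<forall>c\<in>X. \<forall>v. \<forall>x\<in>fst c \<inter> W. A c v x = Re v *\<^sub>R A c 1 x + Im v *\<^sub>R A c \<i> x) \<and>
     (\<forall>c\<in>X. \<forall>d\<in>X. \<forall>v. \<forall>x\<in>fst c \<inter> fst d \<inter> W. A c v x = A d (coord_deriv c d x * v) x)"

lemma one_formI:
  assumes "\<And>c v. c \<in> X \<Longrightarrow> smooth_map X (fst c \<inter> W) (A c v)"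
    "\<And>c v x. c \<in> X \<Longrightarrow> x \<in> fst c \<Longrightarrow> x \<in> W \<Longrightarrow> A c v x = Re v *\<^sub>R A c 1 x + Im v *\<^sub>R A c \<i> x"
    "\<And>c d v x. c \<in> X \<Longrightarrow> d \<in> X \<Longrightarrow> x \<in> fst c \<Longrightarrow> x \<in> fst d \<Longrightarrow> x \<in> W \<Longrightarrow> A c v x = A d (coord_deriv c d x * v) x"
  shows "one_form X W A"
  unfolding one_form_def using assms by blast

lemma one_formD:
  assumes "one_form X W A" "c \<in> X"
  shows "smooth_map X (fst c \<inter> W) (A c v)"
    "x \<in> fst c \<Longrightarrow> x \<in> W \<Longrightarrow> A c v x = Re v *\<^sub>R A c 1 x + Im v *\<^sub>R A c \<i> x"
    "d \<in> X \<Longrightarrow> x \<in> fst c \<Longrightarrow> x \<in> fst d \<Longrightarrow> x \<in> W \<Longrightarrow> A c v x = A d (coord_deriv c d x * v) x"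
  using assms unfolding one_form_def by blast+

lemma density_transform:
  "density X \<eta> \<Longrightarrow> c \<in> X \<Longrightarrow> d \<in> X \<Longrightarrow> x \<in> fst c \<Longrightarrow> x \<in> fst d \<Longrightarrow> \<eta> c x = (cmod (coord_deriv c d x))\<^sup>2 * \<eta> d x"
  unfolding density_def by blast

lemma density_continuous_on: "density X \<eta> \<Longrightarrow> c \<in> X \<Longrightarrow> continuous_on (fst c) (\<eta> c)"
  unfolding density_def by blast

lemma densityI:
  assumes "\<And>c. c \<in> X \<Longrightarrow> continuous_on (fst c) (\<eta> c)"
    "\<And>c d x. c \<in> X \<Longrightarrow> d \<in> X \<Longrightarrow> x \<in> fst c \<Longrightarrow> x \<in> fst d \<Longrightarrow> \<eta> c x = (cmod (coord_deriv c d x))\<^sup>2 * \<eta> d x"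
  shows "density X \<eta>"
  unfolding density_def using assms by blast

context riemann
begin

lemma continuous_on_param: "c \<in> X \<Longrightarrow> continuous_on (snd c ` fst c) (param c)"
  using homeo by (auto simp: homeomorphism_def)

lemma continuous_on_coord: "c \<in> X \<Longrightarrow> continuous_on (fst c) (snd c)"
  using homeo by (auto simp: homeomorphism_def)

lemma continuous_on_chart:
  assumes "c \<in> X" "C \<subseteq> fst c" "continuous_on C f"
  shows "continuous_on (snd c ` C) (\<lambda>z. f (param c z))"
proof -
  have "param c ` snd c ` C = C" using param_coord[OF assms(1)] assms(2) by force
  moreover have "continuous_on (snd c ` C) (param c)"
    by (rule continuous_on_subset[OF continuous_on_param[OF assms(1)]]) (use assms(2) in blast)
  ultimately show ?thesis by (intro continuous_on_compose2[OF assms(3)]) auto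
qed

lemma compact_coord_image: "c \<in> X \<Longrightarrow> compact C \<Longrightarrow> C \<subseteq> fst c \<Longrightarrow> compact (snd c ` C)"
  using compact_continuous_image continuous_on_subset[OF continuous_on_coord] by blast

lemma smooth_map_continuous_on:
  assumes "smooth_map X W f" "open W"
  shows "continuous_on W f"
proof (rule continuous_at_imp_continuous_on, rule ballI)
  fix x assume x: "x \<in> W"
  obtain c where c: "c \<in> X" "x \<in> fst c" using chart_exists by blast
  have "continuous_on (snd c ` (fst c \<inter> W)) (\<lambda>z. f (param c z))"
    by (rule smooth_on_continuous_on[OF smooth_map_onD[OF assms(1) c(1)]])
  moreover have "continuous_on (fst c \<inter> W) (snd c)"
    using homeo[OF c(1)] by (auto simp: homeomorphism_def intro: continuous_on_subset)
  ultimately have "continuous_on (fst c \<inter> W) (\<lambda>x. f (param c (snd c x)))"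
    using continuous_on_compose2 by blast
  then have "continuous_on (fst c \<inter> W) f"
    by (rule continuous_on_eq) (use c in auto)
  then show "isCont f x"
    using continuous_on_eq_continuous_at[of "fst c \<inter> W"] open_chart[OF c(1)] assms(2) x c(2) by blast
qed

text \<open>The exterior derivative commutes with coordinate changes: the second derivatives cancel,
  and the real Jacobian determinant of a holomorphic change is the squared modulus of its
  derivative.\<close>

lemma curl_chart_change:
  assumes "c \<in> X" "d \<in> X" "x \<in> fst c" "x \<in> fst d" "x \<in> W" "open W" and A: "one_form X W A"
  shows "curl A c x = (cmod (coord_deriv c d x))\<^sup>2 *\<^sub>R curl A d x"
proof -
  let ?q = "coord_deriv c d"
  let ?W = "fst c \<inter> fst d \<inter> W"
  have oW: "open ?W" using assms open_chart by blast
  have sm: "smooth_map X (fst d \<inter> W) (A d v)" for v using A assms(2) by (auto simp: one_form_def)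
  have da: "diff_at c (A d v) x" "diff_at d (A d v) x" for v
    using smooth_map_diff_at[OF sm] assms by auto
  have dq: "diff_at c ?q x" using smooth_map_diff_at[OF smooth_map_coord_deriv] assms by auto
  have dR: "diff_at c (\<lambda>y. Re (?q y)) x" "diff_at c (\<lambda>y. Im (?q y)) x" "diff_at c (\<lambda>y. - Im (?q y)) x"
    and pR: "pd c v (\<lambda>y. Re (?q y)) x = Re (pd c v ?q x)" "pd c v (\<lambda>y. Im (?q y)) x = Im (pd c v ?q x)"
      "pd c v (\<lambda>y. - Im (?q y)) x = - Im (pd c v ?q x)" for v
    using diff_at_bounded_linear[OF bounded_linear_Re dq] diff_at_bounded_linear[OF bounded_linear_Im dq]
      diff_at_bounded_linear[OF bounded_linear_minus[OF bounded_linear_Im] dq]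
      pd_bounded_linear[OF bounded_linear_Re dq] pd_bounded_linear[OF bounded_linear_Im dq]
      pd_bounded_linear[OF bounded_linear_minus[OF bounded_linear_Im] dq] by auto
  \<comment> \<open>Along \<i> the derivative of \<open>?q\<close> is \<open>r * \<i>\<close>, with
    real part \<open>- Im r\<close> and imaginary part \<open>Re r\<close>. Hence the terms in
    \<open>e1\<close> and \<open>e2\<close> that contain \<open>A d\<close> undifferentiated
    coincide and cancel in the difference.\<close>
  obtain r where r: "\<And>v. pd c v ?q x = r * v" using pd_coord_deriv assms by blast
  have pc: "param c (snd c x) = x" using assms by simp
  have tr: "A c v y = Re (?q y * v) *\<^sub>R A d 1 y + Im (?q y * v) *\<^sub>R A d \<i> y" if "y \<in> ?W" for v y
  proof -
    have "A c v y = A d (?q y * v) y" using A assms(1,2) that unfolding one_form_def by blast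
    also have "\<dots> = Re (?q y * v) *\<^sub>R A d 1 y + Im (?q y * v) *\<^sub>R A d \<i> y"
      using A assms(2) that unfolding one_form_def by blast
    finally show ?thesis .
  qed
  have "pd c 1 (A c \<i>) x = pd c 1 (\<lambda>y. (- Im (?q y)) *\<^sub>R A d 1 y + Re (?q y) *\<^sub>R A d \<i> y) x"
    by (rule pd_cong[OF oW assms(1)]) (use assms tr in auto)
  also have "\<dots> = (- Im (?q x)) *\<^sub>R pd c 1 (A d 1) x + (- Im r) *\<^sub>R A d 1 x + (Re (?q x) *\<^sub>R pd c 1 (A d \<i>) x + Re r *\<^sub>R A d \<i> x)"
    by (subst pd_add) (simp_all add: diff_at_bounded_bilinear[OF bounded_bilinear_scaleR] dR da pc
        pd_bounded_bilinear[OF bounded_bilinear_scaleR dR(1) da(1) pc] pd_bounded_bilinear[OF bounded_bilinear_scaleR dR(3) da(1) pc] pR r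
        del: scaleR_minus_left)
  finally have e1: "pd c 1 (A c \<i>) x = \<dots>" .
  have "pd c \<i> (A c 1) x = pd c \<i> (\<lambda>y. Re (?q y) *\<^sub>R A d 1 y + Im (?q y) *\<^sub>R A d \<i> y) x"
    by (rule pd_cong[OF oW assms(1)]) (use assms tr in auto)
  also have "\<dots> = Re (?q x) *\<^sub>R pd c \<i> (A d 1) x + (- Im r) *\<^sub>R A d 1 x + (Im (?q x) *\<^sub>R pd c \<i> (A d \<i>) x + Re r *\<^sub>R A d \<i> x)"
    by (subst pd_add) (simp_all add: diff_at_bounded_bilinear[OF bounded_bilinear_scaleR] dR da pc
        pd_bounded_bilinear[OF bounded_bilinear_scaleR dR(1) da(1) pc] pd_bounded_bilinear[OF bounded_bilinear_scaleR dR(2) da(1) pc] pR r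
        del: scaleR_minus_left)
  finally have e2: "pd c \<i> (A c 1) x = \<dots>" .
  have p1: "pd c 1 (A d v) x = Re (?q x) *\<^sub>R pd d 1 (A d v) x + Im (?q x) *\<^sub>R pd d \<i> (A d v) x" for v
    using pd_chart_change[OF assms(1-4) da(2), of 1 v] pd_complex[OF da(2), of "?q x" v] by simp
  have p2: "pd c \<i> (A d v) x = (- Im (?q x)) *\<^sub>R pd d 1 (A d v) x + Re (?q x) *\<^sub>R pd d \<i> (A d v) x" for v
    using pd_chart_change[OF assms(1-4) da(2), of \<i> v] pd_complex[OF da(2), of "?q x * \<i>" v] by simp
  show ?thesis
    unfolding curl_def e1 e2 p1 p2 cmod_power2
    by (simp add: algebra_simps power2_eq_square)
qed

end

locale compact_riemann = riemann X for X :: "('x::t2_space) chart set" +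
  assumes compact: "compact (UNIV :: 'x set)"
begin

text \<open>The partition picked by \<open>SOME\<close> does not depend on the integrand, so one
  triple serves all \<eta> at once. This is what makes integrals comparable and additive.\<close>

lemma partition_of_unity_surface_integral:
  obtains N c u where "partition_of_unity X N c u"
    "\<And>\<eta>. surface_integral X \<eta> = (\<Sum>i<N. LINT z : snd (c i) ` fst (c i) | lborel.
            2 * (u i (param (c i) z) * \<eta> (c i) (param (c i) z)))"
proof -
  obtain N c u where p: "(SOME (N, c, u). partition_of_unity X N c u) = (N, c, u)"
    by (metis prod.exhaust)
  have "case (SOME (N, c, u). partition_of_unity X N c u) of (N, c, u) \<Rightarrow> partition_of_unity X N c u"
    by (rule someI_ex) (use partition_of_unity_exists[OF compact] in auto)
  then show ?thesis using that[of N c u] p by (simp add: surface_integral_def)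
qed

lemma set_integrable_chart:
  assumes "c \<in> X" "compact C" "C \<subseteq> fst c" "continuous_on C f" "\<And>x. x \<in> fst c \<Longrightarrow> x \<notin> C \<Longrightarrow> f x = (0::real)"
    "C \<subseteq> W"
  shows "set_integrable lborel (snd c ` (fst c \<inter> W)) (\<lambda>z. f (param c z))"
proof (rule set_integrable_compact_support[where K="snd c ` C"])
  show "compact (snd c ` C)" by (rule compact_coord_image[OF assms(1-3)])
  show "continuous_on (snd c ` C) (\<lambda>z. f (param c z))" by (rule continuous_on_chart[OF assms(1,3,4)])
  show "snd c ` C \<subseteq> snd c ` (fst c \<inter> W)" using assms(3,6) by blast
  fix z assume z: "z \<in> snd c ` (fst c \<inter> W)" "z \<notin> snd c ` C"
  then have "param c z \<in> fst c" "param c z \<notin> C"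
    using param_in[OF assms(1)] coord_param[OF assms(1)] by (blast, force simp: image_iff)
  then show "f (param c z) = 0" using assms(5) by blast
qed

text \<open>Holomorphic substitution on the overlap of the two charts; in the application
  \<open>g\<close> is a member of a partition of unity. The integrand vanishes off \<open>C\<close>
  in either chart, so the parts of the charts outside the overlap contribute nothing.\<close>

lemma integral_chart_change:
  assumes cd: "c \<in> X" "d \<in> X" and C: "compact C" "C \<subseteq> fst c" "C \<subseteq> fst d"
    and \<eta>: "density X \<eta>" and g: "continuous_on UNIV g"
    and supp: "\<And>x e. e = c \<or> e = d \<Longrightarrow> x \<in> fst e \<Longrightarrow> x \<notin> C \<Longrightarrow> g x * \<eta> e x = 0"
  shows "(LINT z : snd c ` fst c | lborel. g (param c z) * \<eta> c (param c z)) =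
         (LINT z : snd d ` fst d | lborel. g (param d z) * \<eta> d (param d z))"
proof -
  let ?S = "snd c ` (fst c \<inter> fst d)" and ?T = "snd d ` (fst d \<inter> fst c)"
  define \<phi> where "\<phi> z = snd d (param c z)" for z
  have \<phi>: "\<phi> holomorphic_on ?S" unfolding \<phi>_def by (rule transition_holomorphic[OF cd])
  have img: "\<phi> ` ?S = ?T"
  proof -
    have "\<phi> ` ?S = (\<lambda>x. \<phi> (snd c x)) ` (fst c \<inter> fst d)" by (simp add: image_image)
    also have "\<dots> = snd d ` (fst c \<inter> fst d)" by (rule image_cong) (auto simp: \<phi>_def cd)
    finally show ?thesis by (simp add: Int_commute)
  qed
  have inj: "inj_on \<phi> ?S"
  proof (rule inj_onI)
    fix z w assume z: "z \<in> ?S" and w: "w \<in> ?S" and eq: "\<phi> z = \<phi> w"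
    obtain x y where x: "x \<in> fst c" "x \<in> fst d" "z = snd c x" and y: "y \<in> fst c" "y \<in> fst d" "w = snd c y"
      using z w by auto
    have "snd d x = snd d y" using eq x y cd by (simp add: \<phi>_def)
    then have "x = y" using param_coord[OF cd(2)] x y by metis
    then show "z = w" using x y by simp
  qed
  have cont: "continuous_on C (\<lambda>x. g x * \<eta> e x)" if "e = c \<or> e = d" for e
  proof (rule continuous_on_mult)
    have "continuous_on (fst e) (\<eta> e)" "C \<subseteq> fst e" using density_continuous_on[OF \<eta>] that cd C by blast+
    then show "continuous_on C (\<eta> e)" by (rule continuous_on_subset)
  qed (rule continuous_on_subset[OF g], simp)
  have ic: "set_integrable lborel ?S (\<lambda>z. g (param c z) * \<eta> c (param c z))"
    using set_integrable_chart[OF cd(1) C(1,2) cont[of c], of "fst d"] supp C by auto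
  have id: "set_integrable lborel ?T (\<lambda>z. g (param d z) * \<eta> d (param d z))"
    using set_integrable_chart[OF cd(2) C(1,3) cont[of d], of "fst c"] supp C by auto
  have eq: "g (param c z) * \<eta> c (param c z) =
      (cmod (deriv \<phi> z))\<^sup>2 * (g (param d (\<phi> z)) * \<eta> d (param d (\<phi> z)))" if z: "z \<in> ?S" for z
  proof -
    obtain x where x: "x \<in> fst c" "x \<in> fst d" "z = snd c x" using z by auto
    have "\<eta> c x = (cmod (coord_deriv c d x))\<^sup>2 * \<eta> d x" using density_transform[OF \<eta> cd x(1,2)] .
    then show ?thesis using x cd by (simp add: \<phi>_def[abs_def] coord_deriv_def comp_def)
  qed
  have z: "g (param e z) * \<eta> e (param e z) = 0" if "e = c \<or> e = d" "z \<in> snd e ` fst e" "z \<notin> snd e ` (fst c \<inter> fst d)" for e z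
  proof (rule supp[OF that(1)])
    have e: "e \<in> X" using that(1) cd by auto
    show "param e z \<in> fst e" using param_in[OF e that(2)] .
    then show "param e z \<notin> C" using that(2,3) coord_param[OF e that(2)] C by (metis Int_iff imageI subsetD)
  qed
  have "(LINT z : snd c ` fst c | lborel. g (param c z) * \<eta> c (param c z)) =
      (LINT z : ?S | lborel. g (param c z) * \<eta> c (param c z))"
    by (rule set_integral_cong_support) (use z in auto)
  also have "\<dots> = (LINT z : ?S | lborel. (cmod (deriv \<phi> z))\<^sup>2 * (g (param d (\<phi> z)) * \<eta> d (param d (\<phi> z))))"
    by (rule set_lebesgue_integral_cong) (use eq open_image_inter[OF cd] in auto)
  also have "\<dots> = (LINT w : \<phi> ` ?S | lborel. g (param d w) * \<eta> d (param d w))"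
  proof (rule integral_holomorphic_substitution[OF open_image_inter[OF cd] \<phi> inj])
    show "set_integrable lborel (\<phi> ` ?S) (\<lambda>w. g (param d w) * \<eta> d (param d w))" using id img by simp
    show "set_integrable lborel ?S (\<lambda>z. (cmod (deriv \<phi> z))\<^sup>2 * (g (param d (\<phi> z)) * \<eta> d (param d (\<phi> z))))"
    proof -
      have "(\<lambda>z. indicator ?S z *\<^sub>R (g (param c z) * \<eta> c (param c z))) =
          (\<lambda>z. indicator ?S z *\<^sub>R ((cmod (deriv \<phi> z))\<^sup>2 * (g (param d (\<phi> z)) * \<eta> d (param d (\<phi> z)))))"
        using eq by (force simp: indicator_def)
      then show ?thesis using ic by (simp only: set_integrable_def)
    qed
  qed
  also have "\<dots> = (LINT z : snd d ` fst d | lborel. g (param d z) * \<eta> d (param d z))"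
    unfolding img by (rule set_integral_cong_support[symmetric]) (use z[of d] in \<open>auto simp: Int_commute\<close>)
  finally show ?thesis .
qed

lemma partition_support:
  assumes "partition_of_unity X N c u" "i < N"
  shows "c i \<in> X" "compact (closure {x. u i x \<noteq> 0})" "closure {x. u i x \<noteq> 0} \<subseteq> fst (c i)"
    "smooth_map X UNIV (u i)" "\<And>x. 0 \<le> u i x" "continuous_on UNIV (u i)" "\<And>x. (\<Sum>i<N. u i x) = 1"
    "\<And>x. x \<notin> closure {x. u i x \<noteq> 0} \<Longrightarrow> u i x = 0"
proof -
  show "compact (closure {x. u i x \<noteq> 0})" using closed_Int_compact[OF closed_closure compact] by simp
  show s: "smooth_map X UNIV (u i)" using assms by (auto simp: partition_of_unity_def)
  show "continuous_on UNIV (u i)" using smooth_map_continuous_on[OF s] by simp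
  show "x \<notin> closure {x. u i x \<noteq> 0} \<Longrightarrow> u i x = 0" for x using closure_subset[of "{x. u i x \<noteq> 0}"] by auto
qed (use assms in \<open>auto simp: partition_of_unity_def\<close>)

lemma set_integrable_partition:
  assumes "partition_of_unity X N c u" "i < N" "density X \<eta>"
  shows "set_integrable lborel (snd (c i) ` fst (c i)) (\<lambda>z. u i (param (c i) z) * \<eta> (c i) (param (c i) z))"
proof -
  note p = partition_support[OF assms(1,2)]
  have "set_integrable lborel (snd (c i) ` (fst (c i) \<inter> UNIV)) (\<lambda>z. (\<lambda>x. u i x * \<eta> (c i) x) (param (c i) z))"
  proof (rule set_integrable_chart[where f="\<lambda>x. u i x * \<eta> (c i) x", OF p(1-3)])
    show "continuous_on (closure {x. u i x \<noteq> 0}) (\<lambda>x. u i x * \<eta> (c i) x)"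
    proof (rule continuous_on_mult)
      have "continuous_on (fst (c i)) (\<eta> (c i))" using p(1) density_continuous_on[OF assms(3)] by blast
      then show "continuous_on (closure {x. u i x \<noteq> 0}) (\<eta> (c i))" by (rule continuous_on_subset[OF _ p(3)])
    qed (rule continuous_on_subset[OF p(6)], simp)
  qed (auto dest: p(8))
  then show ?thesis by simp
qed

lemma surface_integral_cong:
  assumes "\<And>c x. c \<in> X \<Longrightarrow> x \<in> fst c \<Longrightarrow> \<eta> c x = \<zeta> c x"
  shows "surface_integral X \<eta> = surface_integral X \<zeta>"
proof -
  obtain N c u where p: "partition_of_unity X N c u" and
    J: "\<And>\<eta>. surface_integral X \<eta> = (\<Sum>i<N. LINT z : snd (c i) ` fst (c i) | lborel.
            2 * (u i (param (c i) z) * \<eta> (c i) (param (c i) z)))"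
    by (rule partition_of_unity_surface_integral, rule that)
  show ?thesis unfolding J
  proof (rule sum.cong[OF refl], rule set_lebesgue_integral_cong)
    fix i assume "i \<in> {..<N}"
    then have c: "c i \<in> X" using partition_support(1)[OF p] by auto
    show "snd (c i) ` fst (c i) \<in> sets lborel" using open_image_chart[OF c] by simp
    show "\<forall>z. z \<in> snd (c i) ` fst (c i) \<longrightarrow> 2 * (u i (param (c i) z) * \<eta> (c i) (param (c i) z)) =
        2 * (u i (param (c i) z) * \<zeta> (c i) (param (c i) z))"
      using assms[OF c param_in[OF c]] by simp
  qed
qed

lemma surface_integral_linear:
  assumes "density X \<eta>" "density X \<zeta>"
  shows "surface_integral X (\<lambda>c x. a * \<eta> c x + b * \<zeta> c x) = a * surface_integral X \<eta> + b * surface_integral X \<zeta>"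
proof -
  obtain N c u where p: "partition_of_unity X N c u" and
    J: "\<And>\<eta>. surface_integral X \<eta> = (\<Sum>i<N. LINT z : snd (c i) ` fst (c i) | lborel.
            2 * (u i (param (c i) z) * \<eta> (c i) (param (c i) z)))"
    by (rule partition_of_unity_surface_integral, rule that)
  have "(LINT z : snd (c i) ` fst (c i) | lborel. 2 * (u i (param (c i) z) * (a * \<eta> (c i) (param (c i) z) + b * \<zeta> (c i) (param (c i) z))))
    = a * (LINT z : snd (c i) ` fst (c i) | lborel. 2 * (u i (param (c i) z) * \<eta> (c i) (param (c i) z)))
    + b * (LINT z : snd (c i) ` fst (c i) | lborel. 2 * (u i (param (c i) z) * \<zeta> (c i) (param (c i) z)))" if "i < N" for i
  proof -
    let ?S = "snd (c i) ` fst (c i)"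
    let ?f = "\<lambda>z. u i (param (c i) z) * \<eta> (c i) (param (c i) z)" and ?g = "\<lambda>z. u i (param (c i) z) * \<zeta> (c i) (param (c i) z)"
    have i: "set_integrable lborel ?S (\<lambda>z. k * ?f z)" "set_integrable lborel ?S (\<lambda>z. k * ?g z)" for k
      using set_integrable_partition[OF p that] assms by auto
    have "(LINT z : ?S | lborel. (2 * a) * ?f z + (2 * b) * ?g z) = (LINT z : ?S | lborel. (2 * a) * ?f z) + (LINT z : ?S | lborel. (2 * b) * ?g z)"
      by (rule set_integral_add(2)[OF i])
    then show ?thesis by (simp add: algebra_simps)
  qed
  then show ?thesis unfolding J by (simp add: sum.distrib sum_distrib_left)
qed

lemma density_zero: "density X (\<lambda>_ _. 0)"
  by (rule densityI) auto

lemma density_linear: "density X \<eta> \<Longrightarrow> density X \<zeta> \<Longrightarrow> density X (\<lambda>c x. a * \<eta> c x + b * \<zeta> c x)"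
proof (rule densityI)
  assume d: "density X \<eta>" "density X \<zeta>"
  show "continuous_on (fst c) (\<lambda>x. a * \<eta> c x + b * \<zeta> c x)" if "c \<in> X" for c
    using d that by (intro continuous_intros density_continuous_on[where X=X])
  show "a * \<eta> c x + b * \<zeta> c x = (cmod (coord_deriv c e x))\<^sup>2 * (a * \<eta> e x + b * \<zeta> e x)"
    if "c \<in> X" "e \<in> X" "x \<in> fst c" "x \<in> fst e" for c e x
    unfolding density_transform[OF d(1) that] density_transform[OF d(2) that] by (simp add: algebra_simps)
qed

lemma density_sum: "(\<And>i. i \<in> I \<Longrightarrow> density X (\<eta> i)) \<Longrightarrow> density X (\<lambda>c x. \<Sum>i\<in>I. \<eta> i c x)"
proof (induction I rule: infinite_finite_induct)
  case (insert i I)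
  then show ?case using density_linear[of "\<eta> i" "\<lambda>c x. \<Sum>i\<in>I. \<eta> i c x" 1 1] by simp
qed (auto intro: density_zero)

lemma surface_integral_sum:
  assumes "finite I" "\<And>i. i \<in> I \<Longrightarrow> density X (\<eta> i)"
  shows "surface_integral X (\<lambda>c x. \<Sum>i\<in>I. \<eta> i c x) = (\<Sum>i\<in>I. surface_integral X (\<eta> i))"
  using assms
proof (induction I rule: finite_induct)
  case empty
  show ?case using surface_integral_linear[OF density_zero density_zero, of 0 0] by simp
next
  case (insert i I)
  then show ?case
    using surface_integral_linear[of "\<eta> i" "\<lambda>c x. \<Sum>i\<in>I. \<eta> i c x" 1 1] density_sum[of I \<eta>] by simp
qed

text \<open>Each summand of the integral is nonnegative and therefore 0. Some member of the
  partition is nonzero at \<open>x\<close>, and the corresponding continuous integrand vanishes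
  there.\<close>

lemma surface_integral_nonneg_eq_0:
  assumes \<eta>: "density X \<eta>" and nonneg: "\<And>c x. c \<in> X \<Longrightarrow> x \<in> fst c \<Longrightarrow> 0 \<le> \<eta> c x"
    and zero: "surface_integral X \<eta> = 0" and d: "d \<in> X" "x \<in> fst d"
  shows "\<eta> d x = 0"
proof -
  obtain N c u where p: "partition_of_unity X N c u" and
    J: "\<And>\<eta>. surface_integral X \<eta> = (\<Sum>i<N. LINT z : snd (c i) ` fst (c i) | lborel.
            2 * (u i (param (c i) z) * \<eta> (c i) (param (c i) z)))"
    by (rule partition_of_unity_surface_integral, rule that)
  let ?f = "\<lambda>i z. 2 * (u i (param (c i) z) * \<eta> (c i) (param (c i) z))"
  have pos: "0 \<le> ?f i z" if "i < N" "z \<in> snd (c i) ` fst (c i)" for i z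
    using partition_support(1,5)[OF p that(1)] nonneg param_in that(2) by simp
  have int: "(LINT z : snd (c i) ` fst (c i) | lborel. ?f i z) \<ge> 0" if "i < N" for i
    unfolding set_lebesgue_integral_def using pos[OF that]
    by (intro Bochner_Integration.integral_nonneg) (auto simp: indicator_def)
  have int0: "(LINT z : snd (c i) ` fst (c i) | lborel. ?f i z) = 0" if "i < N" for i
    using zero int that unfolding J by (subst (asm) sum_nonneg_eq_0_iff) auto
  obtain i where i: "i < N" "u i x \<noteq> 0"
    using p unfolding partition_of_unity_def by (metis lessThan_iff sum.neutral zero_neq_one)
  note pi = partition_support[OF p i(1)]
  have x: "x \<in> fst (c i)" using i(2) pi(3,8) by blast
  have "?f i (snd (c i) x) = 0"
  proof (rule continuous_nonneg_integral_0[OF open_image_chart[OF pi(1)] _ pos[OF i(1)] _ int0[OF i(1)]])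
    show "set_integrable lborel (snd (c i) ` fst (c i)) (?f i)" using set_integrable_partition[OF p i(1) \<eta>] by simp
    have "continuous_on (fst (c i)) (\<lambda>x. 2 * (u i x * \<eta> (c i) x))"
      by (intro continuous_intros continuous_on_subset[OF pi(6)]) (use density_continuous_on[OF \<eta> pi(1)] in auto)
    then show "continuous_on (snd (c i) ` fst (c i)) (?f i)"
      by (rule continuous_on_chart[OF pi(1) order_refl])
  qed (use x in auto)
  then have "\<eta> (c i) x = 0" using i(2) pi(1) x by simp
  moreover have "\<eta> d x = (cmod (coord_deriv d (c i) x))\<^sup>2 * \<eta> (c i) x"
    by (rule density_transform[OF \<eta> d(1) pi(1) d(2) x])
  ultimately show ?thesis by simp
qed

text \<open>For a form supported in one chart, all summands can be moved to that chart, where the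
  members of the partition add up to 1; the chosen partition disappears from the value.\<close>

lemma surface_integral_localize:
  assumes d: "d \<in> X" and C: "compact C" "C \<subseteq> fst d" and \<eta>: "density X \<eta>"
    and supp: "\<And>c x. c \<in> X \<Longrightarrow> x \<in> fst c \<Longrightarrow> x \<notin> C \<Longrightarrow> \<eta> c x = 0"
  shows "surface_integral X \<eta> = (LINT z : snd d ` fst d | lborel. 2 * \<eta> d (param d z))"
proof -
  obtain N c u where p: "partition_of_unity X N c u" and
    J: "\<And>\<eta>. surface_integral X \<eta> = (\<Sum>i<N. LINT z : snd (c i) ` fst (c i) | lborel.
            2 * (u i (param (c i) z) * \<eta> (c i) (param (c i) z)))"
    by (rule partition_of_unity_surface_integral, rule that)
  have "(LINT z : snd (c i) ` fst (c i) | lborel. u i (param (c i) z) * \<eta> (c i) (param (c i) z)) =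
      (LINT z : snd d ` fst d | lborel. u i (param d z) * \<eta> d (param d z))" if "i < N" for i
  proof (rule integral_chart_change[OF _ d _ _ _ \<eta>])
    note pi = partition_support[OF p that]
    let ?C = "C \<inter> closure {x. u i x \<noteq> 0}"
    show "compact ?C" using C(1) by (intro compact_Int_closed) auto
    show "?C \<subseteq> fst (c i)" "?C \<subseteq> fst d" using pi(3) C(2) by auto
    show "u i x * \<eta> e x = 0" if "e = c i \<or> e = d" "x \<in> fst e" "x \<notin> ?C" for x e
    proof (cases "x \<in> C")
      case True
      then have "u i x = 0" using that(3) by (intro pi(8)) auto
      then show ?thesis by simp
    next
      case False
      then have "\<eta> e x = 0" using supp[of e x] that(1,2) pi(1) d by blast
      then show ?thesis by simp
    qed
  qed (rule partition_support[OF p that])+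
  then have "surface_integral X \<eta> = (\<Sum>i<N. LINT z : snd d ` fst d | lborel. 2 * (u i (param d z) * \<eta> d (param d z)))"
    unfolding J by simp
  also have "\<dots> = (\<Sum>i<N. \<integral>z. indicator (snd d ` fst d) z *\<^sub>R (2 * (u i (param d z) * \<eta> d (param d z))) \<partial>lborel)"
    by (simp only: set_lebesgue_integral_def)
  also have "\<dots> = (\<integral>z. (\<Sum>i<N. indicator (snd d ` fst d) z *\<^sub>R (2 * (u i (param d z) * \<eta> d (param d z)))) \<partial>lborel)"
  proof (rule Bochner_Integration.integral_sum[symmetric])
    fix i assume "i \<in> {..<N}"
    then have pi: "continuous_on UNIV (u i)" using partition_support(6)[OF p] by auto
    have "set_integrable lborel (snd d ` (fst d \<inter> UNIV)) (\<lambda>z. (\<lambda>x. 2 * (u i x * \<eta> d x)) (param d z))"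
    proof (rule set_integrable_chart[where f="\<lambda>x. 2 * (u i x * \<eta> d x)", OF d C])
      show "continuous_on C (\<lambda>x. 2 * (u i x * \<eta> d x))"
        by (intro continuous_intros continuous_on_subset[OF pi] continuous_on_subset[OF density_continuous_on[OF \<eta> d] C(2)]) simp
    qed (use supp d in auto)
    then show "integrable lborel (\<lambda>z. indicator (snd d ` fst d) z *\<^sub>R (2 * (u i (param d z) * \<eta> d (param d z))))"
      by (simp add: set_integrable_def)
  qed
  also have "(\<lambda>z. \<Sum>i<N. indicator (snd d ` fst d) z *\<^sub>R (2 * (u i (param d z) * \<eta> d (param d z)))) =
      (\<lambda>z. indicator (snd d ` fst d) z *\<^sub>R (2 * \<eta> d (param d z)))"
  proof
    fix z
    have "(\<Sum>i<N. u i (param d z)) = 1" using p by (simp add: partition_of_unity_def)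
    then have "(\<Sum>i<N. u i (param d z) * \<eta> d (param d z)) = \<eta> d (param d z)"
      by (simp add: sum_distrib_right[symmetric])
    then show "(\<Sum>i<N. indicator (snd d ` fst d) z *\<^sub>R (2 * (u i (param d z) * \<eta> d (param d z)))) =
      indicator (snd d ` fst d) z *\<^sub>R (2 * \<eta> d (param d z))"
      by (simp add: scaleR_sum_right[symmetric] sum_distrib_left[symmetric])
  qed
  finally show ?thesis by (simp only: set_lebesgue_integral_def)
qed

lemma density_curl:
  assumes "one_form X UNIV B"
  shows "density X (curl B)"
proof -
  have B: "smooth_map X (fst c) (B c v)" if "c \<in> X" for c v
    using assms that by (simp add: one_form_def)
  have "continuous_on (fst c) (curl B c)" if "c \<in> X" for c
  proof -
    have "smooth_map X (fst c) (curl B c)"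
      unfolding curl_def[abs_def]
      using smooth_map_pd[OF B[OF that] that open_chart[OF that]] open_chart[OF that]
      by (intro smooth_map_diff) simp_all
    then show ?thesis using smooth_map_continuous_on open_chart[OF that] by blast
  qed
  then show ?thesis
    using curl_chart_change[OF _ _ _ _ UNIV_I open_UNIV assms] unfolding real_scaleR_def by (rule densityI)
qed

text \<open>Stokes' theorem on a closed surface. A partition of unity cuts the 1-form into pieces
  supported in single charts, and in a chart both terms of the curl are directional derivatives of
  compactly supported functions on the plane, which integrate to 0.\<close>

theorem surface_integral_curl:
  fixes B :: "'x chart \<Rightarrow> complex \<Rightarrow> 'x \<Rightarrow> real"
  assumes B: "one_form X UNIV B"
  shows "surface_integral X (curl B) = 0"
proof -
  have Bs: "smooth_map X (fst c) (B c v)" if "c \<in> X" for c v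
    using B that by (simp add: one_form_def)
  obtain N k u where p: "partition_of_unity X N k u"
    using partition_of_unity_exists[OF compact] by blast
  define Bu where "Bu j c v x = u j x * B c v x" for j c v x
  have Bu: "one_form X UNIV (Bu j)" if "j < N" for j
  proof -
    have sm: "smooth_map X (fst c) (Bu j c v)" if c: "c \<in> X" for c v
      unfolding Bu_def[abs_def]
      by (rule smooth_map_mult[OF smooth_map_subset[OF partition_support(4)[OF p \<open>j < N\<close>]] Bs[OF c] open_chart[OF c]]) simp
    show ?thesis
    proof (rule one_formI)
      show "Bu j c v x = Re v *\<^sub>R Bu j c 1 x + Im v *\<^sub>R Bu j c \<i> x" if "c \<in> X" "x \<in> fst c" for c v x
        unfolding Bu_def one_formD(2)[OF B that UNIV_I, of v] by (simp add: algebra_simps)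
      show "Bu j c v x = Bu j d (coord_deriv c d x * v) x" if "c \<in> X" "d \<in> X" "x \<in> fst c" "x \<in> fst d" for c d v x
        unfolding Bu_def one_formD(3)[OF B that UNIV_I, of v] by (rule refl)
    qed (simp add: sm)
  qed
  have Bus: "smooth_map X (fst c) (Bu j c v)" if "j < N" "c \<in> X" for j c v
    using Bu[OF that(1)] that(2) by (simp add: one_form_def)
  have split: "curl B c x = (\<Sum>j<N. curl (Bu j) c x)" if c: "c \<in> X" "x \<in> fst c" for c x
  proof -
    have "pd c w (B c v) x = (\<Sum>j<N. pd c w (Bu j c v) x)" for v w
    proof -
      have "B c v = (\<lambda>x. \<Sum>j<N. Bu j c v x)"
        using p by (simp add: Bu_def partition_of_unity_def sum_distrib_right[symmetric])
      then show ?thesis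
        using pd_sum[of "{..<N}" c "\<lambda>j. Bu j c v" x w] smooth_map_diff_at[OF Bus _ c(2,2)] c(1) by simp
    qed
    then show ?thesis by (simp add: curl_def sum_subtractf)
  qed
  have zero: "surface_integral X (curl (Bu j)) = 0" if j: "j < N" for j
  proof -
    let ?d = "k j"
    note pj = partition_support[OF p j]
    define C where "C = closure {x. u j x \<noteq> 0}"
    define S where "S = snd ?d ` fst ?d"
    have oS: "open S" unfolding S_def by (rule open_image_chart[OF pj(1)])
    have comp: "compact (snd ?d ` C)"
      unfolding C_def by (rule compact_coord_image[OF pj(1-3)])
    have curl0: "curl (Bu j) c x = 0" if "c \<in> X" "x \<in> fst c" "x \<notin> C" for c x
    proof -
      have "pd c w (Bu j c v) x = pd c w (\<lambda>_. 0) x" for v w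
        by (rule pd_cong[where W="- C"]) (use that in \<open>auto simp: C_def Bu_def dest: pj(8)\<close>)
      then show ?thesis by (simp add: curl_def pd_const)
    qed
    \<comment> \<open>Extension by 0 from the image of the chart to the plane. It is smooth because
      it already vanishes off the compact, hence closed, image of \<open>C\<close>.\<close>
    define f where "f v z = (if z \<in> S then Bu j ?d v (param ?d z) else 0)" for v z
    have f0: "f v z = 0" if "z \<notin> snd ?d ` C" for v z
    proof (cases "z \<in> S")
      case True
      then have "param ?d z \<notin> C" using that coord_param[OF pj(1)] unfolding S_def by (metis imageI)
      then have "u j (param ?d z) = 0" unfolding C_def by (rule pj(8))
      then show ?thesis by (simp add: f_def Bu_def)
    qed (simp add: f_def)
    have fs: "smooth_on UNIV (f v)" for v
    proof (rule smooth_on_Union)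
      fix z :: complex
      show "\<exists>T. z \<in> T \<and> smooth_on T (f v)"
      proof (cases "z \<in> S")
        case True
        have "smooth_on S (\<lambda>z. Bu j ?d v (param ?d z))"
          using smooth_map_onD[OF Bus[OF j pj(1)] pj(1)] by (simp add: S_def)
        then have "smooth_on S (f v)" by (subst smooth_on_cong[OF oS]) (auto simp: f_def)
        then show ?thesis using True by blast
      next
        case False
        have o: "open (- (snd ?d ` C))" using compact_imp_closed[OF comp] by auto
        have "smooth_on (- (snd ?d ` C)) (f v)"
          by (subst smooth_on_cong[OF o, where g="\<lambda>_. 0"]) (auto simp: f0 intro: smooth_on_const[OF o])
        moreover have "z \<in> - (snd ?d ` C)" using False pj(3) by (auto simp: S_def C_def)
        ultimately show ?thesis by blast
      qed
    qed
    have fd: "frechet_derivative (f v) (at z) w = pd ?d w (Bu j ?d v) (param ?d z)" if "z \<in> S" for z v w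
    proof -
      have "frechet_derivative (f v) (at z) = frechet_derivative (Bu j ?d v \<circ> param ?d) (at z)"
        by (rule frechet_derivative_cong_open[OF oS that]) (simp add: f_def)
      then show ?thesis using coord_param[OF pj(1)] that by (simp add: pd_def S_def)
    qed
    have fd0: "frechet_derivative (f v) (at z) w = 0" if "z \<notin> S" for z v w
    proof -
      have "frechet_derivative (f v) (at z) = frechet_derivative (\<lambda>_. 0) (at z)"
        by (rule frechet_derivative_cong_open[where S="- (snd ?d ` C)"])
          (use f0 comp compact_imp_closed that pj(3) in \<open>auto simp: S_def C_def\<close>)
      then show ?thesis by simp
    qed
    have "surface_integral X (curl (Bu j)) = (LINT z : S | lborel. 2 * curl (Bu j) ?d (param ?d z))"
      unfolding S_def
      by (rule surface_integral_localize[OF pj(1) pj(2,3) density_curl[OF Bu[OF j]]]) (use curl0 in \<open>auto simp: C_def\<close>)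
    also have "\<dots> = (\<integral>z. 2 * (frechet_derivative (f \<i>) (at z) 1 - frechet_derivative (f 1) (at z) \<i>) \<partial>lborel)"
      unfolding set_lebesgue_integral_def
      by (rule Bochner_Integration.integral_cong) (auto simp: indicator_def curl_def fd fd0)
    also have "\<dots> = 0"
      using integral_directional_derivative_eq_0[OF fs comp f0] by simp
    finally show ?thesis .
  qed
  have "surface_integral X (curl B) = surface_integral X (\<lambda>c x. \<Sum>j<N. curl (Bu j) c x)"
    by (rule surface_integral_cong) (rule split)
  also have "\<dots> = (\<Sum>j<N. surface_integral X (curl (Bu j)))"
    by (rule surface_integral_sum) (auto intro: density_curl Bu)
  also have "\<dots> = 0" by (simp add: zero)
  finally show ?thesis .
qed

end

section \<open>Matrix groups and their Lie algebras\<close>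

lemma bounded_bilinear_matrix_mult: "bounded_bilinear ((**) :: complex^'n^'m \<Rightarrow> complex^'p^'n \<Rightarrow> complex^'p^'m)"
proof (rule bilinear_conv_bounded_bilinear[THEN iffD1], unfold bilinear_def, intro conjI allI)
  show "linear (\<lambda>B. (A::complex^'n^'m) ** (B::complex^'p^'n))" for A
    by (rule linearI) (simp_all add: matrix_add_ldistrib matrix_scalar_ac scalar_matrix_assoc)
  show "linear (\<lambda>A. (A::complex^'n^'m) ** (B::complex^'p^'n))" for B
    by (rule linearI) (simp_all add: vec_eq_iff matrix_matrix_mult_def sum.distrib distrib_right scaleR_sum_right)
qed

lemmas matrix_mult_simps =
  bounded_bilinear.add_left[OF bounded_bilinear_matrix_mult] bounded_bilinear.add_right[OF bounded_bilinear_matrix_mult]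
  bounded_bilinear.diff_left[OF bounded_bilinear_matrix_mult] bounded_bilinear.diff_right[OF bounded_bilinear_matrix_mult]
  bounded_bilinear.minus_left[OF bounded_bilinear_matrix_mult] bounded_bilinear.minus_right[OF bounded_bilinear_matrix_mult]
  bounded_bilinear.scaleR_left[OF bounded_bilinear_matrix_mult] bounded_bilinear.scaleR_right[OF bounded_bilinear_matrix_mult]
  bounded_bilinear.zero_left[OF bounded_bilinear_matrix_mult] bounded_bilinear.zero_right[OF bounded_bilinear_matrix_mult]

lemma matrix_inv_mult:
  fixes A :: "complex^'n^'n"
  assumes "invertible A"
  shows "A ** matrix_inv A = mat 1" "matrix_inv A ** A = mat 1"
proof -
  have "A ** matrix_inv A = mat 1 \<and> matrix_inv A ** A = mat 1"
    unfolding matrix_inv_def using assms unfolding invertible_def by (rule someI_ex)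
  then show "A ** matrix_inv A = mat 1" "matrix_inv A ** A = mat 1" by auto
qed

lemma matrix_inv_unique:
  fixes A B :: "complex^'n^'n"
  assumes "A ** B = mat 1"
  shows "matrix_inv A = B"
proof -
  have "invertible A" using assms matrix_left_right_inverse unfolding invertible_def by blast
  then have "matrix_inv A = matrix_inv A ** (A ** B)" using assms by simp
  also have "\<dots> = B" using matrix_inv_mult(2)[OF \<open>invertible A\<close>] by (simp add: matrix_mul_assoc)
  finally show ?thesis .
qed

lemma group_GL: "group (GL :: 'n::finite cmat monoid)"
proof (rule groupI)
  fix x y z :: "'n cmat"
  assume x: "x \<in> carrier GL" and y: "y \<in> carrier GL"
  have "(x ** y) ** (matrix_inv y ** matrix_inv x) = x ** (y ** matrix_inv y) ** matrix_inv x"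
    by (simp only: matrix_mul_assoc)
  also have "\<dots> = mat 1" using x y by (simp add: GL_def matrix_inv_mult)
  finally show "x \<otimes>\<^bsub>GL\<^esub> y \<in> carrier GL" unfolding GL_def invertible_right_inverse by auto
  show "\<exists>y\<in>carrier GL. y \<otimes>\<^bsub>GL\<^esub> x = \<one>\<^bsub>GL\<^esub>"
    using x matrix_inv_mult[of x] by (intro bexI[of _ "matrix_inv x"]) (auto simp: GL_def invertible_def)
next
  have "mat 1 ** mat 1 = (mat 1 :: 'n cmat)" by simp
  then show "\<one>\<^bsub>GL\<^esub> \<in> carrier (GL :: 'n cmat monoid)" unfolding GL_def invertible_def by auto
qed (auto simp: GL_def matrix_mul_assoc)

lemma subgroup_GL:
  assumes "subgroup H GL"
  shows "mat 1 \<in> H" "g \<in> H \<Longrightarrow> invertible g" "g \<in> H \<Longrightarrow> h \<in> H \<Longrightarrow> g ** h \<in> H" "g \<in> H \<Longrightarrow> matrix_inv g \<in> H"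
    "g \<in> H \<Longrightarrow> g ** matrix_inv g = mat 1" "g \<in> H \<Longrightarrow> matrix_inv g ** g = mat 1"
proof -
  interpret group "GL :: 'a cmat monoid" by (rule group_GL)
  interpret subgroup H GL by fact
  show 1: "mat 1 \<in> H" using one_closed by (simp add: GL_def)
  show inv: "g \<in> H \<Longrightarrow> invertible g" using mem_carrier by (simp add: GL_def)
  show "g \<in> H \<Longrightarrow> h \<in> H \<Longrightarrow> g ** h \<in> H" using m_closed by (simp add: GL_def)
  show "g \<in> H \<Longrightarrow> g ** matrix_inv g = mat 1" "g \<in> H \<Longrightarrow> matrix_inv g ** g = mat 1"
    using inv matrix_inv_mult by auto
  show "matrix_inv g \<in> H" if g: "g \<in> H"
  proof -
    have "g ** inv\<^bsub>GL\<^esub> g = mat 1" using r_inv[OF mem_carrier[OF g]] by (simp add: GL_def)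
    then show ?thesis using matrix_inv_unique m_inv_closed[OF g] by metis
  qed
qed

lemma smooth_on_sin: "smooth_on UNIV (sin :: real \<Rightarrow> real)"
proof (rule smooth_onI_real_deriv[where P="\<lambda>f. \<exists>a b. f = (\<lambda>t. a * sin t + b * cos t)"])
  show "\<exists>a b. sin = (\<lambda>t::real. a * sin t + b * cos t)" by (rule exI[of _ 1], rule exI[of _ 0]) auto
  show "\<exists>g. (\<exists>a b. g = (\<lambda>t. a * sin t + b * cos t)) \<and> (\<forall>x\<in>UNIV. (f has_real_derivative g x) (at x))"
    if f: "\<exists>a b. f = (\<lambda>t. a * sin t + b * cos t)" for f :: "real \<Rightarrow> real"
  proof -
    obtain a b where f: "f = (\<lambda>t. a * sin t + b * cos t)" using f by blast
    have "(f has_real_derivative (- b) * sin x + a * cos x) (at x)" for x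
      unfolding f by (auto intro!: derivative_eq_intros)
    then show ?thesis by (intro exI[of _ "\<lambda>x. (- b) * sin x + a * cos x"]) blast
  qed
  show "\<exists>a b. (\<lambda>x. f x * v) = (\<lambda>t. a * sin t + b * cos t)" if f: "\<exists>a b. f = (\<lambda>t. a * sin t + b * cos t)" for f :: "real \<Rightarrow> real" and v
  proof -
    obtain a b where f: "f = (\<lambda>t. a * sin t + b * cos t)" using f by blast
    show ?thesis by (rule exI[of _ "a * v"], rule exI[of _ "b * v"]) (auto simp: f algebra_simps)
  qed
qed auto

text \<open>A linear projection onto the subspace leaves \<open>f\<close> unchanged near
  \<open>x\<close>, so by uniqueness of derivatives it leaves \<open>D\<close> unchanged as
  well.\<close>

lemma derivative_in_subspace:
  fixes f :: "'a::real_normed_vector \<Rightarrow> 'b::euclidean_space"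
  assumes S: "subspace S" and T: "open T" "x \<in> T" and f: "\<And>z. z \<in> T \<Longrightarrow> f z \<in> S" "(f has_derivative D) (at x)"
  shows "D v \<in> S"
proof -
  obtain P :: "'b \<Rightarrow> 'b" where P: "range P \<subseteq> S" "linear P" "\<And>v. v \<in> S \<Longrightarrow> P v = v"
    using linear_exists_left_inverse_on[of "\<lambda>x. x" S] S linear_ident by auto
  have "((\<lambda>z. P (f z)) has_derivative (\<lambda>v. P (D v))) (at x)"
    by (rule bounded_linear.has_derivative[OF _ f(2)]) (use P(2) linear_conv_bounded_linear in blast)
  then have "(f has_derivative (\<lambda>v. P (D v))) (at x)"
    by (rule has_derivative_transform_within_open[OF _ T]) (use P(3) f(1) in auto)
  then have "D = (\<lambda>v. P (D v))" using f(2) has_derivative_unique by blast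
  then have "D v = P (D v)" by (rule fun_cong)
  then show ?thesis using P(1) by (metis range_subsetD)
qed

lemma vector_derivative_in_subspace:
  fixes f :: "real \<Rightarrow> 'b::euclidean_space"
  assumes "subspace S" "\<And>t. f t \<in> S" "(f has_vector_derivative D) (at x)"
  shows "D \<in> S"
  using derivative_in_subspace[where f=f and T=UNIV and x=x and D="\<lambda>t. t *\<^sub>R D" and v=1, OF assms(1) open_UNIV UNIV_I assms(2)] assms(3)
  by (simp add: has_vector_derivative_def)

lemma has_vector_derivative_limit:
  "(f has_vector_derivative D) (at x) \<longleftrightarrow> ((\<lambda>h. (f (x + h) - f x) /\<^sub>R h) \<longlongrightarrow> D) (at 0)"
proof -
  have "(f has_vector_derivative D) (at x) \<longleftrightarrow> ((\<lambda>h. norm (f (x + h) - f x - h *\<^sub>R D) / norm h) \<longlongrightarrow> 0) (at 0)"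
    by (simp add: has_vector_derivative_def has_derivative_at bounded_linear_scaleR_left)
  also have "\<dots> \<longleftrightarrow> ((\<lambda>h. norm ((f (x + h) - f x) /\<^sub>R h - D)) \<longlongrightarrow> 0) (at 0)"
  proof (rule filterlim_cong[OF refl refl])
    have "norm (f (x + h) - f x - h *\<^sub>R D) / norm h = norm ((f (x + h) - f x) /\<^sub>R h - D)" if "h \<noteq> 0" for h
    proof -
      have "(f (x + h) - f x) /\<^sub>R h - D = (f (x + h) - f x - h *\<^sub>R D) /\<^sub>R h"
        using that by (simp add: scaleR_diff_right)
      then show ?thesis by (simp add: divide_inverse mult.commute)
    qed
    then show "\<forall>\<^sub>F h in at 0. norm (f (x + h) - f x - h *\<^sub>R D) / norm h = norm ((f (x + h) - f x) /\<^sub>R h - D)"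
      by (simp add: eventually_at_filter)
  qed
  also have "\<dots> \<longleftrightarrow> ((\<lambda>h. (f (x + h) - f x) /\<^sub>R h) \<longlongrightarrow> D) (at 0)"
    by (simp only: tendsto_norm_zero_iff Lim_null[symmetric])
  finally show ?thesis .
qed

locale matrix_group =
  fixes H :: "'n::finite cmat set"
  assumes H: "subgroup H GL"
begin

lemmas H_simps = subgroup_GL[OF H]

text \<open>The product of two curves through the identity has the sum of their velocities
  there.\<close>

lemma lie_algebra_add:
  assumes "A \<in> lie_algebra H" "B \<in> lie_algebra H"
  shows "A + B \<in> lie_algebra H"
proof -
  obtain c d where c: "curve_through_one H A c" and d: "curve_through_one H B d"
    using assms by (auto simp: lie_algebra_def)
  have "curve_through_one H (A + B) (\<lambda>t. c t ** d t)"
    unfolding curve_through_one_def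
  proof (intro conjI)
    show "range (\<lambda>t. c t ** d t) \<subseteq> H"
      using c d by (auto simp: curve_through_one_def image_subset_iff intro!: H_simps(3))
    show "smooth_on UNIV (\<lambda>t. c t ** d t)"
      by (rule smooth_on_bounded_bilinear[OF bounded_bilinear_matrix_mult]) (use c d in \<open>auto simp: curve_through_one_def\<close>)
    show "((\<lambda>t. c t ** d t) has_vector_derivative A + B) (at 0)"
      using bounded_bilinear.has_vector_derivative[OF bounded_bilinear_matrix_mult, of c A 0 UNIV d B] c d
      by (simp add: curve_through_one_def add.commute)
  qed (use c d in \<open>simp add: curve_through_one_def\<close>)
  then show ?thesis by (auto simp: lie_algebra_def)
qed

lemma lie_algebra_scaleR:
  assumes "A \<in> lie_algebra H"
  shows "r *\<^sub>R A \<in> lie_algebra H"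
proof -
  obtain c where c: "curve_through_one H A c"
    using assms by (auto simp: lie_algebra_def)
  have "curve_through_one H (r *\<^sub>R A) (\<lambda>t. c (r * t))"
    unfolding curve_through_one_def
  proof (intro conjI)
    show "range (\<lambda>t. c (r * t)) \<subseteq> H" using c by (auto simp: curve_through_one_def)
    show "smooth_on UNIV (\<lambda>t. c (r * t))"
      by (rule smooth_on_compose[of UNIV c UNIV "(*) r"])
        (use c smooth_on_bounded_linear_id[OF bounded_linear_mult_right] in \<open>auto simp: curve_through_one_def\<close>)
    have "((\<lambda>t. r * t) has_vector_derivative r) (at 0)" by (auto intro!: derivative_eq_intros)
    moreover have "(c has_vector_derivative A) (at (r * 0))" using c by (simp add: curve_through_one_def)
    ultimately show "((\<lambda>t. c (r * t)) has_vector_derivative r *\<^sub>R A) (at 0)"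
      using vector_diff_chain_at[of "\<lambda>t. r * t" r 0 c A] by (simp add: o_def)
  qed (use c in \<open>simp add: curve_through_one_def\<close>)
  then show ?thesis by (auto simp: lie_algebra_def)
qed

lemma subspace_lie_algebra: "subspace (lie_algebra H)"
proof (rule subspaceI)
  have "curve_through_one H 0 (\<lambda>_. mat 1)"
    using H_simps(1) smooth_on_const[OF open_UNIV] by (auto simp: curve_through_one_def)
  then show "0 \<in> lie_algebra H" by (auto simp: lie_algebra_def)
qed (auto intro: lie_algebra_add lie_algebra_scaleR)

lemma curve_conjugate:
  assumes "g \<in> H" "curve_through_one H A c"
  shows "curve_through_one H (g ** A ** matrix_inv g) (\<lambda>t. g ** c t ** matrix_inv g)"
  unfolding curve_through_one_def
proof (intro conjI)
  have bl: "bounded_linear (\<lambda>A. g ** A ** matrix_inv g)"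
    by (rule bounded_linear_compose[OF bounded_bilinear.bounded_linear_left[OF bounded_bilinear_matrix_mult]
          bounded_bilinear.bounded_linear_right[OF bounded_bilinear_matrix_mult]])
  show "range (\<lambda>t. g ** c t ** matrix_inv g) \<subseteq> H"
    using assms H_simps(3,4) by (auto simp: curve_through_one_def)
  show "smooth_on UNIV (\<lambda>t. g ** c t ** matrix_inv g)"
    by (rule smooth_on_bounded_linear[OF bl]) (use assms in \<open>auto simp: curve_through_one_def\<close>)
  show "((\<lambda>t. g ** c t ** matrix_inv g) has_vector_derivative g ** A ** matrix_inv g) (at 0)"
    by (rule bounded_linear.has_vector_derivative[OF bl]) (use assms in \<open>auto simp: curve_through_one_def\<close>)
qed (use assms H_simps in \<open>simp add: curve_through_one_def\<close>)

lemma lie_algebra_conjugate: "g \<in> H \<Longrightarrow> A \<in> lie_algebra H \<Longrightarrow> g ** A ** matrix_inv g \<in> lie_algebra H"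
  using curve_conjugate unfolding lie_algebra_def by blast

text \<open>The curve \<open>t \<mapsto> f x\<inverse> f (x + \<epsilon> sin (t/\<epsilon>) v)\<close> is defined for all times and has
  the same velocity at \<open>t = 0\<close> as the straight one.\<close>

lemma logarithmic_derivative_in_lie_algebra:
  fixes f :: "complex \<Rightarrow> 'n cmat"
  assumes S: "open S" "x \<in> S" and f: "smooth_on S f" "\<And>z. z \<in> S \<Longrightarrow> f z \<in> H"
  shows "matrix_inv (f x) ** frechet_derivative f (at x) v \<in> lie_algebra H"
proof -
  obtain r where r: "r > 0" "ball x r \<subseteq> S" using S openE by blast
  \<comment> \<open>This keeps the amplitude of the sine times \<open>norm v\<close> at most
    \<open>r / 2\<close>; the summand 1 guards against \<open>v = 0\<close>.\<close>
  define e where "e = r / (2 * (norm v + 1))"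
  have nv: "norm v + 1 > 0" by (simp add: add_nonneg_pos)
  have e: "e > 0" using r nv by (simp add: e_def)
  define p where "p t = x + (e * sin (t / e)) *\<^sub>R v" for t
  have pS: "p t \<in> S" for t
  proof -
    have "\<bar>e * sin (t / e)\<bar> * norm v \<le> e * 1 * (norm v + 1)"
      using e by (intro mult_mono) (auto simp: abs_mult)
    also have "\<dots> = r / 2"
    proof -
      have "r / (2 * a) * 1 * a = r / 2" if "a > 0" for a using that by (simp add: field_simps)
      from this[OF nv] show ?thesis unfolding e_def .
    qed
    also have "\<dots> < r" using r by simp
    finally show ?thesis using r(2) by (auto simp: p_def subset_iff dist_norm)
  qed
  have ps: "smooth_on UNIV p"
  proof -
    have "smooth_on UNIV (\<lambda>t. sin (t / e))"
      by (rule smooth_on_compose[OF smooth_on_sin, of UNIV "\<lambda>t. t / e"])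
        (auto intro: smooth_on_bounded_linear_id bounded_linear_divide)
    then have "smooth_on UNIV (\<lambda>t. (\<lambda>s. (e * s) *\<^sub>R v) (sin (t / e)))"
      by (intro smooth_on_bounded_linear[where L="\<lambda>s. (e * s) *\<^sub>R v"])
        (auto intro: bounded_linear_compose[OF bounded_linear_scaleR_left bounded_linear_mult_right])
    then show ?thesis unfolding p_def[abs_def]
      using smooth_on_add[OF smooth_on_const[OF open_UNIV, of x]] by auto
  qed
  have pd: "(p has_vector_derivative v) (at 0)"
    unfolding p_def[abs_def] using e by (auto intro!: derivative_eq_intros)
  have p0: "p 0 = x" by (simp add: p_def)
  have bl: "bounded_linear (\<lambda>A. matrix_inv (f x) ** A)"
    by (rule bounded_bilinear.bounded_linear_right[OF bounded_bilinear_matrix_mult])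
  have "curve_through_one H (matrix_inv (f x) ** frechet_derivative f (at x) v) (\<lambda>t. matrix_inv (f x) ** f (p t))"
    unfolding curve_through_one_def
  proof (intro conjI)
    show "range (\<lambda>t. matrix_inv (f x) ** f (p t)) \<subseteq> H"
      using f(2) pS S(2) H_simps(3,4) by auto
    show "smooth_on UNIV (\<lambda>t. matrix_inv (f x) ** f (p t))"
      by (rule smooth_on_bounded_linear[OF bl], rule smooth_on_compose[OF f(1) ps]) (use pS S in auto)
    show "matrix_inv (f x) ** f (p 0) = mat 1" using p0 f(2)[OF S(2)] H_simps by simp
    have "((\<lambda>t. f (p t)) has_vector_derivative frechet_derivative f (at x) v) (at 0)"
    proof -
      have "(f has_derivative frechet_derivative f (at x)) (at (p 0) within range p)"
        unfolding p0 by (rule has_derivative_at_withinI[OF smooth_on_has_derivative[OF f(1) S(2)]])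
      from vector_derivative_diff_chain_within[OF pd this] show ?thesis by (simp add: o_def)
    qed
    then show "((\<lambda>t. matrix_inv (f x) ** f (p t)) has_vector_derivative matrix_inv (f x) ** frechet_derivative f (at x) v) (at 0)"
      by (rule bounded_linear.has_vector_derivative[OF bl])
  qed
  then show ?thesis by (auto simp: lie_algebra_def)
qed

end

locale compact_matrix_group = matrix_group H for H :: "'n::finite cmat set" +
  assumes compact: "compact H"
begin

text \<open>The inverses stay in the compact group and are therefore uniformly bounded. The identity
  \<open>inv1\<close> then yields first continuity of the inverse at 0 and then its
  derivative.\<close>

lemma inverse_has_derivative:
  assumes c: "\<And>t. c t \<in> H" "c 0 = mat 1" "(c has_vector_derivative A) (at (0::real))"
  shows "((\<lambda>t. matrix_inv (c t)) has_vector_derivative - A) (at 0)"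
proof -
  obtain B where B: "\<And>g. g \<in> H \<Longrightarrow> norm g \<le> B"
    using compact_imp_bounded[OF compact] by (auto simp: bounded_iff)
  obtain k where k: "k > 0" "\<And>(a :: 'n cmat) (b :: 'n cmat). norm (a ** b) \<le> norm a * norm b * k"
    using bounded_bilinear.pos_bounded[OF bounded_bilinear_matrix_mult] by metis
  have inv1: "matrix_inv (c t) - mat 1 = - (matrix_inv (c t) ** (c t - mat 1))" for t
    using H_simps(6)[OF c(1)] by (simp add: matrix_mult_simps)
  have lim_c: "(c \<longlongrightarrow> mat 1) (at 0)"
    using has_vector_derivative_continuous[OF c(3)] c(2) by (simp add: continuous_within)
  have lim_i: "((\<lambda>t. matrix_inv (c t)) \<longlongrightarrow> mat 1) (at 0)"
  proof -
    have "((\<lambda>t. matrix_inv (c t) - mat 1) \<longlongrightarrow> 0) (at 0)"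
    proof (rule Lim_null_comparison[where g="\<lambda>t. B * norm (c t - mat 1) * k"])
      have "norm (matrix_inv (c t) - mat 1) \<le> B * norm (c t - mat 1) * k" for t
      proof -
        have "norm (matrix_inv (c t) - mat 1) \<le> norm (matrix_inv (c t)) * norm (c t - mat 1) * k"
          unfolding inv1[of t] norm_minus_cancel by (rule k(2))
        also have "\<dots> \<le> B * norm (c t - mat 1) * k"
          using B[OF H_simps(4)[OF c(1)]] k(1) by (intro mult_right_mono) auto
        finally show ?thesis .
      qed
      then show "\<forall>\<^sub>F t in at 0. norm (matrix_inv (c t) - mat 1) \<le> B * norm (c t - mat 1) * k" by simp
      have "((\<lambda>t. B * norm (c t - mat 1) * k) \<longlongrightarrow> B * norm (mat 1 - mat 1 :: 'n cmat) * k) (at 0)"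
        by (intro tendsto_intros lim_c)
      then show "((\<lambda>t. B * norm (c t - mat 1) * k) \<longlongrightarrow> 0) (at 0)" by simp
    qed
    then show ?thesis using Lim_null by blast
  qed
  have "((\<lambda>t. (c t - mat 1) /\<^sub>R t) \<longlongrightarrow> A) (at 0)"
    using c(2,3) by (simp add: has_vector_derivative_limit)
  then have "((\<lambda>t. - (matrix_inv (c t) ** ((c t - mat 1) /\<^sub>R t))) \<longlongrightarrow> - (mat 1 ** A)) (at 0)"
    by (intro tendsto_minus bounded_bilinear.tendsto[OF bounded_bilinear_matrix_mult] lim_i)
  moreover have "- (matrix_inv (c t) ** ((c t - mat 1) /\<^sub>R t)) = (matrix_inv (c t) - mat 1) /\<^sub>R t" for t
    unfolding inv1[of t]
    by (simp only: bounded_bilinear.scaleR_right[OF bounded_bilinear_matrix_mult] scaleR_minus_right)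
  ultimately have "((\<lambda>t. (matrix_inv (c t) - mat 1) /\<^sub>R t) \<longlongrightarrow> - A) (at 0)" by simp
  moreover have "matrix_inv (c 0) = mat 1" unfolding c(2) by (rule matrix_inv_unique) simp
  ultimately show ?thesis by (simp add: has_vector_derivative_limit)
qed

lemma conjugate_has_derivative:
  assumes c: "\<And>t. c t \<in> H" "c 0 = mat 1" "(c has_vector_derivative A) (at (0::real))"
  shows "((\<lambda>t. c t ** B ** matrix_inv (c t)) has_vector_derivative bracket A B) (at 0)"
proof -
  have "matrix_inv (mat 1) = (mat 1 :: 'n cmat)" by (rule matrix_inv_unique) simp
  moreover have "((\<lambda>t. c t ** B) has_vector_derivative A ** B) (at 0)"
    by (rule bounded_linear.has_vector_derivative[OF bounded_bilinear.bounded_linear_left[OF bounded_bilinear_matrix_mult] c(3)])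
  ultimately show ?thesis
    using bounded_bilinear.has_vector_derivative[OF bounded_bilinear_matrix_mult _ inverse_has_derivative[OF c]]
    by (fastforce simp: c(2) bracket_def matrix_mult_simps)
qed

text \<open>The bracket is the velocity at 0 of a conjugated vector, and the conjugated vector stays
  in the linear subspace \<open>lie_algebra H\<close> for all times.\<close>

lemma lie_algebra_bracket:
  assumes "A \<in> lie_algebra H" "B \<in> lie_algebra H"
  shows "bracket A B \<in> lie_algebra H"
proof -
  obtain c where "curve_through_one H A c" using assms by (auto simp: lie_algebra_def)
  then have c: "\<And>t. c t \<in> H" "c 0 = mat 1" "(c has_vector_derivative A) (at 0)"
    by (auto simp: curve_through_one_def)
  show ?thesis
    by (rule vector_derivative_in_subspace[OF subspace_lie_algebra lie_algebra_conjugate[OF c(1) assms(2)] conjugate_has_derivative[OF c]])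
qed

end

section \<open>The trace form on directions tangent to a compact matrix group\<close>

definition adj :: "complex^'n^'m \<Rightarrow> complex^'m^'n" where
  "adj A = (\<chi> i j. cnj (A $ j $ i))"

lemma adj_adj [simp]: "adj (adj A) = A"
  by (simp add: adj_def vec_eq_iff)

lemma adj_mult: "adj (A ** B) = adj B ** adj A"
  by (simp add: adj_def vec_eq_iff matrix_matrix_mult_def mult.commute)

lemma bounded_linear_adj: "bounded_linear (adj :: complex^'n^'m \<Rightarrow> complex^'m^'n)"
  by (intro linear_conv_bounded_linear[THEN iffD1] linearI) (auto simp: adj_def vec_eq_iff)

lemma bounded_linear_trace: "bounded_linear (trace :: complex^'n^'n \<Rightarrow> complex)"
  by (intro linear_conv_bounded_linear[THEN iffD1] linearI) (auto simp: trace_def sum.distrib scaleR_sum_right)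

lemma power2_norm_vec: "(norm (x :: 'a::real_normed_vector^'n))\<^sup>2 = (\<Sum>i\<in>UNIV. (norm (x $ i))\<^sup>2)"
  by (simp add: norm_vec_def L2_set_def sum_nonneg)

lemma trace_mult_adj: "Re (trace (A ** adj A)) = (norm (A :: complex^'n^'m))\<^sup>2"
  by (simp add: trace_def matrix_matrix_mult_def adj_def power2_norm_vec complex_norm_square[symmetric] flip: of_real_power)

lemma norm_adj: "norm (adj (A :: complex^'n^'m)) = norm A"
proof -
  have "(norm (adj A))\<^sup>2 = (norm A)\<^sup>2"
    unfolding power2_norm_vec by (simp add: adj_def, rule sum.swap)
  then show ?thesis by simp
qed

text \<open>Powers are formed with \<open>**\<close>, since the multiplication \<open>*\<close> of
  this type is componentwise.\<close>

primrec mpow :: "'n::finite cmat \<Rightarrow> nat \<Rightarrow> 'n cmat" where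
  "mpow g 0 = mat 1"
| "mpow g (Suc k) = mpow g k ** g"

lemma (in matrix_group) mpow_closed: "g \<in> H \<Longrightarrow> mpow g k \<in> H"
  by (induction k) (auto simp: H_simps)

context compact_matrix_group
begin

text \<open>Averaging \<open>h\<^sup>* h\<close> over the powers of \<open>g n\<close> gives, in the limit, a positive definite \<open>P\<close>
  with \<open>B\<^sup>* P + P B = 0\<close>.\<close>

lemma invariant_form:
  assumes g: "\<And>n. g n \<in> H" and B: "(\<lambda>n. real n *\<^sub>R (g n - mat 1)) \<longlonglongrightarrow> B"
  shows "\<exists>P. adj B ** P + P ** B = 0 \<and> adj P = P \<and>
    (\<forall>\<phi> b. bounded_linear \<phi> \<longrightarrow> (\<forall>h\<in>H. \<phi> (adj h ** h) \<ge> b) \<longrightarrow> \<phi> P \<ge> (b :: real))"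
proof -
  define F where "F h = adj h ** h" for h :: "'n cmat"
  obtain k where k: "k > 0" "\<And>(a :: 'n cmat) (b :: 'n cmat). norm (a ** b) \<le> norm a * norm b * k"
    using bounded_bilinear.pos_bounded[OF bounded_bilinear_matrix_mult] by metis
  obtain C where C: "\<And>h. h \<in> H \<Longrightarrow> norm h \<le> C"
    using compact_imp_bounded[OF compact] by (auto simp: bounded_iff)
  define M where "M = C * C * k"
  have FM: "norm (F h) \<le> M" if "h \<in> H" for h
  proof -
    have "norm (F h) \<le> norm h * norm h * k" unfolding F_def using k(2)[of "adj h" h] by (simp add: norm_adj)
    also have "\<dots> \<le> M" unfolding M_def
      using C[OF that] k(1) norm_ge_zero[of h] order_trans[OF norm_ge_zero[of h] C[OF that]]
      by (intro mult_right_mono mult_mono) auto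
    finally show ?thesis .
  qed
  \<comment> \<open>Telescoping bounds the invariance defect of the average by
    \<open>2 * M / N n\<close>. Below it is multiplied by \<open>n\<close>, so the number of
    averaged powers has to grow faster than \<open>n\<close>.\<close>
  define N where "N n = (Suc n)\<^sup>2" for n
  have N: "real (N n) > 0" for n by (simp add: N_def)
  define A where "A n = (1 / real (N n)) *\<^sub>R (\<Sum>k<N n. F (mpow (g n) k))" for n
  have pH: "mpow (g n) k \<in> H" for n k by (rule mpow_closed[OF g])
  have bdd: "norm (A n) \<le> M" for n
  proof -
    have "norm (\<Sum>k<N n. F (mpow (g n) k)) \<le> (\<Sum>k<N n. M)"
      by (rule sum_norm_le) (use FM pH in auto)
    then have "norm (\<Sum>k<N n. F (mpow (g n) k)) \<le> real (N n) * M" by simp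
    then show ?thesis using N[of n] by (simp add: A_def divide_le_eq mult.commute)
  qed
  then have "bounded (range A)" by (auto simp: bounded_iff)
  then obtain P r where r: "strict_mono r" "(A \<circ> r) \<longlonglongrightarrow> P"
    using bounded_imp_convergent_subsequence by blast
  \<comment> \<open>A linear lower bound valid for every \<open>adj h ** h\<close> survives
    averaging and the limit; this is the form in which the definiteness of \<open>P\<close> is
    exported.\<close>
  have half: "\<phi> P \<ge> b" if \<phi>: "bounded_linear \<phi>" "\<And>h. h \<in> H \<Longrightarrow> \<phi> (F h) \<ge> b" for \<phi> :: "'n cmat \<Rightarrow> real" and b
  proof -
    have "\<phi> (A n) \<ge> b" for n
    proof -
      have "\<phi> (A n) = (1 / real (N n)) * (\<Sum>k<N n. \<phi> (F (mpow (g n) k)))"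
        unfolding A_def by (simp add: linear_simps(5)[OF \<phi>(1)] linear_sum[OF bounded_linear.linear[OF \<phi>(1)]])
      moreover have "(\<Sum>k<N n. \<phi> (F (mpow (g n) k))) \<ge> (\<Sum>k<N n. b)"
        by (rule sum_mono) (use \<phi>(2) pH in auto)
      ultimately show ?thesis using N[of n] by (simp add: le_divide_eq mult.commute)
    qed
    moreover have "(\<lambda>n. \<phi> ((A \<circ> r) n)) \<longlonglongrightarrow> \<phi> P" by (rule bounded_linear.tendsto[OF \<phi>(1) r(2)])
    ultimately show ?thesis by (intro LIMSEQ_le_const[of "\<lambda>n. \<phi> ((A \<circ> r) n)"]) auto
  qed
  have sa: "adj P = P"
  proof -
    have F: "adj (F h) = F h" for h by (simp add: F_def adj_mult)
    have "adj (A n) = A n" for n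
      unfolding A_def by (simp add: linear_simps(5)[OF bounded_linear_adj] linear_sum[OF bounded_linear.linear[OF bounded_linear_adj]] F)
    then have "(A \<circ> r) \<longlonglongrightarrow> adj P"
      using bounded_linear.tendsto[OF bounded_linear_adj r(2)] by (simp add: o_def)
    then show ?thesis using r(2) LIMSEQ_unique by blast
  qed
  define E where "E n = g n - mat 1" for n
  define Z where "Z n = real n *\<^sub>R E n" for n
  have Z: "Z \<longlonglongrightarrow> B" using B by (simp add: Z_def[abs_def] E_def)
  have E0: "E \<longlonglongrightarrow> 0"
  proof -
    have "(\<lambda>n. (1 / real n) *\<^sub>R Z n) \<longlonglongrightarrow> 0 *\<^sub>R B" by (intro tendsto_intros lim_1_over_n Z)
    moreover have "\<forall>\<^sub>F n in sequentially. (1 / real n) *\<^sub>R Z n = E n"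
      using eventually_gt_at_top[of 0] by eventually_elim (simp add: Z_def)
    ultimately show ?thesis using tendsto_cong by force
  qed
  \<comment> \<open>The map \<open>?L\<close> raises each power of \<open>g n\<close> by one, so
    that only the two ends of the sum survive.\<close>
  have inv: "adj (g n) ** A n ** g n - A n = (1 / real (N n)) *\<^sub>R (F (mpow (g n) (N n)) - F (mat 1))" for n
  proof -
    let ?L = "\<lambda>Y. adj (g n) ** Y ** g n"
    have bl: "bounded_linear ?L"
      by (rule bounded_linear_compose[OF bounded_bilinear.bounded_linear_left[OF bounded_bilinear_matrix_mult]
          bounded_bilinear.bounded_linear_right[OF bounded_bilinear_matrix_mult]])
    have "?L (F (mpow (g n) k)) = F (mpow (g n) (Suc k))" for k
      by (simp add: F_def adj_mult matrix_mul_assoc)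
    then have "?L (A n) = (1 / real (N n)) *\<^sub>R (\<Sum>k<N n. F (mpow (g n) (Suc k)))"
      unfolding A_def by (simp only: linear_simps(5)[OF bl] linear_sum[OF bounded_linear.linear[OF bl]])
    then have "?L (A n) - A n = (1 / real (N n)) *\<^sub>R (\<Sum>k<N n. F (mpow (g n) (Suc k)) - F (mpow (g n) k))"
      by (simp only: A_def sum_subtractf scaleR_diff_right)
    also have "(\<Sum>k<N n. F (mpow (g n) (Suc k)) - F (mpow (g n) k)) = F (mpow (g n) (N n)) - F (mat 1)"
      by (subst sum_lessThan_telescope) simp
    finally show ?thesis .
  qed
  \<comment> \<open>This is \<open>n\<close> times the invariance defect, expanded in
    \<open>E n\<close>. In the limit along the subsequence the last term dies because
    \<open>E n\<close> tends to 0, and the first two give the condition on \<open>B\<close>.\<close>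
  let ?w = "\<lambda>n. adj (Z n) ** A n + A n ** Z n + adj (E n) ** A n ** Z n"
  have w: "norm (?w n) \<le> (1 / real (Suc n)) * (2 * M)" for n
  proof -
    have "adj (g n) = mat 1 + adj (E n)"
    proof -
      have "adj (mat 1 + E n) = mat 1 + adj (E n)"
        by (simp add: adj_def mat_def vec_eq_iff)
      then show ?thesis by (simp add: E_def)
    qed
    moreover have "g n = mat 1 + E n" by (simp add: E_def)
    ultimately have "adj (g n) ** A n ** g n - A n = adj (E n) ** A n + A n ** E n + adj (E n) ** A n ** E n"
      by (simp add: matrix_mult_simps)
    then have "?w n = real n *\<^sub>R (adj (g n) ** A n ** g n - A n)"
      by (simp add: Z_def linear_simps(5)[OF bounded_linear_adj] matrix_mult_simps scaleR_add_right)
    also have "\<dots> = (real n / real (N n)) *\<^sub>R (F (mpow (g n) (N n)) - F (mat 1))"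
      unfolding inv by simp
    also have "norm \<dots> = (real n / real (N n)) * norm (F (mpow (g n) (N n)) - F (mat 1))" by simp
    also have "\<dots> \<le> (1 / real (Suc n)) * (2 * M)"
    proof (rule mult_mono)
      show "real n / real (N n) \<le> 1 / real (Suc n)"
      proof -
        have "real n / real (N n) \<le> real (Suc n) / real (N n)" by (rule divide_right_mono) auto
        also have "\<dots> = 1 / real (Suc n)"
          unfolding N_def power2_eq_square of_nat_mult by (rule nonzero_divide_mult_cancel_left) simp
        finally show ?thesis .
      qed
      show "norm (F (mpow (g n) (N n)) - F (mat 1)) \<le> 2 * M"
        using norm_triangle_ineq4[of "F (mpow (g n) (N n))" "F (mat 1)"] FM[OF pH[of n "N n"]] FM[OF H_simps(1)] by linarith
    qed auto
    finally show ?thesis .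
  qed
  have "?w \<longlonglongrightarrow> 0"
  proof (rule Lim_null_comparison[where g="\<lambda>n. (1 / real (Suc n)) * (2 * M)"])
    have "(\<lambda>n. 1 / real (Suc n)) \<longlonglongrightarrow> 0" using LIMSEQ_inverse_real_of_nat by (simp add: inverse_eq_divide)
    from tendsto_mult_left_zero[OF this, of "2 * M"] show "(\<lambda>n. (1 / real (Suc n)) * (2 * M)) \<longlonglongrightarrow> 0" .
  qed (use w in auto)
  then have "(?w \<circ> r) \<longlonglongrightarrow> 0" by (rule LIMSEQ_subseq_LIMSEQ[OF _ r(1)])
  moreover have "(?w \<circ> r) \<longlonglongrightarrow> adj B ** P + P ** B + adj 0 ** P ** B"
  proof -
    have s: "(\<lambda>n. A (r n)) \<longlonglongrightarrow> P" using r(2) by (simp add: o_def)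
    have Zr: "(\<lambda>n. Z (r n)) \<longlonglongrightarrow> B" and Er: "(\<lambda>n. E (r n)) \<longlonglongrightarrow> 0"
      using LIMSEQ_subseq_LIMSEQ[OF Z r(1)] LIMSEQ_subseq_LIMSEQ[OF E0 r(1)] by (simp_all add: o_def)
    show ?thesis unfolding o_def
      by (intro tendsto_add bounded_bilinear.tendsto[OF bounded_bilinear_matrix_mult] bounded_linear.tendsto[OF bounded_linear_adj] s Zr Er)
  qed
  ultimately have "adj B ** P + P ** B + adj 0 ** P ** B = 0" using LIMSEQ_unique by blast
  then have "adj B ** P + P ** B = 0" by (simp add: linear_simps(3)[OF bounded_linear_adj] matrix_mult_simps)
  then show ?thesis using sa half unfolding F_def by (intro exI[of _ P] conjI allI impI) auto
qed

text \<open>\<open>B\<close> is skew for the Hermitian form \<open>P\<close> of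
  \<open>invariant_form\<close>. With \<open>Q\<close> inverse to \<open>P\<close> this gives
  \<open>- (B ** B) = B ** Q ** adj B ** P\<close>, whose trace is bounded below by a positive
  multiple of \<open>(norm B)\<^sup>2\<close>. Positivity is drawn from the linear lower bounds that
  \<open>P\<close> inherits from \<open>adj h ** h\<close>.\<close>

lemma trace_square_negative:
  assumes g: "\<And>n. g n \<in> H" and B: "(\<lambda>n. real n *\<^sub>R (g n - mat 1)) \<longlonglongrightarrow> B" and "B \<noteq> 0"
  shows "Re (trace (B ** B)) < 0"
proof -
  obtain P where P: "adj B ** P + P ** B = 0" "adj P = P"
    and half': "\<forall>\<phi> b. bounded_linear \<phi> \<longrightarrow> (\<forall>h\<in>H. \<phi> (adj h ** h) \<ge> b) \<longrightarrow> \<phi> P \<ge> (b :: real)"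
    using invariant_form[OF g B] by blast
  have half: "\<phi> P \<ge> b" if "bounded_linear \<phi>" "\<And>h. h \<in> H \<Longrightarrow> \<phi> (adj h ** h) \<ge> b" for \<phi> :: "'n cmat \<Rightarrow> real" and b
    using half' that by blast
  obtain k where k: "k > 0" "\<And>(a :: 'n cmat) (b :: 'n cmat). norm (a ** b) \<le> norm a * norm b * k"
    using bounded_bilinear.pos_bounded[OF bounded_bilinear_matrix_mult] by metis
  obtain C' where "\<And>h. h \<in> H \<Longrightarrow> norm h \<le> C'"
    using compact_imp_bounded[OF compact] by (auto simp: bounded_iff)
  then obtain C where C: "C > 0" "\<And>h. h \<in> H \<Longrightarrow> norm h \<le> C"
    by (metis less_le_trans max.cobounded1 max.cobounded2 order_trans zero_less_one)
  have lower: "norm Y \<le> norm (Y ** h) * (C * k)" if "h \<in> H" for Y h :: "'n cmat"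
  proof -
    have "norm Y = norm ((Y ** h) ** matrix_inv h)"
      using H_simps(5)[OF that] by (simp add: matrix_mul_assoc[symmetric])
    also have "\<dots> \<le> norm (Y ** h) * norm (matrix_inv h) * k" by (rule k(2))
    also have "\<dots> \<le> norm (Y ** h) * C * k"
      using C(2)[OF H_simps(4)[OF that]] k(1) by (intro mult_right_mono mult_left_mono) auto
    finally show ?thesis by (simp add: mult.assoc)
  qed
  have lower': "norm Y \<le> norm (h ** Y) * (C * k)" if "h \<in> H" for Y h :: "'n cmat"
  proof -
    have "norm Y = norm (matrix_inv h ** (h ** Y))"
      using H_simps(6)[OF that] by (simp add: matrix_mul_assoc)
    also have "\<dots> \<le> norm (matrix_inv h) * norm (h ** Y) * k" by (rule k(2))
    also have "\<dots> \<le> C * norm (h ** Y) * k"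
      using C(2)[OF H_simps(4)[OF that]] k(1) by (intro mult_right_mono) auto
    finally show ?thesis by (simp add: mult.assoc mult.left_commute)
  qed
  \<comment> \<open>The inverse of \<open>h\<close> has norm at most \<open>C\<close>, so
    multiplying by \<open>h\<close> on either side shrinks norms by at most the factor
    \<open>C * k\<close>; \<delta> is the resulting constant for squared norms.\<close>
  define \<delta> where "\<delta> = 1 / (C * k)\<^sup>2"
  have \<delta>: "\<delta> > 0" using C k by (simp add: \<delta>_def)
  have sq: "\<delta> * a\<^sup>2 \<le> b\<^sup>2" if "a \<le> b * (C * k)" "0 \<le> a" for a b :: real
  proof -
    have "a\<^sup>2 \<le> (b * (C * k))\<^sup>2" using that by (intro power_mono)
    then show ?thesis using C k by (simp add: \<delta>_def power_mult_distrib divide_le_eq)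
  qed
  have bl: "bounded_linear (\<lambda>Z. Re (trace (Y1 ** Z ** Y2)))" for Y1 Y2 :: "'n cmat"
    by (intro bounded_linear_compose[OF bounded_linear_Re] bounded_linear_compose[OF bounded_linear_trace]
        bounded_linear_compose[OF bounded_bilinear.bounded_linear_left[OF bounded_bilinear_matrix_mult]
          bounded_bilinear.bounded_linear_right[OF bounded_bilinear_matrix_mult]])
  have pos: "Re (trace (Y ** P ** adj Y)) \<ge> \<delta> * (norm Y)\<^sup>2" for Y :: "'n cmat"
  proof (rule half[OF bl])
    fix h assume h: "h \<in> H"
    have "norm (adj Y) \<le> norm (h ** adj Y) * (C * k)" by (rule lower'[OF h])
    moreover have "norm (h ** adj Y) = norm (Y ** adj h)"
      using norm_adj[of "h ** adj Y"] by (simp add: adj_mult)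
    ultimately have "\<delta> * (norm Y)\<^sup>2 \<le> (norm (Y ** adj h))\<^sup>2"
      by (intro sq) (simp_all add: norm_adj)
    moreover have "Y ** (adj h ** h) ** adj Y = (Y ** adj h) ** adj (Y ** adj h)"
      by (simp add: adj_mult matrix_mul_assoc)
    ultimately show "\<delta> * (norm Y)\<^sup>2 \<le> Re (trace (Y ** (adj h ** h) ** adj Y))"
      by (simp add: trace_mult_adj)
  qed
  \<comment> \<open>A nonzero null vector of \<open>P\<close>, repeated in all columns of
    \<open>Z\<close>, would violate the lower bound \<open>pos\<close>.\<close>
  have "\<exists>Q. Q ** P = mat 1"
    unfolding matrix_left_invertible_ker
  proof (intro allI impI)
    fix x :: "complex^'n" assume x: "P *v x = 0"
    define Z :: "'n cmat" where "Z = (\<chi> i j. x $ i)"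
    have "P ** Z = 0" using x by (simp add: Z_def vec_eq_iff matrix_matrix_mult_def matrix_vector_mult_def)
    then have "adj Z ** P ** adj (adj Z) = 0" by (simp add: matrix_mul_assoc[symmetric] matrix_mult_simps)
    then have "\<delta> * (norm (adj Z))\<^sup>2 \<le> 0" using pos[of "adj Z"] by (simp add: trace_def)
    then have "Z = 0" using \<delta> by (simp add: norm_adj mult_le_0_iff)
    then show "x = 0" by (simp add: Z_def vec_eq_iff)
  qed
  then obtain Q where Q: "Q ** P = mat 1" by blast
  then have Q': "P ** Q = mat 1" by (simp add: matrix_left_right_inverse)
  \<comment> \<open>Writing \<open>M = Y ** P\<close> turns \<open>pos\<close> for \<open>Y\<close>
    into a bound for \<open>Q\<close> and \<open>M\<close>; \<epsilon> is \<delta> divided by the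
    square of a bound for right multiplication by \<open>P\<close>.\<close>
  define \<epsilon> where "\<epsilon> = \<delta> / ((norm P + 1) * k)\<^sup>2"
  have nP: "norm P + 1 > 0" by (simp add: add_nonneg_pos)
  have \<epsilon>: "\<epsilon> > 0" unfolding \<epsilon>_def using \<delta> k nP by (intro divide_pos_pos zero_less_power mult_pos_pos)
  have pos': "Re (trace (M ** Q ** adj M)) \<ge> \<epsilon> * (norm M)\<^sup>2" for M :: "'n cmat"
  proof -
    define Y where "Y = M ** Q"
    have M: "M = Y ** P" using Q by (simp add: Y_def matrix_mul_assoc[symmetric])
    have "norm M \<le> norm Y * norm P * k" unfolding M by (rule k(2))
    also have "\<dots> \<le> norm Y * (norm P + 1) * k"
      using k(1) by (intro mult_right_mono mult_left_mono) auto
    finally have "(norm M)\<^sup>2 \<le> (norm Y * ((norm P + 1) * k))\<^sup>2" by (intro power_mono) (simp_all add: mult.assoc)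
    then have "\<epsilon> * (norm M)\<^sup>2 \<le> \<epsilon> * (norm Y * ((norm P + 1) * k))\<^sup>2"
      using \<epsilon> by (intro mult_left_mono) auto
    also have "\<dots> = \<delta> * (norm Y)\<^sup>2"
    proof -
      have "\<delta> / s\<^sup>2 * (y * s)\<^sup>2 = \<delta> * y\<^sup>2" if "s > 0" for s y :: real
        using that by (simp add: power_mult_distrib)
      from this[OF mult_pos_pos[OF nP k(1)]] show ?thesis unfolding \<epsilon>_def .
    qed
    finally have "\<epsilon> * (norm M)\<^sup>2 \<le> \<delta> * (norm Y)\<^sup>2" .
    also have "\<dots> \<le> Re (trace (Y ** P ** adj Y))" by (rule pos)
    also have "Y ** P ** adj Y = M ** Q ** adj M"
    proof -
      have "adj M = P ** adj Y" by (simp add: M adj_mult P(2))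
      then have "M ** Q ** adj M = Y ** (P ** Q) ** P ** adj Y" by (simp add: M matrix_mul_assoc)
      then show ?thesis using Q' by simp
    qed
    finally show ?thesis .
  qed
  \<comment> \<open>By cyclicity of the trace this functional is bounded below on every
    \<open>adj h ** h\<close>, and hence also at \<open>P\<close>.\<close>
  have "Re (trace ((B ** Q ** adj B) ** P ** mat 1)) \<ge> \<epsilon> * (\<delta> * (norm B)\<^sup>2)"
  proof (rule half[OF bl])
    fix h assume h: "h \<in> H"
    have "\<delta> * (norm B)\<^sup>2 \<le> (norm (h ** B))\<^sup>2" by (rule sq[OF lower'[OF h]]) simp
    then have "\<epsilon> * (\<delta> * (norm B)\<^sup>2) \<le> \<epsilon> * (norm (h ** B))\<^sup>2" using \<epsilon> by simp
    also have "\<dots> \<le> Re (trace ((h ** B) ** Q ** adj (h ** B)))" by (rule pos')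
    also have "(h ** B) ** Q ** adj (h ** B) = h ** (B ** Q ** adj B ** adj h)" by (simp add: adj_mult matrix_mul_assoc)
    also have "trace \<dots> = trace ((B ** Q ** adj B ** adj h) ** h)" by (rule trace_mul_sym)
    also have "(B ** Q ** adj B ** adj h) ** h = (B ** Q ** adj B) ** (adj h ** h) ** mat 1" by (simp add: matrix_mul_assoc)
    finally show "\<epsilon> * (\<delta> * (norm B)\<^sup>2) \<le> Re (trace ((B ** Q ** adj B) ** (adj h ** h) ** mat 1))" .
  qed
  moreover have "(B ** Q ** adj B) ** P ** mat 1 = - (B ** B)"
  proof -
    have "adj B ** P = - (P ** B)" using P(1) by (simp add: eq_neg_iff_add_eq_0)
    then have "(B ** Q ** adj B) ** P = - (B ** (Q ** P) ** B)"
      by (simp add: matrix_mul_assoc[symmetric] matrix_mult_simps)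
    then show ?thesis using Q by simp
  qed
  moreover have "trace (- (B ** B)) = - trace (B ** B)" by (rule linear_simps(4)[OF bounded_linear_trace])
  moreover have "\<epsilon> * (\<delta> * (norm B)\<^sup>2) > 0" using \<epsilon> \<delta> \<open>B \<noteq> 0\<close> by simp
  ultimately show ?thesis by simp
qed

end

section \<open>Regular functions and the differential of a representation\<close>

lemma polynomial_funs_sum:
  "finite I \<Longrightarrow> (\<And>i. i \<in> I \<Longrightarrow> p i \<in> polynomial_funs) \<Longrightarrow> (\<lambda>A. \<Sum>i\<in>I. p i A) \<in> polynomial_funs"
  by (induction I rule: finite_induct) (auto intro: polynomial_funs.intros)

lemma polynomial_funs_prod:
  "finite I \<Longrightarrow> (\<And>i. i \<in> I \<Longrightarrow> p i \<in> polynomial_funs) \<Longrightarrow> (\<lambda>A. \<Prod>i\<in>I. p i A) \<in> polynomial_funs"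
  by (induction I rule: finite_induct) (auto intro: polynomial_funs.intros)

lemma det_polynomial: "(det :: 'n::finite cmat \<Rightarrow> complex) \<in> polynomial_funs"
proof -
  have "(\<lambda>A :: 'n cmat. \<Sum>p\<in>{p. p permutes UNIV}. of_int (sign p) * (\<Prod>i\<in>UNIV. A $ i $ p i)) \<in> polynomial_funs"
    by (intro polynomial_funs_sum polynomial_funs.mult polynomial_funs.const polynomial_funs_prod polynomial_funs.entry) auto
  then show ?thesis by (simp add: det_def[abs_def])
qed

lemma polynomial_funs_differentiable: "p \<in> polynomial_funs \<Longrightarrow> p differentiable (at A)"
proof (induction rule: polynomial_funs.induct)
  case (entry i j)
  have "bounded_linear (\<lambda>A :: 'a cmat. A $ i $ j)"
    by (rule bounded_linear_compose[OF bounded_linear_vec_nth bounded_linear_vec_nth])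
  then show ?case by (rule bounded_linear_imp_differentiable)
qed auto

lemma differentiable_vec_lambda:
  fixes f :: "'a::real_normed_vector \<Rightarrow> 'n::finite \<Rightarrow> 'b::euclidean_space"
  assumes "\<And>i. (\<lambda>x. f x i) differentiable (at a)"
  shows "(\<lambda>x. \<chi> i. f x i) differentiable (at a)"
proof -
  obtain D where D: "\<And>i. ((\<lambda>x. f x i) has_derivative D i) (at a)"
    using assms unfolding differentiable_def by metis
  have "((\<lambda>x. \<chi> i. f x i) has_derivative (\<lambda>v. \<chi> i. D i v)) (at a)"
    by (subst has_derivative_componentwise_within)
      (auto simp: Basis_vec_def inner_axis intro!: has_derivative_inner_left D)
  then show ?thesis unfolding differentiable_def by blast
qed

lemma bounded_bilinear_cscale: "bounded_bilinear (cscale :: complex \<Rightarrow> 'n::finite cmat \<Rightarrow> 'n cmat)"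
proof (rule bilinear_conv_bounded_bilinear[THEN iffD1], unfold bilinear_def, intro conjI allI)
  show "linear (\<lambda>A :: 'n cmat. cscale a A)" for a
    by (rule linearI) (simp_all add: cscale_def vec_eq_iff algebra_simps)
  show "linear (\<lambda>a. cscale a (A :: 'n cmat))" for A
    by (rule linearI) (simp_all add: cscale_def vec_eq_iff algebra_simps)
qed

lemma cscale_cscale [simp]: "cscale a (cscale b A) = cscale (a * b) A"
  by (simp add: cscale_def vec_eq_iff)

lemma cscale_one [simp]: "cscale 1 A = A"
  by (simp add: cscale_def vec_eq_iff)

lemma cscale_of_real: "cscale (of_real r) A = r *\<^sub>R A"
  by (simp add: cscale_def vec_eq_iff complex_eq_iff)

lemma cscale_mult_left: "cscale a A ** B = cscale a (A ** B)"
  by (simp add: cscale_def vec_eq_iff matrix_matrix_mult_def sum_distrib_left mult.assoc)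

lemma cscale_mult_right: "A ** cscale a B = cscale a (A ** B)"
  by (simp add: cscale_def vec_eq_iff matrix_matrix_mult_def sum_distrib_left mult.left_commute)

text \<open>\<open>lie_re\<close>, \<open>lie_im\<close> and \<open>inner_k\<close> are controlled
  only on \<open>lie_algebra G\<close>. The linear maps \<open>re\<close>, \<open>im\<close> and the
  bounded bilinear \<open>ip\<close>, which \<open>lie_data_exists\<close> chooses to agree with
  them there, are total and so commute with derivatives and limits.\<close>

locale lie_data = compact_matrix_group K for K :: "'n::finite cmat set" +
  fixes re im :: "'n cmat \<Rightarrow> 'n cmat" and ip :: "'n cmat \<Rightarrow> 'n cmat \<Rightarrow> real"
  assumes linear_re: "linear re" and linear_im: "linear im"
    and re_decomp: "A \<in> lie_algebra K \<Longrightarrow> B \<in> lie_algebra K \<Longrightarrow> re (A + cscale \<i> B) = A"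
    and im_decomp: "A \<in> lie_algebra K \<Longrightarrow> B \<in> lie_algebra K \<Longrightarrow> im (A + cscale \<i> B) = B"
    and bilinear_ip: "bounded_bilinear ip" and ip_sym: "ip A B = ip B A"
    and ip_conjugate: "g \<in> K \<Longrightarrow> A \<in> lie_algebra K \<Longrightarrow> B \<in> lie_algebra K \<Longrightarrow>
      ip (g ** A ** matrix_inv g) (g ** B ** matrix_inv g) = ip A B"
    and ip_bracket: "C \<in> lie_algebra K \<Longrightarrow> A \<in> lie_algebra K \<Longrightarrow> B \<in> lie_algebra K \<Longrightarrow>
      ip (bracket C A) B + ip A (bracket C B) = 0"
    and ip_pos: "A \<in> lie_algebra K \<Longrightarrow> A \<noteq> 0 \<Longrightarrow> ip A A > 0"

text \<open>A regular function is rational in the matrix entries, so on \<open>G\<close> the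
  representation agrees with a map \<open>R\<close> that is differentiable at every matrix of
  nonzero determinant. The derivative of \<open>R\<close> at the identity is one linear map that
  serves all curves.\<close>

lemma representation_derivative:
  fixes G :: "'n::finite cmat set" and \<rho> :: "'n cmat \<Rightarrow> 'm::finite cmat"
  assumes G: "subgroup G GL" and \<rho>: "faithful_representation G \<rho>"
  obtains L where "linear L" "\<And>A c. curve_through_one G A c \<Longrightarrow> ((\<lambda>t. \<rho> (c t)) has_vector_derivative L A) (at 0)"
    "continuous_on G \<rho>"
proof -
  interpret G: matrix_group G by (rule matrix_group.intro[OF G])
  have "\<forall>i j. \<exists>p k. p \<in> polynomial_funs \<and> (\<forall>g\<in>G. \<rho> g $ i $ j = p g / det g ^ k)"
    using \<rho> unfolding faithful_representation_def regular_function_def by blast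
  then obtain p k where p: "\<And>i j. p i j \<in> polynomial_funs" and pk: "\<And>i j g. g \<in> G \<Longrightarrow> \<rho> g $ i $ j = p i j g / det g ^ k i j"
    by metis
  define R where "R g = (\<chi> i j. p i j g / det g ^ k i j)" for g
  have R: "\<rho> g = R g" if "g \<in> G" for g using pk[OF that] by (simp add: R_def vec_eq_iff)
  have dR: "R differentiable (at g)" if "det g \<noteq> 0" for g
    unfolding R_def[abs_def]
    by (intro differentiable_vec_lambda differentiable_divide differentiable_power polynomial_funs_differentiable p det_polynomial)
      (use that in simp)
  define L where "L = frechet_derivative R (at (mat 1))"
  have L: "(R has_derivative L) (at (mat 1))"
    using dR[of "mat 1"] by (simp add: L_def frechet_derivative_works[symmetric])
  have 1: "linear L" using has_derivative_linear[OF L] .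
  have 2: "((\<lambda>t. \<rho> (c t)) has_vector_derivative L A) (at 0)" if c: "curve_through_one G A c" for A c
  proof -
    have "(R has_derivative L) (at (c 0) within range c)"
      using has_derivative_at_withinI[OF L] c by (simp add: curve_through_one_def)
    then have "((R \<circ> c) has_vector_derivative L A) (at 0)"
      using vector_derivative_diff_chain_within[of c A 0 UNIV R L] c by (simp add: curve_through_one_def)
    moreover have "(\<lambda>t. \<rho> (c t)) = R \<circ> c" using c R by (auto simp: curve_through_one_def image_subset_iff)
    ultimately show ?thesis by simp
  qed
  have "continuous_on G R"
  proof (rule continuous_at_imp_continuous_on, rule ballI)
    fix g assume "g \<in> G"
    then have "det g \<noteq> 0" using G.H_simps(2) invertible_det_nz by blast
    then show "isCont R g" using dR differentiable_imp_continuous_within by blast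
  qed
  then have 3: "continuous_on G \<rho>" by (rule continuous_on_eq) (simp add: R)
  show ?thesis by (rule that[OF 1 2 3])
qed

lemma mpow_minus_one: "mpow g n - mat 1 = (\<Sum>j<n. mpow g j ** (g - mat 1))"
proof -
  have "mpow g n - mpow g 0 = (\<Sum>j<n. mpow g (Suc j) - mpow g j)" by (rule sum_lessThan_telescope[symmetric])
  then show ?thesis by (simp add: matrix_mult_simps)
qed

text \<open>Tangent vectors enter the arguments about compact groups as limits of n (g_n - 1) with
  group elements g_n, because statements about powers of the g_n can then be exploited.\<close>

lemma harmonic_difference_quotient:
  assumes "(c has_vector_derivative D) (at 0)"
  shows "(\<lambda>n. real n *\<^sub>R (c (1 / real n) - c 0)) \<longlonglongrightarrow> D"
proof -
  have "((\<lambda>h. (c (0 + h) - c 0) /\<^sub>R h) \<longlongrightarrow> D) (at 0)" using assms by (simp only: has_vector_derivative_limit)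
  moreover have "filterlim (\<lambda>n. 1 / real n) (at 0) sequentially"
    by (rule filterlim_atI[OF lim_1_over_n]) (use eventually_gt_at_top[of 0] in eventually_elim, simp)
  ultimately have "(\<lambda>n. (c (0 + 1 / real n) - c 0) /\<^sub>R (1 / real n)) \<longlonglongrightarrow> D" by (rule filterlim_compose)
  then show ?thesis by simp
qed

text \<open>If \<open>\<rho> \<circ> c\<close> has derivative 0, then the powers \<open>\<rho> (c (1/n))\<^sup>j\<close>, \<open>j \<le> n\<close>, are uniformly close
  to 1, and so are \<open>c (1/n)\<^sup>j\<close> because \<open>\<rho>\<close> is injective on a compact group.\<close>

lemma injective_representation_derivative:
  fixes \<rho> :: "'n::finite cmat \<Rightarrow> 'm::finite cmat"
  assumes K: "compact_matrix_group K" and K': "compact_matrix_group K'" and im: "\<rho> ` K \<subseteq> K'"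
    and hom: "\<And>g h. g \<in> K \<Longrightarrow> h \<in> K \<Longrightarrow> \<rho> (g ** h) = \<rho> g ** \<rho> h" "\<rho> (mat 1) = mat 1"
    and inj: "inj_on \<rho> K" and cont: "continuous_on K \<rho>"
    and c: "\<And>t. c t \<in> K" "c 0 = mat 1" "(c has_vector_derivative A) (at (0::real))"
    and \<rho>c: "((\<lambda>t. \<rho> (c t)) has_vector_derivative 0) (at 0)"
  shows "A = 0"
proof -
  interpret K: compact_matrix_group K by (rule K)
  interpret K': compact_matrix_group K' by (rule K')
  define x where "x n = c (1 / real n)" for n
  have x: "x n \<in> K" for n by (simp add: x_def c)
  define a where "a n = real n *\<^sub>R (x n - mat 1)" for n
  define b where "b n = real n *\<^sub>R (\<rho> (x n) - mat 1)" for n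
  have a: "a \<longlonglongrightarrow> A" using harmonic_difference_quotient[OF c(3)] by (simp add: a_def[abs_def] x_def c(2))
  have b: "b \<longlonglongrightarrow> 0" using harmonic_difference_quotient[OF \<rho>c] by (simp add: b_def[abs_def] x_def c(2) hom(2))
  obtain k where k: "k > 0" "\<And>(a :: 'm cmat) (b :: 'm cmat). norm (a ** b) \<le> norm a * norm b * k"
    using bounded_bilinear.pos_bounded[OF bounded_bilinear_matrix_mult] by metis
  obtain k' where k': "k' > 0" "\<And>(a :: 'n cmat) (b :: 'n cmat). norm (a ** b) \<le> norm a * norm b * k'"
    using bounded_bilinear.pos_bounded[OF bounded_bilinear_matrix_mult] by metis
  obtain C where C: "\<And>h. h \<in> K' \<Longrightarrow> norm h \<le> C"
    using compact_imp_bounded[OF K'.compact] by (auto simp: bounded_iff)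
  have C0: "C \<ge> 0" using C[OF K'.H_simps(1)] norm_ge_zero order_trans by blast
  have pow: "\<rho> (mpow (x n) j) = mpow (\<rho> (x n)) j" for n j
    by (induction j) (simp_all add: hom K.mpow_closed x)
  have \<rho>x: "\<rho> (x n) \<in> K'" for n using im x by blast
  \<comment> \<open>The powers in the telescoped sum lie in the compact \<open>K'\<close> and are
    bounded; there are at most \<open>n\<close> terms, and the remaining factor \<open>n\<close>
    turns the small increment into \<open>b n\<close>. The bound is uniform in
    \<open>j\<close>.\<close>
  have small: "norm (\<rho> (mpow (x n) j) - mat 1) \<le> C * k * norm (b n)" if "j \<le> n" for n j
  proof -
    have "norm (\<rho> (mpow (x n) j) - mat 1) \<le> (\<Sum>i<j. C * norm (\<rho> (x n) - mat 1) * k)"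
      unfolding pow mpow_minus_one
    proof (rule sum_norm_le)
      fix i
      have "norm (mpow (\<rho> (x n)) i ** (\<rho> (x n) - mat 1)) \<le> norm (mpow (\<rho> (x n)) i) * norm (\<rho> (x n) - mat 1) * k" by (rule k(2))
      also have "\<dots> \<le> C * norm (\<rho> (x n) - mat 1) * k"
        using C[OF K'.mpow_closed[OF \<rho>x]] k(1) by (intro mult_right_mono) auto
      finally show "norm (mpow (\<rho> (x n)) i ** (\<rho> (x n) - mat 1)) \<le> C * norm (\<rho> (x n) - mat 1) * k" .
    qed
    also have "\<dots> = real j * (C * norm (\<rho> (x n) - mat 1) * k)" by simp
    also have "\<dots> \<le> real n * (C * norm (\<rho> (x n) - mat 1) * k)"
      using that C0 k(1) by (intro mult_right_mono) auto
    also have "\<dots> = C * k * norm (b n)" by (simp add: b_def)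
    finally show ?thesis .
  qed
  \<comment> \<open>On the compact part of \<open>K\<close> at distance at least \<delta> from 1,
    the distance of the image from 1 attains a minimum, which is positive by injectivity.\<close>
  have unif: "\<exists>\<eta>>0. \<forall>g\<in>K. norm (\<rho> g - mat 1) < \<eta> \<longrightarrow> norm (g - mat 1) < \<delta>" if \<delta>: "\<delta> > 0" for \<delta>
  proof -
    define S where "S = K \<inter> {g. norm (g - mat 1) \<ge> \<delta>}"
    have S: "compact S" unfolding S_def
      by (intro compact_Int_closed K.compact closed_Collect_le continuous_intros)
    show ?thesis
    proof (cases "S = {}")
      case True then show ?thesis by (intro exI[of _ 1]) (auto simp: S_def not_le)
    next
      case False
      have "continuous_on S (\<lambda>g. norm (\<rho> g - mat 1))"
        by (intro continuous_intros continuous_on_subset[OF cont]) (auto simp: S_def)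
      then obtain g0 where g0: "g0 \<in> S" "\<And>g. g \<in> S \<Longrightarrow> norm (\<rho> g0 - mat 1) \<le> norm (\<rho> g - mat 1)"
        using continuous_attains_inf[OF S False] by blast
      have "\<rho> g0 \<noteq> mat 1"
      proof
        assume "\<rho> g0 = mat 1"
        then have "\<rho> g0 = \<rho> (mat 1)" using hom(2) by simp
        then have "g0 = mat 1" using inj g0(1) K.H_simps(1) unfolding S_def by (blast dest: inj_onD)
        then show False using g0(1) \<delta> by (simp add: S_def)
      qed
      then show ?thesis using g0(2) by (intro exI[of _ "norm (\<rho> g0 - mat 1)"]) (auto simp: S_def not_le[symmetric])
    qed
  qed
  obtain D where D: "\<And>n. norm (a n) \<le> D" "D > 0"
    using convergent_imp_Bseq[of a] a unfolding convergent_def Bseq_def by blast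
  have "a \<longlonglongrightarrow> 0"
  proof (rule LIMSEQ_I)
    fix e :: real assume e: "e > 0"
    \<comment> \<open>Chosen so that \<open>\<delta> * (1 + k' * D)\<close> is \<open>e / 2\<close>;
      \<open>D\<close> bounds the sequence \<open>a\<close>, which reappears on the right of its own
      estimate.\<close>
    define \<delta> where "\<delta> = e / (2 * (1 + k' * D))"
    have kD: "1 + k' * D > 0" using k'(1) D(2) by (simp add: add_pos_pos)
    have \<delta>: "\<delta> > 0" using e kD by (simp add: \<delta>_def)
    obtain \<eta> where \<eta>: "\<eta> > 0" "\<And>g. g \<in> K \<Longrightarrow> norm (\<rho> g - mat 1) < \<eta> \<Longrightarrow> norm (g - mat 1) < \<delta>"
      using unif[OF \<delta>] by blast
    have "(\<lambda>n. C * k * norm (b n)) \<longlonglongrightarrow> C * k * norm (0 :: 'm cmat)" by (intro tendsto_intros b)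
    then have "\<forall>\<^sub>F n in sequentially. C * k * norm (b n) < \<eta>" using \<eta>(1) by (intro order_tendstoD) auto
    then obtain n0 where n0: "\<And>n. n \<ge> n0 \<Longrightarrow> C * k * norm (b n) < \<eta>" by (auto simp: eventually_sequentially)
    have "norm (a n - 0) < e" if n: "n \<ge> n0" for n
    proof -
      have close: "norm (mpow (x n) j - mat 1) < \<delta>" if "j \<le> n" for j
        using \<eta>(2)[OF K.mpow_closed[OF x]] small[OF that] n0[OF n] by (meson le_less_trans)
      \<comment> \<open>Replacing every power in the telescoped sum by 1 leaves \<open>n\<close>
        copies of \<open>x n - mat 1\<close>, that is \<open>a n\<close>. So \<open>a n\<close> is
        small once all powers up to \<open>n\<close> are close to 1.\<close>
      have "mpow (x n) n - mat 1 = (\<Sum>j<n. (mpow (x n) j - mat 1) ** (x n - mat 1)) + a n"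
        unfolding mpow_minus_one[of "x n" n] by (simp add: matrix_mult_simps sum_subtractf a_def scaleR_diff_right sum_constant_scaleR del: sum_constant)
      then have "norm (a n) = norm ((mpow (x n) n - mat 1) - (\<Sum>j<n. (mpow (x n) j - mat 1) ** (x n - mat 1)))" by simp
      also have "\<dots> \<le> norm (mpow (x n) n - mat 1) + norm (\<Sum>j<n. (mpow (x n) j - mat 1) ** (x n - mat 1))"
        by (rule norm_triangle_ineq4)
      also have "\<dots> \<le> \<delta> + (\<Sum>j<n. \<delta> * norm (x n - mat 1) * k')"
      proof (intro add_mono sum_norm_le)
        show "norm (mpow (x n) n - mat 1) \<le> \<delta>" using close[of n] by simp
        fix j assume "j \<in> {..<n}"
        then have "norm (mpow (x n) j - mat 1) * norm (x n - mat 1) * k' \<le> \<delta> * norm (x n - mat 1) * k'"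
          using close[of j] k'(1) by (intro mult_right_mono) auto
        then show "norm ((mpow (x n) j - mat 1) ** (x n - mat 1)) \<le> \<delta> * norm (x n - mat 1) * k'"
          using k'(2) order_trans by blast
      qed
      also have "\<dots> = \<delta> + \<delta> * k' * norm (a n)" by (simp add: a_def)
      also have "\<dots> \<le> \<delta> + \<delta> * k' * D" using D(1)[of n] \<delta> k'(1) by simp
      also have "\<dots> = \<delta> * (1 + k' * D)" by (simp add: algebra_simps)
      also have "\<dots> = e / 2"
      proof -
        have "e / (2 * r) * r = e / 2" if "r > 0" for r using that by (simp add: field_simps)
        from this[OF kD] show ?thesis unfolding \<delta>_def .
      qed
      finally show ?thesis using e by simp
    qed
    then show "\<exists>n0. \<forall>n\<ge>n0. norm (a n - 0) < e" by blast
  qed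
  then show ?thesis using a LIMSEQ_unique by blast
qed

text \<open>Definiteness comes from the trace form on the compact group \<open>Kt\<close> together
  with injectivity of the differential of \<rho> on \<open>lie_algebra K\<close>. Invariance is
  cyclicity of the trace, and its infinitesimal version follows by differentiation.\<close>

lemma lie_data_exists:
  fixes G K :: "'n::finite cmat set" and Kt :: "'m::finite cmat set" and \<rho> :: "'n cmat \<Rightarrow> 'm cmat"
  assumes G: "linear_algebraic_group G" and mK: "maximal_compact_subgroup K G"
    and cpl: "lie_complexification G K" and \<rho>: "faithful_representation G \<rho>"
    and Kt: "maximal_compact_subgroup Kt (carrier GL)" and \<rho>K: "\<rho> ` K \<subseteq> Kt"
  obtains re im ip where "lie_data K re im ip"
    "\<And>Z. Z \<in> lie_algebra G \<Longrightarrow> lie_re K Z = re Z" "\<And>Z. Z \<in> lie_algebra G \<Longrightarrow> lie_im K Z = im Z"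
    "\<And>A B. A \<in> lie_algebra G \<Longrightarrow> B \<in> lie_algebra G \<Longrightarrow> inner_k G \<rho> A B = ip A B"
proof -
  interpret G: matrix_group G by (rule matrix_group.intro) (use G in \<open>simp add: linear_algebraic_group_def\<close>)
  interpret K: compact_matrix_group K
    by (intro compact_matrix_group.intro matrix_group.intro compact_matrix_group_axioms.intro)
      (use mK in \<open>simp_all add: maximal_compact_subgroup_def\<close>)
  interpret Kt: compact_matrix_group Kt
    by (intro compact_matrix_group.intro matrix_group.intro compact_matrix_group_axioms.intro)
      (use Kt in \<open>simp_all add: maximal_compact_subgroup_def\<close>)
  let ?k = "lie_algebra K"
  have KG: "K \<subseteq> G" using mK by (simp add: maximal_compact_subgroup_def)
  have gk: "lie_algebra G = {A + cscale \<i> B | A B. A \<in> ?k \<and> B \<in> ?k}" and k0: "?k \<inter> cscale \<i> ` ?k = {0}"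
    using cpl by (auto simp: lie_complexification_def)
  have curveKG: "curve_through_one K A c \<Longrightarrow> curve_through_one G A c" for A c
    using KG by (auto simp: curve_through_one_def)
  have kg: "A \<in> ?k \<Longrightarrow> A \<in> lie_algebra G" for A using curveKG by (auto simp: lie_algebra_def)
  note sub = K.subspace_lie_algebra
  define f where "f v = fst v + cscale \<i> (snd v)" for v :: "'n cmat \<times> 'n cmat"
  have lf: "linear f" unfolding f_def[abs_def]
    by (rule linearI) (simp_all add: bounded_bilinear.add_right[OF bounded_bilinear_cscale] bounded_bilinear.scaleR_right[OF bounded_bilinear_cscale] scaleR_add_right)
  have inj: "inj_on f (?k \<times> ?k)"
  proof (rule inj_onI)
    fix v w assume v: "v \<in> ?k \<times> ?k" and w: "w \<in> ?k \<times> ?k" and eq: "f v = f w"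
    have d: "fst v - fst w = cscale \<i> (snd w - snd v)"
      using eq by (simp add: f_def bounded_bilinear.diff_right[OF bounded_bilinear_cscale] algebra_simps)
    have "fst v - fst w \<in> ?k" "snd w - snd v \<in> ?k" using v w subspace_diff[OF sub] by auto
    then have "fst v - fst w \<in> ?k \<inter> cscale \<i> ` ?k" using d by auto
    then have 1: "fst v - fst w = 0" using k0 by blast
    then have "cscale (- \<i>) (cscale \<i> (snd w - snd v)) = cscale (- \<i>) 0" using d by simp
    then have "snd w - snd v = 0" by (simp add: bounded_bilinear.zero_right[OF bounded_bilinear_cscale])
    then show "v = w" using 1 by (simp add: prod_eq_iff)
  qed
  \<comment> \<open>A left inverse of \<open>f\<close> on \<open>?k \<times> ?k\<close> that is
    defined and linear on all matrices; its components are \<open>re\<close> and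
    \<open>im\<close>.\<close>
  obtain q where q: "linear q" "\<And>v. v \<in> ?k \<times> ?k \<Longrightarrow> q (f v) = v"
    using linear_exists_left_inverse_on[OF lf subspace_Times[OF sub sub] inj] by blast
  define re im where "re = fst \<circ> q" and "im = snd \<circ> q"
  have re: "linear re" "linear im" unfolding re_def im_def
    by (rule linear_compose[OF q(1) bounded_linear.linear[OF bounded_linear_fst]],
        rule linear_compose[OF q(1) bounded_linear.linear[OF bounded_linear_snd]])
  have dec: "re (A + cscale \<i> B) = A" "im (A + cscale \<i> B) = B" if "A \<in> ?k" "B \<in> ?k" for A B
    using q(2)[of "(A, B)"] that by (simp_all add: re_def im_def f_def)
  have lre: "lie_re K Z = re Z" and lim: "lie_im K Z = im Z" if Z: "Z \<in> lie_algebra G" for Z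
  proof -
    obtain A B where AB: "A \<in> ?k" "B \<in> ?k" "Z = A + cscale \<i> B" using Z gk by blast
    have Z': "re Z = A" "im Z = B" unfolding AB(3) by (rule dec[OF AB(1,2)])+
    show "lie_re K Z = re Z" unfolding lie_re_def
    proof (rule the_equality)
      show "re Z \<in> ?k \<and> (\<exists>B\<in>?k. Z = re Z + cscale \<i> B)" unfolding Z' using AB by blast
      show "A' = re Z" if A': "A' \<in> ?k \<and> (\<exists>B\<in>?k. Z = A' + cscale \<i> B)" for A'
        using A' dec(1)[of A'] by auto
    qed
    show "lie_im K Z = im Z" unfolding lie_im_def
    proof (rule the_equality)
      show "im Z \<in> ?k \<and> (\<exists>A\<in>?k. Z = A + cscale \<i> (im Z))" unfolding Z' using AB by blast
      show "B' = im Z" if B': "B' \<in> ?k \<and> (\<exists>A\<in>?k. Z = A + cscale \<i> B')" for B'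
        using B' dec(2)[of _ B'] by auto
    qed
  qed
  obtain L where L: "linear L" and Lc: "\<And>A c. curve_through_one G A c \<Longrightarrow> ((\<lambda>t. \<rho> (c t)) has_vector_derivative L A) (at 0)"
    and cont: "continuous_on G \<rho>"
    by (rule representation_derivative[OF G.H \<rho>], rule that)
  have lmap: "lie_map G \<rho> A = L A" if A: "A \<in> lie_algebra G" for A
    unfolding lie_map_def
  proof (rule the_equality)
    show "\<forall>c. curve_through_one G A c \<longrightarrow> (\<rho> \<circ> c has_vector_derivative L A) (at 0)"
      using Lc by (simp add: o_def)
    fix B assume B: "\<forall>c. curve_through_one G A c \<longrightarrow> (\<rho> \<circ> c has_vector_derivative B) (at 0)"
    obtain c where "curve_through_one G A c" using A by (auto simp: lie_algebra_def)
    then have "(\<rho> \<circ> c has_vector_derivative B) (at 0)" "(\<rho> \<circ> c has_vector_derivative L A) (at 0)"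
      using B Lc[of A c] by (simp_all add: o_def)
    then show "B = L A" by (rule vector_derivative_unique_at)
  qed
  have hom: "\<rho> (g ** h) = \<rho> g ** \<rho> h" if "g \<in> G" "h \<in> G" for g h
    using \<rho> that by (auto simp: faithful_representation_def hom_def GL_def)
  have inv\<rho>: "invertible (\<rho> g)" if "g \<in> G" for g
    using \<rho> that by (auto simp: faithful_representation_def hom_def GL_def)
  have \<rho>1: "\<rho> (mat 1) = mat 1"
  proof -
    have "\<rho> (mat 1) ** \<rho> (mat 1) = \<rho> (mat 1)" using hom[OF G.H_simps(1) G.H_simps(1)] by simp
    then have "matrix_inv (\<rho> (mat 1)) ** (\<rho> (mat 1) ** \<rho> (mat 1)) = matrix_inv (\<rho> (mat 1)) ** \<rho> (mat 1)" by simp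
    then show ?thesis using matrix_inv_mult(2)[OF inv\<rho>[OF G.H_simps(1)]] by (simp add: matrix_mul_assoc)
  qed
  have \<rho>inv: "\<rho> (matrix_inv g) = matrix_inv (\<rho> g)" if "g \<in> G" for g
    by (rule matrix_inv_unique[symmetric]) (use hom[OF that G.H_simps(4)[OF that]] G.H_simps(5)[OF that] \<rho>1 in simp)
  have Lconj: "L (g ** A ** matrix_inv g) = \<rho> g ** L A ** matrix_inv (\<rho> g)" if g: "g \<in> G" and A: "A \<in> lie_algebra G" for g A
  proof -
    obtain c where c: "curve_through_one G A c" using A by (auto simp: lie_algebra_def)
    have bl: "bounded_linear (\<lambda>A. \<rho> g ** A ** matrix_inv (\<rho> g))"
      by (rule bounded_linear_compose[OF bounded_bilinear.bounded_linear_left[OF bounded_bilinear_matrix_mult]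
          bounded_bilinear.bounded_linear_right[OF bounded_bilinear_matrix_mult]])
    have "((\<lambda>t. \<rho> (g ** c t ** matrix_inv g)) has_vector_derivative L (g ** A ** matrix_inv g)) (at 0)"
      by (rule Lc[OF G.curve_conjugate[OF g c]])
    moreover have "(\<lambda>t. \<rho> (g ** c t ** matrix_inv g)) = (\<lambda>t. \<rho> g ** \<rho> (c t) ** matrix_inv (\<rho> g))"
    proof
      fix t
      have "c t \<in> G" using c by (auto simp: curve_through_one_def)
      then show "\<rho> (g ** c t ** matrix_inv g) = \<rho> g ** \<rho> (c t) ** matrix_inv (\<rho> g)"
        using g by (simp add: hom G.H_simps \<rho>inv)
    qed
    moreover have "((\<lambda>t. \<rho> g ** \<rho> (c t) ** matrix_inv (\<rho> g)) has_vector_derivative \<rho> g ** L A ** matrix_inv (\<rho> g)) (at 0)"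
      by (rule bounded_linear.has_vector_derivative[OF bl Lc[OF c]])
    ultimately show ?thesis using vector_derivative_unique_at by metis
  qed
  define ip where "ip A B = - Re (trace (L A ** L B))" for A B
  have bip: "bounded_bilinear ip"
  proof (rule bilinear_conv_bounded_bilinear[THEN iffD1], unfold bilinear_def, intro conjI allI)
    note simps = ip_def linear_add[OF L] linear_scale[OF L] matrix_mult_simps trace_add linear_simps(5)[OF bounded_linear_trace]
    show "linear (\<lambda>B. ip A B)" for A by (rule linearI) (simp_all add: simps)
    show "linear (\<lambda>A. ip A B)" for B by (rule linearI) (simp_all add: simps)
  qed
  have "lie_data K re im ip"
  proof (intro lie_data.intro lie_data_axioms.intro)
    show "compact_matrix_group K" by (rule K.compact_matrix_group_axioms)
    show "linear re" "linear im" by (fact re)+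
    show "bounded_bilinear ip" by (fact bip)
    show "ip A B = ip B A" for A B unfolding ip_def by (subst trace_mul_sym) (rule refl)
    show conj: "ip (g ** A ** matrix_inv g) (g ** B ** matrix_inv g) = ip A B"
      if g: "g \<in> K" and A: "A \<in> ?k" and B: "B \<in> ?k" for g A B
    proof -
      have gG: "g \<in> G" using g KG by blast
      have "L (g ** A ** matrix_inv g) ** L (g ** B ** matrix_inv g) =
          \<rho> g ** L A ** (matrix_inv (\<rho> g) ** \<rho> g) ** L B ** matrix_inv (\<rho> g)"
        by (simp add: Lconj[OF gG kg[OF A]] Lconj[OF gG kg[OF B]] matrix_mul_assoc)
      also have "\<dots> = \<rho> g ** (L A ** L B ** matrix_inv (\<rho> g))"
        using matrix_inv_mult(2)[OF inv\<rho>[OF gG]] by (simp add: matrix_mul_assoc)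
      also have "trace \<dots> = trace ((L A ** L B ** matrix_inv (\<rho> g)) ** \<rho> g)" by (rule trace_mul_sym)
      also have "(L A ** L B ** matrix_inv (\<rho> g)) ** \<rho> g = L A ** L B"
        using matrix_inv_mult(2)[OF inv\<rho>[OF gG]] by (simp add: matrix_mul_assoc[symmetric])
      finally show ?thesis by (simp add: ip_def)
    qed
    show "ip (bracket C A) B + ip A (bracket C B) = 0" if C: "C \<in> ?k" and A: "A \<in> ?k" and B: "B \<in> ?k" for C A B
    proof -
      obtain c where "curve_through_one K C c" using C by (auto simp: lie_algebra_def)
      then have c: "\<And>t. c t \<in> K" "c 0 = mat 1" "(c has_vector_derivative C) (at 0)"
        by (auto simp: curve_through_one_def)
      have m1: "matrix_inv (mat 1) = (mat 1 :: 'n cmat)" by (rule matrix_inv_unique) simp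
      \<comment> \<open>The pairing of the conjugated vectors is constant along \<open>c\<close>, so
        the derivative given by the product rule must vanish.\<close>
      have "((\<lambda>t. ip (c t ** A ** matrix_inv (c t)) (c t ** B ** matrix_inv (c t))) has_vector_derivative
          ip (c 0 ** A ** matrix_inv (c 0)) (bracket C B) + ip (bracket C A) (c 0 ** B ** matrix_inv (c 0))) (at 0)"
        by (rule bounded_bilinear.has_vector_derivative[OF bip K.conjugate_has_derivative[OF c] K.conjugate_has_derivative[OF c]])
      then have "((\<lambda>t. ip A B) has_vector_derivative ip A (bracket C B) + ip (bracket C A) B) (at 0)"
        by (simp add: conj[OF c(1) A B] c(2) m1)
      then have "ip A (bracket C B) + ip (bracket C A) B = 0"
        using vector_derivative_unique_at has_vector_derivative_const by blast
      then show ?thesis by simp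
    qed
    show "ip A A > 0" if A: "A \<in> ?k" "A \<noteq> 0" for A
    proof -
      obtain c where cK: "curve_through_one K A c" using A(1) by (auto simp: lie_algebra_def)
      then have c: "\<And>t. c t \<in> K" "c 0 = mat 1" "(c has_vector_derivative A) (at 0)"
        by (auto simp: curve_through_one_def)
      note d = Lc[OF curveKG[OF cK]]
      have "L A \<noteq> 0"
      proof
        assume L0: "L A = 0"
        have "A = 0"
        proof (rule injective_representation_derivative[OF K.compact_matrix_group_axioms Kt.compact_matrix_group_axioms \<rho>K _ \<rho>1 _ _ c])
          show "\<rho> (g ** h) = \<rho> g ** \<rho> h" if "g \<in> K" "h \<in> K" for g h using hom that KG by blast
          show "inj_on \<rho> K" using \<rho> KG inj_on_subset by (auto simp: faithful_representation_def)
          show "continuous_on K \<rho>" by (rule continuous_on_subset[OF cont KG])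
          show "((\<lambda>t. \<rho> (c t)) has_vector_derivative 0) (at 0)" using d L0 by simp
        qed
        then show False using A(2) by simp
      qed
      moreover have "(\<lambda>n. real n *\<^sub>R (\<rho> (c (1 / real n)) - mat 1)) \<longlonglongrightarrow> L A"
        using harmonic_difference_quotient[OF d] by (simp add: c(2) \<rho>1)
      moreover have "\<rho> (c (1 / real n)) \<in> Kt" for n using c(1) \<rho>K by blast
      ultimately have "Re (trace (L A ** L A)) < 0"
        by (intro Kt.trace_square_negative[of "\<lambda>n. \<rho> (c (1 / real n))"])
      then show ?thesis by (simp add: ip_def)
    qed
  qed (use dec in auto)
  moreover have "inner_k G \<rho> A B = ip A B" if "A \<in> lie_algebra G" "B \<in> lie_algebra G" for A B
    using that linear_simps(4)[OF bounded_linear_trace] by (simp add: inner_k_def ip_def lmap)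
  ultimately show ?thesis using that[of re im ip] lre lim by blast
qed

section \<open>Connections and Higgs fields in local frames\<close>

text \<open>The adjoint action of the inverse of \<open>g\<close>: how coefficients change when a
  frame is translated by \<open>g\<close>.\<close>

definition cj :: "'n::finite cmat \<Rightarrow> 'n cmat \<Rightarrow> 'n cmat" where
  "cj g A = matrix_inv g ** A ** g"

lemma bounded_linear_cj: "bounded_linear (cj g)"
  unfolding cj_def[abs_def]
  by (rule bounded_linear_compose[OF bounded_bilinear.bounded_linear_left[OF bounded_bilinear_matrix_mult]
          bounded_bilinear.bounded_linear_right[OF bounded_bilinear_matrix_mult]])

lemmas cj_simps = linear_simps[OF bounded_linear_cj]

lemma cj_cscale: "cj g (cscale a A) = cscale a (cj g A)"
  by (simp add: cj_def cscale_mult_left cscale_mult_right)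

lemma bounded_bilinear_bracket: "bounded_bilinear (bracket :: 'n::finite cmat \<Rightarrow> 'n cmat \<Rightarrow> 'n cmat)"
proof (rule bilinear_conv_bounded_bilinear[THEN iffD1], unfold bilinear_def, intro conjI allI)
  show "linear (\<lambda>B :: 'n cmat. bracket A B)" for A
    by (rule linearI) (simp_all add: bracket_def matrix_mult_simps scaleR_diff_right)
  show "linear (\<lambda>A :: 'n cmat. bracket A B)" for B
    by (rule linearI) (simp_all add: bracket_def matrix_mult_simps scaleR_diff_right)
qed

lemmas bracket_simps =
  bounded_bilinear.add_left[OF bounded_bilinear_bracket] bounded_bilinear.add_right[OF bounded_bilinear_bracket]
  bounded_bilinear.diff_left[OF bounded_bilinear_bracket] bounded_bilinear.diff_right[OF bounded_bilinear_bracket]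
  bounded_bilinear.minus_left[OF bounded_bilinear_bracket] bounded_bilinear.minus_right[OF bounded_bilinear_bracket]
  bounded_bilinear.scaleR_left[OF bounded_bilinear_bracket] bounded_bilinear.scaleR_right[OF bounded_bilinear_bracket]
  bounded_bilinear.zero_left[OF bounded_bilinear_bracket] bounded_bilinear.zero_right[OF bounded_bilinear_bracket]

lemmas cscale_simps =
  bounded_bilinear.add_left[OF bounded_bilinear_cscale] bounded_bilinear.add_right[OF bounded_bilinear_cscale]
  bounded_bilinear.diff_left[OF bounded_bilinear_cscale] bounded_bilinear.diff_right[OF bounded_bilinear_cscale]
  bounded_bilinear.minus_left[OF bounded_bilinear_cscale] bounded_bilinear.minus_right[OF bounded_bilinear_cscale]
  bounded_bilinear.scaleR_left[OF bounded_bilinear_cscale] bounded_bilinear.scaleR_right[OF bounded_bilinear_cscale]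
  bounded_bilinear.zero_left[OF bounded_bilinear_cscale] bounded_bilinear.zero_right[OF bounded_bilinear_cscale]

lemma bracket_swap: "bracket A B = - bracket B A"
  by (simp add: bracket_def)

lemma bracket_self [simp]: "bracket A A = 0"
  by (simp add: bracket_def)

lemma bracket_cscale_left: "bracket (cscale a A) B = cscale a (bracket A B)"
  by (simp add: bracket_def cscale_mult_left cscale_mult_right cscale_simps)

lemma bracket_cscale_right: "bracket A (cscale a B) = cscale a (bracket A B)"
  by (simp add: bracket_def cscale_mult_left cscale_mult_right cscale_simps)

lemma bracket_jacobi: "bracket (bracket A B) C + bracket B (bracket A C) = bracket A (bracket B C)"
  by (simp add: bracket_def matrix_mult_simps matrix_mul_assoc)

lemma cscale_complex: "cscale a A = Re a *\<^sub>R A + Im a *\<^sub>R cscale \<i> A"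
  by (simp add: cscale_def vec_eq_iff complex_eq_iff)

context lie_data
begin

abbreviation "\<kk> \<equiv> lie_algebra K"

text \<open>Built from \<open>K\<close> alone, so that the local calculus stays independent of
  \<open>G\<close>; it is identified with \<open>lie_algebra G\<close> at the end.\<close>

definition gC :: "'n cmat set" where
  "gC = {A + cscale \<i> B | A B. A \<in> \<kk> \<and> B \<in> \<kk>}"

lemma gC_I: "A \<in> \<kk> \<Longrightarrow> B \<in> \<kk> \<Longrightarrow> A + cscale \<i> B \<in> gC"
  by (auto simp: gC_def)

lemma k_add: "A \<in> \<kk> \<Longrightarrow> B \<in> \<kk> \<Longrightarrow> A + B \<in> \<kk>"
  and k_diff: "A \<in> \<kk> \<Longrightarrow> B \<in> \<kk> \<Longrightarrow> A - B \<in> \<kk>"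
  and k_minus: "A \<in> \<kk> \<Longrightarrow> - A \<in> \<kk>"
  and k_scaleR: "A \<in> \<kk> \<Longrightarrow> r *\<^sub>R A \<in> \<kk>"
  and k_zero: "0 \<in> \<kk>"
  using subspace_lie_algebra subspace_add subspace_diff subspace_neg subspace_scale subspace_0 by blast+

lemmas k_bracket = lie_algebra_bracket
lemmas k_closed = k_add k_diff k_minus k_scaleR k_zero k_bracket

lemma gC_decomp:
  assumes "Z \<in> gC"
  shows "re Z \<in> \<kk>" "im Z \<in> \<kk>" "Z = re Z + cscale \<i> (im Z)"
  using assms re_decomp im_decomp by (auto simp: gC_def)

lemma re_k: "A \<in> \<kk> \<Longrightarrow> re A = A" and im_k: "A \<in> \<kk> \<Longrightarrow> im A = 0"
  using re_decomp[OF _ k_zero, of A] im_decomp[OF _ k_zero, of A] by (auto simp: cscale_simps)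

lemma re_im_eqI:
  assumes "A \<in> \<kk>" "B \<in> \<kk>" "Z = A + cscale \<i> B"
  shows "re Z = A" "im Z = B"
  using assms re_decomp im_decomp by auto

lemma subspace_gC: "subspace gC"
proof (rule subspaceI)
  show "0 \<in> gC" using gC_I[OF k_zero k_zero] by (simp add: cscale_simps)
  show "x + y \<in> gC" if x: "x \<in> gC" and y: "y \<in> gC" for x y
  proof -
    have "x + y = (re x + cscale \<i> (im x)) + (re y + cscale \<i> (im y))"
      by (rule arg_cong2[where f=plus, OF gC_decomp(3)[OF x] gC_decomp(3)[OF y]])
    also have "\<dots> = (re x + re y) + cscale \<i> (im x + im y)" by (simp add: cscale_simps)
    finally have "x + y = (re x + re y) + cscale \<i> (im x + im y)" .
    then show ?thesis using gC_I k_add gC_decomp x y by metis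
  qed
  show "r *\<^sub>R x \<in> gC" if x: "x \<in> gC" for x r
  proof -
    have "r *\<^sub>R x = r *\<^sub>R re x + cscale \<i> (r *\<^sub>R im x)"
      using gC_decomp(3)[OF x] by (metis cscale_simps(8) scaleR_add_right)
    then show ?thesis using gC_I k_scaleR gC_decomp x by metis
  qed
qed

lemma cscale_gC:
  assumes "Z \<in> gC"
  shows "cscale a Z \<in> gC" "re (cscale a Z) = Re a *\<^sub>R re Z - Im a *\<^sub>R im Z"
    "im (cscale a Z) = Re a *\<^sub>R im Z + Im a *\<^sub>R re Z"
proof -
  note d = gC_decomp[OF assms]
  have "cscale a (re Z + cscale \<i> (im Z)) = (Re a *\<^sub>R re Z - Im a *\<^sub>R im Z) + cscale \<i> (Re a *\<^sub>R im Z + Im a *\<^sub>R re Z)"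
    by (subst cscale_complex) (simp add: cscale_simps scaleR_add_right scaleR_diff_right cscale_of_real[of "- 1", simplified])
  then have eq: "cscale a Z = (Re a *\<^sub>R re Z - Im a *\<^sub>R im Z) + cscale \<i> (Re a *\<^sub>R im Z + Im a *\<^sub>R re Z)"
    using d(3) by simp
  have k: "Re a *\<^sub>R re Z - Im a *\<^sub>R im Z \<in> \<kk>" "Re a *\<^sub>R im Z + Im a *\<^sub>R re Z \<in> \<kk>"
    using d by (auto intro!: k_closed)
  show "cscale a Z \<in> gC" unfolding eq by (rule gC_I[OF k])
  show "re (cscale a Z) = Re a *\<^sub>R re Z - Im a *\<^sub>R im Z" "im (cscale a Z) = Re a *\<^sub>R im Z + Im a *\<^sub>R re Z"
    using re_im_eqI[OF k eq] by auto
qed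

lemma inv_inv: "g \<in> K \<Longrightarrow> matrix_inv (matrix_inv g) = g"
  by (rule matrix_inv_unique) (simp add: H_simps)

lemma cj_k: "g \<in> K \<Longrightarrow> A \<in> \<kk> \<Longrightarrow> cj g A \<in> \<kk>"
  using lie_algebra_conjugate[OF H_simps(4)[of g], of A] by (simp add: cj_def inv_inv)

lemma ip_cj: "g \<in> K \<Longrightarrow> A \<in> \<kk> \<Longrightarrow> B \<in> \<kk> \<Longrightarrow> ip (cj g A) (cj g B) = ip A B"
  using ip_conjugate[OF H_simps(4)[of g], of A B] by (simp add: cj_def inv_inv)

lemma cj_gC:
  assumes "g \<in> K" "Z \<in> gC"
  shows "cj g Z \<in> gC" "re (cj g Z) = cj g (re Z)" "im (cj g Z) = cj g (im Z)"
proof -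
  note d = gC_decomp[OF assms(2)]
  have eq: "cj g Z = cj g (re Z) + cscale \<i> (cj g (im Z))"
    by (subst d(3)) (simp add: cj_simps cj_cscale)
  note k = cj_k[OF assms(1) d(1)] cj_k[OF assms(1) d(2)]
  show "cj g Z \<in> gC" unfolding eq by (rule gC_I[OF k])
  show "re (cj g Z) = cj g (re Z)" "im (cj g Z) = cj g (im Z)" using re_im_eqI[OF k eq] by auto
qed

lemma inv_cancel:
  assumes "g \<in> K"
  shows "g ** (matrix_inv g ** A) = A" "matrix_inv g ** (g ** A) = A"
  using assms by (simp_all add: matrix_mul_assoc H_simps)

lemma cj_bracket: "g \<in> K \<Longrightarrow> cj g (bracket A B) = bracket (cj g A) (cj g B)"
  by (simp add: cj_def bracket_def matrix_mult_simps matrix_mul_assoc[symmetric] inv_cancel)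

lemma bounded_linear_re: "bounded_linear re" and bounded_linear_im: "bounded_linear im"
  using linear_re linear_im linear_conv_bounded_linear by blast+

lemmas re_simps = linear_simps[OF bounded_linear_re] linear_simps[OF bounded_linear_im]

lemmas ip_simps =
  bounded_bilinear.add_left[OF bilinear_ip] bounded_bilinear.add_right[OF bilinear_ip]
  bounded_bilinear.diff_left[OF bilinear_ip] bounded_bilinear.diff_right[OF bilinear_ip]
  bounded_bilinear.minus_left[OF bilinear_ip] bounded_bilinear.minus_right[OF bilinear_ip]
  bounded_bilinear.scaleR_left[OF bilinear_ip] bounded_bilinear.scaleR_right[OF bilinear_ip]
  bounded_bilinear.zero_left[OF bilinear_ip] bounded_bilinear.zero_right[OF bilinear_ip]

lemma ip_bracket_right: "C \<in> \<kk> \<Longrightarrow> A \<in> \<kk> \<Longrightarrow> B \<in> \<kk> \<Longrightarrow> ip A (bracket C B) = - ip (bracket C A) B"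
  using ip_bracket[of C A B] by simp

lemma ip_nonneg: "A \<in> \<kk> \<Longrightarrow> ip A A \<ge> 0"
  using ip_pos[of A] by (cases "A = 0") (auto simp: ip_simps)

end

text \<open>\<open>Fr\<close> is the set of frames with transition functions \<open>tr\<close>, and \<open>fr x\<close> is a frame near \<open>x\<close>,
  used to evaluate fibre norms.\<close>

locale higgs_bundle = compact_riemann X + lie_data K re im ip
  for X :: "('x::t2_space) chart set" and K :: "'n::finite cmat set" and re im ip +
  fixes Fr :: "('x, 'q) frame set" and tr :: "('x, 'q) frame \<Rightarrow> ('x, 'q) frame \<Rightarrow> 'x \<Rightarrow> 'n cmat"
    and fr :: "'x \<Rightarrow> ('x, 'q) frame" and h :: "'x chart \<Rightarrow> 'x \<Rightarrow> real"
  assumes open_frame: "s \<in> Fr \<Longrightarrow> open (fst s)"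
    and tr_K: "s \<in> Fr \<Longrightarrow> t \<in> Fr \<Longrightarrow> x \<in> fst s \<Longrightarrow> x \<in> fst t \<Longrightarrow> tr s t x \<in> K"
    and tr_smooth: "s \<in> Fr \<Longrightarrow> t \<in> Fr \<Longrightarrow> smooth_map X (fst s \<inter> fst t) (tr s t)"
    and tr_inverse: "s \<in> Fr \<Longrightarrow> t \<in> Fr \<Longrightarrow> x \<in> fst s \<Longrightarrow> x \<in> fst t \<Longrightarrow> tr t s x = matrix_inv (tr s t x)"
    and fr: "fr x \<in> Fr" "x \<in> fst (fr x)"
    and metric: "hermitian_metric X h"
begin

section \<open>Sections and forms with values in the adjoint bundle\<close>

lemma open_dom: "c \<in> X \<Longrightarrow> s \<in> Fr \<Longrightarrow> open (fst c \<inter> fst s)"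
  using open_chart open_frame by blast

definition smooth_family :: "('x chart \<Rightarrow> ('x, 'q) frame \<Rightarrow> 'x \<Rightarrow> 'n cmat) \<Rightarrow> 'n cmat set \<Rightarrow> bool" where
  "smooth_family n V \<longleftrightarrow> (\<forall>c\<in>X. \<forall>s\<in>Fr. smooth_map X (fst c \<inter> fst s) (n c s) \<and> (\<forall>x\<in>fst c \<inter> fst s. n c s x \<in> V))"

text \<open>The weight \<open>w\<close> records the behaviour under coordinate changes: constantly 1
  for sections of the real adjoint bundle, the squared modulus for coefficients of dx \<and>
  dy.\<close>

definition ksec :: "(complex \<Rightarrow> real) \<Rightarrow> ('x chart \<Rightarrow> ('x, 'q) frame \<Rightarrow> 'x \<Rightarrow> 'n cmat) \<Rightarrow> bool" where
  "ksec w n \<longleftrightarrow> smooth_family n \<kk> \<and>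
     (\<forall>c\<in>X. \<forall>d\<in>X. \<forall>s\<in>Fr. \<forall>x\<in>fst c \<inter> fst d \<inter> fst s. n c s x = w (coord_deriv c d x) *\<^sub>R n d s x) \<and>
     (\<forall>c\<in>X. \<forall>s\<in>Fr. \<forall>t\<in>Fr. \<forall>x\<in>fst c \<inter> fst s \<inter> fst t. n c t x = cj (tr s t x) (n c s x))"

text \<open>\<open>e\<close> is \<open>cnj\<close> for type (0,1) and the identity for type (1,0).
  Only coordinate changes are constrained: forms and holomorphic structures share this part and
  differ in their response to a change of frame.\<close>

definition cfam :: "(complex \<Rightarrow> complex) \<Rightarrow> ('x chart \<Rightarrow> ('x, 'q) frame \<Rightarrow> 'x \<Rightarrow> 'n cmat) \<Rightarrow> bool" where
  "cfam e \<omega> \<longleftrightarrow> smooth_family \<omega> gC \<and>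
     (\<forall>c\<in>X. \<forall>d\<in>X. \<forall>s\<in>Fr. \<forall>x\<in>fst c \<inter> fst d \<inter> fst s. \<omega> c s x = cscale (e (coord_deriv c d x)) (\<omega> d s x))"

definition cform :: "(complex \<Rightarrow> complex) \<Rightarrow> ('x chart \<Rightarrow> ('x, 'q) frame \<Rightarrow> 'x \<Rightarrow> 'n cmat) \<Rightarrow> bool" where
  "cform e \<omega> \<longleftrightarrow> cfam e \<omega> \<and>
     (\<forall>c\<in>X. \<forall>s\<in>Fr. \<forall>t\<in>Fr. \<forall>x\<in>fst c \<inter> fst s \<inter> fst t. \<omega> c t x = cj (tr s t x) (\<omega> c s x))"

definition holstr :: "('x chart \<Rightarrow> ('x, 'q) frame \<Rightarrow> 'x \<Rightarrow> 'n cmat) \<Rightarrow> bool" where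
  "holstr \<alpha> \<longleftrightarrow> cfam cnj \<alpha> \<and>
     (\<forall>c\<in>X. \<forall>s\<in>Fr. \<forall>t\<in>Fr. \<forall>x\<in>fst c \<inter> fst s \<inter> fst t.
        \<alpha> c t x = cj (tr s t x) (\<alpha> c s x) + matrix_inv (tr s t x) ** d_zbar (tr s t \<circ> param c) (snd c x))"

lemma smooth_familyD:
  assumes "smooth_family n V" "c \<in> X" "s \<in> Fr"
  shows "smooth_map X (fst c \<inter> fst s) (n c s)" "x \<in> fst c \<Longrightarrow> x \<in> fst s \<Longrightarrow> n c s x \<in> V"
    "x \<in> fst c \<Longrightarrow> x \<in> fst s \<Longrightarrow> diff_at c (n c s) x"
  using assms smooth_map_diff_at[of "fst c \<inter> fst s" "n c s" c x] unfolding smooth_family_def by auto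

lemma ksecD:
  assumes "ksec w n" "c \<in> X" "s \<in> Fr" "x \<in> fst c" "x \<in> fst s"
  shows "n c s x \<in> \<kk>" "diff_at c (n c s) x"
    "d \<in> X \<Longrightarrow> x \<in> fst d \<Longrightarrow> n c s x = w (coord_deriv c d x) *\<^sub>R n d s x"
    "t \<in> Fr \<Longrightarrow> x \<in> fst t \<Longrightarrow> n c t x = cj (tr s t x) (n c s x)"
proof -
  have sf: "smooth_family n \<kk>" using assms(1) unfolding ksec_def by blast
  show "n c s x \<in> \<kk>" "diff_at c (n c s) x" using smooth_familyD(2,3)[OF sf assms(2,3)] assms(4,5) by blast+
  show "d \<in> X \<Longrightarrow> x \<in> fst d \<Longrightarrow> n c s x = w (coord_deriv c d x) *\<^sub>R n d s x"
    "t \<in> Fr \<Longrightarrow> x \<in> fst t \<Longrightarrow> n c t x = cj (tr s t x) (n c s x)"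
    using assms unfolding ksec_def by blast+
qed

lemma ksec_smooth: "ksec w n \<Longrightarrow> c \<in> X \<Longrightarrow> s \<in> Fr \<Longrightarrow> smooth_map X (fst c \<inter> fst s) (n c s)"
  unfolding ksec_def using smooth_familyD by blast

lemma ksecI:
  assumes "\<And>c s. c \<in> X \<Longrightarrow> s \<in> Fr \<Longrightarrow> smooth_map X (fst c \<inter> fst s) (n c s)"
    "\<And>c s x. c \<in> X \<Longrightarrow> s \<in> Fr \<Longrightarrow> x \<in> fst c \<Longrightarrow> x \<in> fst s \<Longrightarrow> n c s x \<in> \<kk>"
    "\<And>c d s x. c \<in> X \<Longrightarrow> d \<in> X \<Longrightarrow> s \<in> Fr \<Longrightarrow> x \<in> fst c \<Longrightarrow> x \<in> fst d \<Longrightarrow> x \<in> fst s \<Longrightarrow> n c s x = w (coord_deriv c d x) *\<^sub>R n d s x"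
    "\<And>c s t x. c \<in> X \<Longrightarrow> s \<in> Fr \<Longrightarrow> t \<in> Fr \<Longrightarrow> x \<in> fst c \<Longrightarrow> x \<in> fst s \<Longrightarrow> x \<in> fst t \<Longrightarrow> n c t x = cj (tr s t x) (n c s x)"
  shows "ksec w n"
  unfolding ksec_def smooth_family_def by (intro conjI ballI) (use assms in blast)+

lemma cfamD:
  assumes "cfam e \<omega>" "c \<in> X" "s \<in> Fr" "x \<in> fst c" "x \<in> fst s"
  shows "\<omega> c s x \<in> gC" "diff_at c (\<omega> c s) x" "re (\<omega> c s x) \<in> \<kk>" "im (\<omega> c s x) \<in> \<kk>"
    "\<omega> c s x = re (\<omega> c s x) + cscale \<i> (im (\<omega> c s x))"
    "d \<in> X \<Longrightarrow> x \<in> fst d \<Longrightarrow> \<omega> c s x = cscale (e (coord_deriv c d x)) (\<omega> d s x)"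
proof -
  show 1: "\<omega> c s x \<in> gC" "diff_at c (\<omega> c s) x"
    "d \<in> X \<Longrightarrow> x \<in> fst d \<Longrightarrow> \<omega> c s x = cscale (e (coord_deriv c d x)) (\<omega> d s x)"
  proof -
    have sf: "smooth_family \<omega> gC" using assms(1) unfolding cfam_def by blast
    show "\<omega> c s x \<in> gC" "diff_at c (\<omega> c s) x" using smooth_familyD(2,3)[OF sf assms(2,3)] assms(4,5) by blast+
    show "d \<in> X \<Longrightarrow> x \<in> fst d \<Longrightarrow> \<omega> c s x = cscale (e (coord_deriv c d x)) (\<omega> d s x)"
      using assms unfolding cfam_def by blast
  qed
  show "re (\<omega> c s x) \<in> \<kk>" "im (\<omega> c s x) \<in> \<kk>" "\<omega> c s x = re (\<omega> c s x) + cscale \<i> (im (\<omega> c s x))"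
    using gC_decomp[OF 1(1)] by auto
qed

lemma cfam_smooth: "cfam e \<omega> \<Longrightarrow> c \<in> X \<Longrightarrow> s \<in> Fr \<Longrightarrow> smooth_map X (fst c \<inter> fst s) (\<omega> c s)"
  unfolding cfam_def using smooth_familyD by blast

lemma cform_cfam: "cform e \<omega> \<Longrightarrow> cfam e \<omega>"
  by (simp add: cform_def)

lemma holstr_cfam: "holstr \<alpha> \<Longrightarrow> cfam cnj \<alpha>"
  by (simp add: holstr_def)

lemma cform_frame: "cform e \<omega> \<Longrightarrow> c \<in> X \<Longrightarrow> s \<in> Fr \<Longrightarrow> t \<in> Fr \<Longrightarrow> x \<in> fst c \<Longrightarrow> x \<in> fst s \<Longrightarrow> x \<in> fst t \<Longrightarrow>
    \<omega> c t x = cj (tr s t x) (\<omega> c s x)"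
  unfolding cform_def by blast

text \<open>The \<kk>-valued form whose (0,1)-coefficient, half of its value on 1 plus \<i> times
  its value on \<i>, is \<open>\<alpha> c s x\<close>. For a holomorphic structure this is the Chern
  connection; for a (0,1)-form it is the corresponding \<kk>-valued 1-form.\<close>

definition conn :: "('x chart \<Rightarrow> ('x, 'q) frame \<Rightarrow> 'x \<Rightarrow> 'n cmat) \<Rightarrow> ('x, 'q) frame \<Rightarrow> 'x chart \<Rightarrow> complex \<Rightarrow> 'x \<Rightarrow> 'n cmat" where
  "conn \<alpha> s c v x = (2 * Re v) *\<^sub>R re (\<alpha> c s x) + (2 * Im v) *\<^sub>R im (\<alpha> c s x)"

lemma conn_simps: "conn \<alpha> s c 1 x = 2 *\<^sub>R re (\<alpha> c s x)" "conn \<alpha> s c \<i> x = 2 *\<^sub>R im (\<alpha> c s x)"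
  by (simp_all add: conn_def)

lemma smooth_map_conn:
  assumes "cfam e \<alpha>" "c \<in> X" "s \<in> Fr"
  shows "smooth_map X (fst c \<inter> fst s) (conn \<alpha> s c v)"
  unfolding conn_def[abs_def]
  by (intro smooth_map_add smooth_map_bounded_linear[OF bounded_linear_scaleR_right] smooth_map_bounded_linear[OF bounded_linear_re]
      smooth_map_bounded_linear[OF bounded_linear_im] cfam_smooth[OF assms] open_dom assms)

lemma one_form_conn:
  assumes "cfam cnj \<alpha>" "s \<in> Fr"
  shows "one_form X (fst s) (conn \<alpha> s)"
proof (rule one_formI)
  show "smooth_map X (fst c \<inter> fst s) (conn \<alpha> s c v)" if "c \<in> X" for c v
    by (rule smooth_map_conn[OF assms(1) that assms(2)])
  show "conn \<alpha> s c v x = Re v *\<^sub>R conn \<alpha> s c 1 x + Im v *\<^sub>R conn \<alpha> s c \<i> x" for c v x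
    by (simp add: conn_def mult.commute)
  show "conn \<alpha> s c v x = conn \<alpha> s d (coord_deriv c d x * v) x"
    if "c \<in> X" "d \<in> X" "x \<in> fst c" "x \<in> fst d" "x \<in> fst s" for c d v x
  proof -
    note f = cfamD(1)[OF assms(1) that(2) assms(2) that(4,5)]
    note e = cfamD(6)[OF assms(1) that(1) assms(2) that(3,5,2,4)]
    show ?thesis unfolding conn_def e cscale_gC[OF f] by (simp add: algebra_simps)
  qed
qed

lemma conn_k: "cfam e \<alpha> \<Longrightarrow> c \<in> X \<Longrightarrow> s \<in> Fr \<Longrightarrow> x \<in> fst c \<Longrightarrow> x \<in> fst s \<Longrightarrow> conn \<alpha> s c v x \<in> \<kk>"
  unfolding conn_def by (intro k_closed cfamD(3,4))

lemma conn_diff_at: "cfam e \<alpha> \<Longrightarrow> c \<in> X \<Longrightarrow> s \<in> Fr \<Longrightarrow> x \<in> fst c \<Longrightarrow> x \<in> fst s \<Longrightarrow> diff_at c (conn \<alpha> s c v) x"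
  by (rule smooth_map_diff_at[OF smooth_map_conn]) auto

lemma conn_frame_cform:
  assumes "cform e \<omega>" "c \<in> X" "s \<in> Fr" "t \<in> Fr" "x \<in> fst c" "x \<in> fst s" "x \<in> fst t"
  shows "conn \<omega> t c v x = cj (tr s t x) (conn \<omega> s c v x)"
  unfolding conn_def cform_frame[OF assms] cj_gC[OF tr_K[OF assms(3,4,6,7)] cfamD(1)[OF cform_cfam[OF assms(1)] assms(2,3,5,6)]]
  by (simp add: cj_simps)

section \<open>Change of frame\<close>

lemma tr_diff_at:
  assumes "c \<in> X" "s \<in> Fr" "t \<in> Fr" "x \<in> fst c" "x \<in> fst s" "x \<in> fst t"
  shows "diff_at c (tr s t) x"
  using smooth_map_diff_at[OF tr_smooth[OF assms(2,3)] assms(1)] assms by blast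

lemma tr_log_derivative:
  assumes "c \<in> X" "s \<in> Fr" "t \<in> Fr" "x \<in> fst c" "x \<in> fst s" "x \<in> fst t"
  shows "matrix_inv (tr s t x) ** pd c v (tr s t) x \<in> \<kk>"
proof -
  let ?S = "snd c ` (fst c \<inter> (fst s \<inter> fst t))"
  have o: "open ?S" using open_image[OF assms(1)] open_frame assms by blast
  have "matrix_inv ((tr s t \<circ> param c) (snd c x)) ** frechet_derivative (tr s t \<circ> param c) (at (snd c x)) v \<in> \<kk>"
  proof (rule logarithmic_derivative_in_lie_algebra[OF o])
    show "smooth_on ?S (tr s t \<circ> param c)" using tr_smooth[OF assms(2,3)] assms(1) by (auto simp: smooth_map_def)
    show "snd c x \<in> ?S" using assms by blast
    fix z assume "z \<in> ?S"
    then obtain y where y: "y \<in> fst c" "y \<in> fst s" "y \<in> fst t" "z = snd c y" by blast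
    then show "(tr s t \<circ> param c) z \<in> K" using tr_K[OF assms(2,3) y(2,3)] assms(1) by simp
  qed
  then show ?thesis using assms by (simp add: pd_def)
qed

text \<open>Transition functions are K-valued, so their logarithmic derivatives lie in \<kk>. The
  inhomogeneous term of \<alpha> therefore splits into real and imaginary parts in \<kk>, which
  combine to the usual gauge transformation of a connection.\<close>

lemma conn_frame:
  assumes "holstr \<alpha>" and c: "c \<in> X" "s \<in> Fr" "t \<in> Fr" "x \<in> fst c" "x \<in> fst s" "x \<in> fst t"
  shows "conn \<alpha> t c v x = cj (tr s t x) (conn \<alpha> s c v x) + matrix_inv (tr s t x) ** pd c v (tr s t) x"
proof -
  note f = holstr_cfam[OF assms(1)]
  note g = tr_K[OF c(2,3,5,6)]
  note a = cfamD[OF f c(1,2,4,5)]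
  let ?D = "\<lambda>v. matrix_inv (tr s t x) ** pd c v (tr s t) x"
  have Dk: "?D v \<in> \<kk>" for v by (rule tr_log_derivative[OF c])
  have eq: "\<alpha> c t x = (cj (tr s t x) (re (\<alpha> c s x)) + (1/2) *\<^sub>R ?D 1) + cscale \<i> (cj (tr s t x) (im (\<alpha> c s x)) + (1/2) *\<^sub>R ?D \<i>)"
  proof -
    have "\<alpha> c t x = cj (tr s t x) (\<alpha> c s x) + matrix_inv (tr s t x) ** d_zbar (tr s t \<circ> param c) (snd c x)"
      using assms unfolding holstr_def by blast
    also have "cj (tr s t x) (\<alpha> c s x) = cj (tr s t x) (re (\<alpha> c s x)) + cscale \<i> (cj (tr s t x) (im (\<alpha> c s x)))"
      by (subst a(5)) (simp add: cj_simps cj_cscale)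
    also have "matrix_inv (tr s t x) ** d_zbar (tr s t \<circ> param c) (snd c x) = (1/2) *\<^sub>R ?D 1 + cscale \<i> ((1/2) *\<^sub>R ?D \<i>)"
    proof -
      have hc: "cscale (\<i> / 2) Y = (1/2) *\<^sub>R cscale \<i> Y" for Y :: "'n cmat"
        using cscale_of_real[of "1/2" "cscale \<i> Y"] by simp
      show ?thesis unfolding d_zbar_def pd_def using cscale_of_real[of "1/2"]
        by (simp add: hc matrix_mult_simps cscale_mult_right cscale_simps scaleR_add_right)
    qed
    finally show ?thesis by (simp add: cscale_simps)
  qed
  have "re (\<alpha> c t x) = cj (tr s t x) (re (\<alpha> c s x)) + (1/2) *\<^sub>R ?D 1"
    "im (\<alpha> c t x) = cj (tr s t x) (im (\<alpha> c s x)) + (1/2) *\<^sub>R ?D \<i>"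
    by (rule re_im_eqI[OF _ _ eq]; intro k_closed cj_k g a Dk)+
  moreover have "?D v = Re v *\<^sub>R ?D 1 + Im v *\<^sub>R ?D \<i>"
    by (subst pd_complex[OF tr_diff_at[OF c]]) (simp add: matrix_mult_simps)
  ultimately show ?thesis
    unfolding conn_def by (simp add: cj_simps scaleR_add_right)
qed

lemma pd_k:
  assumes "c \<in> X" "s \<in> Fr" "x \<in> fst c" "x \<in> fst s" "diff_at c f x" "\<And>y. y \<in> fst c \<Longrightarrow> y \<in> fst s \<Longrightarrow> f y \<in> \<kk>"
  shows "pd c v f x \<in> \<kk>"
proof (rule derivative_in_subspace[OF subspace_lie_algebra open_image[OF assms(1) open_frame[OF assms(2)]]])
  show "((\<lambda>z. f (param c z)) has_derivative (\<lambda>v. pd c v f x)) (at (snd c x))" by (rule pd_has_derivative[OF assms(5)])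
  show "f (param c z) \<in> \<kk>" if "z \<in> snd c ` (fst c \<inter> fst s)" for z using that assms by auto
qed (use assms in auto)

text \<open>\<open>D\<close> is the logarithmic derivative of the transition function. The inverse
  is differentiable because it is the transition function in the opposite direction, and its
  derivative comes from differentiating the product with its inverse, which is constantly 1.\<close>

lemma pd_cj:
  fixes v :: complex
  assumes c: "c \<in> X" "s \<in> Fr" "t \<in> Fr" "x \<in> fst c" "x \<in> fst s" "x \<in> fst t" and f: "diff_at c f x"
  defines "g \<equiv> tr s t x" and "D \<equiv> matrix_inv (tr s t x) ** pd c v (tr s t) x"
  shows "pd c v (\<lambda>y. cj (tr s t y) (f y)) x = cj g (pd c v f x) + bracket (cj g (f x)) D"
    "diff_at c (\<lambda>y. cj (tr s t y) (f y)) x"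
    "pd c v (\<lambda>y. matrix_inv (tr s t y)) x = - (D ** matrix_inv g)"
    "diff_at c (\<lambda>y. matrix_inv (tr s t y)) x"
proof -
  let ?W = "fst c \<inter> (fst s \<inter> fst t)"
  have oW: "open ?W" using open_chart open_frame c by blast
  have ost: "open (fst s \<inter> fst t)" using open_frame c by blast
  have pc: "param c (snd c x) = x" using c by simp
  note dg = tr_diff_at[OF c]
  have di: "diff_at c (tr t s) x" by (rule tr_diff_at[OF c(1,3,2,4,6,5)])
  have gK: "g \<in> K" unfolding g_def by (rule tr_K[OF c(2,3,5,6)])
  have inv: "tr t s y = matrix_inv (tr s t y)" if "y \<in> ?W" for y using tr_inverse[OF c(2,3)] that by blast
  have eqp: "pd c v (\<lambda>y. matrix_inv (tr s t y)) x = pd c v (tr t s) x" for v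
    by (rule pd_cong[OF oW c(1)]) (use c inv in auto)
  have hd: "((\<lambda>z. matrix_inv (tr s t (param c z))) has_derivative (\<lambda>v. pd c v (tr t s) x)) (at (snd c x))"
    by (rule has_derivative_transform_within_open[OF pd_has_derivative[OF di] open_image[OF c(1) ost]])
      (use c inv in auto)
  show dinv: "diff_at c (\<lambda>y. matrix_inv (tr s t y)) x" using pd_eqI(1)[where f="\<lambda>y. matrix_inv (tr s t y)", OF hd] .
  have "pd c v (\<lambda>y. matrix_inv (tr s t y) ** tr s t y) x = pd c v (\<lambda>y. mat 1) x"
  proof (rule pd_cong[OF oW c(1)])
    show "matrix_inv (tr s t y) ** tr s t y = mat 1" if "y \<in> ?W" for y
      using H_simps(6)[OF tr_K[OF c(2,3)]] that by blast
  qed (use c in auto)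
  then have "matrix_inv g ** pd c v (tr s t) x + pd c v (\<lambda>y. matrix_inv (tr s t y)) x ** g = 0"
    unfolding pd_bounded_bilinear[OF bounded_bilinear_matrix_mult dinv dg pc] pd_const g_def .
  then have "D ** matrix_inv g + pd c v (\<lambda>y. matrix_inv (tr s t y)) x ** g ** matrix_inv g = 0 ** matrix_inv g"
    unfolding D_def g_def[symmetric] by (metis bounded_bilinear.add_left[OF bounded_bilinear_matrix_mult])
  then have "D ** matrix_inv g + pd c v (\<lambda>y. matrix_inv (tr s t y)) x = 0"
    using H_simps(5)[OF gK] by (simp add: matrix_mul_assoc[symmetric] matrix_mult_simps)
  then show pinv: "pd c v (\<lambda>y. matrix_inv (tr s t y)) x = - (D ** matrix_inv g)"
    by (simp add: eq_neg_iff_add_eq_0 add.commute)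
  have d1: "diff_at c (\<lambda>y. matrix_inv (tr s t y) ** f y) x"
    by (rule diff_at_bounded_bilinear[OF bounded_bilinear_matrix_mult dinv f pc])
  show "diff_at c (\<lambda>y. cj (tr s t y) (f y)) x" unfolding cj_def
    by (rule diff_at_bounded_bilinear[OF bounded_bilinear_matrix_mult d1 dg pc])
  have gD: "pd c v (tr s t) x = g ** D" unfolding D_def g_def[symmetric] by (simp add: inv_cancel[OF gK])
  show "pd c v (\<lambda>y. cj (tr s t y) (f y)) x = cj g (pd c v f x) + bracket (cj g (f x)) D"
    unfolding cj_def pd_bounded_bilinear[OF bounded_bilinear_matrix_mult d1 dg pc]
      pd_bounded_bilinear[OF bounded_bilinear_matrix_mult dinv f pc] pinv gD g_def[symmetric]
    by (simp add: bracket_def matrix_mult_simps matrix_mul_assoc[symmetric] inv_cancel[OF gK])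
qed

text \<open>The coefficient of dx \<and> dy in dA + A \<and> A.\<close>

definition curv :: "('x chart \<Rightarrow> ('x, 'q) frame \<Rightarrow> 'x \<Rightarrow> 'n cmat) \<Rightarrow> 'x chart \<Rightarrow> ('x, 'q) frame \<Rightarrow> 'x \<Rightarrow> 'n cmat" where
  "curv \<alpha> c s x = curl (conn \<alpha> s) c x + bracket (conn \<alpha> s c 1 x) (conn \<alpha> s c \<i> x)"

definition nabla :: "('x chart \<Rightarrow> ('x, 'q) frame \<Rightarrow> 'x \<Rightarrow> 'n cmat) \<Rightarrow> ('x chart \<Rightarrow> ('x, 'q) frame \<Rightarrow> 'x \<Rightarrow> 'n cmat) \<Rightarrow>
    'x chart \<Rightarrow> ('x, 'q) frame \<Rightarrow> complex \<Rightarrow> 'x \<Rightarrow> 'n cmat" where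
  "nabla \<alpha> \<mu> c s v x = pd c v (\<mu> c s) x + bracket (conn \<alpha> s c v x) (\<mu> c s x)"

text \<open>Differentiating the conjugation produces a bracket with the logarithmic derivative, and
  the inhomogeneous term of the connection cancels it.\<close>

lemma nabla_frame:
  assumes "holstr \<alpha>" "ksec w \<mu>" and c: "c \<in> X" "s \<in> Fr" "t \<in> Fr" "x \<in> fst c" "x \<in> fst s" "x \<in> fst t"
  shows "nabla \<alpha> \<mu> c t v x = cj (tr s t x) (nabla \<alpha> \<mu> c s v x)"
proof -
  let ?W = "fst c \<inter> (fst s \<inter> fst t)"
  have oW: "open ?W" using open_chart open_frame c by blast
  have gK: "tr s t x \<in> K" by (rule tr_K[OF c(2,3,5,6)])
  have "pd c v (\<mu> c t) x = pd c v (\<lambda>y. cj (tr s t y) (\<mu> c s y)) x"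
    by (rule pd_cong[OF oW c(1)]) (use c(4-6) ksecD(4)[OF assms(2) c(1,2) _ _ c(3)] in blast)+
  then show ?thesis
    unfolding nabla_def conn_frame[OF assms(1) c] ksecD(4)[OF assms(2) c(1,2,4,5,3,6)]
    by (simp add: pd_cj(1)[OF c ksecD(2)[OF assms(2) c(1,2,4,5)]] bracket_simps cj_simps cj_bracket[OF gK]
      bracket_swap[of "matrix_inv (tr s t x) ** pd c v (tr s t) x"])
qed

text \<open>The second derivatives of the transition function cancel by symmetry, and the products
  of its logarithmic derivatives cancel against the brackets of the inhomogeneous terms.\<close>

lemma curv_frame:
  assumes "holstr \<alpha>" and c: "c \<in> X" "s \<in> Fr" "t \<in> Fr" "x \<in> fst c" "x \<in> fst s" "x \<in> fst t"
  shows "curv \<alpha> c t x = cj (tr s t x) (curv \<alpha> c s x)"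
proof -
  let ?W = "fst c \<inter> (fst s \<inter> fst t)"
  have oW: "open ?W" using open_chart open_frame c by blast
  have pc: "param c (snd c x) = x" using c by simp
  define g where "g = tr s t x"
  have gK: "g \<in> K" unfolding g_def by (rule tr_K[OF c(2,3,5,6)])
  note f = holstr_cfam[OF assms(1)]
  define D where "D v = matrix_inv g ** pd c v (tr s t) x" for v
  define B where "B v = cj g (conn \<alpha> s c v x)" for v
  have dc: "diff_at c (conn \<alpha> s c v) x" for v by (rule conn_diff_at[OF f c(1,2,4,5)])
  have dp: "diff_at c (pd c v (tr s t)) x" for v
    using smooth_map_diff_at[OF smooth_map_pd[OF tr_smooth[OF c(2,3)] c(1)] c(1)] c open_frame by blast
  have gD: "pd c v (tr s t) x = g ** D v" for v unfolding D_def by (simp add: inv_cancel[OF gK])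
  have p: "pd c v (conn \<alpha> t c w) x =
      cj g (pd c v (conn \<alpha> s c w) x) + bracket (B w) (D v) + (matrix_inv g ** pd c v (pd c w (tr s t)) x - D v ** D w)" for v w
  proof -
    have "pd c v (conn \<alpha> t c w) x = pd c v (\<lambda>y. cj (tr s t y) (conn \<alpha> s c w y) + matrix_inv (tr s t y) ** pd c w (tr s t) y) x"
      by (rule pd_cong[OF oW c(1)]) (use c conn_frame[OF assms(1) c(1-3)] in auto)
    also have "\<dots> = pd c v (\<lambda>y. cj (tr s t y) (conn \<alpha> s c w y)) x + pd c v (\<lambda>y. matrix_inv (tr s t y) ** pd c w (tr s t) y) x"
      by (rule pd_add[OF pd_cj(2)[OF c dc] diff_at_bounded_bilinear[OF bounded_bilinear_matrix_mult pd_cj(4)[OF c dc] dp pc]])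
    also have "pd c v (\<lambda>y. matrix_inv (tr s t y) ** pd c w (tr s t) y) x = matrix_inv g ** pd c v (pd c w (tr s t)) x - D v ** D w"
      unfolding pd_bounded_bilinear[OF bounded_bilinear_matrix_mult pd_cj(4)[OF c dc] dp pc] pd_cj(3)[OF c dc] g_def[symmetric]
      unfolding D_def by (simp add: matrix_mult_simps matrix_mul_assoc[symmetric])
    finally show ?thesis unfolding pd_cj(1)[OF c dc] g_def[symmetric] D_def B_def by simp
  qed
  have comm: "pd c 1 (pd c \<i> (tr s t)) x = pd c \<i> (pd c 1 (tr s t)) x"
    using pd_commute[OF tr_smooth[OF c(2,3)] c(1)] open_frame c by blast
  have "conn \<alpha> t c v x = B v + D v" for v
    unfolding conn_frame[OF assms(1) c] B_def D_def g_def ..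
  then show ?thesis
    unfolding curv_def curl_def p comm g_def[symmetric] cj_simps cj_bracket[OF gK]
    unfolding B_def[symmetric]
    by (simp add: bracket_def matrix_mult_simps)
qed

lemma smooth_map_curl:
  assumes "one_form X W A" "c \<in> X" "open W"
  shows "smooth_map X (fst c \<inter> W) (curl A c)"
proof -
  have o: "open (fst c \<inter> W)" using open_chart assms by blast
  have "smooth_map X (fst c \<inter> (fst c \<inter> W)) (pd c v (A c w))" for v w
    by (rule smooth_map_pd[OF one_formD(1)[OF assms(1,2)] assms(2) o])
  then have "smooth_map X (fst c \<inter> W) (pd c v (A c w))" for v w by (simp add: Int_assoc[symmetric])
  then show ?thesis unfolding curl_def[abs_def] by (intro smooth_map_diff o)
qed

lemma ksec_curv:
  assumes "holstr \<alpha>"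
  shows "ksec (\<lambda>q. (cmod q)\<^sup>2) (curv \<alpha>)"
proof (rule ksecI)
  note f = holstr_cfam[OF assms]
  fix c s assume c: "c \<in> X" "s \<in> Fr"
  show "smooth_map X (fst c \<inter> fst s) (curv \<alpha> c s)"
    unfolding curv_def[abs_def]
    by (intro smooth_map_add smooth_map_curl[OF one_form_conn[OF f c(2)] c(1) open_frame[OF c(2)]]
        smooth_map_bounded_bilinear[OF bounded_bilinear_bracket] smooth_map_conn[OF f c] open_dom c)
  fix x assume x: "x \<in> fst c" "x \<in> fst s"
  show "curv \<alpha> c s x \<in> \<kk>"
    unfolding curv_def curl_def
    by (intro k_closed pd_k[OF c x] conn_k[OF f c] conn_diff_at[OF f c] x)
  show "curv \<alpha> c s x = (cmod (coord_deriv c d x))\<^sup>2 *\<^sub>R curv \<alpha> d s x" if d: "d \<in> X" "x \<in> fst d" for d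
  proof -
    let ?q = "coord_deriv c d x"
    note of = one_form_conn[OF f c(2)]
    have "bracket (conn \<alpha> s c 1 x) (conn \<alpha> s c \<i> x) = (cmod ?q)\<^sup>2 *\<^sub>R bracket (conn \<alpha> s d 1 x) (conn \<alpha> s d \<i> x)"
    proof -
      have e: "conn \<alpha> s c v x = Re (?q * v) *\<^sub>R conn \<alpha> s d 1 x + Im (?q * v) *\<^sub>R conn \<alpha> s d \<i> x" for v
        unfolding one_formD(3)[OF of c(1) d(1) x(1) d(2) x(2)] by (rule one_formD(2)[OF of d x(2)])
      show ?thesis unfolding e cmod_power2
        by (simp add: bracket_simps bracket_swap[of "conn \<alpha> s d \<i> x" "conn \<alpha> s d 1 x"] algebra_simps power2_eq_square)
    qed
    then show ?thesis
      unfolding curv_def curl_chart_change[OF c(1) d(1) x(1) d(2) x(2) open_frame[OF c(2)] of]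
      by (simp add: scaleR_add_right)
  qed
  show "curv \<alpha> c t x = cj (tr s t x) (curv \<alpha> c s x)" if "t \<in> Fr" "x \<in> fst t" for t
    by (rule curv_frame[OF assms c(1,2) that(1) x that(2)])
qed

text \<open>Write \<theta> = P + \<i> Q with P and Q in \<kk>. The bracket of \<theta> with its star
  is 2 \<i> [P, Q] dz \<and> d(cnj z), which equals 4 [P, Q] dx \<and> dy. So this is the
  \<kk>-valued coefficient of dx \<and> dy.\<close>

definition higgs_curv :: "('x chart \<Rightarrow> ('x, 'q) frame \<Rightarrow> 'x \<Rightarrow> 'n cmat) \<Rightarrow> ('x chart \<Rightarrow> ('x, 'q) frame \<Rightarrow> 'x \<Rightarrow> 'n cmat) \<Rightarrow>
    'x chart \<Rightarrow> ('x, 'q) frame \<Rightarrow> 'x \<Rightarrow> 'n cmat" where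
  "higgs_curv \<alpha> \<theta> c s x = curv \<alpha> c s x + 4 *\<^sub>R bracket (re (\<theta> c s x)) (im (\<theta> c s x))"

lemma ksec_higgs_curv:
  assumes "holstr \<alpha>" and \<theta>: "cform (\<lambda>q. q) \<theta>"
  shows "ksec (\<lambda>q. (cmod q)\<^sup>2) (higgs_curv \<alpha> \<theta>)"
proof (rule ksecI)
  note ks = ksec_curv[OF assms(1)]
  note t = cform_cfam[OF \<theta>]
  fix c s assume c: "c \<in> X" "s \<in> Fr"
  show "smooth_map X (fst c \<inter> fst s) (higgs_curv \<alpha> \<theta> c s)"
    unfolding higgs_curv_def[abs_def]
    by (intro smooth_map_add ksec_smooth[OF ks] smooth_map_bounded_linear[OF bounded_linear_scaleR_right]
        smooth_map_bounded_bilinear[OF bounded_bilinear_bracket] smooth_map_bounded_linear[OF bounded_linear_re]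
        smooth_map_bounded_linear[OF bounded_linear_im] cfam_smooth[OF t] open_dom c)
  fix x assume x: "x \<in> fst c" "x \<in> fst s"
  show "higgs_curv \<alpha> \<theta> c s x \<in> \<kk>"
    unfolding higgs_curv_def by (intro k_closed ksecD(1)[OF ks] cfamD(3,4)[OF t] c x)
  show "higgs_curv \<alpha> \<theta> c s x = (cmod (coord_deriv c d x))\<^sup>2 *\<^sub>R higgs_curv \<alpha> \<theta> d s x" if d: "d \<in> X" "x \<in> fst d" for d
    unfolding higgs_curv_def ksecD(3)[OF ks c x d] cfamD(6)[OF t c x d] cscale_gC[OF cfamD(1)[OF t d(1) c(2) d(2) x(2)]] cmod_power2
    by (simp add: bracket_simps bracket_swap[of "im (\<theta> d s x)" "re (\<theta> d s x)"] algebra_simps power2_eq_square)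
  show "higgs_curv \<alpha> \<theta> c t' x = cj (tr s t' x) (higgs_curv \<alpha> \<theta> c s x)" if t': "t' \<in> Fr" "x \<in> fst t'" for t'
    unfolding higgs_curv_def ksecD(4)[OF ks c x t'] cform_frame[OF \<theta> c t'(1) x t'(2)]
      cj_gC[OF tr_K[OF c(2) t'(1) x(2) t'(2)] cfamD(1)[OF t c x]]
    by (simp add: cj_simps cj_bracket[OF tr_K[OF c(2) t'(1) x(2) t'(2)]])
qed

end

section \<open>The gradient of the Yang--Mills--Higgs functional\<close>

context higgs_bundle
begin

lemma metric_facts:
  assumes "c \<in> X"
  shows "x \<in> fst c \<Longrightarrow> h c x > 0" "smooth_map X (fst c) (h c)"
    "d \<in> X \<Longrightarrow> x \<in> fst c \<Longrightarrow> x \<in> fst d \<Longrightarrow> h c x = (cmod (coord_deriv c d x))\<^sup>2 * h d x"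
proof -
  show "x \<in> fst c \<Longrightarrow> h c x > 0" using metric assms unfolding hermitian_metric_def by blast
  have "smooth_on (snd c ` fst c) (\<lambda>z. h c (param c z))"
    using metric assms unfolding hermitian_metric_def comp_def by blast
  then show "smooth_map X (fst c) (h c)" by (rule smooth_map_chart[OF assms order_refl open_chart[OF assms]])
  show "d \<in> X \<Longrightarrow> x \<in> fst c \<Longrightarrow> x \<in> fst d \<Longrightarrow> h c x = (cmod (coord_deriv c d x))\<^sup>2 * h d x"
    using metric assms unfolding hermitian_metric_def by blast
qed

lemma smooth_map_inverse_metric: "c \<in> X \<Longrightarrow> smooth_map X (fst c) (\<lambda>x. inverse (h c x))"
proof -
  assume c: "c \<in> X"
  have "h c x \<noteq> 0" if "x \<in> fst c" for x using metric_facts(1)[OF c that] by simp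
  then show ?thesis by (rule smooth_map_inverse[OF metric_facts(2)[OF c] open_chart[OF c]])
qed

text \<open>The frame \<open>fr x\<close> may jump with \<open>x\<close>, but near any point it can
  be replaced by one fixed frame.\<close>

lemma smooth_map_fr:
  assumes "c \<in> X"
    and sm: "\<And>s. s \<in> Fr \<Longrightarrow> smooth_map X (fst c \<inter> fst s) (F s)"
    and eq: "\<And>s t x. s \<in> Fr \<Longrightarrow> t \<in> Fr \<Longrightarrow> x \<in> fst c \<Longrightarrow> x \<in> fst s \<Longrightarrow> x \<in> fst t \<Longrightarrow> F t x = F s x"
  shows "smooth_map X (fst c) (\<lambda>x. F (fr x) x)"
proof (rule smooth_map_local)
  fix x assume x: "x \<in> fst c"
  let ?V = "fst c \<inter> fst (fr x)"
  have "smooth_map X ?V (\<lambda>y. F (fr y) y) \<longleftrightarrow> smooth_map X ?V (F (fr x))"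
    by (rule smooth_map_cong[OF open_dom[OF assms(1) fr(1)]]) (use eq[OF fr(1) fr(1) _ _ fr(2)] in blast)
  then have "smooth_map X ?V (\<lambda>y. F (fr y) y)" using sm[OF fr(1)] by simp
  then show "\<exists>V. x \<in> V \<and> smooth_map X V (\<lambda>y. F (fr y) y)" using x fr(2) by blast
qed

lemma density_fr:
  assumes sm: "\<And>c s. c \<in> X \<Longrightarrow> s \<in> Fr \<Longrightarrow> smooth_map X (fst c \<inter> fst s) (F c s)"
    and eq: "\<And>c s t x. c \<in> X \<Longrightarrow> s \<in> Fr \<Longrightarrow> t \<in> Fr \<Longrightarrow> x \<in> fst c \<Longrightarrow> x \<in> fst s \<Longrightarrow> x \<in> fst t \<Longrightarrow> F c t x = F c s x"
    and ch: "\<And>c d s x. c \<in> X \<Longrightarrow> d \<in> X \<Longrightarrow> s \<in> Fr \<Longrightarrow> x \<in> fst c \<Longrightarrow> x \<in> fst d \<Longrightarrow> x \<in> fst s \<Longrightarrow>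
      F c s x = (cmod (coord_deriv c d x))\<^sup>2 * F d s x"
  shows "density X (\<lambda>c x. F c (fr x) x)"
proof (rule densityI)
  show "continuous_on (fst c) (\<lambda>x. F c (fr x) x)" if "c \<in> X" for c
    by (rule smooth_map_continuous_on[OF smooth_map_fr[OF that sm[OF that] eq[OF that]] open_chart[OF that]])
qed (rule ch[OF _ _ fr(1) _ _ fr(2)])

section \<open>The curvature along an affine line of pairs\<close>

lemma ksec_linear:
  assumes "ksec w m" "ksec w n"
  shows "ksec w (\<lambda>c s x. a *\<^sub>R m c s x + b *\<^sub>R n c s x)"
proof (rule ksecI)
  fix c s assume c: "c \<in> X" "s \<in> Fr"
  show "smooth_map X (fst c \<inter> fst s) (\<lambda>x. a *\<^sub>R m c s x + b *\<^sub>R n c s x)"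
    by (intro smooth_map_add smooth_map_bounded_linear[OF bounded_linear_scaleR_right] ksec_smooth[OF assms(1)]
        ksec_smooth[OF assms(2)] open_dom c)
  fix x assume x: "x \<in> fst c" "x \<in> fst s"
  show "a *\<^sub>R m c s x + b *\<^sub>R n c s x \<in> \<kk>" by (intro k_closed ksecD(1)[OF assms(1)] ksecD(1)[OF assms(2)] c x)
  show "a *\<^sub>R m c s x + b *\<^sub>R n c s x = w (coord_deriv c d x) *\<^sub>R (a *\<^sub>R m d s x + b *\<^sub>R n d s x)"
    if d: "d \<in> X" "x \<in> fst d" for d
    unfolding ksecD(3)[OF assms(1) c x d] ksecD(3)[OF assms(2) c x d] by (simp add: algebra_simps)
  show "a *\<^sub>R m c t x + b *\<^sub>R n c t x = cj (tr s t x) (a *\<^sub>R m c s x + b *\<^sub>R n c s x)" if t: "t \<in> Fr" "x \<in> fst t" for t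
    unfolding ksecD(4)[OF assms(1) c x t] ksecD(4)[OF assms(2) c x t] by (simp add: cj_simps)
qed

lemma ksec_cong:
  assumes "ksec w m" "\<And>c s x. c \<in> X \<Longrightarrow> s \<in> Fr \<Longrightarrow> x \<in> fst c \<Longrightarrow> x \<in> fst s \<Longrightarrow> n c s x = m c s x"
  shows "ksec w n"
proof (rule ksecI)
  fix c s assume c: "c \<in> X" "s \<in> Fr"
  have "smooth_map X (fst c \<inter> fst s) (n c s) \<longleftrightarrow> smooth_map X (fst c \<inter> fst s) (m c s)"
    by (rule smooth_map_cong[OF open_dom[OF c]]) (use assms(2)[OF c] in blast)
  then show "smooth_map X (fst c \<inter> fst s) (n c s)" using ksec_smooth[OF assms(1) c] by simp
  fix x assume x: "x \<in> fst c" "x \<in> fst s"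
  show "n c s x \<in> \<kk>" unfolding assms(2)[OF c x] by (rule ksecD(1)[OF assms(1) c x])
  show "n c s x = w (coord_deriv c d x) *\<^sub>R n d s x" if d: "d \<in> X" "x \<in> fst d" for d
    unfolding assms(2)[OF c x] assms(2)[OF d(1) c(2) d(2) x(2)] by (rule ksecD(3)[OF assms(1) c x d])
  show "n c t x = cj (tr s t x) (n c s x)" if t: "t \<in> Fr" "x \<in> fst t" for t
    unfolding assms(2)[OF c x] assms(2)[OF c(1) t(1) x(1) t(2)] by (rule ksecD(4)[OF assms(1) c x t])
qed

lemma cform_linear:
  assumes "cform e \<omega>" "cform e \<eta>"
  shows "cform e (\<lambda>c s x. \<omega> c s x + r *\<^sub>R \<eta> c s x)"
proof -
  note f = cform_cfam[OF assms(1)] cform_cfam[OF assms(2)]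
  have "smooth_family (\<lambda>c s x. \<omega> c s x + r *\<^sub>R \<eta> c s x) gC"
    unfolding smooth_family_def
  proof (intro ballI conjI)
    fix c s assume c: "c \<in> X" "s \<in> Fr"
    show "smooth_map X (fst c \<inter> fst s) (\<lambda>x. \<omega> c s x + r *\<^sub>R \<eta> c s x)"
      by (intro smooth_map_add smooth_map_bounded_linear[OF bounded_linear_scaleR_right] cfam_smooth[OF f(1)]
          cfam_smooth[OF f(2)] open_dom c)
    fix x assume x: "x \<in> fst c \<inter> fst s"
    show "\<omega> c s x + r *\<^sub>R \<eta> c s x \<in> gC"
      using x by (intro subspace_add[OF subspace_gC] subspace_scale[OF subspace_gC] cfamD(1)[OF f(1)] cfamD(1)[OF f(2)] c) auto
  qed
  moreover have "\<omega> c s x + r *\<^sub>R \<eta> c s x = cscale (e (coord_deriv c d x)) (\<omega> d s x + r *\<^sub>R \<eta> d s x)"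
    if c: "c \<in> X" "d \<in> X" "s \<in> Fr" "x \<in> fst c \<inter> fst d \<inter> fst s" for c d s x
    using cfamD(6)[OF f(1) c(1,3) _ _ c(2), of x] cfamD(6)[OF f(2) c(1,3) _ _ c(2), of x] c(4) by (simp add: cscale_simps)
  moreover have "\<omega> c t x + r *\<^sub>R \<eta> c t x = cj (tr s t x) (\<omega> c s x + r *\<^sub>R \<eta> c s x)"
    if c: "c \<in> X" "s \<in> Fr" "t \<in> Fr" "x \<in> fst c \<inter> fst s \<inter> fst t" for c s t x
    using cform_frame[OF assms(1) c(1-3), of x] cform_frame[OF assms(2) c(1-3), of x] c(4) by (simp add: cj_simps)
  ultimately show ?thesis unfolding cform_def cfam_def by blast
qed

text \<open>The inhomogeneous term in the frame change belongs to \<alpha> alone, so holomorphic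
  structures form an affine space over the (0,1)-forms.\<close>

lemma holstr_translate:
  assumes "holstr \<alpha>" "cform cnj a"
  shows "holstr (\<lambda>c s x. \<alpha> c s x + r *\<^sub>R a c s x)"
proof -
  note f = holstr_cfam[OF assms(1)] cform_cfam[OF assms(2)]
  have "smooth_family (\<lambda>c s x. \<alpha> c s x + r *\<^sub>R a c s x) gC"
    unfolding smooth_family_def
  proof (intro ballI conjI)
    fix c s assume c: "c \<in> X" "s \<in> Fr"
    show "smooth_map X (fst c \<inter> fst s) (\<lambda>x. \<alpha> c s x + r *\<^sub>R a c s x)"
      by (intro smooth_map_add smooth_map_bounded_linear[OF bounded_linear_scaleR_right] cfam_smooth[OF f(1)]
          cfam_smooth[OF f(2)] open_dom c)
    fix x assume x: "x \<in> fst c \<inter> fst s"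
    show "\<alpha> c s x + r *\<^sub>R a c s x \<in> gC"
      using x by (intro subspace_add[OF subspace_gC] subspace_scale[OF subspace_gC] cfamD(1)[OF f(1)] cfamD(1)[OF f(2)] c) auto
  qed
  moreover have "\<alpha> c s x + r *\<^sub>R a c s x = cscale (cnj (coord_deriv c d x)) (\<alpha> d s x + r *\<^sub>R a d s x)"
    if c: "c \<in> X" "d \<in> X" "s \<in> Fr" "x \<in> fst c \<inter> fst d \<inter> fst s" for c d s x
    using cfamD(6)[OF f(1) c(1,3) _ _ c(2), of x] cfamD(6)[OF f(2) c(1,3) _ _ c(2), of x] c(4) by (simp add: cscale_simps)
  moreover have "\<alpha> c t x + r *\<^sub>R a c t x = cj (tr s t x) (\<alpha> c s x + r *\<^sub>R a c s x)
      + matrix_inv (tr s t x) ** d_zbar (tr s t \<circ> param c) (snd c x)"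
    if c: "c \<in> X" "s \<in> Fr" "t \<in> Fr" "x \<in> fst c \<inter> fst s \<inter> fst t" for c s t x
  proof -
    have "\<alpha> c t x = cj (tr s t x) (\<alpha> c s x) + matrix_inv (tr s t x) ** d_zbar (tr s t \<circ> param c) (snd c x)"
      using assms(1) c unfolding holstr_def by blast
    then show ?thesis using cform_frame[OF assms(2) c(1-3), of x] c(4) by (simp add: cj_simps)
  qed
  ultimately show ?thesis unfolding holstr_def cfam_def by blast
qed

text \<open>The linearised curvature, that is, the covariant exterior derivative of
  \<open>conn a\<close>.\<close>

definition dcurv where
  "dcurv \<alpha> a c s x = curl (conn a s) c x + bracket (conn \<alpha> s c 1 x) (conn a s c \<i> x) + bracket (conn a s c 1 x) (conn \<alpha> s c \<i> x)"

text \<open>\<open>var1\<close> and \<open>var2\<close> are the coefficients of \<open>r\<close> and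
  \<open>r\<^sup>2\<close> in \<open>higgs_curv\<close> along an affine line, and the expansion
  stops there.\<close>

definition var1 where
  "var1 \<alpha> \<theta> a \<phi> c s x = dcurv \<alpha> a c s x + 4 *\<^sub>R (bracket (re (\<theta> c s x)) (im (\<phi> c s x)) + bracket (re (\<phi> c s x)) (im (\<theta> c s x)))"

definition var2 where
  "var2 a \<phi> c s x = bracket (conn a s c 1 x) (conn a s c \<i> x) + 4 *\<^sub>R bracket (re (\<phi> c s x)) (im (\<phi> c s x))"

lemma higgs_curv_translate:
  assumes "cfam e \<alpha>" "cfam e' a" and c: "c \<in> X" "s \<in> Fr" "x \<in> fst c" "x \<in> fst s"
  shows "higgs_curv (\<lambda>c s x. \<alpha> c s x + r *\<^sub>R a c s x) (\<lambda>c s x. \<theta> c s x + r *\<^sub>R \<phi> c s x) c s x =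
    higgs_curv \<alpha> \<theta> c s x + r *\<^sub>R var1 \<alpha> \<theta> a \<phi> c s x + r\<^sup>2 *\<^sub>R var2 a \<phi> c s x"
proof -
  have cn: "conn (\<lambda>c s x. \<alpha> c s x + r *\<^sub>R a c s x) s c v = (\<lambda>x. conn \<alpha> s c v x + r *\<^sub>R conn a s c v x)" for v
    by (rule ext) (simp add: conn_def re_simps algebra_simps)
  have d: "diff_at c (conn \<alpha> s c v) x" "diff_at c (conn a s c v) x" "diff_at c (\<lambda>x. r *\<^sub>R conn a s c v x) x" for v
    by (rule conn_diff_at[OF assms(1) c] conn_diff_at[OF assms(2) c]
        diff_at_bounded_linear[OF bounded_linear_scaleR_right conn_diff_at[OF assms(2) c]])+
  have "curl (conn (\<lambda>c s x. \<alpha> c s x + r *\<^sub>R a c s x) s) c x = curl (conn \<alpha> s) c x + r *\<^sub>R curl (conn a s) c x"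
    unfolding curl_def cn pd_add[OF d(1,3)] pd_bounded_linear[OF bounded_linear_scaleR_right d(2)]
    by (simp add: algebra_simps)
  then show ?thesis
    unfolding higgs_curv_def curv_def var1_def var2_def dcurv_def cn
    by (simp add: re_simps bracket_simps algebra_simps power2_eq_square)
qed

text \<open>The transformation laws are inherited rather than verified by hand: the two coefficients
  are recovered from the quadratic polynomial in \<open>r\<close> by its values at 1, -1 and 0, each
  of which transforms correctly as the curvature of a pair.\<close>

lemma
  assumes "holstr \<alpha>" "cform cnj a" "cform (\<lambda>q. q) \<theta>" "cform (\<lambda>q. q) \<phi>"
  shows ksec_var1: "ksec (\<lambda>q. (cmod q)\<^sup>2) (var1 \<alpha> \<theta> a \<phi>)"
    and ksec_var2: "ksec (\<lambda>q. (cmod q)\<^sup>2) (var2 a \<phi>)"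
proof -
  define H where "H r = higgs_curv (\<lambda>c s x. \<alpha> c s x + r *\<^sub>R a c s x) (\<lambda>c s x. \<theta> c s x + r *\<^sub>R \<phi> c s x)" for r
  have H: "ksec (\<lambda>q. (cmod q)\<^sup>2) (H r)" for r
    unfolding H_def by (intro ksec_higgs_curv holstr_translate cform_linear assms)
  have eq: "H r c s x = H 0 c s x + r *\<^sub>R var1 \<alpha> \<theta> a \<phi> c s x + r\<^sup>2 *\<^sub>R var2 a \<phi> c s x"
    if "c \<in> X" "s \<in> Fr" "x \<in> fst c" "x \<in> fst s" for r c s x
    unfolding H_def higgs_curv_translate[OF holstr_cfam[OF assms(1)] cform_cfam[OF assms(2)] that] by simp
  have odd: "(1/2) *\<^sub>R (y + v + w) + (- 1/2) *\<^sub>R (y - v + w) = v" for y v w :: "'n cmat"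
  proof -
    have "(1/2) *\<^sub>R (y + v + w) + (- 1/2) *\<^sub>R (y - v + w) = (1/2) *\<^sub>R ((y + v + w) - (y - v + w))"
    proof -
      have "(- 1/2) *\<^sub>R z = - ((1/2) *\<^sub>R z)" for z :: "'n cmat" by simp
      then show ?thesis by (simp only: scaleR_diff_right add_uminus_conv_diff)
    qed
    also have "(y + v + w) - (y - v + w) = v + v" by simp
    finally show ?thesis by (simp only: scaleR_half_double)
  qed
  have even: "(1/2) *\<^sub>R (y + v + w) + (1/2) *\<^sub>R (y - v + w) - y = w" for y v w :: "'n cmat"
  proof -
    have "(1/2) *\<^sub>R (y + v + w) + (1/2) *\<^sub>R (y - v + w) = (1/2) *\<^sub>R ((y + v + w) + (y - v + w))"
      by (simp only: scaleR_add_right)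
    also have "(y + v + w) + (y - v + w) = (y + w) + (y + w)" by (simp add: algebra_simps)
    finally have e: "(1/2) *\<^sub>R (y + v + w) + (1/2) *\<^sub>R (y - v + w) = y + w" by (simp only: scaleR_half_double)
    show ?thesis unfolding e by simp
  qed
  show "ksec (\<lambda>q. (cmod q)\<^sup>2) (var1 \<alpha> \<theta> a \<phi>)"
  proof (rule ksec_cong[OF ksec_linear[OF H[of 1] H[of "- 1"], of "1/2" "- 1/2"]])
    fix c s x assume d: "c \<in> X" "s \<in> Fr" "x \<in> fst c" "x \<in> fst s"
    show "var1 \<alpha> \<theta> a \<phi> c s x = (1/2) *\<^sub>R H 1 c s x + (- 1/2) *\<^sub>R H (- 1) c s x"
      using odd[of "H 0 c s x" "var1 \<alpha> \<theta> a \<phi> c s x" "var2 a \<phi> c s x"]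
      unfolding eq[OF d, of 1] eq[OF d, of "- 1"] by simp
  qed
  have "ksec (\<lambda>q. (cmod q)\<^sup>2) (\<lambda>c s x. (1/2) *\<^sub>R H 1 c s x + (1/2) *\<^sub>R H (- 1) c s x)" by (rule ksec_linear[OF H H])
  from ksec_linear[OF this H[of 0], of 1 "- 1"]
  show "ksec (\<lambda>q. (cmod q)\<^sup>2) (var2 a \<phi>)"
  proof (rule ksec_cong)
    fix c s x assume d: "c \<in> X" "s \<in> Fr" "x \<in> fst c" "x \<in> fst s"
    have "var2 a \<phi> c s x = ((1/2) *\<^sub>R H 1 c s x + (1/2) *\<^sub>R H (- 1) c s x) - H 0 c s x"
      using even[of "H 0 c s x" "var1 \<alpha> \<theta> a \<phi> c s x" "var2 a \<phi> c s x"]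
      unfolding eq[OF d, of 1] eq[OF d, of "- 1"] by simp
    then show "var2 a \<phi> c s x = 1 *\<^sub>R ((1/2) *\<^sub>R H 1 c s x + (1/2) *\<^sub>R H (- 1) c s x) + (- 1) *\<^sub>R H 0 c s x" by simp
  qed
qed

text \<open>The two weights contribute the fourth power of the modulus, of which the inverse metric
  absorbs a square.\<close>

lemma density_ip:
  assumes "ksec (\<lambda>q. (cmod q)\<^sup>2) m" "ksec (\<lambda>q. (cmod q)\<^sup>2) n"
  shows "density X (\<lambda>c x. ip (m c (fr x) x) (n c (fr x) x) * inverse (h c x))"
proof (rule density_fr[where F="\<lambda>c s x. ip (m c s x) (n c s x) * inverse (h c x)"])
  show "smooth_map X (fst c \<inter> fst s) (\<lambda>x. ip (m c s x) (n c s x) * inverse (h c x))" if "c \<in> X" "s \<in> Fr" for c s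
    by (intro smooth_map_mult smooth_map_bounded_bilinear[OF bilinear_ip] ksec_smooth[OF assms(1)] ksec_smooth[OF assms(2)]
        smooth_map_subset[OF smooth_map_inverse_metric] open_dom that) simp
  show "ip (m c t x) (n c t x) * inverse (h c x) = ip (m c s x) (n c s x) * inverse (h c x)"
    if c: "c \<in> X" "s \<in> Fr" "t \<in> Fr" "x \<in> fst c" "x \<in> fst s" "x \<in> fst t" for c s t x
    unfolding ksecD(4)[OF assms(1) c(1,2,4,5,3,6)] ksecD(4)[OF assms(2) c(1,2,4,5,3,6)]
    by (simp add: ip_cj[OF tr_K[OF c(2,3,5,6)] ksecD(1)[OF assms(1) c(1,2,4,5)] ksecD(1)[OF assms(2) c(1,2,4,5)]])
  show "ip (m c s x) (n c s x) * inverse (h c x) = (cmod (coord_deriv c d x))\<^sup>2 * (ip (m d s x) (n d s x) * inverse (h d x))"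
    if c: "c \<in> X" "d \<in> X" "s \<in> Fr" "x \<in> fst c" "x \<in> fst d" "x \<in> fst s" for c d s x
    unfolding ksecD(3)[OF assms(1) c(1,3,4,6,2,5)] ksecD(3)[OF assms(2) c(1,3,4,6,2,5)] metric_facts(3)[OF c(1,2,4,5)]
    using coord_deriv_nonzero[OF c(1,2,4,5)] by (simp add: ip_simps power2_eq_square field_simps)
qed

section \<open>The L2 pairing and the candidate gradient\<close>

definition pair where
  "pair v1 v2 w1 w2 c s x = ip (re (v1 c s x)) (re (w1 c s x)) + ip (im (v1 c s x)) (im (w1 c s x))
     + (ip (re (v2 c s x)) (re (w2 c s x)) + ip (im (v2 c s x)) (im (w2 c s x)))"

lemma density_pair_aux:
  assumes f: "cform e v" "cform e w" and e: "\<And>q. cmod (e q) = cmod q"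
  shows "density X (\<lambda>c x. ip (re (v c (fr x) x)) (re (w c (fr x) x)) + ip (im (v c (fr x) x)) (im (w c (fr x) x)))"
proof (rule density_fr[where F="\<lambda>c s x. ip (re (v c s x)) (re (w c s x)) + ip (im (v c s x)) (im (w c s x))"])
  note g = cform_cfam[OF f(1)] cform_cfam[OF f(2)]
  show "smooth_map X (fst c \<inter> fst s) (\<lambda>x. ip (re (v c s x)) (re (w c s x)) + ip (im (v c s x)) (im (w c s x)))"
    if "c \<in> X" "s \<in> Fr" for c s
    by (intro smooth_map_add smooth_map_bounded_bilinear[OF bilinear_ip] smooth_map_bounded_linear[OF bounded_linear_re]
        smooth_map_bounded_linear[OF bounded_linear_im] cfam_smooth[OF g(1)] cfam_smooth[OF g(2)] open_dom that)
  show "ip (re (v c t x)) (re (w c t x)) + ip (im (v c t x)) (im (w c t x)) = ip (re (v c s x)) (re (w c s x)) + ip (im (v c s x)) (im (w c s x))"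
    if c: "c \<in> X" "s \<in> Fr" "t \<in> Fr" "x \<in> fst c" "x \<in> fst s" "x \<in> fst t" for c s t x
    using ip_cj[OF tr_K[OF c(2,3,5,6)]] cj_gC[OF tr_K[OF c(2,3,5,6)]] cfamD[OF g(1) c(1,2,4,5)] cfamD[OF g(2) c(1,2,4,5)]
    unfolding cform_frame[OF f(1) c] cform_frame[OF f(2) c] by simp
  show "ip (re (v c s x)) (re (w c s x)) + ip (im (v c s x)) (im (w c s x)) =
     (cmod (coord_deriv c d x))\<^sup>2 * (ip (re (v d s x)) (re (w d s x)) + ip (im (v d s x)) (im (w d s x)))"
    if c: "c \<in> X" "d \<in> X" "s \<in> Fr" "x \<in> fst c" "x \<in> fst d" "x \<in> fst s" for c d s x
    unfolding cfamD(6)[OF g(1) c(1,3,4,6,2,5)] cfamD(6)[OF g(2) c(1,3,4,6,2,5)]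
      cscale_gC[OF cfamD(1)[OF g(1) c(2,3,5,6)]] cscale_gC[OF cfamD(1)[OF g(2) c(2,3,5,6)]]
      e[of "coord_deriv c d x", symmetric] cmod_power2
    by (simp add: ip_simps algebra_simps power2_eq_square)
qed

lemma density_pair:
  assumes "cform cnj v1" "cform (\<lambda>q. q) v2" "cform cnj w1" "cform (\<lambda>q. q) w2"
  shows "density X (\<lambda>c x. pair v1 v2 w1 w2 c (fr x) x)"
  unfolding pair_def
  using density_linear[OF density_pair_aux[OF assms(1,3)] density_pair_aux[OF assms(2,4)], of 1 1] by simp

text \<open>Numerator and \<open>h\<close> scale by the same factor under coordinate changes, so the
  quotient is a section of the real adjoint bundle.\<close>

definition mu where
  "mu \<alpha> \<theta> c s x = inverse (h c x) *\<^sub>R higgs_curv \<alpha> \<theta> c s x"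

lemma ksec_mu:
  assumes "holstr \<alpha>" "cform (\<lambda>q. q) \<theta>"
  shows "ksec (\<lambda>_. 1) (mu \<alpha> \<theta>)"
proof (rule ksecI)
  note ks = ksec_higgs_curv[OF assms]
  fix c s assume c: "c \<in> X" "s \<in> Fr"
  show "smooth_map X (fst c \<inter> fst s) (mu \<alpha> \<theta> c s)"
    unfolding mu_def[abs_def]
    by (intro smooth_map_scaleR smooth_map_subset[OF smooth_map_inverse_metric] ksec_smooth[OF ks] open_dom c) simp
  fix x assume x: "x \<in> fst c" "x \<in> fst s"
  show "mu \<alpha> \<theta> c s x \<in> \<kk>" unfolding mu_def by (intro k_closed ksecD(1)[OF ks] c x)
  show "mu \<alpha> \<theta> c s x = 1 *\<^sub>R mu \<alpha> \<theta> d s x" if d: "d \<in> X" "x \<in> fst d" for d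
    unfolding mu_def ksecD(3)[OF ks c x d] metric_facts(3)[OF c(1) d(1) x(1) d(2)]
    using coord_deriv_nonzero[OF c(1) d(1) x(1) d(2)] by simp
  show "mu \<alpha> \<theta> c t x = cj (tr s t x) (mu \<alpha> \<theta> c s x)" if t: "t \<in> Fr" "x \<in> fst t" for t
    unfolding mu_def ksecD(4)[OF ks c x t] by (simp add: cj_simps)
qed

text \<open>\<open>grad1\<close> is -2 \<i> times the (0,1)-derivative of \<open>mu\<close>, and
  \<open>grad2\<close> is -2 \<i> times the bracket of \<theta> with \<open>mu\<close>. They are
  written with their real and imaginary parts in \<kk> displayed, because these are what integration
  by parts produces.\<close>

definition grad1 where
  "grad1 \<alpha> \<theta> c s x = nabla \<alpha> (mu \<alpha> \<theta>) c s \<i> x + cscale \<i> (- nabla \<alpha> (mu \<alpha> \<theta>) c s 1 x)"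

definition grad2 where
  "grad2 \<alpha> \<theta> c s x = 2 *\<^sub>R bracket (im (\<theta> c s x)) (mu \<alpha> \<theta> c s x) + cscale \<i> (- 2 *\<^sub>R bracket (re (\<theta> c s x)) (mu \<alpha> \<theta> c s x))"

lemma nabla_k:
  assumes "cfam e \<alpha>" "ksec w \<mu>" and c: "c \<in> X" "s \<in> Fr" "x \<in> fst c" "x \<in> fst s"
  shows "nabla \<alpha> \<mu> c s v x \<in> \<kk>"
  unfolding nabla_def
  by (intro k_closed pd_k[OF c] ksecD(1,2)[OF assms(2)] conn_k[OF assms(1)] c)

lemma smooth_map_nabla:
  assumes "cfam e \<alpha>" "ksec w \<mu>" and c: "c \<in> X" "s \<in> Fr"
  shows "smooth_map X (fst c \<inter> fst s) (nabla \<alpha> \<mu> c s v)"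
proof -
  have "smooth_map X (fst c \<inter> (fst c \<inter> fst s)) (pd c v (\<mu> c s))"
    by (rule smooth_map_pd[OF ksec_smooth[OF assms(2) c] c(1) open_dom[OF c]])
  then have "smooth_map X (fst c \<inter> fst s) (pd c v (\<mu> c s))" by (simp add: Int_assoc[symmetric])
  then show ?thesis unfolding nabla_def[abs_def]
    by (intro smooth_map_add smooth_map_bounded_bilinear[OF bounded_bilinear_bracket] smooth_map_conn[OF assms(1)]
        ksec_smooth[OF assms(2)] open_dom c)
qed

text \<open>For weight 1 the covariant derivative is a 1-form; for another weight the derivative of
  the scaling factor would intervene.\<close>

lemma nabla_chart:
  assumes "holstr \<alpha>" "ksec (\<lambda>_. 1) \<mu>" and c: "c \<in> X" "d \<in> X" "s \<in> Fr" "x \<in> fst c" "x \<in> fst d" "x \<in> fst s"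
  shows "nabla \<alpha> \<mu> c s v x = Re (coord_deriv c d x * v) *\<^sub>R nabla \<alpha> \<mu> d s 1 x + Im (coord_deriv c d x * v) *\<^sub>R nabla \<alpha> \<mu> d s \<i> x"
proof -
  let ?W = "fst c \<inter> fst d \<inter> fst s"
  have oW: "open ?W" using open_chart open_frame c by blast
  note of = one_form_conn[OF holstr_cfam[OF assms(1)] c(3)]
  have "pd c v (\<mu> c s) x = pd c v (\<mu> d s) x"
    by (rule pd_cong[OF oW c(1)]) (use c(4-6) ksecD(3)[OF assms(2) c(1,3) _ _ c(2)] in auto)
  also have "\<dots> = pd d (coord_deriv c d x * v) (\<mu> d s) x"
    by (rule pd_chart_change[OF c(1,2,4,5) ksecD(2)[OF assms(2) c(2,3,5,6)]])
  also have "\<dots> = Re (coord_deriv c d x * v) *\<^sub>R pd d 1 (\<mu> d s) x + Im (coord_deriv c d x * v) *\<^sub>R pd d \<i> (\<mu> d s) x"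
    by (rule pd_complex[OF ksecD(2)[OF assms(2) c(2,3,5,6)]])
  finally have p: "pd c v (\<mu> c s) x = \<dots>" .
  have "conn \<alpha> s c v x = conn \<alpha> s d (coord_deriv c d x * v) x" by (rule one_formD(3)[OF of c(1,2,4,5,6)])
  also have "\<dots> = Re (coord_deriv c d x * v) *\<^sub>R conn \<alpha> s d 1 x + Im (coord_deriv c d x * v) *\<^sub>R conn \<alpha> s d \<i> x"
    by (rule one_formD(2)[OF of c(2,5,6)])
  finally have q: "conn \<alpha> s c v x = \<dots>" .
  have m: "\<mu> c s x = \<mu> d s x" using ksecD(3)[OF assms(2) c(1,3,4,6,2,5)] by simp
  show ?thesis unfolding nabla_def p q m by (simp add: bracket_simps algebra_simps)
qed

lemma grad_re_im:
  assumes "holstr \<alpha>" "cform (\<lambda>q. q) \<theta>" and c: "c \<in> X" "s \<in> Fr" "x \<in> fst c" "x \<in> fst s"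
  shows "grad1 \<alpha> \<theta> c s x \<in> gC" "re (grad1 \<alpha> \<theta> c s x) = nabla \<alpha> (mu \<alpha> \<theta>) c s \<i> x" "im (grad1 \<alpha> \<theta> c s x) = - nabla \<alpha> (mu \<alpha> \<theta>) c s 1 x"
    "grad2 \<alpha> \<theta> c s x \<in> gC" "re (grad2 \<alpha> \<theta> c s x) = 2 *\<^sub>R bracket (im (\<theta> c s x)) (mu \<alpha> \<theta> c s x)"
    "im (grad2 \<alpha> \<theta> c s x) = - 2 *\<^sub>R bracket (re (\<theta> c s x)) (mu \<alpha> \<theta> c s x)"
proof -
  have 1: "nabla \<alpha> (mu \<alpha> \<theta>) c s \<i> x \<in> \<kk>" "- nabla \<alpha> (mu \<alpha> \<theta>) c s 1 x \<in> \<kk>"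
    by (intro k_closed nabla_k[OF holstr_cfam[OF assms(1)] ksec_mu[OF assms(1,2)] c])+
  have 2: "2 *\<^sub>R bracket (im (\<theta> c s x)) (mu \<alpha> \<theta> c s x) \<in> \<kk>" "- 2 *\<^sub>R bracket (re (\<theta> c s x)) (mu \<alpha> \<theta> c s x) \<in> \<kk>"
    by (intro k_closed cfamD(3,4)[OF cform_cfam[OF assms(2)] c] ksecD(1)[OF ksec_mu[OF assms(1,2)] c])+
  show "grad1 \<alpha> \<theta> c s x \<in> gC" "grad2 \<alpha> \<theta> c s x \<in> gC" unfolding grad1_def grad2_def by (intro gC_I 1 2)+
  show "re (grad1 \<alpha> \<theta> c s x) = nabla \<alpha> (mu \<alpha> \<theta>) c s \<i> x" "im (grad1 \<alpha> \<theta> c s x) = - nabla \<alpha> (mu \<alpha> \<theta>) c s 1 x"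
    unfolding grad1_def by (rule re_decomp[OF 1] im_decomp[OF 1])+
  show "re (grad2 \<alpha> \<theta> c s x) = 2 *\<^sub>R bracket (im (\<theta> c s x)) (mu \<alpha> \<theta> c s x)"
    "im (grad2 \<alpha> \<theta> c s x) = - 2 *\<^sub>R bracket (re (\<theta> c s x)) (mu \<alpha> \<theta> c s x)"
    unfolding grad2_def by (rule re_decomp[OF 2] im_decomp[OF 2])+
qed

lemma cform_grad1:
  assumes a: "holstr \<alpha>" and t: "cform (\<lambda>q. q) \<theta>"
  shows "cform cnj (grad1 \<alpha> \<theta>)"
  unfolding cform_def cfam_def smooth_family_def
proof (intro conjI ballI)
  note m = ksec_mu[OF a t]
  note f = holstr_cfam[OF a]
  fix c s assume c: "c \<in> X" "s \<in> Fr"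
  show "smooth_map X (fst c \<inter> fst s) (grad1 \<alpha> \<theta> c s)"
    unfolding grad1_def[abs_def]
    by (intro smooth_map_add smooth_map_bounded_linear[OF bounded_bilinear.bounded_linear_right[OF bounded_bilinear_cscale]]
        smooth_map_minus smooth_map_nabla[OF f m] open_dom c)
  show "x \<in> fst c \<inter> fst s \<Longrightarrow> grad1 \<alpha> \<theta> c s x \<in> gC" for x using grad_re_im(1)[OF a t c] by blast
next
  note m = ksec_mu[OF a t]
  fix c d s x assume c: "c \<in> X" "d \<in> X" "s \<in> Fr" and "x \<in> fst c \<inter> fst d \<inter> fst s"
  then have x: "x \<in> fst c" "x \<in> fst d" "x \<in> fst s" by auto
  have e: "cscale (cnj q) (N + cscale \<i> (- M)) = (Re (q * \<i>) *\<^sub>R M + Im (q * \<i>) *\<^sub>R N) + cscale \<i> (- (Re (q * 1) *\<^sub>R M + Im (q * 1) *\<^sub>R N))"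
    for q and M N :: "'n cmat"
    by (subst cscale_complex) (simp add: cscale_simps scaleR_add_right scaleR_diff_right cscale_of_real[of "- 1", simplified])
  show "grad1 \<alpha> \<theta> c s x = cscale (cnj (coord_deriv c d x)) (grad1 \<alpha> \<theta> d s x)"
    unfolding grad1_def nabla_chart[OF a m c x] e ..
next
  note m = ksec_mu[OF a t]
  fix c s t' x assume c: "c \<in> X" "s \<in> Fr" "t' \<in> Fr" and "x \<in> fst c \<inter> fst s \<inter> fst t'"
  then have x: "x \<in> fst c" "x \<in> fst s" "x \<in> fst t'" by auto
  show "grad1 \<alpha> \<theta> c t' x = cj (tr s t' x) (grad1 \<alpha> \<theta> c s x)"
    unfolding grad1_def nabla_frame[OF a m c x] by (simp add: cj_simps cj_cscale cscale_simps)
qed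

lemma cform_grad2:
  assumes a: "holstr \<alpha>" and t: "cform (\<lambda>q. q) \<theta>"
  shows "cform (\<lambda>q. q) (grad2 \<alpha> \<theta>)"
  unfolding cform_def cfam_def smooth_family_def
proof (intro conjI ballI)
  note m = ksec_mu[OF a t]
  note f = cform_cfam[OF t]
  fix c s assume c: "c \<in> X" "s \<in> Fr"
  show "smooth_map X (fst c \<inter> fst s) (grad2 \<alpha> \<theta> c s)"
    unfolding grad2_def[abs_def]
    by (intro smooth_map_add smooth_map_bounded_linear[OF bounded_bilinear.bounded_linear_right[OF bounded_bilinear_cscale]]
        smooth_map_bounded_linear[OF bounded_linear_scaleR_right] smooth_map_bounded_bilinear[OF bounded_bilinear_bracket]
        smooth_map_bounded_linear[OF bounded_linear_re] smooth_map_bounded_linear[OF bounded_linear_im]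
        cfam_smooth[OF f] ksec_smooth[OF m] open_dom c)
  show "x \<in> fst c \<inter> fst s \<Longrightarrow> grad2 \<alpha> \<theta> c s x \<in> gC" for x using grad_re_im(4)[OF a t c] by blast
next
  note m = ksec_mu[OF a t]
  note f = cform_cfam[OF t]
  fix c d s x assume c: "c \<in> X" "d \<in> X" "s \<in> Fr" and "x \<in> fst c \<inter> fst d \<inter> fst s"
  then have x: "x \<in> fst c" "x \<in> fst d" "x \<in> fst s" by auto
  have mm: "mu \<alpha> \<theta> c s x = mu \<alpha> \<theta> d s x" using ksecD(3)[OF m c(1,3) x(1,3) c(2) x(2)] by simp
  show "grad2 \<alpha> \<theta> c s x = cscale (coord_deriv c d x) (grad2 \<alpha> \<theta> d s x)"
    unfolding grad2_def mm cfamD(6)[OF f c(1,3) x(1,3) c(2) x(2)] cscale_gC[OF cfamD(1)[OF f c(2,3) x(2,3)]]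
    unfolding cscale_complex[of "coord_deriv c d x"]
    by (simp add: cscale_simps bracket_simps cscale_of_real[of "- 1", simplified] algebra_simps)
next
  note m = ksec_mu[OF a t]
  note f = cform_cfam[OF t]
  fix c s t' x assume c: "c \<in> X" "s \<in> Fr" "t' \<in> Fr" and "x \<in> fst c \<inter> fst s \<inter> fst t'"
  then have x: "x \<in> fst c" "x \<in> fst s" "x \<in> fst t'" by auto
  note gK = tr_K[OF c(2,3) x(2,3)]
  show "grad2 \<alpha> \<theta> c t' x = cj (tr s t' x) (grad2 \<alpha> \<theta> c s x)"
    unfolding grad2_def cform_frame[OF t c x] cj_gC[OF gK cfamD(1)[OF f c(1,2) x(1,2)]] ksecD(4)[OF m c(1,2) x(1,2) c(3) x(3)]
    by (simp add: cj_simps cj_cscale cscale_simps cj_bracket[OF gK])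
qed

section \<open>Integration by parts\<close>

lemma one_form_beta:
  assumes m: "ksec (\<lambda>_. 1) \<mu>" and a: "cform cnj a"
  shows "one_form X UNIV (\<lambda>c v x. ip (\<mu> c (fr x) x) (conn a (fr x) c v x))"
proof (rule one_formI)
  note f = cform_cfam[OF a]
  have "smooth_map X (fst c) (\<lambda>x. ip (\<mu> c (fr x) x) (conn a (fr x) c v x))" if c: "c \<in> X" for c v
  proof (rule smooth_map_fr[where F="\<lambda>s x. ip (\<mu> c s x) (conn a s c v x)", OF c])
    show "smooth_map X (fst c \<inter> fst s) (\<lambda>x. ip (\<mu> c s x) (conn a s c v x))" if "s \<in> Fr" for s
      by (intro smooth_map_bounded_bilinear[OF bilinear_ip] ksec_smooth[OF m] smooth_map_conn[OF f] open_dom that c)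
    show "ip (\<mu> c t x) (conn a t c v x) = ip (\<mu> c s x) (conn a s c v x)"
      if s: "s \<in> Fr" "t \<in> Fr" "x \<in> fst c" "x \<in> fst s" "x \<in> fst t" for s t x
      unfolding ksecD(4)[OF m c s(1,3,4,2,5)] conn_frame_cform[OF a c s]
      by (rule ip_cj[OF tr_K[OF s(1,2,4,5)] ksecD(1)[OF m c s(1,3,4)] conn_k[OF f c s(1,3,4)]])
  qed
  then show "c \<in> X \<Longrightarrow> smooth_map X (fst c \<inter> UNIV) (\<lambda>x. ip (\<mu> c (fr x) x) (conn a (fr x) c v x))" for c v by simp
  show "ip (\<mu> c (fr x) x) (conn a (fr x) c v x) =
      Re v *\<^sub>R ip (\<mu> c (fr x) x) (conn a (fr x) c 1 x) + Im v *\<^sub>R ip (\<mu> c (fr x) x) (conn a (fr x) c \<i> x)" for c v x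
    by (simp add: conn_def ip_simps)
  show "ip (\<mu> c (fr x) x) (conn a (fr x) c v x) = ip (\<mu> d (fr x) x) (conn a (fr x) d (coord_deriv c d x * v) x)"
    if "c \<in> X" "d \<in> X" "x \<in> fst c" "x \<in> fst d" for c d v x
    using one_formD(3)[OF one_form_conn[OF f fr(1)] that(1,2,3,4) fr(2), of v] ksecD(3)[OF m that(1) fr(1) that(3) fr(2) that(2,4)]
    by simp
qed

text \<open>The exact term of the integration by parts. Since \<open>ip\<close> is invariant under
  brackets, the connection terms can be added and cancel, which turns the partial derivatives of the
  Leibniz rule into covariant ones.\<close>

lemma curl_beta:
  assumes al: "holstr \<alpha>" and m: "ksec (\<lambda>_. 1) \<mu>" and a: "cform cnj a" and c: "c \<in> X" "x \<in> fst c"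
  shows "curl (\<lambda>c v x. ip (\<mu> c (fr x) x) (conn a (fr x) c v x)) c x =
    ip (nabla \<alpha> \<mu> c (fr x) 1 x) (conn a (fr x) c \<i> x) - ip (nabla \<alpha> \<mu> c (fr x) \<i> x) (conn a (fr x) c 1 x)
      + ip (\<mu> c (fr x) x) (dcurv \<alpha> a c (fr x) x)"
proof -
  note f = cform_cfam[OF a]
  note g = holstr_cfam[OF al]
  define s where "s = fr x"
  have s: "s \<in> Fr" "x \<in> fst s" using fr by (auto simp: s_def)
  have pc: "param c (snd c x) = x" using c by simp
  note dm = ksecD(2)[OF m c(1) s(1) c(2) s(2)]
  note dc = conn_diff_at[OF f c(1) s(1) c(2) s(2)]
  have p: "pd c v (\<lambda>y. ip (\<mu> c (fr y) y) (conn a (fr y) c w y)) x =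
      ip (\<mu> c s x) (pd c v (conn a s c w) x) + ip (pd c v (\<mu> c s) x) (conn a s c w x)" for v w
  proof -
    have "pd c v (\<lambda>y. ip (\<mu> c (fr y) y) (conn a (fr y) c w y)) x = pd c v (\<lambda>y. ip (\<mu> c s y) (conn a s c w y)) x"
    proof (rule pd_cong[OF open_dom[OF c(1) s(1)] c(1)])
      show "x \<in> fst c \<inter> fst s" "x \<in> fst c" using c s by auto
      fix y assume "y \<in> fst c \<inter> fst s"
      then have y: "y \<in> fst c" "y \<in> fst s" by auto
      show "ip (\<mu> c (fr y) y) (conn a (fr y) c w y) = ip (\<mu> c s y) (conn a s c w y)"
        unfolding ksecD(4)[OF m c(1) s(1) y fr] conn_frame_cform[OF a c(1) s(1) fr(1) y fr(2)]
        by (rule ip_cj[OF tr_K[OF s(1) fr(1) y(2) fr(2)] ksecD(1)[OF m c(1) s(1) y] conn_k[OF f c(1) s(1) y]])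
    qed
    then show ?thesis unfolding pd_bounded_bilinear[OF bilinear_ip dm dc pc] .
  qed
  note kA = conn_k[OF g c(1) s(1) c(2) s(2)] and kB = conn_k[OF f c(1) s(1) c(2) s(2)] and kM = ksecD(1)[OF m c(1) s(1) c(2) s(2)]
  have br: "ip (\<mu> c s x) (bracket (conn \<alpha> s c v x) (conn a s c w x)) = - ip (bracket (conn \<alpha> s c v x) (\<mu> c s x)) (conn a s c w x)" for v w
    by (rule ip_bracket_right[OF kA kM kB])
  show ?thesis
    unfolding s_def[symmetric] nabla_def dcurv_def curl_def[of "conn a s"]
    unfolding curl_def p bracket_swap[of "conn a s c 1 x"]
    by (simp add: ip_simps br s_def[symmetric])
qed

text \<open>Invariance of \<open>ip\<close> moves the brackets from the variation onto
  \<open>mu\<close>. The factor 2 reflects that \<open>conn a\<close> doubles real and imaginary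
  parts, and that \<open>var1\<close> carries a 4 where \<open>grad2\<close> carries a 2.\<close>

lemma first_variation:
  assumes al: "holstr \<alpha>" and th: "cform (\<lambda>q. q) \<theta>" and a: "cform cnj a" and ph: "cform (\<lambda>q. q) \<phi>" and c: "c \<in> X" "x \<in> fst c"
  shows "ip (mu \<alpha> \<theta> c (fr x) x) (var1 \<alpha> \<theta> a \<phi> c (fr x) x) =
    curl (\<lambda>c v x. ip (mu \<alpha> \<theta> c (fr x) x) (conn a (fr x) c v x)) c x + 2 * pair (grad1 \<alpha> \<theta>) (grad2 \<alpha> \<theta>) a \<phi> c (fr x) x"
proof -
  note m = ksec_mu[OF al th]
  define s where "s = fr x"
  have s: "s \<in> Fr" "x \<in> fst s" using fr by (auto simp: s_def)
  note k1 = cfamD(3,4)[OF cform_cfam[OF th] c(1) s(1) c(2) s(2)]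
  note k2 = cfamD(3,4)[OF cform_cfam[OF ph] c(1) s(1) c(2) s(2)]
  note k3 = ksecD(1)[OF m c(1) s(1) c(2) s(2)]
  have b1: "ip (mu \<alpha> \<theta> c s x) (bracket (re (\<theta> c s x)) (im (\<phi> c s x))) = - ip (bracket (re (\<theta> c s x)) (mu \<alpha> \<theta> c s x)) (im (\<phi> c s x))"
    by (rule ip_bracket_right[OF k1(1) k3 k2(2)])
  have b2: "ip (mu \<alpha> \<theta> c s x) (bracket (re (\<phi> c s x)) (im (\<theta> c s x))) = ip (bracket (im (\<theta> c s x)) (mu \<alpha> \<theta> c s x)) (re (\<phi> c s x))"
    unfolding bracket_swap[of "re (\<phi> c s x)"] using ip_bracket_right[OF k1(2) k3 k2(1)] by (simp add: ip_simps)
  show ?thesis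
    unfolding curl_beta[OF al m a c] var1_def pair_def s_def[symmetric] grad_re_im[OF al th c(1) s(1) c(2) s(2)] conn_simps[of a]
    by (simp add: ip_simps b1 b2)
qed

lemma surface_integral_scale:
  assumes "density X \<eta>"
  shows "surface_integral X (\<lambda>c x. r * \<eta> c x) = r * surface_integral X \<eta>" "density X (\<lambda>c x. r * \<eta> c x)"
  using surface_integral_linear[OF assms assms, of r 0] density_linear[OF assms assms, of r 0] by simp_all

text \<open>The integrand is a polynomial of degree at most four in \<open>r\<close> with densities
  as coefficients, so the derivative at 0 is the integral of the linear coefficient. The division by
  4 comes from passing from dx \<and> dy to dz \<and> d(cnj z).\<close>

theorem functional_has_derivative:
  assumes al: "holstr \<alpha>" and th: "cform (\<lambda>q. q) \<theta>" and a: "cform cnj a" and ph: "cform (\<lambda>q. q) \<phi>"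
  defines "H r \<equiv> higgs_curv (\<lambda>c s x. \<alpha> c s x + r *\<^sub>R a c s x) (\<lambda>c s x. \<theta> c s x + r *\<^sub>R \<phi> c s x)"
  shows "((\<lambda>r. surface_integral X (\<lambda>c x. ip (H r c (fr x) x) (H r c (fr x) x) / 4 * inverse (h c x))) has_real_derivative
    surface_integral X (\<lambda>c x. pair (grad1 \<alpha> \<theta>) (grad2 \<alpha> \<theta>) a \<phi> c (fr x) x)) (at 0)"
proof -
  let ?m0 = "higgs_curv \<alpha> \<theta>" and ?m1 = "var1 \<alpha> \<theta> a \<phi>" and ?m2 = "var2 a \<phi>"
  note ks = ksec_higgs_curv[OF al th] ksec_var1[OF al a th ph] ksec_var2[OF al a th ph]
  define D where "D m n c x = ip (m c (fr x) x) (n c (fr x) x) * inverse (h c x)" for m n c x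
  have dD: "density X (D m n)" if "ksec (\<lambda>q. (cmod q)\<^sup>2) m" "ksec (\<lambda>q. (cmod q)\<^sup>2) n" for m n
    using density_ip[OF that] by (simp add: D_def[abs_def])
  \<comment> \<open>\<open>e j\<close> is the coefficient of \<open>r ^ j\<close> in a quarter of
    the squared norm over \<open>h\<close>.\<close>
  define e where "e j = (if j = 0 then (\<lambda>c x. (1/4) * D ?m0 ?m0 c x) else if j = 1 then (\<lambda>c x. (1/2) * D ?m0 ?m1 c x)
     else if j = 2 then (\<lambda>c x. (1/4) * D ?m1 ?m1 c x + (1/2) * D ?m0 ?m2 c x)
     else if j = 3 then (\<lambda>c x. (1/2) * D ?m1 ?m2 c x) else (\<lambda>c x. (1/4) * D ?m2 ?m2 c x))" for j :: nat
  have de: "density X (e j)" for j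
  proof -
    note q = surface_integral_scale(2)[OF dD[OF ks(1) ks(1)], of "1/4"] surface_integral_scale(2)[OF dD[OF ks(1) ks(2)], of "1/2"]
      density_linear[OF dD[OF ks(2) ks(2)] dD[OF ks(1) ks(3)], of "1/4" "1/2"]
      surface_integral_scale(2)[OF dD[OF ks(2) ks(3)], of "1/2"] surface_integral_scale(2)[OF dD[OF ks(3) ks(3)], of "1/4"]
    show ?thesis using q by (simp add: e_def)
  qed
  have J: "surface_integral X (\<lambda>c x. ip (H r c (fr x) x) (H r c (fr x) x) / 4 * inverse (h c x)) = (\<Sum>j<5. r ^ j * surface_integral X (e j))" for r
  proof -
    have "surface_integral X (\<lambda>c x. ip (H r c (fr x) x) (H r c (fr x) x) / 4 * inverse (h c x)) = surface_integral X (\<lambda>c x. \<Sum>j<5. r ^ j * e j c x)"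
    proof (rule surface_integral_cong)
      fix c x assume c: "c \<in> X" "x \<in> fst c"
      show "ip (H r c (fr x) x) (H r c (fr x) x) / 4 * inverse (h c x) = (\<Sum>j<5. r ^ j * e j c x)"
        unfolding H_def higgs_curv_translate[OF holstr_cfam[OF al] cform_cfam[OF a] c(1) fr(1) c(2) fr(2)]
        by (simp add: ip_simps e_def D_def eval_nat_numeral algebra_simps add_divide_distrib
            ip_sym[of "?m1 c (fr x) x" "?m0 c (fr x) x"] ip_sym[of "?m2 c (fr x) x" "?m0 c (fr x) x"] ip_sym[of "?m2 c (fr x) x" "?m1 c (fr x) x"])
    qed
    also have "\<dots> = (\<Sum>j<5. r ^ j * surface_integral X (e j))"
      by (subst surface_integral_sum) (auto simp: surface_integral_scale[OF de])
    finally show ?thesis .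
  qed
  \<comment> \<open>This is half of the first variation: its exact part integrates to 0, and the
    factor 2 in front of \<open>pair\<close> cancels.\<close>
  have e1: "surface_integral X (e 1) = surface_integral X (\<lambda>c x. pair (grad1 \<alpha> \<theta>) (grad2 \<alpha> \<theta>) a \<phi> c (fr x) x)"
  proof -
    let ?\<beta> = "\<lambda>c v x. ip (mu \<alpha> \<theta> c (fr x) x) (conn a (fr x) c v x)"
    note ob = one_form_beta[OF ksec_mu[OF al th] a]
    note dp = density_pair[OF cform_grad1[OF al th] cform_grad2[OF al th] a ph]
    have "surface_integral X (e 1) = surface_integral X (\<lambda>c x. (1/2) * curl ?\<beta> c x + 1 * pair (grad1 \<alpha> \<theta>) (grad2 \<alpha> \<theta>) a \<phi> c (fr x) x)"
    proof (rule surface_integral_cong)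
      fix c x assume c: "c \<in> X" "x \<in> fst c"
      have "e 1 c x = (1/2) * ip (mu \<alpha> \<theta> c (fr x) x) (?m1 c (fr x) x)"
        by (simp add: e_def D_def mu_def ip_simps)
      then show "e 1 c x = (1/2) * curl ?\<beta> c x + 1 * pair (grad1 \<alpha> \<theta>) (grad2 \<alpha> \<theta>) a \<phi> c (fr x) x"
        unfolding first_variation[OF al th a ph c] by simp
    qed
    also have "\<dots> = (1/2) * surface_integral X (curl ?\<beta>) + 1 * surface_integral X (\<lambda>c x. pair (grad1 \<alpha> \<theta>) (grad2 \<alpha> \<theta>) a \<phi> c (fr x) x)"
      by (rule surface_integral_linear[OF density_curl[OF ob] dp])
    finally show ?thesis using surface_integral_curl[OF ob] by simp
  qed
  have "((\<lambda>r. \<Sum>j<5. r ^ j * k j) has_real_derivative k 1) (at 0)" for k :: "nat \<Rightarrow> real"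
    by (simp add: eval_nat_numeral) (auto intro!: derivative_eq_intros)
  from this[of "\<lambda>j. surface_integral X (e j)"] show ?thesis unfolding J e1 .
qed

text \<open>Testing against the difference of the two candidates is enough: its pairing with itself
  integrates to 0, so by definiteness of \<open>ip\<close> it vanishes at every point.\<close>

lemma gradient_unique:
  assumes v: "cform cnj v1" "cform (\<lambda>q. q) v2" and u: "cform cnj u1" "cform (\<lambda>q. q) u2"
    and eq: "surface_integral X (\<lambda>c x. pair v1 v2 (\<lambda>c s x. v1 c s x - u1 c s x) (\<lambda>c s x. v2 c s x - u2 c s x) c (fr x) x)
      = surface_integral X (\<lambda>c x. pair u1 u2 (\<lambda>c s x. v1 c s x - u1 c s x) (\<lambda>c s x. v2 c s x - u2 c s x) c (fr x) x)"
    and c: "c \<in> X" "s \<in> Fr" "x \<in> fst c" "x \<in> fst s"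
  shows "v1 c s x = u1 c s x" "v2 c s x = u2 c s x"
proof -
  define w1 where "w1 = (\<lambda>c s x. v1 c s x - u1 c s x)"
  define w2 where "w2 = (\<lambda>c s x. v2 c s x - u2 c s x)"
  have w: "cform cnj w1" "cform (\<lambda>q. q) w2"
    using cform_linear[OF v(1) u(1), of "- 1"] cform_linear[OF v(2) u(2), of "- 1"] by (simp_all add: w1_def w2_def)
  have sp: "pair w1 w2 w1 w2 c s x = 1 * pair v1 v2 w1 w2 c s x + (- 1) * pair u1 u2 w1 w2 c s x" for c s x
    by (simp add: pair_def w1_def w2_def re_simps ip_simps)
  have "surface_integral X (\<lambda>c x. pair w1 w2 w1 w2 c (fr x) x) = 0"
    unfolding sp surface_integral_linear[OF density_pair[OF v w] density_pair[OF u w]]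
    using eq by (simp add: w1_def w2_def)
  have nn: "pair w1 w2 w1 w2 c s x \<ge> 0" if "c \<in> X" "s \<in> Fr" "x \<in> fst c" "x \<in> fst s" for c s x
    unfolding pair_def using cfamD(3,4)[OF cform_cfam[OF w(1)] that] cfamD(3,4)[OF cform_cfam[OF w(2)] that]
    by (intro add_nonneg_nonneg ip_nonneg)
  let ?s = "fr x"
  have z: "pair w1 w2 w1 w2 c ?s x = 0"
    by (rule surface_integral_nonneg_eq_0[OF density_pair[OF w w] _ \<open>surface_integral X _ = 0\<close> c(1,3)]) (use nn fr in blast)
  note k = cfamD(3,4)[OF cform_cfam[OF w(1)] c(1) fr(1) c(3) fr(2)] cfamD(3,4)[OF cform_cfam[OF w(2)] c(1) fr(1) c(3) fr(2)]
  have "re (w1 c ?s x) = 0" "im (w1 c ?s x) = 0" "re (w2 c ?s x) = 0" "im (w2 c ?s x) = 0"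
    using z ip_nonneg[OF k(1)] ip_nonneg[OF k(2)] ip_nonneg[OF k(3)] ip_nonneg[OF k(4)]
      ip_pos[OF k(1)] ip_pos[OF k(2)] ip_pos[OF k(3)] ip_pos[OF k(4)] unfolding pair_def by linarith+
  then have "w1 c ?s x = 0" "w2 c ?s x = 0"
    using cfamD(5)[OF cform_cfam[OF w(1)] c(1) fr(1) c(3) fr(2)] cfamD(5)[OF cform_cfam[OF w(2)] c(1) fr(1) c(3) fr(2)]
    by (simp_all add: cscale_simps)
  then have "w1 c s x = 0" "w2 c s x = 0"
    using cform_frame[OF w(1) c(1) fr(1) c(2,3) fr(2) c(4)] cform_frame[OF w(2) c(1) fr(1) c(2,3) fr(2) c(4)]
    by (simp_all add: cj_simps)
  then show "v1 c s x = u1 c s x" "v2 c s x = u2 c s x" by (simp_all add: w1_def w2_def)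
qed

end

section \<open>The gradient flow preserves Higgs bundles\<close>

context higgs_bundle
begin

text \<open>The operator \<open>dbar_ad\<close> expressed through \<open>pd\<close>, so that the
  product rules for \<open>pd\<close> apply.\<close>

definition dbar where
  "dbar \<alpha> \<theta> c s x = cscale (1/2) (pd c 1 (\<theta> c s) x + cscale \<i> (pd c \<i> (\<theta> c s) x)) + bracket (\<alpha> c s x) (\<theta> c s x)"

text \<open>The gradient at \<open>(\<alpha>, \<theta>)\<close> is the infinitesimal action of the complex gauge transformation
  \<open>2 \<i> \<mu>\<close>, under which \<open>dbar \<alpha> \<theta>\<close> is equivariant.\<close>

lemma dbar_grad:
  assumes al: "holstr \<alpha>" and th: "cform (\<lambda>q. q) \<theta>" and c: "c \<in> X" "s \<in> Fr" "x \<in> fst c" "x \<in> fst s"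
  shows "cscale (1/2) (pd c 1 (grad2 \<alpha> \<theta> c s) x + cscale \<i> (pd c \<i> (grad2 \<alpha> \<theta> c s) x)) +
      (bracket (grad1 \<alpha> \<theta> c s x) (\<theta> c s x) + bracket (\<alpha> c s x) (grad2 \<alpha> \<theta> c s x))
    = - bracket (dbar \<alpha> \<theta> c s x) (cscale (2 * \<i>) (mu \<alpha> \<theta> c s x))"
proof -
  note m = ksec_mu[OF al th]
  note f = cform_cfam[OF th]
  note g = holstr_cfam[OF al]
  have pc: "param c (snd c x) = x" using c by simp
  define T where "T = \<theta> c s x"
  define A where "A = \<alpha> c s x"
  define M where "M = mu \<alpha> \<theta> c s x"
  define T1 where "T1 e = pd c e (\<theta> c s) x" for e
  define M1 where "M1 e = pd c e (mu \<alpha> \<theta> c s) x" for e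
  \<comment> \<open>Back in complex notation, the gradient is visibly the action of
    \<open>cscale (2 * \<i>)\<close> applied to \<open>mu\<close>.\<close>
  have g2: "grad2 \<alpha> \<theta> c s y = cscale (- 2 * \<i>) (bracket (\<theta> c s y) (mu \<alpha> \<theta> c s y))" if y: "y \<in> fst c" "y \<in> fst s" for y
  proof -
    have t: "cscale 2 Y = 2 *\<^sub>R Y" for Y :: "'n cmat" using cscale_of_real[of 2 Y] by simp
    have "cscale (- 2 * \<i>) (bracket (P + cscale \<i> Q) N) = 2 *\<^sub>R bracket Q N + cscale \<i> (- 2 *\<^sub>R bracket P N)" for P Q N :: "'n cmat"
      by (subst cscale_complex) (simp add: bracket_simps bracket_cscale_left cscale_simps algebra_simps)
    then show ?thesis unfolding grad2_def using cfamD(5)[OF f c(1,2) y] by metis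
  qed
  have c2: "cscale (- 2) Y = - (2 *\<^sub>R Y)" "cscale (\<i> * 2) Y = 2 *\<^sub>R cscale \<i> Y" "cscale (2 * \<i>) Y = 2 *\<^sub>R cscale \<i> Y" for Y :: "'n cmat"
    using cscale_of_real[of "- 2" Y] cscale_of_real[of 2 "cscale \<i> Y"] by (simp_all add: mult.commute)
  have g1: "grad1 \<alpha> \<theta> c s x = cscale (- \<i>) (M1 1 + cscale \<i> (M1 \<i>)) + cscale (- 2 * \<i>) (bracket A M)"
  proof -
    have "grad1 \<alpha> \<theta> c s x = (M1 \<i> + bracket (conn \<alpha> s c \<i> x) M) + cscale \<i> (- (M1 1 + bracket (conn \<alpha> s c 1 x) M))"
      by (simp add: grad1_def nabla_def M1_def M_def)
    also have "\<dots> = cscale (- \<i>) (M1 1 + cscale \<i> (M1 \<i>)) + cscale (- 2 * \<i>) (bracket (re A + cscale \<i> (im A)) M)"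
      by (simp add: conn_simps A_def bracket_simps bracket_cscale_left cscale_simps)
        (simp add: cscale_complex[of "- \<i>"] cscale_complex[of "- (2 * \<i>)"] c2 algebra_simps)
    also have "re A + cscale \<i> (im A) = A" using cfamD(5)[OF g c] by (simp add: A_def)
    finally show ?thesis .
  qed
  have p2: "pd c e (grad2 \<alpha> \<theta> c s) x = cscale (- 2 * \<i>) (bracket T (M1 e) + bracket (T1 e) M)" for e
  proof -
    note d1 = cfamD(2)[OF f c] and d2 = ksecD(2)[OF m c]
    have "pd c e (grad2 \<alpha> \<theta> c s) x = pd c e (\<lambda>y. cscale (- 2 * \<i>) (bracket (\<theta> c s y) (mu \<alpha> \<theta> c s y))) x"
      by (rule pd_cong[OF open_dom[OF c(1,2)] c(1)]) (use c g2 in auto)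
    also have "\<dots> = cscale (- 2 * \<i>) (pd c e (\<lambda>y. bracket (\<theta> c s y) (mu \<alpha> \<theta> c s y)) x)"
      by (rule pd_bounded_linear[OF bounded_bilinear.bounded_linear_right[OF bounded_bilinear_cscale]
          diff_at_bounded_bilinear[OF bounded_bilinear_bracket d1 d2 pc]])
    finally show ?thesis
      unfolding pd_bounded_bilinear[OF bounded_bilinear_bracket d1 d2 pc] T_def M_def T1_def M1_def .
  qed
  \<comment> \<open>The terms with \<open>A\<close> match by the Jacobi identity; the derivatives of
    \<open>mu\<close> coming from the two components of the gradient cancel each other.\<close>
  have jac: "bracket A (bracket T M) = bracket (bracket A T) M + bracket T (bracket A M)"
    using bracket_jacobi[of A T M] by simp
  show ?thesis
    unfolding p2 g1 g2[OF c(3,4)] dbar_def T_def[symmetric] A_def[symmetric] M_def[symmetric] T1_def[symmetric]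
    by (simp add: bracket_simps bracket_cscale_left bracket_cscale_right cscale_simps jac
        bracket_swap[of "M1 1" T] bracket_swap[of "M1 \<i>" T] bracket_swap[of "bracket A M" T])
qed

end

section \<open>Vanishing of solutions of linear differential equations\<close>

lemma linear_ode_zero_nonneg:
  fixes f :: "real \<Rightarrow> 'a::real_inner"
  assumes f: "\<And>t. (f has_vector_derivative D t) (at t)" and D: "\<And>t. norm (D t) \<le> B t * norm (f t)"
    and B: "continuous_on UNIV B" and f0: "f 0 = 0" and t: "t \<ge> 0"
  shows "f t = 0"
proof -
  have "compact (B ` {0..t})" by (intro compact_continuous_image continuous_on_subset[OF B]) auto
  then have "bounded (B ` {0..t})" by (rule compact_imp_bounded)
  then obtain C where C0: "\<forall>y\<in>B ` {0..t}. norm y \<le> C" unfolding bounded_iff by blast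
  have C: "B s \<le> C" if "s \<in> {0..t}" for s using bspec[OF C0 imageI[OF that]] by simp
  \<comment> \<open>Gronwall's argument: \<open>C\<close> bounds \<open>B\<close> on the compact
    interval, and the exponential weight makes the squared norm nonincreasing.\<close>
  define g where "g s = (f s \<bullet> f s) * exp (- 2 * C * s)" for s
  have dg: "(g has_real_derivative (2 * (f s \<bullet> D s) - 2 * C * (f s \<bullet> f s)) * exp (- 2 * C * s)) (at s)" for s
  proof -
    have "((\<lambda>s. f s \<bullet> f s) has_real_derivative 2 * (f s \<bullet> D s)) (at s)"
      using bounded_bilinear.has_vector_derivative[OF bounded_bilinear_inner f[of s] f[of s]]
      by (simp add: has_real_derivative_iff_has_vector_derivative inner_commute)
    moreover have "((\<lambda>s. exp (- 2 * C * s)) has_real_derivative exp (- 2 * C * s) * (- 2 * C)) (at s)"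
      by (auto intro!: derivative_eq_intros)
    ultimately show ?thesis unfolding g_def[abs_def]
      by (rule DERIV_mult[THEN DERIV_cong]) (simp add: algebra_simps)
  qed
  have "g t \<le> g 0"
  proof (rule DERIV_nonpos_imp_nonincreasing[OF t])
    fix s assume s: "0 \<le> s" "s \<le> t"
    have "f s \<bullet> D s \<le> norm (f s) * norm (D s)" by (rule norm_cauchy_schwarz)
    also have "\<dots> \<le> norm (f s) * (C * norm (f s))"
      using D[of s] C[of s] s by (intro mult_left_mono order_trans[OF D] mult_right_mono) auto
    also have "\<dots> = C * (f s \<bullet> f s)" by (simp add: dot_square_norm power2_eq_square)
    finally have "(2 * (f s \<bullet> D s) - 2 * C * (f s \<bullet> f s)) * exp (- 2 * C * s) \<le> 0"
      by (intro mult_nonpos_nonneg) auto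
    then show "\<exists>y. (g has_real_derivative y) (at s) \<and> y \<le> 0" using dg by blast
  qed
  then have "f t \<bullet> f t \<le> 0" by (simp add: g_def f0 mult_le_0_iff not_le)
  then show ?thesis by (metis inner_eq_zero_iff inner_ge_zero order_antisym)
qed

text \<open>The estimate is symmetric in time, so negative times follow from the reversed
  curve.\<close>

lemma linear_ode_zero:
  fixes f :: "real \<Rightarrow> 'a::real_inner"
  assumes f: "\<And>t. (f has_vector_derivative D t) (at t)" and D: "\<And>t. norm (D t) \<le> B t * norm (f t)"
    and B: "continuous_on UNIV B" and f0: "f 0 = 0"
  shows "f t = 0"
proof (cases "t \<ge> 0")
  case True then show ?thesis by (rule linear_ode_zero_nonneg[OF f D B f0])
next
  case False
  have "(\<lambda>t. f (- t)) (- t) = 0"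
  proof (rule linear_ode_zero_nonneg[where f="\<lambda>t. f (- t)" and D="\<lambda>t. - D (- t)" and B="\<lambda>t. B (- t)"])
    show "((\<lambda>t. f (- t)) has_vector_derivative - D (- t)) (at t)" for t
    proof -
      have "(uminus has_vector_derivative - 1) (at t)" using has_vector_derivative_minus[OF has_vector_derivative_id] .
      from vector_diff_chain_at[OF this, of f "D (- t)"] f[of "- t"] show ?thesis by (simp add: o_def)
    qed
    show "norm (- D (- t)) \<le> B (- t) * norm (f (- t))" for t using D[of "- t"] by simp
    show "continuous_on UNIV (\<lambda>t. B (- t))"
      by (rule continuous_on_compose2[OF B]) (auto intro: continuous_intros)
  qed (use f0 False in auto)
  then show ?thesis by simp
qed

section \<open>Frames induced on the extended bundle\<close>

lemma ext_class:
  assumes K: "subgroup K GL" and KG: "K \<subseteq> G" and P: "principal_bundle X K E" and p: "p \<in> total E"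
  shows "y \<in> ext_rel G K E `` {(p, mat 1)} \<longleftrightarrow> (\<exists>k\<in>K. y = (ract E p k, matrix_inv k))"
proof -
  note KS = subgroup_GL[OF K]
  have G1: "mat 1 \<in> G" using KG KS(1) by blast
  show ?thesis
  proof
    assume "y \<in> ext_rel G K E `` {(p, mat 1)}"
    then obtain q h k where y: "y = (q, h)" "k \<in> K" "q = ract E p k" "mat 1 = k ** h"
      by (auto simp: ext_rel_def)
    then show "\<exists>k\<in>K. y = (ract E p k, matrix_inv k)" using matrix_inv_unique[of k h] by auto
  next
    assume "\<exists>k\<in>K. y = (ract E p k, matrix_inv k)"
    then obtain k where k: "k \<in> K" "y = (ract E p k, matrix_inv k)" by blast
    have "ract E p k \<in> total E" using P p k(1) unfolding principal_bundle_def by blast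
    then show "y \<in> ext_rel G K E `` {(p, mat 1)}"
      using k p G1 KS(4)[OF k(1)] KS(5)[OF k(1)] KG by (auto simp: ext_rel_def)
  qed
qed

lemma principal_bundleD:
  assumes "principal_bundle X K E"
  shows "p \<in> total E \<Longrightarrow> ract E p (mat 1) = p"
    "p \<in> total E \<Longrightarrow> g \<in> K \<Longrightarrow> ract E p g \<in> total E"
    "p \<in> total E \<Longrightarrow> g \<in> K \<Longrightarrow> k \<in> K \<Longrightarrow> ract E (ract E p g) k = ract E p (g ** k)"
    "p \<in> total E \<Longrightarrow> q \<in> total E \<Longrightarrow> proj E p = proj E q \<Longrightarrow> \<exists>!k. k \<in> K \<and> q = ract E p k"
    "\<exists>s\<in>frames E. x \<in> fst s" "s \<in> frames E \<Longrightarrow> open (fst s)"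
    "s \<in> frames E \<Longrightarrow> x \<in> fst s \<Longrightarrow> snd s x \<in> total E" "s \<in> frames E \<Longrightarrow> x \<in> fst s \<Longrightarrow> proj E (snd s x) = x"
    "s \<in> frames E \<Longrightarrow> t \<in> frames E \<Longrightarrow> smooth_map X (fst s \<inter> fst t) (transition K E s t)"
  using assms unfolding principal_bundle_def by blast+

text \<open>The class of (p, 1) consists of the pairs (p k, k^-1) with k in \<open>K\<close>.
  Comparing the classes given by two induced frames forces the relating element of \<open>G\<close>
  to be the transition function of the K-bundle. So induced frames have K-valued transition
  functions, on which all metric computations rest.\<close>

lemma transition_properties:
  fixes G K :: "'n::finite cmat set" and E :: "('p, 'x::t2_space, 'n) pbundle"
  assumes K: "subgroup K GL" and KG: "K \<subseteq> G" and P: "principal_bundle X K E"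
    and s: "s \<in> frames E" "x \<in> fst s" and t: "t \<in> frames E" "x \<in> fst t"
  shows "transition K E s t x \<in> K" "transition K E t s x = matrix_inv (transition K E s t x)"
    "transition G (extension G K E) (ext_frame G K E s) (ext_frame G K E t) x = transition K E s t x"
proof -
  note KS = subgroup_GL[OF K] and PD = principal_bundleD[OF P]
  define p where "p = snd s x"
  define q where "q = snd t x"
  have p: "p \<in> total E" "proj E p = x" and q: "q \<in> total E" "proj E q = x"
    unfolding p_def q_def using PD(7,8) s t by blast+
  have ex: "\<exists>!k. k \<in> K \<and> q = ract E p k" using PD(4)[OF p(1) q(1)] p q by simp
  have ex': "\<exists>!k. k \<in> K \<and> p = ract E q k" using PD(4)[OF q(1) p(1)] p q by simp
  define g where "g = transition K E s t x"
  have g: "g \<in> K" "q = ract E p g"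
    using theI'[OF ex] unfolding g_def transition_def p_def q_def by auto
  then show gK: "transition K E s t x \<in> K" by (simp add: g_def)
  have "p = ract E q (matrix_inv g)"
    unfolding g(2) PD(3)[OF p(1) g(1) KS(4)[OF g(1)]] by (simp add: KS(5)[OF g(1)] PD(1)[OF p(1)])
  then show "transition K E t s x = matrix_inv (transition K E s t x)"
    unfolding transition_def[of K E t s] p_def[symmetric] q_def[symmetric] g_def[symmetric]
    using ex' KS(4)[OF g(1)] by (intro the1_equality) auto
  have cls: "y \<in> ext_rel G K E `` {(r, mat 1)} \<longleftrightarrow> (\<exists>k\<in>K. y = (ract E r k, matrix_inv k))" if "r \<in> total E" for r y
    by (rule ext_class[OF K KG P that])
  define cl where "cl r = ext_rel G K E `` {(r, mat 1)}" for r
  define act :: "'n cmat \<Rightarrow> 'p \<times> 'n cmat \<Rightarrow> 'p \<times> 'n cmat" where "act h z = (case z of (r, h') \<Rightarrow> (r, h' ** h))" for h and z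
  note cls = cls[folded cl_def]
  have "(THE h. h \<in> G \<and> cl q = act h ` cl p) = g"
  proof (rule the_equality)
    have "cl q \<subseteq> act g ` cl p"
    proof
      fix y assume "y \<in> cl q"
      then obtain k where k: "k \<in> K" "y = (ract E q k, matrix_inv k)" using cls[OF q(1)] by blast
      have inv: "matrix_inv (g ** k) ** g = matrix_inv k"
      proof -
        have "(g ** k) ** (matrix_inv k ** matrix_inv g) = g ** (k ** matrix_inv k) ** matrix_inv g"
          by (simp only: matrix_mul_assoc)
        also have "\<dots> = mat 1" by (simp add: KS(5)[OF k(1)] KS(5)[OF g(1)])
        finally have "matrix_inv (g ** k) = matrix_inv k ** matrix_inv g" by (rule matrix_inv_unique)
        then show ?thesis by (simp add: matrix_mul_assoc[symmetric] KS(6)[OF g(1)])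
      qed
      have "(ract E p (g ** k), matrix_inv (g ** k)) \<in> cl p"
        using cls[OF p(1)] KS(3)[OF g(1) k(1)] by blast
      moreover have "y = act g (ract E p (g ** k), matrix_inv (g ** k))"
        unfolding k(2) g(2) PD(3)[OF p(1) g(1) k(1)] by (simp add: inv act_def)
      ultimately show "y \<in> act g ` cl p" by blast
    qed
    moreover have "act g ` cl p \<subseteq> cl q"
    proof
      fix y assume "y \<in> act g ` cl p"
      then obtain z where z: "z \<in> cl p" "y = act g z" by blast
      then obtain k where k: "k \<in> K" "z = (ract E p k, matrix_inv k)" using cls[OF p(1)] by blast
      let ?l = "matrix_inv g ** k"
      have l: "?l \<in> K" using KS(3)[OF KS(4)[OF g(1)] k(1)] .
      have "ract E q ?l = ract E p k"
        unfolding g(2) PD(3)[OF p(1) g(1) l] by (simp add: matrix_mul_assoc KS(5)[OF g(1)])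
      moreover have "matrix_inv ?l = matrix_inv k ** g"
      proof (rule matrix_inv_unique)
        have "?l ** (matrix_inv k ** g) = matrix_inv g ** (k ** matrix_inv k) ** g" by (simp only: matrix_mul_assoc)
        then show "?l ** (matrix_inv k ** g) = mat 1" by (simp add: KS(5)[OF k(1)] KS(6)[OF g(1)])
      qed
      ultimately have "y = (ract E q ?l, matrix_inv ?l)" using z(2) k(2) by (simp add: act_def)
      then show "y \<in> cl q" using cls[OF q(1)] l by blast
    qed
    ultimately show "g \<in> G \<and> cl q = act g ` cl p" using g(1) KG by blast
    fix h assume h: "h \<in> G \<and> cl q = act h ` cl p"
    \<comment> \<open>The representative with second component 1 pins down the group element: it
      forces \<open>k = g\<close> and then \<open>h = k\<close>.\<close>
    have "(ract E q (mat 1), matrix_inv (mat 1)) \<in> cl q" using cls[OF q(1)] KS(1) by blast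
    then have "(q, mat 1) \<in> cl q" unfolding PD(1)[OF q(1)] matrix_inv_unique[OF matrix_mul_lid] .
    then obtain z where z: "z \<in> cl p" "(q, mat 1) = act h z" using h by blast
    then obtain k where k: "k \<in> K" "z = (ract E p k, matrix_inv k)" using cls[OF p(1)] by blast
    have qk: "q = ract E p k" "mat 1 = matrix_inv k ** h" using z(2) k(2) by (simp_all add: act_def)
    then have "k = g" using ex g k(1) by blast
    have "k ** (matrix_inv k ** h) = k" unfolding qk(2)[symmetric] by (rule matrix_mul_rid)
    then show "h = g" using KS(5)[OF k(1)] \<open>k = g\<close> by (simp add: matrix_mul_assoc)
  qed
  then show "transition G (extension G K E) (ext_frame G K E s) (ext_frame G K E t) x = transition K E s t x"
    unfolding transition_def[of G] extension_def ext_frame_def g_def[symmetric] cl_def act_def[abs_def]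
    by (simp add: p_def q_def)
qed

section \<open>Comparison with the concrete definitions\<close>

locale analytic_higgs = compact_riemann X + lie_data K re im ip
  for X :: "('x::t2_space) chart set" and K :: "'n::finite cmat set" and re im ip +
  fixes G :: "'n cmat set" and \<rho> :: "'n cmat \<Rightarrow> 'm::finite cmat" and E :: "('p, 'x, 'n) pbundle"
    and h :: "'x chart \<Rightarrow> 'x \<Rightarrow> real"
  assumes KG: "K \<subseteq> G" and principal: "principal_bundle X K E" and hermitian: "hermitian_metric X h"
    and lie_G: "lie_algebra G = gC"
    and lie_re: "Z \<in> gC \<Longrightarrow> lie_re K Z = re Z" and lie_im: "Z \<in> gC \<Longrightarrow> lie_im K Z = im Z"
    and inner_k: "A \<in> gC \<Longrightarrow> B \<in> gC \<Longrightarrow> inner_k G \<rho> A B = ip A B"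
begin

abbreviation "Ext \<equiv> extension G K E"
abbreviation "ef \<equiv> ext_frame G K E"

lemma fst_ef [simp]: "fst (ef s) = fst s"
  by (simp add: ext_frame_def)

lemma frames_Ext: "frames Ext = ef ` frames E"
  by (simp add: extension_def)

lemma frame_at: "frame_at E x \<in> frames E" "x \<in> fst (frame_at E x)"
proof -
  have "frame_at E x \<in> frames E \<and> x \<in> fst (frame_at E x)"
    unfolding frame_at_def by (rule someI_ex) (use principal_bundleD(5)[OF principal] in blast)
  then show "frame_at E x \<in> frames E" "x \<in> fst (frame_at E x)" by auto
qed

lemmas tp = transition_properties[OF H KG principal]

text \<open>Every frame of the extension is induced from a frame of the K-bundle, so the K-valued
  transition functions required by \<open>higgs_bundle\<close> are available although the structure
  group is \<open>G\<close>.\<close>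

sublocale higgs_bundle X K re im ip "frames Ext" "transition G Ext" "\<lambda>x. ef (frame_at E x)" h
proof (intro higgs_bundle.intro higgs_bundle_axioms.intro)
  show "compact_riemann X" "lie_data K re im ip" by (rule compact_riemann_axioms lie_data_axioms)+
  show "hermitian_metric X h" by (rule hermitian)
  show "ef (frame_at E x) \<in> frames Ext" "x \<in> fst (ef (frame_at E x))" for x
    using frame_at by (auto simp: frames_Ext)
  show "open (fst s)" if "s \<in> frames Ext" for s
    using that principal_bundleD(6)[OF principal] by (auto simp: frames_Ext)
  show "transition G Ext s t x \<in> K" if st: "s \<in> frames Ext" "t \<in> frames Ext" "x \<in> fst s" "x \<in> fst t" for s t x
  proof -
    obtain s' t' where "s' \<in> frames E" "t' \<in> frames E" "s = ef s'" "t = ef t'" using st(1,2) frames_Ext by blast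
    then show ?thesis using tp(1,3)[of s' x t'] st(3,4) by simp
  qed
  show "transition G Ext t s x = matrix_inv (transition G Ext s t x)"
    if st: "s \<in> frames Ext" "t \<in> frames Ext" "x \<in> fst s" "x \<in> fst t" for s t x
  proof -
    obtain s' t' where "s' \<in> frames E" "t' \<in> frames E" "s = ef s'" "t = ef t'" using st(1,2) frames_Ext by blast
    then show ?thesis using tp(2,3)[of s' x t'] tp(3)[of t' x s'] st(3,4) by simp
  qed
  show "smooth_map X (fst s \<inter> fst t) (transition G Ext s t)" if st: "s \<in> frames Ext" "t \<in> frames Ext" for s t
  proof -
    obtain s' t' where s: "s' \<in> frames E" "t' \<in> frames E" "s = ef s'" "t = ef t'" using st(1,2) frames_Ext by blast
    have o: "open (fst s' \<inter> fst t')" using principal_bundleD(6)[OF principal] s(1,2) by blast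
    have "smooth_map X (fst s' \<inter> fst t') (transition G Ext s t) \<longleftrightarrow> smooth_map X (fst s' \<inter> fst t') (transition K E s' t')"
      by (rule smooth_map_cong[OF o]) (use tp(3)[OF s(1) _ s(2)] s(3,4) in blast)
    then show ?thesis using principal_bundleD(9)[OF principal s(1,2)] s(3,4) by simp
  qed
qed

definition dom :: "'x chart \<Rightarrow> ('x, ('p \<times> 'n cmat) set) frame \<Rightarrow> 'x \<Rightarrow> bool" where
  "dom c s x \<longleftrightarrow> c \<in> X \<and> s \<in> frames Ext \<and> x \<in> fst c \<inter> fst s"

lemma smooth_map_family:
  assumes "c \<in> X" "s \<in> frames Ext"
  shows "smooth_on (snd c ` (fst c \<inter> fst s)) (\<omega> \<circ> param c) \<longleftrightarrow> smooth_map X (fst c \<inter> fst s) \<omega>"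
proof
  assume "smooth_on (snd c ` (fst c \<inter> fst s)) (\<omega> \<circ> param c)"
  then show "smooth_map X (fst c \<inter> fst s) \<omega>"
    by (intro smooth_map_chart[OF assms(1) _ open_dom[OF assms]]) (auto simp: comp_def)
next
  assume "smooth_map X (fst c \<inter> fst s) \<omega>"
  from smooth_map_onD[OF this assms(1)] show "smooth_on (snd c ` (fst c \<inter> fst s)) (\<omega> \<circ> param c)"
    by (simp add: comp_def Int_assoc[symmetric])
qed

lemma local_family_smooth:
  assumes "local_family X G Ext \<omega>"
  shows "smooth_family \<omega> gC"
  using assms smooth_map_family unfolding local_family_def smooth_family_def lie_G by blast

lemma ad_forms_cform:
  assumes "\<omega> \<in> ad_forms X G Ext m n"
  shows "cform (\<lambda>q. q ^ m * cnj q ^ n) \<omega>"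
  using assms local_family_smooth unfolding ad_forms_def cform_def cfam_def cj_def Let_def by blast

lemma ad_forms_01: "\<omega> \<in> ad_forms X G Ext 0 1 \<Longrightarrow> cform cnj \<omega>"
  using ad_forms_cform[of \<omega> 0 1] by simp

lemma ad_forms_10: "\<omega> \<in> ad_forms X G Ext 1 0 \<Longrightarrow> cform (\<lambda>q. q) \<omega>"
  using ad_forms_cform[of \<omega> 1 0] by simp

lemma holomorphic_structures_holstr: "\<alpha> \<in> holomorphic_structures X G Ext \<Longrightarrow> holstr \<alpha>"
  using local_family_smooth unfolding holomorphic_structures_def holstr_def cfam_def cj_def Let_def by blast

lemma holstr_holomorphic_structures:
  assumes "local_family X G Ext \<alpha>" "holstr \<alpha>"
  shows "\<alpha> \<in> holomorphic_structures X G Ext"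
  using assms unfolding holomorphic_structures_def holstr_def cfam_def cj_def Let_def by blast

lemma cform_10_ad_forms:
  assumes "local_family X G Ext \<omega>" "cform (\<lambda>q. q) \<omega>"
  shows "\<omega> \<in> ad_forms X G Ext 1 0"
  using assms unfolding ad_forms_def cform_def cfam_def cj_def Let_def power_one_right power_0 mult_1_right by blast

text \<open>The forms in \<open>ad_forms\<close> vanish off the domains, whereas
  \<open>cform\<close> speaks only about the domains; cutting off turns a local formula into an
  admissible form.\<close>

lemma cform_ad_forms:
  assumes "cform (\<lambda>q. q ^ m * cnj q ^ n) \<omega>"
  shows "(\<lambda>c s x. if dom c s x then \<omega> c s x else 0) \<in> ad_forms X G Ext m n" (is "?\<omega> \<in> _")
proof -
  note f = cform_cfam[OF assms]
  have d: "?\<omega> c s x = \<omega> c s x" if "c \<in> X" "s \<in> frames Ext" "x \<in> fst c" "x \<in> fst s" for c s x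
    using that by (simp add: dom_def)
  have "local_family X G Ext ?\<omega>"
    unfolding local_family_def lie_G
  proof (intro conjI allI ballI impI)
    show "\<not> (c \<in> X \<and> s \<in> frames Ext \<and> x \<in> fst c \<inter> fst s) \<Longrightarrow> ?\<omega> c s x = 0" for c s x by (auto simp: dom_def)
    show "?\<omega> c s x \<in> gC" if "c \<in> X" "s \<in> frames Ext" "x \<in> fst c \<inter> fst s" for c s x
      using cfamD(1)[OF f] d that by auto
    show "smooth_on (snd c ` (fst c \<inter> fst s)) (?\<omega> c s \<circ> param c)" if c: "c \<in> X" "s \<in> frames Ext" for c s
      unfolding smooth_map_family[OF c]
      by (subst smooth_map_cong[OF open_dom[OF c], of _ "\<omega> c s"]) (use d c cfam_smooth[OF f c] in auto)
  qed
  moreover have "?\<omega> c s x = cscale (coord_deriv c e x ^ m * cnj (coord_deriv c e x) ^ n) (?\<omega> e s x)"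
    if c: "c \<in> X" "e \<in> X" "s \<in> frames Ext" "x \<in> fst c \<inter> fst e \<inter> fst s" for c e s x
    using cfamD(6)[OF f c(1,3) _ _ c(2), of x] d[OF c(1,3), of x] d[OF c(2,3), of x] c(4) by auto
  moreover have "?\<omega> c t x = matrix_inv (transition G Ext s t x) ** ?\<omega> c s x ** transition G Ext s t x"
    if c: "c \<in> X" "s \<in> frames Ext" "t \<in> frames Ext" "x \<in> fst c \<inter> fst s \<inter> fst t" for c s t x
    using cform_frame[OF assms c(1-3), of x] d[OF c(1,2), of x] d[OF c(1,3), of x] c(4) by (auto simp: cj_def)
  ultimately show ?thesis unfolding ad_forms_def Let_def by blast
qed

text \<open>Existence is the gauge behaviour of \<open>conn\<close>. For uniqueness, a linear
  \<kk>-valued form is recovered from its (0,1)-part because real and imaginary parts in \<kk> are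
  unique; off the domains both forms are 0 by convention.\<close>

lemma chern:
  assumes "\<alpha> \<in> holomorphic_structures X G Ext"
  shows "chern_connection X G K E \<alpha> = (\<lambda>c s x v. if c \<in> X \<and> s \<in> frames E \<and> x \<in> fst c \<inter> fst s then conn \<alpha> (ef s) c v x else 0)"
    (is "_ = ?A")
proof -
  note hs = holomorphic_structures_holstr[OF assms]
  note f = holstr_cfam[OF hs]
  have efE: "s \<in> frames E \<Longrightarrow> ef s \<in> frames Ext" for s by (simp add: frames_Ext)
  have d: "?A c s x v = conn \<alpha> (ef s) c v x" if "c \<in> X" "s \<in> frames E" "x \<in> fst c" "x \<in> fst s" for c s x v
    using that by simp
  have half: "cscale (1/2) (conn \<alpha> (ef s) c 1 x + cscale \<i> (conn \<alpha> (ef s) c \<i> x)) = \<alpha> c (ef s) x"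
    if "c \<in> X" "s \<in> frames E" "x \<in> fst c" "x \<in> fst s" for c s x
  proof -
    have "cscale (1/2) (2 *\<^sub>R P + cscale \<i> (2 *\<^sub>R Q)) = P + cscale \<i> Q" for P Q :: "'n cmat"
      by (simp add: cscale_def scaleR_conv_of_real vec_eq_iff algebra_simps)
    then show ?thesis using cfamD(5)[OF f that(1) efE[OF that(2)] that(3)] that(4) by (simp add: conn_simps)
  qed
  show ?thesis unfolding chern_connection_def
  proof (rule the_equality)
    have "?A \<in> connections X K E"
      unfolding connections_def Let_def
    proof (intro CollectI conjI allI ballI)
      show "linear (?A c s x)" for c s x
        by (rule linearI) (auto simp: conn_def algebra_simps)
      fix v
      show "local_family X K E (\<lambda>c s x. ?A c s x v)"
        unfolding local_family_def
      proof (intro conjI allI ballI impI)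
        show "?A c s x v \<in> lie_algebra K" if "c \<in> X" "s \<in> frames E" "x \<in> fst c \<inter> fst s" for c s x
          using conn_k[OF f that(1) efE[OF that(2)]] that by simp
        fix c s assume c: "c \<in> X" "s \<in> frames E"
        have "smooth_on (snd c ` (fst c \<inter> fst (ef s))) (conn \<alpha> (ef s) c v \<circ> param c)"
          unfolding smooth_map_family[OF c(1) efE[OF c(2)]] by (rule smooth_map_conn[OF f c(1) efE[OF c(2)]])
        then show "smooth_on (snd c ` (fst c \<inter> fst s)) ((\<lambda>x. ?A c s x v) \<circ> param c)"
          using open_dom[OF c(1) efE[OF c(2)]] open_image[OF c(1), of "fst s"] principal_bundleD(6)[OF principal c(2)] c
          by (subst smooth_on_cong[where g="conn \<alpha> (ef s) c v \<circ> param c"]) auto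
      qed auto
    next
      fix c e s x v assume c: "c \<in> X" "e \<in> X" "s \<in> frames E" and "x \<in> fst c \<inter> fst e \<inter> fst s"
      then have x: "x \<in> fst c" "x \<in> fst e" "x \<in> fst s" by auto
      show "?A c s x v = ?A e s x (coord_deriv c e x * v)"
        unfolding d[OF c(1,3) x(1,3)] d[OF c(2,3) x(2,3)]
        by (rule one_formD(3)[OF one_form_conn[OF f efE[OF c(3)]] c(1,2) x(1,2)]) (use x in simp)
    next
      fix c s t x v assume c: "c \<in> X" "s \<in> frames E" "t \<in> frames E" and "x \<in> fst c \<inter> fst s \<inter> fst t"
      then have x: "x \<in> fst c" "x \<in> fst s" "x \<in> fst t" by auto
      have ost: "open (fst s \<inter> fst t)" using principal_bundleD(6)[OF principal] c by blast
      have tr: "transition G Ext (ef s) (ef t) y = transition K E s t y" if "y \<in> fst s \<inter> fst t" for y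
        using tp(3)[OF c(2) _ c(3)] that by blast
      have "pd c v (transition G Ext (ef s) (ef t)) x = pd c v (transition K E s t) x"
        by (rule pd_cong[OF ost c(1)]) (use x tr in auto)
      then show "?A c t x v = matrix_inv (transition K E s t x) ** ?A c s x v ** transition K E s t x +
          matrix_inv (transition K E s t x) ** frechet_derivative (transition K E s t \<circ> param c) (at (snd c x)) v"
        unfolding d[OF c(1,2) x(1,2)] d[OF c(1,3) x(1,3)]
        using conn_frame[OF hs c(1) efE[OF c(2)] efE[OF c(3)] x(1), of v] x tr[of x] by (simp add: cj_def pd_def)
    qed
    then show "?A \<in> connections X K E \<and> (\<forall>c\<in>X. \<forall>s\<in>frames E. \<forall>x\<in>fst c \<inter> fst s.
        cscale (1/2) (?A c s x 1 + cscale \<i> (?A c s x \<i>)) = \<alpha> c (ef s) x)"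
      using half by simp
  next
    fix A assume A: "A \<in> connections X K E \<and> (\<forall>c\<in>X. \<forall>s\<in>frames E. \<forall>x\<in>fst c \<inter> fst s.
        cscale (1/2) (A c s x 1 + cscale \<i> (A c s x \<i>)) = \<alpha> c (ef s) x)"
    have lf: "local_family X K E (\<lambda>c s x. A c s x v)" and lin: "linear (A c s x)" for c s x v
      using A unfolding connections_def by blast+
    show "A = ?A"
    proof (intro ext)
      fix c s x v
      show "A c s x v = ?A c s x v"
      proof (cases "c \<in> X \<and> s \<in> frames E \<and> x \<in> fst c \<inter> fst s")
        case True
        then have c: "c \<in> X" "s \<in> frames E" "x \<in> fst c" "x \<in> fst s" by auto
        have k: "A c s x v \<in> \<kk>" for v using lf[of v] c unfolding local_family_def by blast
        have "\<alpha> c (ef s) x = cscale (1/2) (A c s x 1 + cscale \<i> (A c s x \<i>))" using A c by auto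
        also have "\<dots> = (1/2) *\<^sub>R A c s x 1 + cscale \<i> ((1/2) *\<^sub>R A c s x \<i>)"
        proof -
          have "cscale (\<i>/2) Y = (1/2) *\<^sub>R cscale \<i> Y" for Y :: "'n cmat" using cscale_of_real[of "1/2" "cscale \<i> Y"] by simp
          then show ?thesis using cscale_of_real[of "1/2" "A c s x 1"] by (simp add: cscale_simps)
        qed
        finally have e: "\<alpha> c (ef s) x = \<dots>" .
        note r = re_im_eqI[OF k_scaleR[OF k] k_scaleR[OF k] e]
        have "v = Re v *\<^sub>R 1 + Im v *\<^sub>R \<i>" by (simp add: complex_eq_iff)
        then have "A c s x v = A c s x (Re v *\<^sub>R 1 + Im v *\<^sub>R \<i>)" by (rule arg_cong)
        also have "\<dots> = Re v *\<^sub>R A c s x 1 + Im v *\<^sub>R A c s x \<i>" by (simp only: linear_add[OF lin] linear_scale[OF lin])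
        also have "\<dots> = conn \<alpha> (ef s) c v x" unfolding conn_def r by simp
        also have "\<dots> = ?A c s x v" by (rule d[OF c, symmetric])
        finally show ?thesis .
      next
        case False
        then have "A c s x v = 0" using lf[of v] unfolding local_family_def by blast
        then show ?thesis using False by (simp only: if_False)
      qed
    qed
  qed
qed

text \<open>The factor \<i>/2 converts a coefficient of dx \<and> dy into a coefficient of dz \<and>
  d(cnj z).\<close>

lemma hitchin_form_eq:
  assumes b: "b \<in> B0 X G K E" and c: "c \<in> X" "s \<in> frames E" "x \<in> fst c" "x \<in> fst s"
  shows "hitchin_form X G K E b c s x = cscale (\<i> / 2) (higgs_curv (fst b) (snd b) c (ef s) x)"
proof -
  have \<alpha>: "fst b \<in> holomorphic_structures X G Ext" and \<theta>: "snd b \<in> ad_forms X G Ext 1 0"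
    using b by (auto simp: B0_def)
  note f = cform_cfam[OF ad_forms_10[OF \<theta>]]
  have efs: "ef s \<in> frames Ext" using c by (simp add: frames_Ext)
  have o: "open (snd c ` (fst c \<inter> fst s))" using open_image[OF c(1)] principal_bundleD(6)[OF principal c(2)] by blast
  have fd: "frechet_derivative (\<lambda>z. chern_connection X G K E (fst b) c s (param c z) w) (at (snd c x)) v = pd c v (conn (fst b) (ef s) c w) x" for v w
    unfolding pd_def
    by (rule fun_cong, rule frechet_derivative_cong_open[OF o]) (use c in \<open>auto simp: chern[OF \<alpha>]\<close>)
  have ch: "chern_connection X G K E (fst b) c s x v = conn (fst b) (ef s) c v x" for v
    using c by (simp add: chern[OF \<alpha>])
  let ?T = "snd b c (ef s) x"
  note T = cfamD[OF f c(1) efs c(3)]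
  have T1: "?T \<in> gC" "?T = re ?T + cscale \<i> (im ?T)" using T(1,5) c(4) by simp_all
  have br: "bracket (P + cscale \<i> Q) (- P + cscale \<i> Q) = cscale (\<i> / 2) (4 *\<^sub>R bracket P Q)" for P Q :: "'n cmat"
  proof -
    have "4 *\<^sub>R bracket P Q = cscale 4 (bracket P Q)" using cscale_of_real[of 4 "bracket P Q"] by simp
    moreover have "cscale (2 * \<i>) Y = cscale \<i> Y + cscale \<i> Y" for Y :: "'n cmat" by (simp add: cscale_def vec_eq_iff algebra_simps)
    ultimately show ?thesis
      by (simp add: bracket_simps bracket_cscale_left bracket_cscale_right cscale_simps bracket_swap[of Q P])
  qed
  have "bracket ?T (star K ?T) = cscale (\<i> / 2) (4 *\<^sub>R bracket (re ?T) (im ?T))"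
    unfolding star_def lie_re[OF T1(1)] lie_im[OF T1(1)] br[symmetric] using T1(2) by simp
  then show ?thesis
    unfolding hitchin_form_def curvature_def fd ch Let_def higgs_curv_def curv_def curl_def by (simp add: cscale_simps)
qed

lemma herm_gC:
  assumes "Y \<in> gC" "Z \<in> gC"
  shows "Re (herm G K \<rho> Y Z) = ip (re Y) (re Z) + ip (im Y) (im Z)"
proof -
  have kg: "A \<in> \<kk> \<Longrightarrow> A \<in> gC" for A using gC_I[OF _ k_zero, of A] by (simp add: cscale_simps)
  show ?thesis
    unfolding herm_def lie_re[OF assms(1)] lie_re[OF assms(2)] lie_im[OF assms(1)] lie_im[OF assms(2)]
    using gC_decomp(1,2)[OF assms(1)] gC_decomp(1,2)[OF assms(2)] by (simp add: inner_k kg)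
qed

lemma YMH_eq:
  assumes b: "b \<in> B0 X G K E"
  shows "YMH X h G K \<rho> E b = surface_integral X (\<lambda>c x. ip (higgs_curv (fst b) (snd b) c (ef (frame_at E x)) x)
    (higgs_curv (fst b) (snd b) c (ef (frame_at E x)) x) / 4 * inverse (h c x))"
  unfolding YMH_def Let_def
proof (rule surface_integral_cong)
  fix c x assume c: "c \<in> X" "x \<in> fst c"
  have hs: "holstr (fst b)" "cform (\<lambda>q. q) (snd b)"
    using b by (auto simp: B0_def holomorphic_structures_holstr ad_forms_10)
  let ?m = "higgs_curv (fst b) (snd b) c (ef (frame_at E x)) x"
  have k: "?m \<in> \<kk>" by (rule ksecD(1)[OF ksec_higgs_curv[OF hs] c(1) fr(1) c(2) fr(2)])
  have e: "cscale (\<i> / 2) ?m = 0 + cscale \<i> ((1/2) *\<^sub>R ?m)"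
    using cscale_of_real[of "1/2" "cscale \<i> ?m"] by (simp add: cscale_simps)
  note r = re_im_eqI[OF k_zero k_scaleR[OF k] e]
  have q: "ip 0 0 + ip ((1/2) *\<^sub>R ?m) ((1/2) *\<^sub>R ?m) = ip ?m ?m / 4" by (simp add: ip_simps)
  have g: "cscale (\<i> / 2) ?m \<in> gC" unfolding e by (rule gC_I[OF k_zero k_scaleR[OF k]])
  show "Re (herm G K \<rho> (hitchin_form X G K E b c (frame_at E x) x) (hitchin_form X G K E b c (frame_at E x) x)) / h c x =
    ip ?m ?m / 4 * inverse (h c x)"
    unfolding hitchin_form_eq[OF b c(1) frame_at(1) c(2) frame_at(2)] herm_gC[OF g g] r q by (rule divide_inverse)
qed

lemma riemannian_eq:
  assumes "v \<in> tangent_B0 X G K E" "w \<in> tangent_B0 X G K E"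
  shows "riemannian X G K \<rho> E v w = surface_integral X (\<lambda>c x. pair (fst v) (snd v) (fst w) (snd w) c (ef (frame_at E x)) x)"
  unfolding riemannian_def Let_def
proof (rule surface_integral_cong)
  fix c x assume c: "c \<in> X" "x \<in> fst c"
  have f: "cfam cnj (fst v)" "cfam cnj (fst w)" "cfam (\<lambda>q. q) (snd v)" "cfam (\<lambda>q. q) (snd w)"
    using assms ad_forms_01[THEN cform_cfam] ad_forms_10[THEN cform_cfam] by (simp_all add: tangent_B0_def mem_Times_iff)
  note g = cfamD(1)[OF f(1) c(1) fr(1) c(2) fr(2)] cfamD(1)[OF f(2) c(1) fr(1) c(2) fr(2)]
    cfamD(1)[OF f(3) c(1) fr(1) c(2) fr(2)] cfamD(1)[OF f(4) c(1) fr(1) c(2) fr(2)]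
  show "Re (herm G K \<rho> (fst v c (ef (frame_at E x)) x) (fst w c (ef (frame_at E x)) x) +
      herm G K \<rho> (snd v c (ef (frame_at E x)) x) (snd w c (ef (frame_at E x)) x)) =
    pair (fst v) (snd v) (fst w) (snd w) c (ef (frame_at E x)) x"
    using herm_gC[OF g(1,2)] herm_gC[OF g(3,4)] by (simp add: pair_def)
qed

lemma translate_B0:
  assumes b: "b \<in> B0 X G K E" and w: "w \<in> tangent_B0 X G K E"
  shows "translate b r w \<in> B0 X G K E"
proof -
  have b1: "fst b \<in> holomorphic_structures X G Ext" and b2: "snd b \<in> ad_forms X G Ext 1 0"
    using b by (auto simp: B0_def)
  have w1: "fst w \<in> ad_forms X G Ext 0 1" and w2: "snd w \<in> ad_forms X G Ext 1 0"
    using w by (auto simp: tangent_B0_def)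
  have lf: "local_family X G Ext (\<lambda>c s x. \<omega> c s x + r *\<^sub>R \<eta> c s x)"
    if l: "local_family X G Ext \<omega>" "local_family X G Ext \<eta>" for \<omega> \<eta>
    unfolding local_family_def
  proof (intro conjI allI ballI impI)
    show "\<not> (c \<in> X \<and> s \<in> frames Ext \<and> x \<in> fst c \<inter> fst s) \<Longrightarrow> \<omega> c s x + r *\<^sub>R \<eta> c s x = 0" for c s x
    proof -
      assume n: "\<not> (c \<in> X \<and> s \<in> frames Ext \<and> x \<in> fst c \<inter> fst s)"
      have "\<omega> c s x = 0" "\<eta> c s x = 0" using l n unfolding local_family_def by blast+
      then show ?thesis by simp
    qed
    show "\<omega> c s x + r *\<^sub>R \<eta> c s x \<in> lie_algebra G" if "c \<in> X" "s \<in> frames Ext" "x \<in> fst c \<inter> fst s" for c s x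
      using l that unfolding local_family_def lie_G
      by (intro subspace_add[OF subspace_gC] subspace_scale[OF subspace_gC]) blast+
    fix c s assume c: "c \<in> X" "s \<in> frames Ext"
    have "smooth_map X (fst c \<inter> fst s) (\<omega> c s)" "smooth_map X (fst c \<inter> fst s) (\<eta> c s)"
      using l c unfolding local_family_def smooth_map_family[OF c, symmetric] by blast+
    then show "smooth_on (snd c ` (fst c \<inter> fst s)) ((\<lambda>x. \<omega> c s x + r *\<^sub>R \<eta> c s x) \<circ> param c)"
      unfolding smooth_map_family[OF c]
      by (intro smooth_map_add smooth_map_bounded_linear[OF bounded_linear_scaleR_right] open_dom c)
  qed
  have hs: "holstr (\<lambda>c s x. fst b c s x + r *\<^sub>R fst w c s x)"
    by (rule holstr_translate[OF holomorphic_structures_holstr[OF b1] ad_forms_01[OF w1]])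
  have cf: "cform (\<lambda>q. q) (\<lambda>c s x. snd b c s x + r *\<^sub>R snd w c s x)"
    by (rule cform_linear[OF ad_forms_10[OF b2] ad_forms_10[OF w2]])
  have l1: "local_family X G Ext (fst b)" "local_family X G Ext (snd b)" "local_family X G Ext (fst w)" "local_family X G Ext (snd w)"
    using b1 b2 w1 w2 unfolding holomorphic_structures_def ad_forms_def Let_def by blast+
  have "fst (translate b r w) \<in> holomorphic_structures X G Ext"
    unfolding translate_def fst_conv by (rule holstr_holomorphic_structures[OF lf[OF l1(1,3)] hs])
  moreover have "snd (translate b r w) \<in> ad_forms X G Ext 1 0"
    unfolding translate_def snd_conv by (rule cform_10_ad_forms[OF lf[OF l1(2,4)] cf])
  ultimately show ?thesis by (simp add: B0_def mem_Times_iff)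
qed

text \<open>Both the given gradient and the explicit formula represent the derivative of the
  functional in every tangent direction, in particular in the direction of their own difference,
  where \<open>gradient_unique\<close> applies.\<close>

lemma gradient_eq:
  assumes b: "b \<in> B0 X G K E" and v: "is_gradient_YMH X h G K \<rho> E b v"
    and c: "c \<in> X" "s \<in> frames Ext" "x \<in> fst c" "x \<in> fst s"
  shows "fst v c s x = grad1 (fst b) (snd b) c s x" "snd v c s x = grad2 (fst b) (snd b) c s x"
proof -
  have hs: "holstr (fst b)" "cform (\<lambda>q. q) (snd b)"
    using b by (auto simp: B0_def holomorphic_structures_holstr ad_forms_10)
  have vt: "v \<in> tangent_B0 X G K E" using v by (simp add: is_gradient_YMH_def)
  have vf: "cform cnj (fst v)" "cform (\<lambda>q. q) (snd v)"
    using vt by (auto simp: tangent_B0_def intro: ad_forms_01 ad_forms_10)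
  let ?u1 = "grad1 (fst b) (snd b)" and ?u2 = "grad2 (fst b) (snd b)"
  note uf = cform_grad1[OF hs] cform_grad2[OF hs]
  let ?w1 = "\<lambda>c s x. fst v c s x - ?u1 c s x" and ?w2 = "\<lambda>c s x. snd v c s x - ?u2 c s x"
  have wf: "cform cnj ?w1" "cform (\<lambda>q. q) ?w2"
    using cform_linear[OF vf(1) uf(1), of "- 1"] cform_linear[OF vf(2) uf(2), of "- 1"] by simp_all
  \<comment> \<open>The difference of the two candidates, set to 0 off the domains so that it is an
    admissible tangent vector.\<close>
  define w where "w = (\<lambda>c s x. if dom c s x then ?w1 c s x else 0, \<lambda>c s x. if dom c s x then ?w2 c s x else 0)"
  have w: "w \<in> tangent_B0 X G K E"
    using cform_ad_forms[of 0 1 ?w1] cform_ad_forms[of 1 0 ?w2] wf by (simp add: w_def tangent_B0_def)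
  have wf': "cform cnj (fst w)" "cform (\<lambda>q. q) (snd w)"
    using w by (auto simp: tangent_B0_def intro: ad_forms_01 ad_forms_10)
  have "((\<lambda>r. YMH X h G K \<rho> E (translate b r w)) has_real_derivative riemannian X G K \<rho> E v w) (at 0)"
    using v w by (simp add: is_gradient_YMH_def)
  moreover have "((\<lambda>r. YMH X h G K \<rho> E (translate b r w)) has_real_derivative
      surface_integral X (\<lambda>c x. pair ?u1 ?u2 (fst w) (snd w) c (ef (frame_at E x)) x)) (at 0)"
    using functional_has_derivative[OF hs wf']
    unfolding YMH_eq[OF translate_B0[OF b w]] unfolding translate_def fst_conv snd_conv .
  ultimately have "surface_integral X (\<lambda>c x. pair (fst v) (snd v) (fst w) (snd w) c (ef (frame_at E x)) x) =
      surface_integral X (\<lambda>c x. pair ?u1 ?u2 (fst w) (snd w) c (ef (frame_at E x)) x)"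
    unfolding riemannian_eq[OF vt w] by (rule DERIV_unique)
  moreover have "surface_integral X (\<lambda>c x. pair p q (fst w) (snd w) c (ef (frame_at E x)) x) =
      surface_integral X (\<lambda>c x. pair p q ?w1 ?w2 c (ef (frame_at E x)) x)" for p q
    by (rule surface_integral_cong) (use fr in \<open>simp add: pair_def w_def dom_def\<close>)
  ultimately have "surface_integral X (\<lambda>c x. pair (fst v) (snd v) ?w1 ?w2 c (ef (frame_at E x)) x) =
      surface_integral X (\<lambda>c x. pair ?u1 ?u2 ?w1 ?w2 c (ef (frame_at E x)) x)" by simp
  from gradient_unique[OF vf uf this c]
  show "fst v c s x = ?u1 c s x" "snd v c s x = ?u2 c s x" by simp_all
qed

section \<open>The flow at a single point of the surface\<close>

lemma family_derivative_at_point: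
  assumes fam: "family_has_derivative X Ext \<omega> \<omega>' t" and c: "c \<in> X" "s \<in> frames Ext" "x \<in> fst c" "x \<in> fst s"
    and diff: "\<And>t. diff_at c (\<omega> t c s) x"
  shows "((\<lambda>t. \<omega> t c s x) has_vector_derivative \<omega>' c s x) (at t)"
    "((\<lambda>t. pd c v (\<omega> t c s) x) has_vector_derivative pd c v (\<omega>' c s) x) (at t)"
proof -
  let ?z = "snd c x"
  have lim: "((\<lambda>r. iter_deriv vs (\<lambda>z. (\<omega> (t + r) c s (param c z) - \<omega> t c s (param c z)) /\<^sub>R r) ?z) \<longlongrightarrow>
      iter_deriv vs (\<lambda>z. \<omega>' c s (param c z)) ?z) (at 0)" for vs
  proof -
    \<comment> \<open>Convergence in the smooth topology is used on a one-point compact set; the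
      empty list of directions gives the value, a list with one entry a first derivative.\<close>
    have "compact {?z} \<and> {?z} \<subseteq> snd c ` (fst c \<inter> fst s)" using c by auto
    then have "uniform_limit {?z} (\<lambda>r. iter_deriv vs (\<lambda>z. (\<omega> (t + r) c s (param c z) - \<omega> t c s (param c z)) /\<^sub>R r))
          (iter_deriv vs (\<lambda>z. \<omega>' c s (param c z))) (at 0)"
      using fam c(1,2) unfolding family_has_derivative_def by blast
    then show ?thesis by (rule tendsto_uniform_limitI) simp
  qed
  show "((\<lambda>t. \<omega> t c s x) has_vector_derivative \<omega>' c s x) (at t)"
    using lim[of "[]"] c by (simp add: has_vector_derivative_limit)
  have "frechet_derivative (\<lambda>z. (\<omega> (t + r) c s (param c z) - \<omega> t c s (param c z)) /\<^sub>R r) (at ?z) v =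
      (pd c v (\<omega> (t + r) c s) x - pd c v (\<omega> t c s) x) /\<^sub>R r" for r
  proof -
    have "pd c v (\<lambda>y. (\<omega> (t + r) c s y - \<omega> t c s y) /\<^sub>R r) x = (pd c v (\<omega> (t + r) c s) x - pd c v (\<omega> t c s) x) /\<^sub>R r"
      unfolding pd_bounded_linear[OF bounded_linear_scaleR_right diff_at_diff[OF diff diff]] pd_diff[OF diff diff] ..
    then show ?thesis by (simp add: pd_def comp_def)
  qed
  then show "((\<lambda>t. pd c v (\<omega> t c s) x) has_vector_derivative pd c v (\<omega>' c s) x) (at t)"
    using lim[of "[v]"] by (simp add: has_vector_derivative_limit pd_def comp_def)
qed

theorem flow_preserves_higgs_pairs:
  assumes flow: "gradient_flow_line X h G K \<rho> E \<gamma>" and init: "\<gamma> 0 \<in> higgs_pairs X G K E"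
  shows "\<gamma> t \<in> higgs_pairs X G K E"
proof -
  have B: "\<gamma> t \<in> B0 X G K E" for t using flow by (simp add: gradient_flow_line_def)
  have "\<forall>t. \<exists>v. is_gradient_YMH X h G K \<rho> E (\<gamma> t) v \<and>
           family_has_derivative X Ext (\<lambda>r. fst (\<gamma> r)) (\<lambda>c s x. - fst v c s x) t \<and>
           family_has_derivative X Ext (\<lambda>r. snd (\<gamma> r)) (\<lambda>c s x. - snd v c s x) t"
    using flow by (simp add: gradient_flow_line_def)
  then obtain v where v: "\<And>t. is_gradient_YMH X h G K \<rho> E (\<gamma> t) (v t)"
    and fam: "\<And>t. family_has_derivative X Ext (\<lambda>r. fst (\<gamma> r)) (\<lambda>c s x. - fst (v t) c s x) t"
      "\<And>t. family_has_derivative X Ext (\<lambda>r. snd (\<gamma> r)) (\<lambda>c s x. - snd (v t) c s x) t"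
    by metis
  have hs: "holstr (fst (\<gamma> t))" "cform (\<lambda>q. q) (snd (\<gamma> t))" for t
    using B[of t] by (auto simp: B0_def holomorphic_structures_holstr ad_forms_10)
  have dbar_eq: "dbar_ad (fst (\<gamma> t)) (snd (\<gamma> t)) c s x = dbar (fst (\<gamma> t)) (snd (\<gamma> t)) c s x" for t c s x
    by (simp add: dbar_ad_def dbar_def d_zbar_def pd_def)
  have "dbar (fst (\<gamma> t)) (snd (\<gamma> t)) c s x = 0" if c: "c \<in> X" "s \<in> frames Ext" "x \<in> fst c" "x \<in> fst s" for c s x
  proof -
    note d1 = cfamD(2)[OF holstr_cfam[OF hs(1)] c] and d2 = cfamD(2)[OF cform_cfam[OF hs(2)] c]
    have der1: "((\<lambda>t. fst (\<gamma> t) c s x) has_vector_derivative - grad1 (fst (\<gamma> t)) (snd (\<gamma> t)) c s x) (at t)" for t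
      using family_derivative_at_point(1)[OF fam(1) c d1] gradient_eq(1)[OF B v c] by simp
    have der2: "((\<lambda>t. snd (\<gamma> t) c s x) has_vector_derivative - grad2 (fst (\<gamma> t)) (snd (\<gamma> t)) c s x) (at t)" for t
      using family_derivative_at_point(1)[OF fam(2) c d2] gradient_eq(2)[OF B v c] by simp
    \<comment> \<open>Serves the continuity of \<Psi>, whose curvature part contains first
      derivatives of the holomorphic structure.\<close>
    have dd1: "((\<lambda>t. pd c e (fst (\<gamma> t) c s) x) has_vector_derivative pd c e (\<lambda>y. - fst (v t) c s y) x) (at t)" for t e
      by (rule family_derivative_at_point(2)[OF fam(1) c d1])
    have dd2: "((\<lambda>t. pd c e (snd (\<gamma> t) c s) x) has_vector_derivative - pd c e (grad2 (fst (\<gamma> t)) (snd (\<gamma> t)) c s) x) (at t)" for t e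
    proof -
      have "pd c e (\<lambda>y. - snd (v t) c s y) x = pd c e (\<lambda>y. - grad2 (fst (\<gamma> t)) (snd (\<gamma> t)) c s y) x"
        by (rule pd_cong[OF open_dom[OF c(1,2)] c(1)]) (use c gradient_eq(2)[OF B v c(1,2)] in auto)
      also have "\<dots> = - pd c e (grad2 (fst (\<gamma> t)) (snd (\<gamma> t)) c s) x"
        by (rule pd_bounded_linear[OF bounded_linear_minus[OF bounded_linear_ident] cfamD(2)[OF cform_cfam[OF cform_grad2[OF hs]] c]])
      finally show ?thesis by (rule subst) (rule family_derivative_at_point(2)[OF fam(2) c d2])
    qed
    let ?F = "\<lambda>t. dbar (fst (\<gamma> t)) (snd (\<gamma> t)) c s x"
    define \<Psi> where "\<Psi> t = cscale (2 * \<i>) (mu (fst (\<gamma> t)) (snd (\<gamma> t)) c s x)" for t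
    \<comment> \<open>The product rule gives the derivative of \<open>dbar\<close> along minus the
      gradient, and \<open>dbar_grad\<close> evaluates it; the two minus signs cancel.\<close>
    have dF: "(?F has_vector_derivative bracket (?F t) (\<Psi> t)) (at t)" for t
    proof -
      note cs = bounded_linear.has_vector_derivative[OF bounded_bilinear.bounded_linear_right[OF bounded_bilinear_cscale]]
      have e: "cscale (1/2) (- a + cscale \<i> (- b)) + (bracket A (- g2) + bracket (- g1) T) =
          - (cscale (1/2) (a + cscale \<i> b) + (bracket g1 T + bracket A g2))" for a b A g1 g2 T :: "'n cmat"
        by (simp add: cscale_simps bracket_simps)
      have "(?F has_vector_derivative
          cscale (1/2) (- pd c 1 (grad2 (fst (\<gamma> t)) (snd (\<gamma> t)) c s) x + cscale \<i> (- pd c \<i> (grad2 (fst (\<gamma> t)) (snd (\<gamma> t)) c s) x))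
          + (bracket (fst (\<gamma> t) c s x) (- grad2 (fst (\<gamma> t)) (snd (\<gamma> t)) c s x) + bracket (- grad1 (fst (\<gamma> t)) (snd (\<gamma> t)) c s x) (snd (\<gamma> t) c s x))) (at t)"
        unfolding dbar_def
        by (intro has_vector_derivative_add cs bounded_bilinear.has_vector_derivative[OF bounded_bilinear_bracket] der1 der2 dd2)
      then show ?thesis unfolding e dbar_grad[OF hs c] \<Psi>_def by simp
    qed
    obtain k where k: "k > 0" "\<And>(a :: 'n cmat) (b :: 'n cmat). norm (bracket a b) \<le> norm a * norm b * k"
      using bounded_bilinear.pos_bounded[OF bounded_bilinear_bracket] by metis
    have cont: "continuous_on UNIV f" if "\<And>t. (f has_vector_derivative f' t) (at t)" for f :: "real \<Rightarrow> 'n cmat" and f'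
      using that by (intro continuous_at_imp_continuous_on ballI has_vector_derivative_continuous)
    \<comment> \<open>At a fixed point, \<open>mu\<close> is an algebraic expression in the values
      of both fields and the first derivatives of the holomorphic structure, each of which is
      differentiable in \<open>t\<close>.\<close>
    have "continuous_on UNIV \<Psi>"
    proof -
      have "mu (fst (\<gamma> t)) (snd (\<gamma> t)) c s x = inverse (h c x) *\<^sub>R
          ((2 *\<^sub>R im (pd c 1 (fst (\<gamma> t) c s) x) - 2 *\<^sub>R re (pd c \<i> (fst (\<gamma> t) c s) x)
            + bracket (2 *\<^sub>R re (fst (\<gamma> t) c s x)) (2 *\<^sub>R im (fst (\<gamma> t) c s x)))
           + 4 *\<^sub>R bracket (re (snd (\<gamma> t) c s x)) (im (snd (\<gamma> t) c s x)))" for t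
      proof -
        have e: "conn \<alpha> s c 1 = (\<lambda>x. 2 *\<^sub>R re (\<alpha> c s x))" "conn \<alpha> s c \<i> = (\<lambda>x. 2 *\<^sub>R im (\<alpha> c s x))" for \<alpha>
          by (rule ext, rule conn_simps)+
        have "pd c v (\<lambda>x. 2 *\<^sub>R re (fst (\<gamma> t) c s x)) x = 2 *\<^sub>R re (pd c v (fst (\<gamma> t) c s) x)"
          "pd c v (\<lambda>x. 2 *\<^sub>R im (fst (\<gamma> t) c s x)) x = 2 *\<^sub>R im (pd c v (fst (\<gamma> t) c s) x)" for v
          by (rule pd_bounded_linear[OF bounded_linear_compose[OF bounded_linear_scaleR_right bounded_linear_re] d1]
              pd_bounded_linear[OF bounded_linear_compose[OF bounded_linear_scaleR_right bounded_linear_im] d1])+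
        then show ?thesis unfolding mu_def higgs_curv_def curv_def curl_def e by simp
      qed
      then show ?thesis
        unfolding \<Psi>_def[abs_def]
        by (simp only:) (intro bounded_linear.continuous_on[OF bounded_bilinear.bounded_linear_right[OF bounded_bilinear_cscale]]
            bounded_linear.continuous_on[OF bounded_linear_re] bounded_linear.continuous_on[OF bounded_linear_im]
            bounded_bilinear.continuous_on[OF bounded_bilinear_bracket] continuous_on_add continuous_on_diff
            continuous_on_scaleR continuous_on_const cont[OF der1] cont[OF der2] cont[OF dd1])
    qed
    then have Bc: "continuous_on UNIV (\<lambda>t. norm (\<Psi> t) * k)" by (intro continuous_intros)
    have b: "norm (bracket (?F t) (\<Psi> t)) \<le> norm (\<Psi> t) * k * norm (?F t)" for t
      using k(2)[of "?F t" "\<Psi> t"] by (simp add: mult.commute mult.left_commute)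
    have "?F 0 = 0"
      using init c unfolding higgs_pairs_def dbar_eq[symmetric] by auto
    then show ?thesis by (rule linear_ode_zero[where f="?F" and D="\<lambda>t. bracket (?F t) (\<Psi> t)", OF dF b Bc])
  qed
  then show ?thesis
    using B[of t] unfolding higgs_pairs_def dbar_eq[symmetric] by (auto simp: case_prod_beta)
qed

end

theorem lemma3p3:
  fixes X :: "('x::t2_space) chart set"
    and h\<^sub>0 :: "'x chart \<Rightarrow> 'x \<Rightarrow> real"
    and G K :: "'n::finite cmat set"
    and Kt :: "'m::finite cmat set"
    and \<rho> :: "'n cmat \<Rightarrow> 'm cmat"
    and E\<^sub>K :: "('p, 'x, 'n) pbundle"
    and z :: "('x, 'p, 'n) pair"
    and \<gamma> :: "real \<Rightarrow> ('x, 'p, 'n) pair"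
  assumes surface: "riemann_surface X" "compact (UNIV :: 'x set)" "connected (UNIV :: 'x set)"
    and metric: "hermitian_metric X h\<^sub>0"
    and group: "linear_algebraic_group G" "connected G" "reductive G"
    and maximal_compact: "maximal_compact_subgroup K G"
    and complexification: "lie_complexification G K"
    and representation: "faithful_representation G \<rho>"
    and unitary: "maximal_compact_subgroup Kt (carrier GL)" "\<rho> ` K \<subseteq> Kt"
    and principal: "principal_bundle X K E\<^sub>K"
    and higgs: "z \<in> higgs_pairs X G K E\<^sub>K"
    and flow: "gradient_flow_line X h\<^sub>0 G K \<rho> E\<^sub>K \<gamma>" "\<gamma> 0 = z"
  shows "\<forall>t. \<gamma> t \<in> higgs_pairs X G K E\<^sub>K"
proof -
  obtain re im ip where ld: "lie_data K re im ip"
    and l: "\<And>Z. Z \<in> lie_algebra G \<Longrightarrow> lie_re K Z = re Z" "\<And>Z. Z \<in> lie_algebra G \<Longrightarrow> lie_im K Z = im Z"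
      "\<And>A B. A \<in> lie_algebra G \<Longrightarrow> B \<in> lie_algebra G \<Longrightarrow> inner_k G \<rho> A B = ip A B"
    by (rule lie_data_exists[OF group(1) maximal_compact complexification representation unitary], rule that)
  interpret L: lie_data K re im ip by (rule ld)
  have lG: "lie_algebra G = L.gC"
    using complexification unfolding lie_complexification_def L.gC_def by simp
  have "analytic_higgs X K re im ip G \<rho> E\<^sub>K h\<^sub>0"
  proof (intro analytic_higgs.intro analytic_higgs_axioms.intro compact_riemann.intro riemann.intro
      compact_riemann_axioms.intro)
    show "K \<subseteq> G" using maximal_compact by (simp add: maximal_compact_subgroup_def)
  qed (use surface ld principal metric lG l in auto)
  then show ?thesis using analytic_higgs.flow_preserves_higgs_pairs flow higgs by blast
qed

end
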